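(* Let $i\in\{1,\dots,M\}$ and assume $\delta_i^\ast:=\mathrm{dist}(\omega_i,\partial\omega_i^\ast\setminus\partial\Omega)>0$. There exist constants $\Lambda_i>0$ and $b_i>0$, independent of $\varepsilon$, such that for any $\varepsilon\in(0,1]$, $$d_{n_i}(\omega_i,\omega_i^\ast)\le \varepsilon\, a_{\max}^{1/2}\,\|\nabla\chi_i\|_{L^\infty(\omega_i)}\,e^{-b_i n_i^{1/(d+1)}}\qquad\text{for all integers } n_i>\Lambda_i .$$
   Context: Setting: $\Omega\subset\mathbb{R}^d$ ($d=2,3$) is a bounded Lipschitz polyhedral domain, $\Gamma=\partial\Omega$, $0<\varepsilon\le 1$, and $A\in (L^\infty(\Omega))^{d\times d}$ is pointwise symmetric with $a_{\min}|\xi|^2\le A(x)\xi\cdot\xi\le a_{\max}|\xi|^2$ for all $\xi\in\mathbb{R}^d$, $x\in\Omega$, where $0<a_{\min}<a_{\max}<\infty$. For a subdomain $D\subset\Omega$ and $u,v\in H^1(D)$ put $a_{\varepsilon,D}(u,v)=\varepsilon^2\int_D A\nabla u\cdot\nabla v\,dx+\int_D uv\,dx$ and $\|u\|_{a,\varepsilon,D}=\sqrt{a_{\varepsilon,D}(u,u)}$. Cover and partition of unity: $\{\omega_i\}_{i=1}^M$ are connected open subsets of $\Omega$ with $\bigcup_i\omega_i=\Omega$, each point of $\Omega$ lying in at most $\kappa$ of them; $\{\chi_i\}_{i=1}^M$ are functions with $0\le\chi_i\le1$, $\sum_i\chi_i=1$ on $\Omega$, $\chi_i=0$ on $\Omega\setminus\omega_i$,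 $\chi_i\in W^{1,\infty}(\Omega)$, and $\|\nabla\chi_i\|_{L^\infty(\omega_i)}\le C/\mathrm{diam}(\omega_i)$ for a fixed constant $C$. For each $i$, $\omega_i^\ast$ is a domain with Lipschitz boundary and $\omega_i\subset\omega_i^\ast\subset\Omega$. Generalized harmonic space: $H^1_\Gamma(\omega_i^\ast)=\{v\in H^1(\omega_i^\ast): v=0\text{ on }\partial\omega_i^\ast\cap\Gamma\}$ and $H_{a,\varepsilon}(\omega_i^\ast)=\{u\in H^1_\Gamma(\omega_i^\ast): a_{\varepsilon,\omega_i^\ast}(u,v)=0\ \forall v\in H_0^1(\omega_i^\ast)\}$. Kolmogorov $n$-width: $$d_{n}(\omega_{i},\omega_{i}^{\ast})=\inf_{Q(n)\subset H_{0}^{1}(\omega_{i})}\ \sup_{0\ne u\in H_{a,\varepsilon}(\omega^{\ast}_{i})}\ \inf_{v\in Q(n)}\frac {\Vert \chi_i u-v\Vert_{a,\varepsilon,\omega_i}}{\Vert u \Vert_{a,\varepsilon,\omega_{i}^{\ast}}},$$ where the leftmost infimum is over all $n$-dimensional subspaces $Q(n)$ of $H_0^1(\omega_i)$. *)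

theory Defs
  imports "HOL-Analysis.Analysis" "HOL-Probability.Essential_Supremum"
begin

text \<open>Elements of the function spaces below are functions on the whole of \<open>real^'d\<close>; only their
  values on the domain \<open>D\<close> matter, and functions that agree almost everywhere on \<open>D\<close> represent
  the same element.\<close>

definition domain :: "'a::euclidean_space set \<Rightarrow> bool" where
  "domain D \<longleftrightarrow> open D \<and> connected D \<and> D \<noteq> {}"

text \<open>Near each boundary point, in coordinates whose last axis is the unit vector \<open>e\<close>, \<open>D\<close> is the
  region on one side of the graph of a Lipschitz function on the hyperplane orthogonal to \<open>e\<close>.\<close>

definition lipschitz_boundary :: "'a::euclidean_space set \<Rightarrow> bool" where
  "lipschitz_boundary D \<longleftrightarrow>
     (\<forall>x\<in>frontier D. \<exists>r>0. \<exists>e. norm e = 1 \<and>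
        (\<exists>L \<gamma>. L-lipschitz_on {z. z \<bullet> e = 0} \<gamma> \<and>
           D \<inter> ball x r = {y \<in> ball x r. y \<bullet> e > \<gamma> (y - (y \<bullet> e) *\<^sub>R e)}))"

definition polyhedral :: "'a::euclidean_space set \<Rightarrow> bool" where
  "polyhedral D \<longleftrightarrow> (\<exists>\<P>. finite \<P> \<and> (\<forall>P\<in>\<P>. polytope P) \<and> closure D = \<Union>\<P>)"

text \<open>In contrast to the library function \<open>setdist\<close>, the distance to the empty set is infinite.\<close>

definition set_edist :: "'a::metric_space set \<Rightarrow> 'a set \<Rightarrow> ennreal" where
  "set_edist S T = (INF x\<in>S. INF y\<in>T. ennreal (dist x y))"

definition grad :: "(real^'d \<Rightarrow> real) \<Rightarrow> real^'d \<Rightarrow> real^'d" where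
  "grad f x = (\<chi> i. frechet_derivative f (at x) (axis i 1))"

primrec C_k :: "nat \<Rightarrow> (real^'d \<Rightarrow> real) \<Rightarrow> bool" where
  "C_k 0 f \<longleftrightarrow> continuous_on UNIV f"
| "C_k (Suc k) f \<longleftrightarrow> (\<forall>x. f differentiable (at x)) \<and> (\<forall>i. C_k k (\<lambda>x. grad f x $ i))"

definition smooth :: "(real^'d \<Rightarrow> real) \<Rightarrow> bool" where
  "smooth f \<longleftrightarrow> (\<forall>k. C_k k f)"

definition test_functions :: "(real^'d) set \<Rightarrow> (real^'d \<Rightarrow> real) set" where
  "test_functions D =
     {\<phi>. smooth \<phi> \<and> compact (closure {x. \<phi> x \<noteq> 0}) \<and> closure {x. \<phi> x \<noteq> 0} \<subseteq> D}"

definition locally_integrable ::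
    "(real^'d) set \<Rightarrow> (real^'d \<Rightarrow> 'b::{banach, second_countable_topology}) \<Rightarrow> bool" where
  "locally_integrable D f \<longleftrightarrow> (\<forall>K. compact K \<and> K \<subseteq> D \<longrightarrow> integrable (lebesgue_on K) f)"

definition has_weak_gradient ::
    "(real^'d) set \<Rightarrow> (real^'d \<Rightarrow> real) \<Rightarrow> (real^'d \<Rightarrow> real^'d) \<Rightarrow> bool" where
  "has_weak_gradient D u g \<longleftrightarrow>
     locally_integrable D u \<and> locally_integrable D g \<and>
     (\<forall>\<phi>\<in>test_functions D. \<forall>i.
        (\<integral>x. u x * grad \<phi> x $ i \<partial>lebesgue_on D) = - (\<integral>x. g x $ i * \<phi> x \<partial>lebesgue_on D))"

definition weak_grad :: "(real^'d) set \<Rightarrow> (real^'d \<Rightarrow> real) \<Rightarrow> real^'d \<Rightarrow> real^'d" where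
  "weak_grad D u = (SOME g. has_weak_gradient D u g)"

definition L2 :: "(real^'d) set \<Rightarrow> (real^'d \<Rightarrow> 'b::euclidean_space) set" where
  "L2 D = {f. f \<in> borel_measurable (lebesgue_on D) \<and>
              integrable (lebesgue_on D) (\<lambda>x. (norm (f x))\<^sup>2)}"

definition Linf_norm :: "(real^'d) set \<Rightarrow> (real^'d \<Rightarrow> 'b::euclidean_space) \<Rightarrow> ennreal" where
  "Linf_norm D f = esssup (lebesgue_on D) (\<lambda>x. ennreal (norm (f x)))"

definition Linf :: "(real^'d) set \<Rightarrow> (real^'d \<Rightarrow> 'b::euclidean_space) set" where
  "Linf D = {f. f \<in> borel_measurable (lebesgue_on D) \<and> Linf_norm D f < \<infinity>}"

definition W1inf :: "(real^'d) set \<Rightarrow> (real^'d \<Rightarrow> real) set" where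
  "W1inf D = {u \<in> Linf D. \<exists>g\<in>Linf D. has_weak_gradient D u g}"

definition H1 :: "(real^'d) set \<Rightarrow> (real^'d \<Rightarrow> real) set" where
  "H1 D = {u \<in> L2 D. \<exists>g\<in>L2 D. has_weak_gradient D u g}"

definition H1_norm :: "(real^'d) set \<Rightarrow> (real^'d \<Rightarrow> real) \<Rightarrow> real" where
  "H1_norm D u = sqrt ((\<integral>x. (u x)\<^sup>2 \<partial>lebesgue_on D) +
                       (\<integral>x. (norm (weak_grad D u x))\<^sup>2 \<partial>lebesgue_on D))"

definition H10 :: "(real^'d) set \<Rightarrow> (real^'d \<Rightarrow> real) set" where
  "H10 D = {u \<in> H1 D. \<exists>\<phi>. (\<forall>k::nat. \<phi> k \<in> test_functions D) \<and>
                           (\<lambda>k. H1_norm D (\<lambda>x. \<phi> k x - u x)) \<longlonglongrightarrow> 0}"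

definition hausdorff_pre :: "real \<Rightarrow> nat \<Rightarrow> 'a::metric_space set \<Rightarrow> ennreal" where
  "hausdorff_pre \<delta> s S =
     (INF U\<in>{U. S \<subseteq> (\<Union>k::nat. U k) \<and> (\<forall>k. bounded (U k) \<and> diameter (U k) \<le> \<delta>)}.
        \<Sum>k. ennreal (unit_ball_vol (real s) * (diameter (U k) / 2) ^ s))"

definition hausdorff_outer :: "nat \<Rightarrow> 'a::metric_space set \<Rightarrow> ennreal" where
  "hausdorff_outer s S = (SUP \<delta>\<in>{0<..}. hausdorff_pre \<delta> s S)"

text \<open>Surface measure: the Hausdorff measure of dimension \<open>d - 1\<close>. By Caratheodory's criterion for
  metric outer measures, \<open>hausdorff_outer\<close> is countably additive on the Borel sets. It is used
  for \<open>d \<ge> 2\<close>; at \<open>s = 0\<close> the covering sums above would count empty sets as well.\<close>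

definition surface_measure :: "(real^'d) measure" where
  "surface_measure = measure_of UNIV (sets borel) (hausdorff_outer (CARD('d) - 1))"

text \<open>The trace operator of a bounded Lipschitz domain \<open>D\<close> is the continuous extension from
  \<open>H\<^sup>1(D)\<close> to \<open>L\<^sup>2(\<partial>D)\<close> of the restriction to \<open>\<partial>D\<close> of smooth functions.\<close>

definition is_trace :: "(real^'d) set \<Rightarrow> (real^'d \<Rightarrow> real) \<Rightarrow> (real^'d \<Rightarrow> real) \<Rightarrow> bool" where
  "is_trace D u g \<longleftrightarrow> g \<in> borel_measurable borel \<and>
     (\<exists>\<phi>. (\<forall>k::nat. smooth (\<phi> k)) \<and>
          (\<lambda>k. H1_norm D (\<lambda>x. \<phi> k x - u x)) \<longlonglongrightarrow> 0 \<and>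
          (\<lambda>k. \<integral>\<^sup>+x\<in>frontier D. ennreal ((\<phi> k x - g x)\<^sup>2) \<partial>surface_measure) \<longlonglongrightarrow> 0)"

definition H1_zero_on :: "(real^'d) set \<Rightarrow> (real^'d) set \<Rightarrow> (real^'d \<Rightarrow> real) set" where
  "H1_zero_on D F = {u \<in> H1 D. \<exists>g. is_trace D u g \<and>
     (AE x in surface_measure. x \<in> frontier D \<inter> F \<longrightarrow> g x = 0)}"

definition energy_form :: "(real^'d \<Rightarrow> real^'d^'d) \<Rightarrow> real \<Rightarrow> (real^'d) set \<Rightarrow>
    (real^'d \<Rightarrow> real) \<Rightarrow> (real^'d \<Rightarrow> real) \<Rightarrow> real" where
  "energy_form A \<epsilon> D u v =
     \<epsilon>\<^sup>2 * (\<integral>x. (A x *v weak_grad D u x) \<bullet> weak_grad D v x \<partial>lebesgue_on D) +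
     (\<integral>x. u x * v x \<partial>lebesgue_on D)"

definition energy_norm :: "(real^'d \<Rightarrow> real^'d^'d) \<Rightarrow> real \<Rightarrow> (real^'d) set \<Rightarrow>
    (real^'d \<Rightarrow> real) \<Rightarrow> real" where
  "energy_norm A \<epsilon> D u = sqrt (energy_form A \<epsilon> D u u)"

definition harmonic_space :: "(real^'d \<Rightarrow> real^'d^'d) \<Rightarrow> real \<Rightarrow> (real^'d) set \<Rightarrow> (real^'d) set \<Rightarrow>
    (real^'d \<Rightarrow> real) set" where
  "harmonic_space A \<epsilon> \<Gamma> D = {u \<in> H1_zero_on D \<Gamma>. \<forall>v\<in>H10 D. energy_form A \<epsilon> D u v = 0}"

text \<open>The \<open>n\<close>-dimensional subspaces of \<open>V\<close>, a space of functions on \<open>D\<close> modulo equality almost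
  everywhere; a subspace is represented by the set of all representatives of its elements.\<close>

definition subspaces_of_dim :: "(real^'d) set \<Rightarrow> (real^'d \<Rightarrow> real) set \<Rightarrow> nat \<Rightarrow>
    (real^'d \<Rightarrow> real) set set" where
  "subspaces_of_dim D V n = {Q. \<exists>b. (\<forall>k<n. b k \<in> V) \<and>
     (\<forall>c::nat \<Rightarrow> real. (AE x in lebesgue_on D. (\<Sum>k<n. c k * b k x) = 0) \<longrightarrow> (\<forall>k<n. c k = 0)) \<and>
     Q = {v \<in> V. \<exists>c::nat \<Rightarrow> real. AE x in lebesgue_on D. v x = (\<Sum>k<n. c k * b k x)}}"

text \<open>The value lies in \<open>[0, \<infinity>]\<close>, so that the supremum over the empty set is \<open>0\<close>
  when the harmonic space is trivial.\<close>

definition n_width :: "(real^'d \<Rightarrow> real^'d^'d) \<Rightarrow> real \<Rightarrow> (real^'d) set \<Rightarrow> (real^'d \<Rightarrow> real) \<Rightarrow>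
    (real^'d) set \<Rightarrow> (real^'d) set \<Rightarrow> nat \<Rightarrow> ennreal" where
  "n_width A \<epsilon> \<Gamma> \<eta> \<omega> \<omega>s n =
     (INF Q\<in>subspaces_of_dim \<omega> (H10 \<omega>) n.
        SUP u\<in>{u \<in> harmonic_space A \<epsilon> \<Gamma> \<omega>s. \<not> (AE x in lebesgue_on \<omega>s. u x = 0)}.
          INF v\<in>Q. ennreal (energy_norm A \<epsilon> \<omega> (\<lambda>x. \<eta> x * u x - v x) / energy_norm A \<epsilon> \<omega>s u))"

end

theory Submission
  imports Defs
begin

text \<open>Let \<open>k\<close> be a function of the harmonic space on \<open>\<omega>\<^sup>*\<close> and \<open>s\<close> a cutoff function that passes from
  \<open>1\<close> to \<open>0\<close> in a layer of thickness \<open>\<delta> / N\<close> around \<open>\<omega>\<close>. Testing the equation with \<open>s\<^sup>2 k\<close> bounds the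
  gradient of \<open>s k\<close> by \<open>N / \<delta>\<close> times the \<open>L\<^sup>2\<close> norm of \<open>k\<close> within the outer boundary of the layer, with a
  constant independent of \<open>\<epsilon>\<close> because both sides carry the factor \<open>\<epsilon>\<^sup>2\<close>. If in addition the averages
  of \<open>s k\<close> over the cells of a grid of width proportional to \<open>1 / N\<close> are negligible, then the Poincare
  inequality on the cells turns this into a decrease of the \<open>L\<^sup>2\<close> norm of \<open>k\<close> by a factor \<open>e\<close>. With \<open>N\<close>
  layers these are of the order of \<open>N ^ (d + 1)\<close> linear conditions, which are enforced by subtracting an
  element of a space of this dimension, and they reduce the norm on \<open>\<omega>\<close> by \<open>exp (- N)\<close>. The same test
  argument with the partition function \<open>\<chi>\<close> in place of \<open>s\<close> bounds the energy norm of \<open>\<chi> k\<close> and yields the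
  factor \<open>\<epsilon>\<close> times the maximum of the gradient of \<open>\<chi>\<close>.

  Near the outer boundary \<open>s k\<close> has to be a limit of test functions although \<open>k\<close> only has a vanishing
  trace: the \<open>L\<^sup>2\<close> norm of a smooth function over a strip of height \<open>t\<close> above a Lipschitz graph is at
  most of the order of \<open>t\<close> times that of its gradient plus \<open>sqrt t\<close> times that of its restriction to the
  graph.\<close>

section \<open>Smooth functions and mollification\<close>

text \<open>Only \<open>s k\<close>, never \<open>k\<close>, enters the Poincare inequality. As a
  limit of test functions \<open>s k\<close> can be extended by zero, so one uniform grid that
  ignores every boundary serves all layers and has of the order of \<open>N ^ d\<close> cells. Its
  side \<open>h0 / N\<close> is matched to the gradient bound \<open>N / \<delta>\<close>: the
  powers of \<open>N\<close> cancel, and \<open>h0\<close> is such that the gradient part uses up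
  half of the factor \<open>exp (-2)\<close> by which the squared norm has to drop. The averages are
  kept within the other half.

  The most delicate point is that \<open>\<chi> k\<close> has to be approximated by test functions
  of \<open>\<omega>\<close>. This set is merely open, and \<open>\<chi>\<close> is merely
  continuous with a bounded weak gradient, so mollification alone would leave
  \<open>\<omega>\<close>. The small values of the product are therefore cut off first, which makes
  its support compact.

  \<open>weak_grad\<close> is a choice among functions that agree almost everywhere. The proof
  carries each function together with an explicit gradient and turns to \<open>weak_grad\<close>
  only where the definitions demand it.\<close>

lemma grad_eqI:
  fixes f :: "real^'d \<Rightarrow> real"
  assumes "(f has_derivative (\<lambda>h. g \<bullet> h)) (at x)"
  shows "grad f x = g"
proof -
  have "frechet_derivative f (at x) = (\<lambda>h. g \<bullet> h)" using frechet_derivative_at[OF assms] by simp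
  then show ?thesis by (simp add: grad_def vec_eq_iff inner_axis)
qed

lemma has_derivative_grad:
  fixes f :: "real^'d \<Rightarrow> real"
  assumes "f differentiable (at x)"
  shows "(f has_derivative (\<lambda>h. grad f x \<bullet> h)) (at x)"
proof -
  let ?F = "frechet_derivative f (at x)"
  have F: "(f has_derivative ?F) (at x)" using assms frechet_derivative_works by blast
  then have lin: "linear ?F" using has_derivative_linear by blast
  have "?F h = grad f x \<bullet> h" for h
  proof -
    have "?F h = ?F (\<Sum>i\<in>UNIV. h $ i *\<^sub>R axis i 1)" by (simp add: basis_expansion scalar_mult_eq_scaleR[symmetric])
    also have "\<dots> = (\<Sum>i\<in>UNIV. h $ i * ?F (axis i 1))" by (simp add: linear_sum[OF lin] linear_scale[OF lin] o_def)
    also have "\<dots> = grad f x \<bullet> h" by (simp add: inner_vec_def grad_def mult.commute)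
    finally show ?thesis .
  qed
  then have "?F = (\<lambda>h. grad f x \<bullet> h)" by blast
  then show ?thesis using F by simp
qed

text \<open>Smoothness concerns the derivatives of every order. A set of differentiable functions
  that is closed under partial derivatives is an invariant that settles all orders at once; the
  induction on the order has to range over the whole set.\<close>

lemma smooth_coinduct:
  assumes "f \<in> S" "\<And>f x. f \<in> S \<Longrightarrow> f differentiable (at x)"
    "\<And>f i. f \<in> S \<Longrightarrow> (\<lambda>x. grad f x $ i) \<in> S"
  shows "smooth f"
proof -
  have "f \<in> S \<Longrightarrow> C_k k f" for k f
  proof (induction k arbitrary: f)
    case 0
    then show ?case using assms(2) by (auto simp: continuous_on_eq_continuous_within intro: differentiable_imp_continuous_within)
  next
    case (Suc k)
    then show ?case using assms by simp
  qed
  then show ?thesis using assms(1) by (simp add: smooth_def)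
qed

lemma smooth_differentiable: "smooth f \<Longrightarrow> f differentiable (at x)"
  using C_k.simps(2) smooth_def by blast

lemma smooth_grad: "smooth f \<Longrightarrow> smooth (\<lambda>x. grad f x $ i)"
  using C_k.simps(2) smooth_def by blast

lemma smooth_has_derivative: "smooth f \<Longrightarrow> (f has_derivative (\<lambda>h. grad f x \<bullet> h)) (at x)"
  by (simp add: has_derivative_grad smooth_differentiable)

lemma smooth_continuous: "smooth f \<Longrightarrow> continuous_on S f"
  using C_k.simps(1) smooth_def continuous_on_subset by blast

lemma smooth_grad_continuous: "smooth f \<Longrightarrow> continuous_on S (grad f)"
proof -
  assume f: "smooth f"
  have "continuous_on S (\<lambda>x. \<chi> i. grad f x $ i)" by (rule continuous_on_vec_lambda) (rule smooth_continuous[OF smooth_grad[OF f]])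
  then show ?thesis by (simp only: vec_lambda_eta)
qed

lemma grad_const: "grad (\<lambda>x. c) x = 0"
  by (rule grad_eqI) simp

lemma grad_add:
  assumes "f differentiable (at x)" "g differentiable (at x)"
  shows "grad (\<lambda>x. f x + g x) x = grad f x + grad g x"
  by (rule grad_eqI) (auto simp: inner_add_left intro!: derivative_eq_intros has_derivative_grad assms)

lemma grad_mult:
  assumes "f differentiable (at x)" "g differentiable (at x)"
  shows "grad (\<lambda>x. f x * g x) x = f x *\<^sub>R grad g x + g x *\<^sub>R grad f x"
  by (rule grad_eqI, rule has_derivative_eq_rhs[OF has_derivative_mult[OF has_derivative_grad has_derivative_grad]])
     (auto simp: inner_add_left assms)

text \<open>Partial derivatives of sums and products are polynomials in the generators and their
  derivatives. Hence this algebra can serve as the invariant set of \<open>smooth_coinduct\<close>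
  as soon as it contains the derivatives of the generators.\<close>

inductive_set alg :: "('a \<Rightarrow> real) set \<Rightarrow> ('a \<Rightarrow> real) set" for G where
  alg_base: "f \<in> G \<Longrightarrow> f \<in> alg G"
| alg_const: "(\<lambda>x. c) \<in> alg G"
| alg_add: "f \<in> alg G \<Longrightarrow> g \<in> alg G \<Longrightarrow> (\<lambda>x. f x + g x) \<in> alg G"
| alg_mult: "f \<in> alg G \<Longrightarrow> g \<in> alg G \<Longrightarrow> (\<lambda>x. f x * g x) \<in> alg G"

lemma smooth_alg:
  fixes G :: "(real^'d \<Rightarrow> real) set"
  assumes "\<And>f x. f \<in> G \<Longrightarrow> f differentiable (at x)"
    "\<And>f i. f \<in> G \<Longrightarrow> (\<lambda>x. grad f x $ i) \<in> alg G" and "f \<in> alg G"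
  shows "smooth f"
proof -
  have "(\<forall>x. f differentiable (at x)) \<and> (\<forall>i. (\<lambda>x. grad f x $ i) \<in> alg G)" if "f \<in> alg G" for f using that
  proof induction
    case (alg_add f g)
    then have "(\<lambda>x. grad f x $ i + grad g x $ i) \<in> alg G" for i using alg.alg_add by blast
    then show ?case using alg_add by (auto simp: grad_add)
  next
    case (alg_mult f g)
    then have "(\<lambda>x. f x * grad g x $ i + g x * grad f x $ i) \<in> alg G" for i using alg.alg_add alg.alg_mult by blast
    then show ?case using alg_mult by (auto simp: grad_mult)
  qed (use assms alg_const in \<open>auto simp: grad_const\<close>)
  then show ?thesis using assms(3) by (intro smooth_coinduct[of f "alg G"]) auto
qed

lemma alg_smooth_subset: "f \<in> alg {f. smooth f} \<Longrightarrow> smooth f" for f :: "real^'d \<Rightarrow> real"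
  by (rule smooth_alg) (auto intro: smooth_differentiable alg_base smooth_grad)

lemma smooth_const [simp]: "smooth (\<lambda>x. c)"
  by (auto intro: alg_smooth_subset alg_const)

lemma smooth_add: "smooth f \<Longrightarrow> smooth g \<Longrightarrow> smooth (\<lambda>x. f x + g x)"
  by (auto intro!: alg_smooth_subset alg_add intro: alg_base)

lemma smooth_mult: "smooth f \<Longrightarrow> smooth g \<Longrightarrow> smooth (\<lambda>x. f x * g x)"
  by (auto intro!: alg_smooth_subset alg_mult intro: alg_base)

lemma smooth_diff: "smooth f \<Longrightarrow> smooth g \<Longrightarrow> smooth (\<lambda>x. f x - g x)"
  using smooth_add[of f "\<lambda>x. (-1) * g x"] smooth_mult[of "\<lambda>x. -1" g] by simp

section \<open>A smooth bump function\<close>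

definition flat :: "real poly \<Rightarrow> real \<Rightarrow> real" where
  "flat p t = (if t > 0 then poly p (1/t) * exp (- (1/t)) else 0)"

lemma poly_exp_tendsto_0: "((\<lambda>s. poly p s * exp (- s)) \<longlongrightarrow> (0::real)) at_top"
proof -
  have "((\<lambda>s. \<Sum>i\<le>degree p. coeff p i * (s ^ i / exp s)) \<longlongrightarrow> (\<Sum>i\<le>degree p. coeff p i * 0)) at_top"
    by (intro tendsto_intros tendsto_power_div_exp_0)
  moreover have "poly p s * exp (- s) = (\<Sum>i\<le>degree p. coeff p i * (s ^ i / exp s))" for s by (simp add: poly_altdef sum_distrib_right exp_minus divide_simps)
  ultimately show ?thesis by simp
qed

lemma flat_tendsto_0: "(flat p \<longlongrightarrow> 0) (at 0)"
proof -
  have "((\<lambda>t. poly p (1/t) * exp (- (1/t))) \<longlongrightarrow> 0) (at_right 0)" by (rule filterlim_compose[OF poly_exp_tendsto_0])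
       (simp add: filterlim_inverse_at_top_right flip: inverse_eq_divide)
  then have "(flat p \<longlongrightarrow> 0) (at_right 0)" by (rule Lim_transform_eventually)
       (auto simp: eventually_at_right_field flat_def intro: exI[of _ 1])
  moreover have "(flat p \<longlongrightarrow> 0) (at_left 0)" by (rule Lim_transform_eventually[OF tendsto_const])
       (auto simp: eventually_at_left_field flat_def intro: exI[of _ "-1"])
  ultimately show ?thesis by (simp add: filterlim_split_at)
qed

text \<open>With \<open>s = 1 / t\<close>, the derivative of \<open>p(s) exp(-s)\<close> with
  respect to \<open>t\<close> is \<open>s\<^sup>2 (p(s) - p'(s)) exp(-s)\<close>. So the family
  indexed by all polynomials is closed under differentiation, which the single function
  \<open>exp (- (1 / t))\<close> is not.\<close>

lemma flat_deriv:
  "(flat p has_real_derivative flat ([:0,0,1:] * (p - pderiv p)) t) (at t)"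
proof -
  consider "t > 0" | "t < 0" | "t = 0" by linarith
  then show ?thesis
  proof cases
    case 1
    have "((\<lambda>t. poly p (1/t) * exp (- (1/t))) has_real_derivative
        flat ([:0,0,1:] * (p - pderiv p)) t) (at t)" using 1 by (auto intro!: derivative_eq_intros simp: flat_def field_simps power2_eq_square)
    then show ?thesis by (rule has_field_derivative_transform_within_open[where S="{0<..}"])
         (use 1 in \<open>auto simp: flat_def\<close>)
  next
    case 2
    have "((\<lambda>t. 0) has_real_derivative 0) (at t)" by simp
    then have "(flat p has_real_derivative 0) (at t)" by (rule has_field_derivative_transform_within_open[where S="{..<0}"])
         (use 2 in \<open>auto simp: flat_def\<close>)
    then show ?thesis using 2 by (simp add: flat_def)
  next
    case 3
    \<comment> \<open>The difference quotient of \<open>flat p\<close> at \<open>0\<close> is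
      \<open>flat ([:0,1:] * p)\<close>, which tends to \<open>0\<close> like every member of the
      family.\<close>
    have "((\<lambda>h. flat p h / h) \<longlongrightarrow> 0) (at 0)" by (rule Lim_transform_eventually[OF flat_tendsto_0[of "[:0,1:] * p"]])
         (auto simp: eventually_at flat_def intro: exI[of _ 1])
    then have "(flat p has_real_derivative 0) (at 0)" by (simp add: DERIV_def flat_def)
    then show ?thesis using 3 by (simp add: flat_def)
  qed
qed

definition bump :: "real^'d \<Rightarrow> real" where
  "bump x = flat 1 (1 - x \<bullet> x)"

lemma grad_flat:
  "((\<lambda>x::real^'d. flat p (1 - x \<bullet> x)) has_derivative
     (\<lambda>h. ((-2 * flat ([:0,0,1:] * (p - pderiv p)) (1 - x \<bullet> x)) *\<^sub>R x) \<bullet> h)) (at x)"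
proof -
  have "((\<lambda>x. 1 - x \<bullet> x) has_derivative (\<lambda>h. - (2 * (x \<bullet> h)))) (at x)" by (auto intro!: derivative_eq_intros simp: inner_commute)
  from has_derivative_compose[OF this flat_deriv[THEN has_field_derivative_imp_has_derivative]]
  show ?thesis by (rule has_derivative_eq_rhs) (auto simp: fun_eq_iff)
qed

lemma smooth_bump: "smooth (bump :: real^'d \<Rightarrow> real)"
proof -
  \<comment> \<open>Coordinates together with all \<open>flat\<close> profiles: differentiating a
    profile gives a multiple of a coordinate times another profile.\<close>
  define G :: "(real^'d \<Rightarrow> real) set"
    where "G = range (\<lambda>i x. x $ i) \<union> range (\<lambda>p x. flat p (1 - x \<bullet> x))"
  have cd: "((\<lambda>x::real^'d. x $ i) has_derivative (\<lambda>h. axis i 1 \<bullet> h)) (at x)" for i x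
    by (rule has_derivative_eq_rhs[OF bounded_linear_imp_has_derivative[OF bounded_linear_vec_nth]])
       (auto simp: inner_axis inner_commute)
  show ?thesis
  proof (rule smooth_alg[of G])
    fix f x assume "f \<in> G"
    then show "f differentiable (at x)" unfolding G_def using cd grad_flat differentiableI by blast
  next
    fix f i assume "f \<in> G"
    then consider j where "f = (\<lambda>x. x $ j)" | p where "f = (\<lambda>x. flat p (1 - x \<bullet> x))" by (auto simp: G_def)
    then show "(\<lambda>x. grad f x $ i) \<in> alg G"
    proof cases
      case 1
      then show ?thesis using alg_const by (simp add: grad_eqI[OF cd])
    next
      case 2
      let ?q = "[:0,0,1:] * (p - pderiv p)"
      have "(\<lambda>x. -2 * flat ?q (1 - x \<bullet> x) * x $ i) \<in> alg G" by (intro alg_mult alg_const alg_base) (auto simp: G_def)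
      then show ?thesis by (simp only: 2 grad_eqI[OF grad_flat] vector_scaleR_component real_scaleR_def)
    qed
  next
    show "bump \<in> alg G" by (intro alg_base) (auto simp: G_def bump_def[abs_def])
  qed
qed

lemma bump_nonneg: "0 \<le> bump x" by (simp add: bump_def flat_def)

lemma bump_pos_iff: "bump x > 0 \<longleftrightarrow> norm x < 1"
  using abs_square_less_1[of "norm x"] by (auto simp: bump_def flat_def dot_square_norm)

lemma bump_eq_0: "norm x \<ge> 1 \<Longrightarrow> bump x = 0"
  using bump_pos_iff[of x] bump_nonneg[of x] by linarith

lemma smooth_affine:
  fixes f :: "real^'d \<Rightarrow> real"
  assumes "smooth f"
  shows "smooth (\<lambda>x. f (c *\<^sub>R x + a))" "grad (\<lambda>x. f (c *\<^sub>R x + a)) x = c *\<^sub>R grad f (c *\<^sub>R x + a)"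
proof -
  have d: "((\<lambda>x. k * f (c *\<^sub>R x + a)) has_derivative (\<lambda>h. (k *\<^sub>R c *\<^sub>R grad f (c *\<^sub>R x + a)) \<bullet> h)) (at x)"
    if "smooth f" for f :: "real^'d \<Rightarrow> real" and k x
  proof -
    have "((\<lambda>x. c *\<^sub>R x + a) has_derivative (\<lambda>h. c *\<^sub>R h)) (at x)" by (auto intro!: derivative_eq_intros)
    from has_derivative_mult_right[OF has_derivative_compose[OF this smooth_has_derivative[OF that]]]
    show ?thesis by (rule has_derivative_eq_rhs) auto
  qed
  \<comment> \<open>Each differentiation brings out another factor \<open>c\<close>, so the
    invariant set has to contain all scalar multiples.\<close>
  define S where "S = {(\<lambda>x. k * f (c *\<^sub>R x + a)) | k f. smooth f}"
  have "smooth (\<lambda>x. 1 * f (c *\<^sub>R x + a))"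
  proof (rule smooth_coinduct[of _ S])
    show "(\<lambda>x. 1 * f (c *\<^sub>R x + a)) \<in> S" unfolding S_def using assms by blast
    fix g x assume "g \<in> S"
    then show "g differentiable (at x)" unfolding S_def using d differentiableI by blast
  next
    fix g i assume "g \<in> S"
    then obtain k f where g: "g = (\<lambda>x. k * f (c *\<^sub>R x + a))" "smooth f" unfolding S_def by blast
    have "(\<lambda>x. grad g x $ i) = (\<lambda>x. (k * c) * (\<lambda>y. grad f y $ i) (c *\<^sub>R x + a))" by (simp add: g(1) grad_eqI[OF d[OF g(2)]])
    then show "(\<lambda>x. grad g x $ i) \<in> S" unfolding S_def by (intro CollectI exI[of _ "k * c"] exI[of _ "\<lambda>y. grad f y $ i"] conjI smooth_grad g(2))
  qed
  then show "smooth (\<lambda>x. f (c *\<^sub>R x + a))" by simp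
  show "grad (\<lambda>x. f (c *\<^sub>R x + a)) x = c *\<^sub>R grad f (c *\<^sub>R x + a)" using d[OF assms, of 1] by (intro grad_eqI) auto
qed

section \<open>Smooth functions with bounded support and their integrals\<close>

definition csmooth :: "(real^'d \<Rightarrow> real) \<Rightarrow> bool" where
  "csmooth f \<longleftrightarrow> smooth f \<and> bounded {x. f x \<noteq> 0}"

lemma csmoothI: "smooth f \<Longrightarrow> (\<And>x. norm x > R \<Longrightarrow> f x = 0) \<Longrightarrow> csmooth f"
  unfolding csmooth_def by (auto simp: bounded_iff intro!: exI[of _ R] leI)

lemma csmoothE:
  assumes "csmooth f"
  obtains R where "R > 0" "smooth f" "\<And>x. norm x > R \<Longrightarrow> f x = 0"
proof -
  obtain R where "R > 0" "\<And>x. f x \<noteq> 0 \<Longrightarrow> norm x \<le> R" using assms unfolding csmooth_def bounded_pos by blast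
  then show ?thesis using that assms unfolding csmooth_def by (meson not_le)
qed

lemma grad_eq_0:
  fixes f :: "real^'d \<Rightarrow> real"
  assumes "open U" "x \<in> U" "\<And>y. y \<in> U \<Longrightarrow> f y = c"
  shows "grad f x = 0"
proof (rule grad_eqI)
  have "((\<lambda>_. c) has_derivative (\<lambda>h. 0 \<bullet> h)) (at x)" by simp
  then show "(f has_derivative (\<lambda>h. 0 \<bullet> h)) (at x)" by (rule has_derivative_transform_within_open[OF _ assms(1,2)]) (simp add: assms(3))
qed

lemma csmooth_grad: "csmooth f \<Longrightarrow> csmooth (\<lambda>x. grad f x $ i)"
proof -
  assume f: "csmooth f"
  obtain R where R: "smooth f" "\<And>x. norm x > R \<Longrightarrow> f x = 0" using csmoothE[OF f] by blast
  have "grad f x = 0" if "norm x > R" for x by (rule grad_eq_0[of "- cball 0 R" _ _ 0]) (use that R(2) in auto)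
  then show ?thesis by (intro csmoothI[of _ R] smooth_grad[OF R(1)]) auto
qed

lemma bounded_integrable_mult:
  fixes f g :: "'a \<Rightarrow> real"
  assumes "integrable M f" "g \<in> borel_measurable M" "\<And>x. \<bar>g x\<bar> \<le> B"
  shows "integrable M (\<lambda>x. f x * g x)"
proof (rule Bochner_Integration.integrable_bound[of M "\<lambda>x. B * f x"])
  show "AE x in M. norm (f x * g x) \<le> norm (B * f x)"
  proof (rule AE_I2)
    fix x
    have "\<bar>g x\<bar> * \<bar>f x\<bar> \<le> \<bar>B\<bar> * \<bar>f x\<bar>" using assms(3)[of x] by (intro mult_right_mono) auto
    then show "norm (f x * g x) \<le> norm (B * f x)" by (simp add: abs_mult mult.commute)
  qed
qed (use assms in auto)

lemma continuous_bounded_support: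
  fixes f :: "real^'d \<Rightarrow> real"
  assumes "continuous_on UNIV f" "\<And>x. norm x > R \<Longrightarrow> f x = 0"
  obtains B where "B > 0" "\<And>x. \<bar>f x\<bar> \<le> B"
proof -
  have "compact (f ` cball 0 R)" using assms(1) continuous_on_subset by (intro compact_continuous_image) auto
  then obtain B where B: "B > 0" "\<And>x. x \<in> cball 0 R \<Longrightarrow> norm (f x) \<le> B" unfolding compact_eq_bounded_closed bounded_pos by auto
  have "\<bar>f x\<bar> \<le> B" for x using B assms(2)[of x] by (cases "norm x \<le> R") auto
  then show ?thesis using that B(1) by blast
qed

lemma csmooth_bounded:
  assumes "csmooth f" obtains B where "B > 0" "\<And>x. \<bar>f x\<bar> \<le> B"
proof -
  obtain R where R: "smooth f" "\<And>x. norm x > R \<Longrightarrow> f x = 0" using csmoothE[OF assms] by blast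
  show ?thesis by (rule continuous_bounded_support[OF smooth_continuous[OF R(1)] R(2) that])
qed

lemma continuous_integrable:
  fixes f :: "real^'d \<Rightarrow> real"
  assumes "continuous_on UNIV f" "\<And>x. norm x > R \<Longrightarrow> f x = 0"
  shows "integrable lborel f"
proof -
  have "integrable lborel (\<lambda>x. indicator (cball 0 R) x *\<^sub>R f x)" using assms(1) continuous_on_subset by (intro borel_integrable_compact) auto
  also have "(\<lambda>x. indicator (cball 0 R) x *\<^sub>R f x) = f" using assms(2) by (auto simp: indicator_def fun_eq_iff)
  finally show ?thesis .
qed

lemma csmooth_integrable: "csmooth f \<Longrightarrow> integrable lborel f"
  by (erule csmoothE, rule continuous_integrable[OF smooth_continuous])

lemma smooth_measurable: "smooth f \<Longrightarrow> f \<in> borel_measurable borel"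
  by (simp add: borel_measurable_continuous_onI smooth_continuous)

lemma smooth_grad_measurable: "smooth f \<Longrightarrow> grad f \<in> borel_measurable borel"
  by (simp add: borel_measurable_continuous_onI smooth_grad_continuous)

lemma lborel_integral_affine:
  fixes F :: "real^'d \<Rightarrow> real"
  assumes [measurable]: "F \<in> borel_measurable borel" and c: "c \<noteq> 0"
  shows "integral\<^sup>L lborel (\<lambda>x. F (t + c *\<^sub>R x)) = integral\<^sup>L lborel F / \<bar>c\<bar> ^ CARD('d)"
proof -
  have "integral\<^sup>L lborel F = integral\<^sup>L (density (distr lborel borel (\<lambda>x. t + c *\<^sub>R x)) (\<lambda>_. \<bar>c\<bar>^DIM(real^'d))) F"
    using lborel_affine[OF c, of t] by simp
  also have "\<dots> = \<bar>c\<bar> ^ CARD('d) * integral\<^sup>L lborel (\<lambda>x. F (t + c *\<^sub>R x))" by (subst integral_density) (simp_all add: integral_distr)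
  finally show ?thesis using c by simp
qed

lemma lborel_nn_integral_affine:
  fixes F :: "real^'d \<Rightarrow> ennreal"
  assumes [measurable]: "F \<in> borel_measurable borel" and c: "\<bar>c\<bar> = 1"
  shows "integral\<^sup>N lborel (\<lambda>x. F (t + c *\<^sub>R x)) = integral\<^sup>N lborel F"
proof -
  have "c \<noteq> 0" using c by auto
  then have "integral\<^sup>N lborel F = integral\<^sup>N (density (distr lborel borel (\<lambda>x. t + c *\<^sub>R x)) (\<lambda>_. ennreal (\<bar>c\<bar>^DIM(real^'d)))) F"
    using lborel_affine[of c t] by simp
  also have "\<dots> = integral\<^sup>N lborel (\<lambda>x. F (t + c *\<^sub>R x))" using c by (subst nn_integral_density) (simp_all add: nn_integral_distr)
  finally show ?thesis by simp
qed

section \<open>Convolution with smooth functions of bounded support\<close>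

definition conv :: "(real^'d \<Rightarrow> real) \<Rightarrow> (real^'d \<Rightarrow> real) \<Rightarrow> real^'d \<Rightarrow> real" where
  "conv f s x = (\<integral>y. f y * s (x - y) \<partial>lborel)"

lemma conv_integrable:
  assumes "integrable lborel f" "csmooth s"
  shows "integrable lborel (\<lambda>y. f y * s (x - y))"
proof -
  obtain B where B: "\<And>x. \<bar>s x\<bar> \<le> B" using csmooth_bounded[OF assms(2)] by blast
  have [measurable]: "s \<in> borel_measurable borel" using assms(2) csmooth_def smooth_measurable by blast
  show ?thesis by (rule bounded_integrable_mult[OF assms(1) _ B]) simp
qed

text \<open>If one of two points at distance below \<open>1\<close> is farther than
  \<open>R + 1\<close> from the origin, the function vanishes at both. Otherwise both lie in a
  compact ball, on which it is uniformly continuous.\<close>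

lemma continuous_support_uniform:
  fixes c :: "real^'d \<Rightarrow> 'b::real_normed_vector"
  assumes "continuous_on UNIV c" "\<And>x. norm x > R \<Longrightarrow> c x = 0" "e > 0"
  obtains d where "d > 0" "\<And>x y. dist x y < d \<Longrightarrow> norm (c y - c x) < e"
proof -
  have uc: "uniformly_continuous_on (cball 0 (R+2)) c" by (intro compact_uniformly_continuous continuous_on_subset[OF assms(1)]) auto
  have "\<exists>d>0. \<forall>x\<in>cball 0 (R+2). \<forall>x'\<in>cball 0 (R+2). dist x' x < d \<longrightarrow> dist (c x') (c x) < e"
    using uc assms(3) unfolding uniformly_continuous_on_def by blast
  then obtain d where d: "d > 0"
    "\<And>x x'. x \<in> cball 0 (R+2) \<Longrightarrow> x' \<in> cball 0 (R+2) \<Longrightarrow> dist x' x < d \<Longrightarrow> dist (c x') (c x) < e" by blast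
  have "norm (c y - c x) < e" if "dist x y < min d 1" for x y
  proof (cases "norm x \<le> R + 1")
    case True
    then have "norm y \<le> R + 2" using that norm_triangle_ineq2[of y x] by (simp add: dist_norm norm_minus_commute)
    then show ?thesis using True d(2)[of x y] that by (simp add: dist_norm norm_minus_commute)
  next
    case False
    then have "norm y > R" using that norm_triangle_ineq2[of x y] by (simp add: dist_norm)
    then show ?thesis using False assms(2)[of x] assms(2)[of y] assms(3) by simp
  qed
  then show ?thesis using that[of "min d 1"] d(1) by auto
qed

text \<open>The bound is uniform in the base point \<open>z\<close>. This is what lets the
  difference quotient pass under the integral in \<open>conv_has_derivative\<close> with
  \<open>f\<close> merely integrable.\<close>

lemma csmooth_linearization:
  fixes s :: "real^'d \<Rightarrow> real"
  assumes "csmooth s" "e > 0"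
  obtains d where "d > 0" "\<And>z h. norm h < d \<Longrightarrow> \<bar>s (z + h) - s z - grad s z \<bullet> h\<bar> \<le> e * norm h"
proof -
  obtain R where R: "R > 0" "smooth s" "\<And>x. norm x > R \<Longrightarrow> s x = 0" using csmoothE[OF assms(1)] by blast
  have g0: "grad s x = 0" if "norm x > R" for x by (rule grad_eq_0[of "- cball 0 R" _ _ 0]) (use that R(3) in auto)
  obtain d where d: "d > 0" "\<And>x y. dist x y < d \<Longrightarrow> norm (grad s y - grad s x) < e"
    using continuous_support_uniform[OF smooth_grad_continuous[OF R(2)] g0 assms(2)] by blast
  have "\<bar>s (z + h) - s z - grad s z \<bullet> h\<bar> \<le> e * norm h" if h: "norm h < d" for z h
  proof -
    have "norm (s (z + h) - s z - (\<lambda>k. grad s z \<bullet> k) ((z + h) - z)) \<le> norm ((z + h) - z) * e"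
    proof (rule differentiable_bound_linearization[where S="ball z (d)" and f'="\<lambda>x h. grad s x \<bullet> h"])
      show "z + t *\<^sub>R (z + h - z) \<in> ball z (d)" if "t \<in> {0..1}" for t
      proof -
        have "norm (t *\<^sub>R h) \<le> norm h" using that by (simp add: mult_left_le_one_le)
        then show ?thesis using h by (simp add: dist_norm)
      qed
      show "(s has_derivative (\<lambda>h. grad s x \<bullet> h)) (at x within ball z (d))" for x
        using smooth_has_derivative[OF R(2)] has_derivative_at_withinI by blast
      show "onorm ((\<lambda>k. grad s x \<bullet> k) - (\<lambda>k. grad s z \<bullet> k)) \<le> e" if "x \<in> ball z (d)" for x unfolding fun_diff_def
      proof (rule onorm_le)
        fix k
        have "norm (grad s x \<bullet> k - grad s z \<bullet> k) \<le> norm (grad s x - grad s z) * norm k" by (simp add: inner_diff_left[symmetric] Cauchy_Schwarz_ineq2)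
        also have "\<dots> \<le> e * norm k" using d(2)[of z x] that by (auto intro!: mult_right_mono)
        finally show "norm (grad s x \<bullet> k - grad s z \<bullet> k) \<le> e * norm k" .
      qed
    qed (use d(1) in auto)
    then show ?thesis by (simp add: mult.commute)
  qed
  then show ?thesis using that[of d] d(1) by auto
qed

lemma conv_has_derivative:
  assumes f: "integrable lborel f" and s: "csmooth s"
  shows "(conv f s has_derivative (\<lambda>h. (\<chi> i. conv f (\<lambda>y. grad s y $ i) x) \<bullet> h)) (at x)"
proof -
  let ?g = "\<chi> i. conv f (\<lambda>y. grad s y $ i) x"
  have int: "integrable lborel (\<lambda>y. f y * grad s (x - y) $ i)" for i x using conv_integrable[OF f csmooth_grad[OF s]] by simp
  have g: "?g \<bullet> h = (\<integral>y. f y * (grad s (x - y) \<bullet> h) \<partial>lborel)"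
    and gi: "integrable lborel (\<lambda>y. f y * (grad s (x - y) \<bullet> h))" for h
  proof -
    have "?g \<bullet> h = (\<Sum>i\<in>UNIV. (\<integral>y. f y * grad s (x - y) $ i * h $ i \<partial>lborel))" by (simp add: inner_vec_def conv_def)
    also have "\<dots> = (\<integral>y. (\<Sum>i\<in>UNIV. f y * grad s (x - y) $ i * h $ i) \<partial>lborel)"
      by (subst Bochner_Integration.integral_sum) (use int in auto)
    finally show "?g \<bullet> h = (\<integral>y. f y * (grad s (x - y) \<bullet> h) \<partial>lborel)" by (simp add: inner_vec_def sum_distrib_left mult.assoc)
    have "integrable lborel (\<lambda>y. (\<Sum>i\<in>UNIV. f y * grad s (x - y) $ i * h $ i))" using int by auto
    then show "integrable lborel (\<lambda>y. f y * (grad s (x - y) \<bullet> h))" by (simp add: inner_vec_def sum_distrib_left mult.assoc)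
  qed
  let ?I = "\<integral>y. \<bar>f y\<bar> \<partial>lborel"
  have I: "?I \<ge> 0" by simp
  show ?thesis unfolding has_derivative_at_alt
  proof (intro conjI allI impI)
    show "bounded_linear (\<lambda>h. ?g \<bullet> h)" by (rule bounded_linear_inner_right)
    fix e :: real assume e: "e > 0"
    \<comment> \<open>The error integrates to \<open>e / (?I + 1) * ?I\<close>; the summand
      \<open>1\<close> keeps the quotient meaningful when \<open>f\<close> vanishes.\<close>
    obtain d where d: "d > 0"
      "\<And>z h. norm h < d \<Longrightarrow> \<bar>s (z + h) - s z - grad s z \<bullet> h\<bar> \<le> (e / (?I + 1)) * norm h"
      using csmooth_linearization[OF s, of "e / (?I + 1)"] e I by auto
    show "\<exists>d>0. \<forall>y. norm (y - x) < d \<longrightarrow> norm (conv f s y - conv f s x - ?g \<bullet> (y - x)) \<le> e * norm (y - x)"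
    proof (intro exI[of _ d] conjI allI impI d(1))
      fix y assume y: "norm (y - x) < d"
      define h where "h = y - x"
      have yz: "x - z + h = y - z" for z by (simp add: h_def)
      have "conv f s y - conv f s x - ?g \<bullet> h
          = (\<integral>z. f z * (s (x - z + h) - s (x - z) - grad s (x - z) \<bullet> h) \<partial>lborel)"
        using conv_integrable[OF f s, of y] conv_integrable[OF f s, of x] gi[of h] unfolding yz g unfolding conv_def by (simp add: right_diff_distrib)
      also have "\<bar>\<dots>\<bar> \<le> (\<integral>z. (e / (?I + 1) * norm h) * \<bar>f z\<bar> \<partial>lborel)"
      proof (rule integral_abs_bound[THEN order_trans], rule integral_mono)
        have "integrable lborel (\<lambda>z. f z * s (x - z + h) - f z * s (x - z) - f z * (grad s (x - z) \<bullet> h))"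
          using conv_integrable[OF f s, of y] conv_integrable[OF f s, of x] gi[of h] unfolding yz by (intro Bochner_Integration.integrable_diff)
        then show "integrable lborel (\<lambda>z. \<bar>f z * (s (x - z + h) - s (x - z) - grad s (x - z) \<bullet> h)\<bar>)" by (simp add: right_diff_distrib)
        show "integrable lborel (\<lambda>z. (e / (?I + 1) * norm h) * \<bar>f z\<bar>)" using f by simp
        fix z
        show "\<bar>f z * (s (x - z + h) - s (x - z) - grad s (x - z) \<bullet> h)\<bar> \<le> (e / (?I + 1) * norm h) * \<bar>f z\<bar>"
          using mult_left_mono[OF d(2)[of h "x - z"], of "\<bar>f z\<bar>"] y by (simp add: abs_mult h_def[symmetric] mult.commute mult.left_commute)
      qed
      also have "\<dots> = (e / (?I + 1) * norm h) * ?I" by simp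
      also have "\<dots> = e * norm h * (?I / (?I + 1))" by (simp only: times_divide_eq_left times_divide_eq_right mult_ac)
      also have "\<dots> \<le> e * norm h"
      proof (rule mult_left_le)
        show "?I / (?I + 1) \<le> 1" using I by (subst divide_le_eq_1_pos) linarith+
      qed (use e in simp)
      finally show "norm (conv f s y - conv f s x - ?g \<bullet> (y - x)) \<le> e * norm (y - x)" by (simp add: h_def)
    qed
  qed
qed

text \<open>For fixed \<open>f\<close> the convolutions with all smooth functions of bounded support
  form an invariant set in the sense of \<open>smooth_coinduct\<close>.\<close>

lemma
  assumes f: "integrable lborel f" and s: "csmooth s"
  shows smooth_conv: "smooth (conv f s)"
    and grad_conv: "grad (conv f s) x $ i = conv f (\<lambda>y. grad s y $ i) x"
proof -
  have g: "grad (conv f s) x $ i = conv f (\<lambda>y. grad s y $ i) x" if "csmooth s" for s x i by (simp add: grad_eqI[OF conv_has_derivative[OF f that]])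
  show "grad (conv f s) x $ i = conv f (\<lambda>y. grad s y $ i) x" using g[OF s] .
  show "smooth (conv f s)"
  proof (rule smooth_coinduct[of _ "conv f ` {s. csmooth s}"])
    fix h x assume "h \<in> conv f ` {s. csmooth s}"
    then show "h differentiable (at x)" by (auto intro: differentiableI[OF conv_has_derivative[OF f]])
  next
    fix h i assume "h \<in> conv f ` {s. csmooth s}"
    then show "(\<lambda>x. grad h x $ i) \<in> conv f ` {s. csmooth s}" by (auto simp: g intro!: imageI csmooth_grad)
  qed (use s in auto)
qed

section \<open>Mollifiers\<close>

definition moll :: "real \<Rightarrow> real^'d \<Rightarrow> real" where
  "moll r x = bump ((1/r) *\<^sub>R x) / (\<integral>y. bump ((1/r) *\<^sub>R y :: real^'d) \<partial>lborel)"

lemma csmooth_bump: "csmooth bump"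
  by (rule csmoothI[of _ 1]) (auto simp: smooth_bump bump_eq_0)

lemma bump_integral_pos: "0 < (\<integral>x. bump (x::real^'d) \<partial>lborel)"
proof -
  have i: "integrable lborel (bump :: real^'d \<Rightarrow> real)" by (rule csmooth_integrable[OF csmooth_bump])
  have "(\<integral>x. bump (x::real^'d) \<partial>lborel) \<noteq> 0"
  proof
    assume "(\<integral>x. bump (x::real^'d) \<partial>lborel) = 0"
    then have "AE x in lborel. bump (x::real^'d) = 0" using integral_nonneg_eq_0_iff_AE[OF i] bump_nonneg by auto
    then have "AE x in lborel. x \<notin> ball (0::real^'d) 1"
    proof eventually_elim
      case (elim x)
      then show ?case using bump_pos_iff[of x] by auto
    qed
    then have "emeasure lborel (ball (0::real^'d) 1) = 0" by (subst AE_iff_measurable[of _ lborel "\<lambda>x. x \<notin> ball 0 1", symmetric]) auto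
    then show False using emeasure_ball[of 1 "0::real^'d"] unit_ball_vol_pos[of "real CARD('d)"] by simp
  qed
  moreover have "0 \<le> (\<integral>x. bump (x::real^'d) \<partial>lborel)" by (simp add: bump_nonneg)
  ultimately show ?thesis by simp
qed

lemma bump_scaled_integral:
  "r > 0 \<Longrightarrow> (\<integral>y. bump ((1/r) *\<^sub>R y :: real^'d) \<partial>lborel) = r ^ CARD('d) * (\<integral>x. bump (x::real^'d) \<partial>lborel)"
  using lborel_integral_affine[of "bump :: real^'d \<Rightarrow> real" "1/r" 0] smooth_measurable[OF smooth_bump[where 'd='d]] by (simp add: power_divide)

lemma moll_nonneg: "r > 0 \<Longrightarrow> 0 \<le> moll r x"
  unfolding moll_def using bump_nonneg by (auto intro!: divide_nonneg_nonneg)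

lemma moll_eq_0: "r > 0 \<Longrightarrow> norm x \<ge> r \<Longrightarrow> moll r x = 0" for x :: "real^'d"
  by (simp add: moll_def bump_eq_0)

lemma csmooth_moll: "r > 0 \<Longrightarrow> csmooth (moll r :: real^'d \<Rightarrow> real)"
proof (rule csmoothI[of _ r])
  show "smooth (moll r :: real^'d \<Rightarrow> real)" using smooth_mult[OF smooth_affine(1)[OF smooth_bump, of "1/r" 0] smooth_const]
    unfolding moll_def[abs_def] divide_inverse by simp
qed (auto simp: moll_eq_0)

lemma moll_integral: "r > 0 \<Longrightarrow> (\<integral>x. moll r (x::real^'d) \<partial>lborel) = 1"
  using bump_scaled_integral[of r, where 'd='d] bump_integral_pos[where 'd='d] by (simp add: moll_def)

lemma moll_integral_reflect: "r > 0 \<Longrightarrow> (\<integral>y. moll r (x - y) \<partial>lborel) = 1" for x :: "real^'d"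
  using lborel_integral_affine[of "moll r" "-1" x] moll_integral[where 'd='d, of r]
    smooth_measurable[of "moll r :: real^'d \<Rightarrow> real"] csmooth_moll[where 'd='d, of r] by (simp add: csmooth_def)

lemma moll_integrable: "r > 0 \<Longrightarrow> integrable lborel (\<lambda>y. moll r (x - y))" for x :: "real^'d"
  using moll_integral_reflect[of r x] not_integrable_integral_eq by fastforce

text \<open>As a function of \<open>y\<close>, \<open>moll r (x - y)\<close> is a probability
  density supported in the ball of radius \<open>r\<close> about \<open>x\<close>, so a convolution
  with it is an average of nearby values.\<close>

lemma moll_average_le:
  fixes x :: "real^'d"
  assumes r: "r > 0" and i: "integrable lborel (\<lambda>y. a y * moll r (x - y))" and le: "\<And>y. dist x y < r \<Longrightarrow> \<bar>a y\<bar> \<le> e"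
  shows "\<bar>\<integral>y. a y * moll r (x - y) \<partial>lborel\<bar> \<le> e"
proof -
  have "\<bar>\<integral>y. a y * moll r (x - y) \<partial>lborel\<bar> \<le> (\<integral>y. \<bar>a y * moll r (x - y)\<bar> \<partial>lborel)" by (rule integral_abs_bound)
  also have "\<dots> \<le> (\<integral>y. e * moll r (x - y) \<partial>lborel)"
  proof (rule Bochner_Integration.integral_mono)
    fix y
    show "\<bar>a y * moll r (x - y)\<bar> \<le> e * moll r (x - y)"
    proof (cases "dist x y < r")
      case True
      then show ?thesis using mult_right_mono[OF le[OF True] moll_nonneg[OF r, of "x - y"]] moll_nonneg[OF r, of "x - y"] by (simp add: abs_mult)
    qed (use moll_eq_0[OF r, of "x - y"] in \<open>simp add: dist_norm\<close>)
  qed (use i moll_integrable[OF r] in auto)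
  also have "\<dots> = e" using moll_integral_reflect[OF r, of x] by simp
  finally show ?thesis .
qed

lemma moll_conv_close:
  fixes c :: "real^'d \<Rightarrow> real"
  assumes c: "integrable lborel c" and r: "r > 0" and close: "\<And>y. dist x y < r \<Longrightarrow> \<bar>c y - c x\<bar> \<le> e"
  shows "\<bar>conv c (moll r) x - c x\<bar> \<le> e"
proof -
  note i = conv_integrable[OF c csmooth_moll[OF r], of x] moll_integrable[OF r, of x]
  have "conv c (moll r) x - c x = (\<integral>y. (c y - c x) * moll r (x - y) \<partial>lborel)"
    using i by (simp add: conv_def moll_integral_reflect[OF r] left_diff_distrib)
  moreover have "integrable lborel (\<lambda>y. (c y - c x) * moll r (x - y))" using i by (simp add: left_diff_distrib)
  ultimately show ?thesis using moll_average_le[OF r _ close] by simp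
qed

text \<open>The first-order expansion is evaluated at a short step in the direction of the gradient
  itself, where the linear term is as large as possible.\<close>

lemma grad_le_lipschitz:
  fixes s :: "real^'d \<Rightarrow> real"
  assumes s: "smooth s" and K: "K \<ge> 0" "\<And>h. \<bar>s (x + h) - s x\<bar> \<le> K * norm h"
  shows "norm (grad s x) \<le> K"
proof (cases "grad s x = 0")
  case False
  show ?thesis
  proof (rule field_le_epsilon)
    fix e :: real assume "e > 0"
    then obtain d where d: "d > 0" "\<And>y. norm (y - x) < d \<Longrightarrow> norm (s y - s x - grad s x \<bullet> (y - x)) \<le> e * norm (y - x)"
      using smooth_has_derivative[OF s, of x] unfolding has_derivative_at_alt by blast
    define h where "h = (d / 2 / norm (grad s x)) *\<^sub>R grad s x"
    have h: "norm h = d / 2" "grad s x \<bullet> h = norm (grad s x) * (d / 2)" using d(1) False by (simp_all add: h_def dot_square_norm power2_eq_square)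
    have "\<bar>s (x + h) - s x - grad s x \<bullet> h\<bar> \<le> e * norm h" using d(2)[of "x + h"] d(1) unfolding add_diff_cancel_left' h(1) real_norm_def by linarith
    then have "norm (grad s x) * (d / 2) \<le> (K + e) * (d / 2)" using K(2)[of h] unfolding h distrib_right by linarith
    then show "norm (grad s x) \<le> K + e" using d(1) by simp
  qed
qed (use K in simp)

section \<open>Smooth cutoff functions with gradient bounds\<close>

definition cutoff :: "real \<Rightarrow> (real^'d \<Rightarrow> real) \<Rightarrow> bool" where
  "cutoff G s \<longleftrightarrow> smooth s \<and> (\<forall>x. 0 \<le> s x \<and> s x \<le> 1 \<and> norm (grad s x) \<le> G)"

text \<open>\<open>0\<close> and \<open>1\<close> are extreme values of \<open>s\<close>, so the
  gradient vanishes wherever one of them is attained, also at points on the edge of a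
  plateau.\<close>

lemma cutoffD:
  assumes "cutoff G s"
  shows "smooth s" "0 \<le> s x" "s x \<le> 1" "norm (grad s x) \<le> G" "s x = 0 \<or> s x = 1 \<Longrightarrow> grad s x = 0"
proof -
  show s: "smooth s" "0 \<le> s x" "s x \<le> 1" "norm (grad s x) \<le> G" for x using assms by (auto simp: cutoff_def)
  assume "s x = 0 \<or> s x = 1"
  then have "(\<lambda>h. grad s x \<bullet> h) = (\<lambda>h. 0)" using differential_zero_maxmin[OF UNIV_I open_UNIV smooth_has_derivative[OF s(1), of x]] s(2,3) by auto
  then show "grad s x = 0" by (metis inner_eq_zero_iff)
qed

lemma lipschitz_cutoff:
  fixes F :: "real^'d \<Rightarrow> real"
  assumes L: "L > 0" "\<And>x y. \<bar>F x - F y\<bar> \<le> L * dist x y" and ab: "a < b" and bd: "bounded {x. a < F x}"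
  obtains s where "cutoff (2 * L / (b - a)) s" "\<And>x. b \<le> F x \<Longrightarrow> s x = 1" "\<And>x. F x \<le> a \<Longrightarrow> s x = 0"
proof -
  \<comment> \<open>The ramp \<open>f\<close> rises only while \<open>F\<close> passes through the
    middle half of the interval. Mollification at scale \<open>c / L\<close> moves \<open>F\<close>
    by less than \<open>c\<close>, so the values \<open>0\<close> and \<open>1\<close> stay exact at
    both ends, and the slope \<open>L / (2 * c)\<close> of the ramp is the stated gradient
    bound.\<close>
  define c where "c = (b - a) / 4"
  have c: "c > 0" and b: "b = a + 4 * c" using ab by (auto simp: c_def field_simps)
  define f where "f y = max 0 (min 1 ((F y - a - c) / (2 * c)))" for y
  have fl: "\<bar>f x - f y\<bar> \<le> L / (2 * c) * dist x y" for x y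
  proof -
    have "\<bar>f x - f y\<bar> \<le> \<bar>(F x - a - c) / (2 * c) - (F y - a - c) / (2 * c)\<bar>" unfolding f_def by linarith
    also have "\<dots> = \<bar>F x - F y\<bar> / (2 * c)" using c by (simp add: diff_divide_distrib[symmetric])
    also have "\<dots> \<le> L * dist x y / (2 * c)" using L(2) c by (intro divide_right_mono) auto
    finally show ?thesis by simp
  qed
  have f01: "0 \<le> f y" "f y \<le> 1" for y by (auto simp: f_def)
  have f0: "f y = 0" if "F y \<le> a + c" for y using that c by (simp add: f_def divide_le_0_iff)
  have f1: "f y = 1" if "F y \<ge> a + 3 * c" for y using that c by (simp add: f_def le_divide_eq)
  have "(L / (2 * c))-lipschitz_on UNIV f" using fl L c by (intro lipschitz_onI) (auto simp: dist_real_def)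
  then have fc: "continuous_on UNIV f" by (rule lipschitz_on_continuous_on)
  obtain R where R: "\<And>x. a < F x \<Longrightarrow> norm x \<le> R" using bd unfolding bounded_iff by auto
  have fR: "f y = 0" if "norm y > R" for y using R[of y] that c by (intro f0) force
  have fi: "integrable lborel f" by (rule continuous_integrable[OF fc fR])
  define r where "r = c / L"
  have r: "r > 0" using c L by (simp add: r_def)
  have near: "\<bar>F y - F x\<bar> < c" if "dist x y < r" for x y using L(2)[of x y] that L(1) by (simp add: r_def pos_less_divide_eq mult.commute abs_minus_commute)
  define s where "s = conv f (moll r)"
  note cm = csmooth_moll[where 'd='d, OF r]
  note i = conv_integrable[OF fi cm]
  have sm: "smooth s" unfolding s_def by (rule smooth_conv[OF fi cm])
  have close: "s x = f x" if "\<And>y. dist x y < r \<Longrightarrow> f y = f x" for x using moll_conv_close[OF fi r, of x 0] that by (simp add: s_def)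
  \<comment> \<open>A translate of \<open>s\<close> is the mollification of the translate of
    \<open>f\<close>, so \<open>s\<close> inherits the Lipschitz constant of the ramp.\<close>
  have lip: "\<bar>s (x + h) - s x\<bar> \<le> L / (2 * c) * norm h" for x h
  proof -
    have "continuous_on UNIV (\<lambda>y. f (h + y))" by (intro continuous_on_compose2[OF fc] continuous_intros) auto
    then have fh: "integrable lborel (\<lambda>y. f (h + y))"
    proof (rule continuous_integrable)
      show "f (h + y) = 0" if "norm y > R + norm h" for y using that norm_diff_ineq[of y h] by (intro fR) (simp add: add.commute)
    qed
    note ih = conv_integrable[OF fh cm, of x]
    have "s (x + h) = (\<integral>y. f (h + y) * moll r (x - y) \<partial>lborel)"
      using lborel_integral_affine[of "\<lambda>y. f y * moll r (x + h - y)" 1 h] borel_measurable_integrable[OF i[of "x + h"]] by (simp add: s_def conv_def add.commute)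
    then have "s (x + h) - s x = (\<integral>y. (f (h + y) - f y) * moll r (x - y) \<partial>lborel)" using ih i[of x] by (simp add: s_def conv_def left_diff_distrib)
    moreover have "integrable lborel (\<lambda>y. (f (h + y) - f y) * moll r (x - y))" using ih i[of x] by (simp add: left_diff_distrib)
    moreover have "\<bar>f (h + y) - f y\<bar> \<le> L / (2 * c) * norm h" for y using fl[of "h + y" y] by (simp add: dist_norm)
    ultimately show ?thesis using moll_average_le[OF r, of "\<lambda>y. f (h + y) - f y" x] by simp
  qed
  have "\<bar>s x\<bar> \<le> 1" for x unfolding s_def conv_def by (rule moll_average_le[OF r i]) (use f01 in auto)
  then have "s x \<le> 1" for x using abs_le_iff by blast
  moreover have "0 \<le> s x" for x unfolding s_def conv_def using f01 moll_nonneg[OF r] by (intro Bochner_Integration.integral_nonneg mult_nonneg_nonneg) auto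
  moreover have "norm (grad s x) \<le> 2 * L / (b - a)" for x using grad_le_lipschitz[OF sm _ lip, of x] L c by (simp add: b)
  ultimately have cs: "cutoff (2 * L / (b - a)) s" using sm by (simp add: cutoff_def)
  show ?thesis
  proof (rule that[OF cs])
    fix x assume x: "b \<le> F x"
    have "f y = 1" if "dist x y < r" for y using near[OF that] x b by (intro f1) linarith
    then show "s x = 1" using close[of x] r by simp
  next
    fix x assume x: "F x \<le> a"
    have "f y = 0" if "dist x y < r" for y using near[OF that] x by (intro f0) linarith
    then show "s x = 0" using close[of x] r by simp
  qed
qed

lemma infdist_cutoff:
  fixes W :: "(real^'d) set"
  assumes W: "bounded W" "W \<noteq> {}" and ab: "a < b"
  obtains s where "cutoff (2 / (b - a)) s" "\<And>x. infdist x W \<le> a \<Longrightarrow> s x = 1" "\<And>x. b \<le> infdist x W \<Longrightarrow> s x = 0"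
proof -
  obtain R where R: "\<And>w. w \<in> W \<Longrightarrow> norm w \<le> R" using W(1) unfolding bounded_iff by blast
  have "norm x \<le> R + b" if "infdist x W < b" for x
  proof -
    have "(INF w\<in>W. dist x w) < b" using that by (simp add: infdist_notempty[OF W(2)])
    moreover have "bdd_below (dist x ` W)" by (auto intro!: bdd_belowI2[of _ 0])
    ultimately obtain w where "w \<in> W" "dist x w < b" using cINF_less_iff[OF W(2)] by blast
    then show ?thesis using R[of w] norm_triangle_ineq2[of x w] unfolding dist_norm by linarith
  qed
  then have "bounded {x. - b < - infdist x W}" unfolding bounded_iff by auto
  moreover have "\<bar>- infdist x W - - infdist y W\<bar> \<le> 1 * dist x y" for x y using infdist_triangle_abs[of x W y] by simp
  ultimately obtain s where "cutoff (2 * 1 / (- a - - b)) s" "\<And>x. - a \<le> - infdist x W \<Longrightarrow> s x = 1" "\<And>x. - infdist x W \<le> - b \<Longrightarrow> s x = 0"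
    using lipschitz_cutoff[of 1 "\<lambda>x. - infdist x W" "- b" "- a"] ab by (metis neg_less_iff_less zero_less_one)
  then show ?thesis using that[of s] by simp
qed

section \<open>Square integrable functions\<close>

definition nrm :: "(real^'d) set \<Rightarrow> (real^'d \<Rightarrow> 'b::euclidean_space) \<Rightarrow> real" where
  "nrm D f = sqrt (\<integral>x. (norm (f x))\<^sup>2 \<partial>lebesgue_on D)"

lemma nrm_nonneg [simp]: "0 \<le> nrm D f" by (simp add: nrm_def)

lemma nrm_sq: "(nrm D f)\<^sup>2 = (\<integral>x. (norm (f x))\<^sup>2 \<partial>lebesgue_on D)"
  by (simp add: nrm_def)

lemma L2_measurable: "f \<in> L2 D \<Longrightarrow> f \<in> borel_measurable (lebesgue_on D)"
  by (simp add: L2_def)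

lemma L2_integrable: "f \<in> L2 D \<Longrightarrow> integrable (lebesgue_on D) (\<lambda>x. (norm (f x))\<^sup>2)"
  by (simp add: L2_def)

lemma L2_bound:
  assumes "h \<in> borel_measurable (lebesgue_on D)" "integrable (lebesgue_on D) w"
    "AE x in lebesgue_on D. (norm (h x))\<^sup>2 \<le> w x"
  shows "h \<in> L2 D" "(nrm D h)\<^sup>2 \<le> (\<integral>x. w x \<partial>lebesgue_on D)"
proof -
  have "integrable (lebesgue_on D) (\<lambda>x. (norm (h x))\<^sup>2)" by (rule Bochner_Integration.integrable_bound[OF assms(2)]) (use assms in auto)
  then show "h \<in> L2 D" "(nrm D h)\<^sup>2 \<le> (\<integral>x. w x \<partial>lebesgue_on D)" unfolding L2_def nrm_sq using assms by (auto intro!: integral_mono_AE)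
qed

lemma L2_AE_cong:
  assumes "f \<in> L2 D" "g \<in> borel_measurable (lebesgue_on D)" "AE x in lebesgue_on D. f x = g x"
  shows "g \<in> L2 D" "nrm D g = nrm D f"
proof -
  show "g \<in> L2 D" by (rule L2_bound(1)[OF assms(2) L2_integrable[OF assms(1)]]) (use assms(3) in auto)
  show "nrm D g = nrm D f" unfolding nrm_def using assms(2,3) L2_measurable[OF assms(1)] by (intro arg_cong[of _ _ sqrt] integral_cong_AE) auto
qed

lemma L2_zero [simp]: "(\<lambda>x. 0) \<in> L2 D" by (simp add: L2_def)

lemma L2_add:
  assumes "f \<in> L2 D" "g \<in> L2 D" shows "(\<lambda>x. f x + g x) \<in> L2 D"
proof (rule L2_bound(1))
  show "AE x in lebesgue_on D. (norm (f x + g x))\<^sup>2 \<le> 2 * (norm (f x))\<^sup>2 + 2 * (norm (g x))\<^sup>2"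
  proof (rule AE_I2)
    fix x
    have "(norm (f x + g x))\<^sup>2 \<le> (norm (f x) + norm (g x))\<^sup>2" by (intro power_mono norm_triangle_ineq) auto
    also have "\<dots> \<le> 2 * (norm (f x))\<^sup>2 + 2 * (norm (g x))\<^sup>2" using sum_squares_bound[of "norm (f x)" "norm (g x)"] by (simp add: power2_sum)
    finally show "(norm (f x + g x))\<^sup>2 \<le> 2 * (norm (f x))\<^sup>2 + 2 * (norm (g x))\<^sup>2" .
  qed
qed (use assms in \<open>auto simp: L2_def\<close>)

lemma L2_scale: "f \<in> L2 D \<Longrightarrow> (\<lambda>x. c *\<^sub>R f x) \<in> L2 D"
  by (auto simp: L2_def power_mult_distrib)

lemma L2_cmult: "f \<in> L2 D \<Longrightarrow> (\<lambda>x. c * f x) \<in> L2 D" for f :: "_ \<Rightarrow> real"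
  using L2_scale[of f D c] by simp

lemma L2_uminus: "f \<in> L2 D \<Longrightarrow> (\<lambda>x. - f x) \<in> L2 D"
  using L2_scale[of f D "-1"] by simp

lemma L2_diff: "f \<in> L2 D \<Longrightarrow> g \<in> L2 D \<Longrightarrow> (\<lambda>x. f x - g x) \<in> L2 D"
  using L2_add[OF _ L2_uminus, of f D g] by simp

lemma L2_sum: "finite I \<Longrightarrow> (\<And>i. i \<in> I \<Longrightarrow> f i \<in> L2 D) \<Longrightarrow> (\<lambda>x. \<Sum>i\<in>I. f i x) \<in> L2 D"
  by (induction I rule: finite_induct) (auto intro: L2_add)

lemma nrm_scale: "nrm D (\<lambda>x. c *\<^sub>R f x) = \<bar>c\<bar> * nrm D f"
  by (simp add: nrm_def power_mult_distrib real_sqrt_mult)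

lemma nrm_cmult: "nrm D (\<lambda>x. c * f x) = \<bar>c\<bar> * nrm D f" for f :: "_ \<Rightarrow> real"
  using nrm_scale[of D c f] by simp

lemma nrm_minus_commute: "nrm D (\<lambda>x. f x - g x) = nrm D (\<lambda>x. g x - f x)"
  by (simp add: nrm_def norm_minus_commute)

lemma L2_bmult:
  assumes a: "a \<in> borel_measurable (lebesgue_on D)" and B: "AE x in lebesgue_on D. \<bar>a x\<bar> \<le> B"
    and f: "f \<in> L2 D" and B0: "B \<ge> 0"
  shows "(\<lambda>x. a x *\<^sub>R f x) \<in> L2 D" "nrm D (\<lambda>x. a x *\<^sub>R f x) \<le> B * nrm D f"
proof -
  have m: "(\<lambda>x. a x *\<^sub>R f x) \<in> borel_measurable (lebesgue_on D)" using a L2_measurable[OF f] by measurable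
  have i: "integrable (lebesgue_on D) (\<lambda>x. B\<^sup>2 * (norm (f x))\<^sup>2)" using L2_integrable[OF f] by auto
  have le: "AE x in lebesgue_on D. (norm (a x *\<^sub>R f x))\<^sup>2 \<le> B\<^sup>2 * (norm (f x))\<^sup>2" using B
  proof eventually_elim
    case (elim x)
    then show ?case using power_mono[OF elim, of 2] by (simp add: power_mult_distrib mult_right_mono)
  qed
  show "(\<lambda>x. a x *\<^sub>R f x) \<in> L2 D" by (rule L2_bound(1)[OF m i le])
  have "(nrm D (\<lambda>x. a x *\<^sub>R f x))\<^sup>2 \<le> (B * nrm D f)\<^sup>2" using L2_bound(2)[OF m i le] by (simp add: nrm_sq power_mult_distrib)
  then show "nrm D (\<lambda>x. a x *\<^sub>R f x) \<le> B * nrm D f" by (rule power2_le_imp_le) (simp add: B0)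
qed

lemma quadratic_nonneg_discriminant:
  fixes a b c :: real
  assumes "\<And>t. 0 \<le> a * t\<^sup>2 + 2 * c * t + b" "a \<ge> 0"
  shows "c\<^sup>2 \<le> a * b"
proof (cases "a = 0")
  case True
  have "c = 0"
  proof (rule ccontr)
    assume "c \<noteq> 0"
    \<comment> \<open>For \<open>a = 0\<close> the expression is affine in \<open>t\<close>; at this
      point its value is \<open>-1\<close>.\<close>
    then show False using assms(1)[of "- (b + 1) / (2 * c)"] True by (simp add: field_simps)
  qed
  then show ?thesis using True by simp
next
  case False
  then have a: "a > 0" using assms(2) by simp
  have "0 \<le> a * (a * (- c / a)\<^sup>2 + 2 * c * (- c / a) + b)" using assms(1)[of "- c / a"] a by (intro mult_nonneg_nonneg) auto
  also have "\<dots> = a * b - c\<^sup>2" using a by (simp add: field_simps power2_eq_square)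
  finally show ?thesis by simp
qed

text \<open>Integrability comes from the arithmetic-geometric mean inequality, and the bound from
  the discriminant of the nonnegative quadratic polynomial in \<open>t\<close> that is the integral
  of the squared norm of \<open>t f + g\<close>.\<close>

lemma L2_inner:
  assumes f: "f \<in> L2 D" and g: "g \<in> L2 D"
  shows "integrable (lebesgue_on D) (\<lambda>x. f x \<bullet> g x)"
    "\<bar>\<integral>x. f x \<bullet> g x \<partial>lebesgue_on D\<bar> \<le> nrm D f * nrm D g"
proof -
  note m [measurable] = L2_measurable[OF f] L2_measurable[OF g]
  show i: "integrable (lebesgue_on D) (\<lambda>x. f x \<bullet> g x)"
  proof (rule Bochner_Integration.integrable_bound[of _ "\<lambda>x. (norm (f x))\<^sup>2 + (norm (g x))\<^sup>2"])
    show "AE x in lebesgue_on D. norm (f x \<bullet> g x) \<le> norm ((norm (f x))\<^sup>2 + (norm (g x))\<^sup>2)"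
    proof (rule AE_I2)
      fix x
      have "2 * \<bar>f x \<bullet> g x\<bar> \<le> 2 * (norm (f x) * norm (g x))" using Cauchy_Schwarz_ineq2[of "f x" "g x"] by simp
      also have "\<dots> \<le> (norm (f x))\<^sup>2 + (norm (g x))\<^sup>2" using sum_squares_bound[of "norm (f x)" "norm (g x)"] by simp
      finally have "\<bar>f x \<bullet> g x\<bar> \<le> (norm (f x))\<^sup>2 + (norm (g x))\<^sup>2" by simp
      then show "norm (f x \<bullet> g x) \<le> norm ((norm (f x))\<^sup>2 + (norm (g x))\<^sup>2)" by simp
    qed
  qed (use f g in \<open>auto simp: L2_def\<close>)
  let ?c = "\<integral>x. f x \<bullet> g x \<partial>lebesgue_on D"
  have "?c\<^sup>2 \<le> (nrm D f)\<^sup>2 * (nrm D g)\<^sup>2"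
  proof (rule quadratic_nonneg_discriminant)
    fix t :: real
    have "0 \<le> (\<integral>x. (norm (t *\<^sub>R f x + g x))\<^sup>2 \<partial>lebesgue_on D)" by simp
    also have "\<dots> = (\<integral>x. t\<^sup>2 * (norm (f x))\<^sup>2 + 2 * t * (f x \<bullet> g x) + (norm (g x))\<^sup>2 \<partial>lebesgue_on D)"
      by (intro Bochner_Integration.integral_cong refl)
         (simp add: power2_norm_eq_inner inner_add_left inner_add_right inner_commute algebra_simps power2_eq_square[of t])
    also have "\<dots> = t\<^sup>2 * (nrm D f)\<^sup>2 + 2 * t * ?c + (nrm D g)\<^sup>2" using L2_integrable[OF f] L2_integrable[OF g] i by (simp add: nrm_sq)
    finally show "0 \<le> (nrm D f)\<^sup>2 * t\<^sup>2 + 2 * ?c * t + (nrm D g)\<^sup>2" by (simp add: algebra_simps)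
  qed simp
  then have "\<bar>?c\<bar>\<^sup>2 \<le> (nrm D f * nrm D g)\<^sup>2" by (simp add: power_mult_distrib)
  then show "\<bar>?c\<bar> \<le> nrm D f * nrm D g" by (rule power2_le_imp_le) simp
qed

lemma L2_mult:
  fixes f g :: "_ \<Rightarrow> real"
  assumes "f \<in> L2 D" "g \<in> L2 D"
  shows "integrable (lebesgue_on D) (\<lambda>x. f x * g x)"
    "\<bar>\<integral>x. f x * g x \<partial>lebesgue_on D\<bar> \<le> nrm D f * nrm D g" using L2_inner[OF assms] by auto

lemma nrm_triangle:
  assumes f: "f \<in> L2 D" and g: "g \<in> L2 D"
  shows "nrm D (\<lambda>x. f x + g x) \<le> nrm D f + nrm D g"
proof (rule power2_le_imp_le)
  have "(nrm D (\<lambda>x. f x + g x))\<^sup>2 = (\<integral>x. (norm (f x))\<^sup>2 + 2 * (f x \<bullet> g x) + (norm (g x))\<^sup>2 \<partial>lebesgue_on D)"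
    unfolding nrm_sq by (intro Bochner_Integration.integral_cong refl)
       (simp add: power2_norm_eq_inner inner_add_left inner_add_right inner_commute)
  also have "\<dots> = (nrm D f)\<^sup>2 + 2 * (\<integral>x. f x \<bullet> g x \<partial>lebesgue_on D) + (nrm D g)\<^sup>2"
    using L2_integrable[OF f] L2_integrable[OF g] L2_inner(1)[OF f g] by (simp add: nrm_sq)
  also have "\<dots> \<le> (nrm D f + nrm D g)\<^sup>2" using L2_inner(2)[OF f g] by (simp add: power2_sum)
  finally show "(nrm D (\<lambda>x. f x + g x))\<^sup>2 \<le> (nrm D f + nrm D g)\<^sup>2" .
qed simp

lemma nrm_triangle3:
  assumes "f \<in> L2 D" "g \<in> L2 D" "h \<in> L2 D"
  shows "nrm D (\<lambda>x. f x - h x) \<le> nrm D (\<lambda>x. f x - g x) + nrm D (\<lambda>x. g x - h x)"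
  using nrm_triangle[OF L2_diff[OF assms(1,2)] L2_diff[OF assms(2,3)]] by simp

lemma nrm_le_add:
  assumes "f \<in> L2 D" "g \<in> L2 D"
  shows "nrm D f \<le> nrm D g + nrm D (\<lambda>x. f x - g x)"
  using nrm_triangle[OF assms(2) L2_diff[OF assms]] by simp

lemma measurable_component:
  "g \<in> borel_measurable M \<Longrightarrow> (\<lambda>x. g x $ i) \<in> borel_measurable M" for g :: "_ \<Rightarrow> real^'d"
  using measurable_compose[OF _ borel_measurable_continuous_onI[of "\<lambda>x. x $ i"]] by (simp add: continuous_on_component)

lemma L2_component:
  fixes g :: "real^'d \<Rightarrow> real^'m"
  assumes "g \<in> L2 D" shows "(\<lambda>x. g x $ i) \<in> L2 D" "nrm D (\<lambda>x. g x $ i) \<le> nrm D g"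
proof -
  have m: "(\<lambda>x. g x $ i) \<in> borel_measurable (lebesgue_on D)"
    by (rule measurable_component[OF L2_measurable[OF assms]])
  have le: "AE x in lebesgue_on D. (norm (g x $ i))\<^sup>2 \<le> (norm (g x))\<^sup>2" using component_le_norm_cart[of "g _" i] by (intro AE_I2 power_mono) auto
  show "(\<lambda>x. g x $ i) \<in> L2 D" by (rule L2_bound(1)[OF m L2_integrable[OF assms] le])
  have "(nrm D (\<lambda>x. g x $ i))\<^sup>2 \<le> (nrm D g)\<^sup>2" using L2_bound(2)[OF m L2_integrable[OF assms] le] by (simp add: nrm_sq)
  then show "nrm D (\<lambda>x. g x $ i) \<le> nrm D g" by (rule power2_le_imp_le) simp
qed

lemma AE_lebesgue_on_subset:
  assumes "D' \<subseteq> D" "D' \<in> sets lebesgue" "D \<in> sets lebesgue" "AE x in lebesgue_on D. P x"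
  shows "AE x in lebesgue_on D'. P x"
  using assms by (auto simp: AE_restrict_space_iff elim!: eventually_mono)

lemma L2_subset:
  assumes s: "D' \<subseteq> D" "D' \<in> sets lebesgue" "D \<in> sets lebesgue" and f: "f \<in> L2 D"
  shows "f \<in> L2 D'" "nrm D' f \<le> nrm D f"
proof -
  have i: "integrable (lebesgue_on D') (\<lambda>x. (norm (f x))\<^sup>2)"
    using L2_integrable[OF f] set_integrable_subset[of lebesgue D "\<lambda>x. (norm (f x))\<^sup>2" D'] s by (simp add: set_integrable_def integrable_restrict_space)
  then show "f \<in> L2 D'" using measurable_restrict_mono[OF L2_measurable[OF f] s(1)] by (simp add: L2_def)
  have "(\<integral>x. (norm (f x))\<^sup>2 \<partial>lebesgue_on D') \<le> (\<integral>x. (norm (f x))\<^sup>2 \<partial>lebesgue_on D)"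
    using s L2_integrable[OF f] by (intro integral_mono_lebesgue_on_AE) auto
  then show "nrm D' f \<le> nrm D f" by (simp add: nrm_def)
qed

lemma emeasure_bounded_lebesgue:
  "bounded D \<Longrightarrow> D \<in> sets lebesgue \<Longrightarrow> finite_measure (lebesgue_on D)"
  by (simp add: bounded_set_imp_lmeasurable finite_measure_lebesgue_on)

lemma L2_bounded:
  assumes "f \<in> borel_measurable (lebesgue_on D)" "AE x in lebesgue_on D. norm (f x) \<le> B"
    "finite_measure (lebesgue_on D)"
  shows "f \<in> L2 D"
proof (rule L2_bound(1)[OF assms(1), of "\<lambda>x. B\<^sup>2"])
  show "integrable (lebesgue_on D) (\<lambda>x. B\<^sup>2)" using assms(3) finite_measure.integrable_const by blast
  show "AE x in lebesgue_on D. (norm (f x))\<^sup>2 \<le> B\<^sup>2" using assms(2) by eventually_elim (auto intro!: power_mono)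
qed

lemma continuous_L2:
  assumes "continuous_on UNIV f" "bounded D" "D \<in> sets lebesgue"
  shows "f \<in> L2 D"
proof -
  have "compact (f ` closure D)" using assms(1,2) continuous_on_subset by (intro compact_continuous_image) auto
  then obtain B where B: "\<And>x. x \<in> closure D \<Longrightarrow> norm (f x) \<le> B" unfolding compact_eq_bounded_closed bounded_iff by auto
  show ?thesis
  proof (rule L2_bounded[OF _ _ emeasure_bounded_lebesgue[OF assms(2,3)], of _ B])
    show "f \<in> borel_measurable (lebesgue_on D)" by (intro continuous_imp_measurable_on_sets_lebesgue assms continuous_on_subset[OF assms(1)]) auto
    show "AE x in lebesgue_on D. norm (f x) \<le> B"  using B closure_subset[of D] by (intro AE_I2) auto
  qed
qed

lemma smooth_L2:
  assumes "smooth f" "bounded D" "D \<in> sets lebesgue"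
  shows "f \<in> L2 D" "grad f \<in> L2 D"
  using assms by (auto intro!: continuous_L2 smooth_continuous smooth_grad_continuous)

lemma smooth_bounded_on:
  assumes "smooth s" "bounded D"
  obtains B where "B > 0" "\<And>x. x \<in> D \<Longrightarrow> \<bar>s x\<bar> \<le> B" "\<And>x. x \<in> D \<Longrightarrow> norm (grad s x) \<le> B"
proof -
  have "compact (s ` closure D)" "compact (grad s ` closure D)" using assms by (auto intro!: compact_continuous_image smooth_continuous smooth_grad_continuous)
  then obtain B1 B2 where "\<And>x. x \<in> closure D \<Longrightarrow> norm (s x) \<le> B1" "\<And>x. x \<in> closure D \<Longrightarrow> norm (grad s x) \<le> B2"
    unfolding compact_eq_bounded_closed bounded_iff by fastforce
  then show ?thesis using closure_subset[of D] that[of "max 1 (max B1 B2)"]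
    by (metis less_max_iff_disj max.coboundedI1 max.coboundedI2 real_norm_def subset_iff zero_less_one)
qed

section \<open>Test functions and locally integrable functions\<close>

lemma test_function_csmooth:
  "\<phi> \<in> test_functions D \<longleftrightarrow> csmooth \<phi> \<and> closure {x. \<phi> x \<noteq> 0} \<subseteq> D"
  by (auto simp: test_functions_def csmooth_def)

lemma test_functionI:
  assumes "smooth \<phi>" "compact K" "K \<subseteq> D" "\<And>x. x \<notin> K \<Longrightarrow> \<phi> x = 0"
  shows "\<phi> \<in> test_functions D"
proof -
  have "{x. \<phi> x \<noteq> 0} \<subseteq> K" using assms(4) by blast
  then have "closure {x. \<phi> x \<noteq> 0} \<subseteq> K" by (rule closure_minimal) (simp add: assms(2) compact_imp_closed)
  then show ?thesis using assms compact_closure compact_imp_bounded bounded_subset[of K]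
      closure_subset unfolding test_functions_def by (metis (mono_tags, lifting) mem_Collect_eq order_trans)
qed

lemma test_functionD:
  assumes "\<phi> \<in> test_functions D"
  obtains K where "smooth \<phi>" "compact K" "K \<subseteq> D" "\<And>x. x \<notin> K \<Longrightarrow> \<phi> x = 0" "\<And>x. x \<notin> K \<Longrightarrow> grad \<phi> x = 0"
proof -
  let ?K = "closure {x. \<phi> x \<noteq> 0}"
  have z: "x \<notin> ?K \<Longrightarrow> \<phi> x = 0" for x using closure_subset[of "{x. \<phi> x \<noteq> 0}"] by blast
  have "grad \<phi> x = 0" if "x \<notin> ?K" for x
  proof (rule grad_eq_0)
    show "open (- ?K)" by (rule open_Compl[OF closed_closure])
    show "x \<in> - ?K" using that by blast
    show "\<phi> y = 0" if "y \<in> - ?K" for y using z that by blast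
  qed
  moreover have "smooth \<phi>" "compact ?K" "?K \<subseteq> D" using assms unfolding test_functions_def by blast+
  ultimately show ?thesis using that z by meson
qed

lemma test_functions_mono: "D' \<subseteq> D \<Longrightarrow> test_functions D' \<subseteq> test_functions D"
  by (auto simp: test_functions_def)

lemma test_function_mult:
  assumes "\<phi> \<in> test_functions D" "smooth s" shows "(\<lambda>x. s x * \<phi> x) \<in> test_functions D"
proof -
  obtain K where K: "smooth \<phi>" "compact K" "K \<subseteq> D" "\<And>x. x \<notin> K \<Longrightarrow> \<phi> x = 0" using test_functionD[OF assms(1)] by metis
  show ?thesis by (rule test_functionI[OF smooth_mult K(2,3)]) (use K assms in auto)
qed

lemma test_function_add:
  assumes "\<phi> \<in> test_functions D" "\<psi> \<in> test_functions D" shows "(\<lambda>x. \<phi> x + \<psi> x) \<in> test_functions D"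
proof -
  obtain K where K: "smooth \<phi>" "compact K" "K \<subseteq> D" "\<And>x. x \<notin> K \<Longrightarrow> \<phi> x = 0" using test_functionD[OF assms(1)] by metis
  obtain L where L: "smooth \<psi>" "compact L" "L \<subseteq> D" "\<And>x. x \<notin> L \<Longrightarrow> \<psi> x = 0" using test_functionD[OF assms(2)] by metis
  show ?thesis by (rule test_functionI[OF smooth_add, of _ _ "K \<union> L"]) (use K L in auto)
qed

lemma test_functions_zero: "(\<lambda>x. 0) \<in> test_functions D"
  by (rule test_functionI[of _ "{}"]) auto

lemma test_function_grad_measurable:
  "\<phi> \<in> test_functions D \<Longrightarrow> (\<lambda>x. grad \<phi> x $ i) \<in> borel_measurable borel"
  by (simp add: smooth_measurable smooth_grad test_functions_def)

lemma locally_integrable_test: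
  fixes w :: "real^'d \<Rightarrow> real"
  assumes "locally_integrable D w" "compact K" "K \<subseteq> D" "D \<in> sets lebesgue" "continuous_on UNIV \<phi>" "\<And>x. x \<notin> K \<Longrightarrow> \<phi> x = 0"
  shows "integrable (lebesgue_on D) (\<lambda>x. w x * \<phi> x)"
    "(\<integral>x. w x * \<phi> x \<partial>lebesgue_on D) = (\<integral>x. w x * \<phi> x \<partial>lebesgue_on K)"
proof -
  have K: "K \<in> sets lebesgue" using assms(2) lmeasurable_compact by blast
  obtain R where R: "\<And>x. x \<in> K \<Longrightarrow> norm x \<le> R" using assms(2) unfolding compact_eq_bounded_closed bounded_iff by blast
  obtain B where B: "\<And>x. \<bar>\<phi> x\<bar> \<le> B" using continuous_bounded_support[OF assms(5), of R] R assms(6) by (metis not_le)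
  have i: "integrable (lebesgue_on K) (\<lambda>x. w x * \<phi> x)"
  proof (rule bounded_integrable_mult[OF _ _ B])
    show "integrable (lebesgue_on K) w" using assms by (auto simp: locally_integrable_def)
    show "\<phi> \<in> borel_measurable (lebesgue_on K)" by (intro continuous_imp_measurable_on_sets_lebesgue K continuous_on_subset[OF assms(5)]) auto
  qed
  have e: "(\<lambda>x. if x \<in> K then w x * \<phi> x else 0) = (\<lambda>x. if x \<in> D then w x * \<phi> x else 0)" using assms(3,6) by (auto simp: fun_eq_iff)
  show "integrable (lebesgue_on D) (\<lambda>x. w x * \<phi> x)"
    using i unfolding Lebesgue_Measure.integrable_restrict_UNIV[OF K, symmetric] Lebesgue_Measure.integrable_restrict_UNIV[OF assms(4), symmetric] e .
  show "(\<integral>x. w x * \<phi> x \<partial>lebesgue_on D) = (\<integral>x. w x * \<phi> x \<partial>lebesgue_on K)"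
    unfolding Lebesgue_Measure.integral_restrict_UNIV[OF K, symmetric] Lebesgue_Measure.integral_restrict_UNIV[OF assms(4), symmetric] e ..
qed

lemma L2_locally_integrable:
  assumes "f \<in> L2 D" "D \<in> sets lebesgue" shows "locally_integrable D f"
  unfolding locally_integrable_def
proof (intro allI impI)
  fix K assume K: "compact K \<and> K \<subseteq> D"
  then have Ks: "K \<in> sets lebesgue" "K \<in> lmeasurable" using lmeasurable_compact by blast+
  have f: "f \<in> L2 K" using L2_subset(1)[OF _ Ks(1) assms(2,1)] K by simp
  interpret finite_measure "lebesgue_on K" using Ks finite_measure_lebesgue_on by blast
  show "integrable (lebesgue_on K) f"
  proof (rule Bochner_Integration.integrable_bound[of _ "\<lambda>x. 1 + (norm (f x))\<^sup>2"])
    show "AE x in lebesgue_on K. norm (f x) \<le> norm (1 + (norm (f x))\<^sup>2)"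
    proof (rule AE_I2)
      fix x show "norm (f x) \<le> norm (1 + (norm (f x))\<^sup>2)" using sum_squares_bound[of 1 "norm (f x)"] norm_ge_zero[of "f x"] by (simp del: norm_ge_zero)
    qed
  qed (use f in \<open>auto simp: L2_def\<close>)
qed

section \<open>Weak gradients\<close>

text \<open>Convolving \<open>\<psi>\<close> with the indicator \<open>f\<close> of a ball that
  exceeds its support gives the constant \<open>\<integral> \<psi>\<close> near the origin. The
  gradient there is zero on the one hand; on the other hand it is the convolution of
  \<open>f\<close> with \<open>grad \<psi>\<close>, which is the integral in question.\<close>

lemma csmooth_integral_grad:
  assumes "csmooth (\<psi> :: real^'d \<Rightarrow> real)"
  shows "(\<integral>x. grad \<psi> x $ i \<partial>lborel) = 0"
proof -
  obtain R where R: "R > 0" "smooth \<psi>" "\<And>x. norm x > R \<Longrightarrow> \<psi> x = 0" using csmoothE[OF assms] by blast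
  have g0: "grad \<psi> x = 0" if "norm x > R" for x by (rule grad_eq_0[of "- cball 0 R" _ _ 0]) (use that R(3) in auto)
  define f where "f = (indicator (cball 0 (R + 1)) :: real^'d \<Rightarrow> real)"
  have f: "integrable lborel f" unfolding f_def by (intro integrable_real_indicator) (auto simp: emeasure_lborel_cball_finite[unfolded infinity_ennreal_def])
  have eq: "conv f p x = (\<integral>y. p y \<partial>lborel)" if "p \<in> borel_measurable borel" "\<And>x. norm x > R \<Longrightarrow> p x = 0" "norm x < 1" for p x
  proof -
    have "f y * p (x - y) = p (x - y)" for y using that(2)[of "x - y"] that(3) norm_triangle_ineq2[of y x] by (auto simp: f_def indicator_def norm_minus_commute)
    then have "(\<lambda>y. f y * p (x - y)) = (\<lambda>y. p (x - y))" by (rule ext)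
    then show ?thesis using lborel_integral_affine[OF that(1), of "-1" x] unfolding conv_def by simp
  qed
  have "grad (conv f \<psi>) 0 = 0" by (rule grad_eq_0[of "ball 0 1" _ _ "\<integral>y. \<psi> y \<partial>lborel"]) (use eq[OF smooth_measurable[OF R(2)] R(3)] in auto)
  then show ?thesis using grad_conv[OF f assms, of 0 i] eq[of "\<lambda>x. grad \<psi> x $ i" 0] smooth_measurable[OF smooth_grad[OF R(2)], of i] g0 by simp
qed

lemma compact_nbhd:
  fixes K :: "(real^'d) set"
  assumes "compact K" "K \<subseteq> D" "open D"
  obtains r where "r > 0" "\<And>x y. x \<in> K \<Longrightarrow> dist x y \<le> r \<Longrightarrow> y \<in> D"
proof -
  obtain e where "e > 0" "(\<Union>x\<in>K. cball x e) \<subseteq> D" using compact_subset_open_imp_cball_epsilon_subset[OF assms(1,3,2)] by blast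
  then show ?thesis using that[of e] by (auto simp: subset_iff)
qed

lemma compact_cutoff:
  fixes K :: "(real^'d) set"
  assumes K: "compact K" and r: "r > 0"
  obtains s where "smooth s" "\<And>x. 0 \<le> s x" "\<And>x. s x \<le> 1" "\<And>x. x \<in> K \<Longrightarrow> s x = 1"
    "\<And>x. (\<And>y. y \<in> K \<Longrightarrow> dist y x \<ge> r) \<Longrightarrow> s x = 0"
proof (cases "K = {}")
  case True
  then show ?thesis using that[of "\<lambda>_. 0"] smooth_const by simp
next
  case False
  obtain s where s: "cutoff (2 / (r - 0)) s" "\<And>x. infdist x K \<le> 0 \<Longrightarrow> s x = 1" "\<And>x. r \<le> infdist x K \<Longrightarrow> s x = 0"
    using infdist_cutoff[OF compact_imp_bounded[OF K] False r] by blast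
  show ?thesis
  proof (rule that[OF cutoffD(1-3)[OF s(1)]])
    show "s x = 0" if "\<And>y. y \<in> K \<Longrightarrow> dist y x \<ge> r" for x
      using that False by (intro s(3)) (auto simp: infdist_notempty dist_commute intro!: cINF_greatest)
  qed (use s(2) in simp)
qed

text \<open>Cutoffs that shrink to a compact set \<open>K\<close> show that the integral of
  \<open>w\<close> over every compact subset of \<open>D\<close> is zero. If \<open>w\<close> were
  positive on a set of positive measure, inner regularity would supply a compact part of it with
  positive integral.\<close>

lemma locally_integrable_test_zero:
  fixes w :: "real^'d \<Rightarrow> real"
  assumes D: "open D" and w: "locally_integrable D w"
    and z: "\<And>\<phi>. \<phi> \<in> test_functions D \<Longrightarrow> (\<integral>x. w x * \<phi> x \<partial>lebesgue_on D) = 0"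
  shows "AE x in lebesgue_on D. w x = 0"
proof -
  have Ds: "D \<in> sets lebesgue" using D by auto
  have int0: "(\<integral>x. w x \<partial>lebesgue_on K) = 0" if K: "compact K" "K \<subseteq> D" for K
  proof -
    have Ks: "K \<in> sets lebesgue" using K(1) lmeasurable_compact by blast
    obtain r where r: "r > 0" "\<And>x y. x \<in> K \<Longrightarrow> dist x y \<le> r \<Longrightarrow> y \<in> D" using compact_nbhd[OF K D] by blast
    define L where "L = (\<Union>x\<in>K. cball x r)"
    have L: "compact L" "L \<subseteq> D" unfolding L_def using compact_minkowski_sum_cball[OF K(1)] r(2) by auto
    have Ls: "L \<in> sets lebesgue" using L(1) lmeasurable_compact by blast
    have "\<exists>s. smooth s \<and> (\<forall>x. 0 \<le> s x \<and> s x \<le> 1) \<and> (\<forall>x\<in>K. s x = 1) \<and>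
         (\<forall>x. (\<forall>y\<in>K. dist y x \<ge> r / (Suc n)) \<longrightarrow> s x = 0)" for n
      using compact_cutoff[OF K(1), of "r / Suc n"] r(1) by (metis divide_pos_pos of_nat_0_less_iff zero_less_Suc)
    then obtain s where s: "\<And>n. smooth (s n)" "\<And>n x. 0 \<le> s n x" "\<And>n x. s n x \<le> 1" "\<And>n x. x \<in> K \<Longrightarrow> s n x = 1"
         "\<And>n x. (\<And>y. y \<in> K \<Longrightarrow> dist y x \<ge> r / (Suc n)) \<Longrightarrow> s n x = 0" by metis
    have sL: "s n x = 0" if "x \<notin> L" for n x
    proof (rule s(5))
      fix y assume "y \<in> K"
      then have "dist y x > r" using that unfolding L_def by auto
      moreover have "r / Suc n \<le> r" using r by (simp add: divide_le_eq)
      ultimately show "dist y x \<ge> r / Suc n" by linarith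
    qed
    have st: "s n \<in> test_functions D" for n by (rule test_functionI[OF s(1) L sL])
    have iw: "integrable (lebesgue_on L) w" using w L unfolding locally_integrable_def by blast
    have wm: "w \<in> borel_measurable (lebesgue_on L)" using iw by auto
    have sm: "s n \<in> borel_measurable (lebesgue_on L)" for n by (intro continuous_imp_measurable_on_sets_lebesgue smooth_continuous s Ls)
    have Km: "indicator K \<in> borel_measurable (lebesgue_on L)"
    proof (rule borel_measurable_indicator)
      have "K \<subseteq> L" unfolding L_def using r(1) by force
      then have "K = L \<inter> K" by blast
      then show "K \<in> sets (lebesgue_on L)" using Ks by (auto simp: sets_restrict_space image_iff intro!: bexI[of _ K])
    qed
    have "(\<lambda>n. \<integral>x. w x * s n x \<partial>lebesgue_on L) \<longlonglongrightarrow> (\<integral>x. w x * indicator K x \<partial>lebesgue_on L)"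
    proof (rule integral_dominated_convergence[where w="\<lambda>x. norm (w x)"])
      show "(\<lambda>x. w x * indicator K x) \<in> borel_measurable (lebesgue_on L)" using wm Km by measurable
      show "(\<lambda>x. w x * s i x) \<in> borel_measurable (lebesgue_on L)" for i using wm sm by measurable
      show "integrable (lebesgue_on L) (\<lambda>x. norm (w x))" using iw by auto
      show "AE x in lebesgue_on L. norm (w x * s i x) \<le> norm (w x)" for i using s(2,3) by (auto simp: abs_mult intro!: mult_left_le)
      show "AE x in lebesgue_on L. (\<lambda>i. w x * s i x) \<longlonglongrightarrow> w x * indicator K x"
      proof (rule AE_I2)
        fix x
        have "(\<lambda>i. s i x) \<longlonglongrightarrow> indicator K x"
        proof (cases "x \<in> K")
          case False
          obtain e where e: "e > 0" "ball x e \<subseteq> - K" using False K(1) by (metis Compl_iff compact_imp_closed open_Compl open_contains_ball)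
          obtain N where N: "r / Suc N < e"
            using reals_Archimedean2[of "r / e"] e(1) r(1) by (auto simp: field_simps) (metis add.commute less_add_same_cancel2 order.strict_trans mult_less_cancel_left_pos zero_less_one)
          have "s n x = 0" if "n \<ge> N" for n
          proof (rule s(5))
            fix y assume "y \<in> K"
            then have "dist y x \<ge> e" using e(2) by (auto simp: subset_iff dist_commute not_less[symmetric])
            moreover have "r / Suc n \<le> r / Suc N" using that r(1) by (intro divide_left_mono) auto
            ultimately show "r / Suc n \<le> dist y x" using N by linarith
          qed
          then have "eventually (\<lambda>n. s n x = indicator K x) sequentially" using False by (auto simp: eventually_sequentially)
          then show ?thesis by (rule tendsto_eventually)
        qed (simp add: s(4))
        then show "(\<lambda>i. w x * s i x) \<longlonglongrightarrow> w x * indicator K x" by (intro tendsto_intros)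
      qed
    qed
    moreover have "(\<integral>x. w x * s n x \<partial>lebesgue_on L) = 0" for n
      using z[OF st] locally_integrable_test(2)[OF w L Ds smooth_continuous[OF s(1)] sL] by simp
    ultimately have "(\<integral>x. w x * indicator K x \<partial>lebesgue_on L) = 0" by (simp add: LIMSEQ_const_iff)
    moreover have "(\<integral>x. w x * indicator K x \<partial>lebesgue_on L) = (\<integral>x. w x \<partial>lebesgue_on K)"
    proof -
      have "K \<subseteq> L" unfolding L_def using r(1) by force
      then have "(\<integral>x. (if x \<in> K then w x else 0) \<partial>lebesgue_on L) = (\<integral>x. w x \<partial>lebesgue_on K)"
        by (rule Lebesgue_Measure.integral_restrict[OF _ Ks Ls])
      moreover have "(\<lambda>x. w x * indicator K x) = (\<lambda>x. if x \<in> K then w x else 0)" by (auto simp: fun_eq_iff)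
      ultimately show ?thesis by simp
    qed
    ultimately show ?thesis by simp
  qed
  \<comment> \<open>It is applied with \<open>c = 1\<close> and \<open>c = -1\<close>, for the two
    signs of \<open>w\<close>.\<close>
  have nz: "{x \<in> K. 0 < c * w x} \<in> null_sets lebesgue" if K: "compact K" "K \<subseteq> D" and c: "c \<noteq> 0" for K c
  proof (rule ccontr)
    let ?P = "{x \<in> K. 0 < c * w x}"
    have Ks: "K \<in> sets lebesgue" using K(1) lmeasurable_compact by blast
    have iw: "integrable (lebesgue_on K) w" using w K unfolding locally_integrable_def by blast
    then have [measurable]: "w \<in> borel_measurable (lebesgue_on K)" by auto
    have "{x \<in> space (lebesgue_on K). 0 < c * w x} \<in> sets (lebesgue_on K)" by measurable
    then have P: "?P \<in> sets lebesgue" using Ks by (auto simp: sets_restrict_space)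
    assume "?P \<notin> null_sets lebesgue"
    then have pos: "emeasure lebesgue ?P > 0" using P by (auto simp: null_sets_def zero_less_iff_neq_zero)
    have fin: "emeasure lebesgue ?P < \<infinity>" using emeasure_mono[of ?P K lebesgue] Ks lmeasurable_compact[OF K(1)]
      by (auto simp: fmeasurable_def intro: le_less_trans)
    define e where "e = enn2real (emeasure lebesgue ?P)"
    have e: "e > 0" "emeasure lebesgue ?P = ennreal e" using pos fin by (auto simp: e_def enn2real_positive_iff)
    \<comment> \<open>The part of \<open>?P\<close> that \<open>T\<close> misses has smaller measure
      than \<open>?P\<close>, so \<open>T\<close> cannot be a null set; the vanishing integral will
      say that it is one.\<close>
    obtain T where T: "closed T" "T \<subseteq> ?P" "emeasure lebesgue (?P - T) < ennreal e" by (rule sets_lebesgue_inner_closed[OF P e(1)])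
    have T1: "T \<subseteq> K" using T(2) by blast
    have Tc: "compact T" using compact_Int_closed[OF K(1) T(1)] T1 by (simp add: Int_absorb1)
    have Ts: "T \<in> sets lebesgue" using Tc lmeasurable_compact by blast
    have TD: "T \<subseteq> D" using T1 K(2) by blast
    have iT: "integrable (lebesgue_on T) (\<lambda>x. c * w x)" using w Tc TD unfolding locally_integrable_def by auto
    have "(\<integral>x. c * w x \<partial>lebesgue_on T) = 0" using int0[OF Tc TD] by simp
    then have "AE x in lebesgue_on T. c * w x = 0"
    proof (subst (asm) integral_nonneg_eq_0_iff_AE[OF iT])
      show "AE x in lebesgue_on T. 0 \<le> c * w x" using T(2) by (intro AE_I2) (simp add: subset_iff less_imp_le)
    qed
    then have "AE x in lebesgue. x \<notin> T" using T(2) Ts by (auto simp: AE_restrict_space_iff elim!: eventually_mono)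
    then have "emeasure lebesgue T = 0" using Ts by (subst (asm) AE_iff_measurable[of T]) auto
    then have "emeasure lebesgue (?P - T) = emeasure lebesgue ?P" using P Ts by (intro emeasure_Diff_null_set) auto
    then show False using T(3) e by simp
  qed
  obtain C where C: "\<And>n. compact (C n)" "\<And>n. C n \<subseteq> D" "D \<subseteq> (\<Union>n::nat. C n)"
    using open_Union_compact_subsets[OF D] by (metis UN_I subsetI)
  have "{x \<in> D. w x \<noteq> 0} \<subseteq> (\<Union>n. {x \<in> C n. 0 < 1 * w x} \<union> {x \<in> C n. 0 < (-1) * w x})" using C(3) by (force simp: subset_iff)
  moreover have "(\<Union>n. {x \<in> C n. 0 < 1 * w x} \<union> {x \<in> C n. 0 < (-1) * w x}) \<in> null_sets lebesgue"
    using nz[OF C(1,2), of 1] nz[OF C(1,2), of "-1"] by (intro null_sets_UN null_sets.Un) auto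
  ultimately have "AE x in lebesgue. x \<in> D \<longrightarrow> w x = 0" by (intro AE_I') auto
  then show ?thesis using Ds by (simp add: AE_restrict_space_iff)
qed

lemma locally_integrable_component:
  "locally_integrable D g \<Longrightarrow> locally_integrable D (\<lambda>x. g x $ i)" for g :: "real^'d \<Rightarrow> real^'d" unfolding locally_integrable_def
  using integrable_bounded_linear[OF bounded_linear_vec_nth] by blast

lemma weak_gradient_unique:
  assumes D: "open D" and g: "has_weak_gradient D u g" and h: "has_weak_gradient D u h"
  shows "AE x in lebesgue_on D. g x = h x"
proof -
  have Ds: "D \<in> sets lebesgue" using D by auto
  have "AE x in lebesgue_on D. g x $ i - h x $ i = 0" for i
  proof (rule locally_integrable_test_zero[OF D])
    have lg: "locally_integrable D (\<lambda>x. g x $ i)" and lh: "locally_integrable D (\<lambda>x. h x $ i)"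
      using g h by (auto simp: has_weak_gradient_def intro: locally_integrable_component)
    then show "locally_integrable D (\<lambda>x. g x $ i - h x $ i)" unfolding locally_integrable_def by auto
    fix \<phi> assume phi: "\<phi> \<in> test_functions D"
    then obtain K where K: "smooth \<phi>" "compact K" "K \<subseteq> D" "\<And>x. x \<notin> K \<Longrightarrow> \<phi> x = 0" using test_functionD by metis
    have "(\<integral>x. (g x $ i - h x $ i) * \<phi> x \<partial>lebesgue_on D)
      = (\<integral>x. g x $ i * \<phi> x \<partial>lebesgue_on D) - (\<integral>x. h x $ i * \<phi> x \<partial>lebesgue_on D)"
      using locally_integrable_test(1)[OF lg K(2,3) Ds smooth_continuous[OF K(1)] K(4)]
        locally_integrable_test(1)[OF lh K(2,3) Ds smooth_continuous[OF K(1)] K(4)] by (simp add: left_diff_distrib)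
    moreover have "(\<integral>x. g x $ i * \<phi> x \<partial>lebesgue_on D) = - (\<integral>x. u x * grad \<phi> x $ i \<partial>lebesgue_on D)"
      using g phi unfolding has_weak_gradient_def by simp
    moreover have "(\<integral>x. h x $ i * \<phi> x \<partial>lebesgue_on D) = - (\<integral>x. u x * grad \<phi> x $ i \<partial>lebesgue_on D)"
      using h phi unfolding has_weak_gradient_def by simp
    ultimately show "(\<integral>x. (g x $ i - h x $ i) * \<phi> x \<partial>lebesgue_on D) = 0" by simp
  qed
  then have "AE x in lebesgue_on D. \<forall>i\<in>UNIV. g x $ i - h x $ i = 0" by (intro AE_finite_allI) auto
  then show ?thesis by eventually_elim (simp add: vec_eq_iff)
qed

lemma has_weak_gradient_AE_cong:
  fixes D :: "(real^'d) set"
  assumes D: "D \<in> sets lebesgue" and w: "has_weak_gradient D u g"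
    and u: "AE x in lebesgue_on D. u x = u' x" "u' \<in> borel_measurable (lebesgue_on D)"
    and g: "AE x in lebesgue_on D. g x = g' x" "g' \<in> borel_measurable (lebesgue_on D)"
  shows "has_weak_gradient D u' g'"
proof -
  have li: "locally_integrable D f'" if "locally_integrable D f" "AE x in lebesgue_on D. f x = f' x" "f' \<in> borel_measurable (lebesgue_on D)"
    for f f' :: "real^'d \<Rightarrow> 'c::{banach, second_countable_topology}" unfolding locally_integrable_def
  proof (intro allI impI)
    fix K assume K: "compact K \<and> K \<subseteq> D"
    then have Ks: "K \<in> sets lebesgue" using lmeasurable_compact by blast
    have "integrable (lebesgue_on K) f" using K that(1) by (simp add: locally_integrable_def)
    then show "integrable (lebesgue_on K) f'" using AE_lebesgue_on_subset[OF _ Ks D that(2)] K measurable_restrict_mono[OF that(3)]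
      by (subst integrable_cong_AE[of f' _ f]) auto
  qed
  have lu: "locally_integrable D u" and lg: "locally_integrable D g" using w by (auto simp: has_weak_gradient_def)
  have eq: "(\<integral>x. u' x * grad \<phi> x $ i \<partial>lebesgue_on D) = - (\<integral>x. g' x $ i * \<phi> x \<partial>lebesgue_on D)"
    if phi: "\<phi> \<in> test_functions D" for \<phi> i
  proof -
    obtain K where K: "smooth \<phi>" "compact K" "K \<subseteq> D" "\<And>x. x \<notin> K \<Longrightarrow> \<phi> x = 0" "\<And>x. x \<notin> K \<Longrightarrow> grad \<phi> x = 0"
      using test_functionD[OF phi] by metis
    have 1: "integrable (lebesgue_on D) (\<lambda>x. u x * grad \<phi> x $ i)"
      by (rule locally_integrable_test(1)[OF lu K(2,3) D smooth_continuous[OF smooth_grad[OF K(1)]]]) (simp add: K(5))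
    have 2: "integrable (lebesgue_on D) (\<lambda>x. g x $ i * \<phi> x)"
      by (rule locally_integrable_test(1)[OF locally_integrable_component[OF lg] K(2,3) D smooth_continuous[OF K(1)] K(4)])
    have m1: "(\<lambda>x. u' x * grad \<phi> x $ i) \<in> borel_measurable (lebesgue_on D)"
      by (intro borel_measurable_times u(2) continuous_imp_measurable_on_sets_lebesgue smooth_continuous smooth_grad K D)
    have m2: "(\<lambda>x. g' x $ i * \<phi> x) \<in> borel_measurable (lebesgue_on D)"
    proof (rule borel_measurable_times)
      show "\<phi> \<in> borel_measurable (lebesgue_on D)" by (intro continuous_imp_measurable_on_sets_lebesgue smooth_continuous K D)
      show "(\<lambda>x. g' x $ i) \<in> borel_measurable (lebesgue_on D)" by (rule measurable_component[OF g(2)])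
    qed
    have "(\<integral>x. u' x * grad \<phi> x $ i \<partial>lebesgue_on D) = (\<integral>x. u x * grad \<phi> x $ i \<partial>lebesgue_on D)"
      using 1 m1 u(1) by (intro integral_cong_AE) auto
    also have "\<dots> = - (\<integral>x. g x $ i * \<phi> x \<partial>lebesgue_on D)" using w phi by (simp add: has_weak_gradient_def)
    also have "(\<integral>x. g x $ i * \<phi> x \<partial>lebesgue_on D) = (\<integral>x. g' x $ i * \<phi> x \<partial>lebesgue_on D)"
      using 2 m2 g(1) by (intro integral_cong_AE) auto
    finally show ?thesis .
  qed
  show ?thesis unfolding has_weak_gradient_def using li[OF lu u] li[OF lg g] eq by blast
qed

section \<open>Square integrable functions paired with an explicit weak gradient\<close>

definition wgrad :: "(real^'d) set \<Rightarrow> (real^'d \<Rightarrow> real) \<Rightarrow> (real^'d \<Rightarrow> real^'d) \<Rightarrow> bool" where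
  "wgrad D u g \<longleftrightarrow> u \<in> L2 D \<and> g \<in> L2 D \<and> has_weak_gradient D u g"

lemma wgradD: "wgrad D u g \<Longrightarrow> u \<in> L2 D" "wgrad D u g \<Longrightarrow> g \<in> L2 D" "wgrad D u g \<Longrightarrow> has_weak_gradient D u g"
  by (simp_all add: wgrad_def)

lemma H1_iff_wgrad: "u \<in> H1 D \<longleftrightarrow> (\<exists>g. wgrad D u g)"
  by (auto simp: H1_def wgrad_def)

lemma wgradI:
  assumes "D \<in> sets lebesgue" "u \<in> L2 D" "g \<in> L2 D"
    "\<And>\<phi> i. \<phi> \<in> test_functions D \<Longrightarrow> (\<integral>x. u x * grad \<phi> x $ i \<partial>lebesgue_on D) = - (\<integral>x. g x $ i * \<phi> x \<partial>lebesgue_on D)"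
  shows "wgrad D u g"
  unfolding wgrad_def has_weak_gradient_def using assms(2-4) L2_locally_integrable[OF assms(2,1)] L2_locally_integrable[OF assms(3,1)] by simp

lemma wgrad_test:
  assumes "wgrad D u g" "\<phi> \<in> test_functions D"
  shows "(\<integral>x. u x * grad \<phi> x $ i \<partial>lebesgue_on D) = - (\<integral>x. g x $ i * \<phi> x \<partial>lebesgue_on D)"
  using assms by (simp add: wgrad_def has_weak_gradient_def)

lemma test_function_L2:
  fixes D :: "(real^'d) set"
  assumes "\<phi> \<in> test_functions D" "D \<in> sets lebesgue"
  shows "\<phi> \<in> L2 D" "grad \<phi> \<in> L2 D" "(\<lambda>x. grad \<phi> x $ i) \<in> L2 D"
proof -
  obtain K where K: "smooth \<phi>" "compact K" "K \<subseteq> D" "\<And>x. x \<notin> K \<Longrightarrow> \<phi> x = 0" "\<And>x. x \<notin> K \<Longrightarrow> grad \<phi> x = 0"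
    using test_functionD[OF assms(1)] by metis
  have Ks: "K \<in> sets lebesgue" using K(2) lmeasurable_compact by blast
  have L2: "f \<in> L2 D" if "f \<in> L2 K" "f \<in> borel_measurable (lebesgue_on D)" "\<And>x. x \<notin> K \<Longrightarrow> f x = 0"
    for f :: "real^'d \<Rightarrow> 'c::euclidean_space"
  proof -
    have "integrable (lebesgue_on K) (\<lambda>x. (norm (f x))\<^sup>2)" using that(1) by (simp add: L2_def)
    then have "integrable lebesgue (\<lambda>x. if x \<in> K then (norm (f x))\<^sup>2 else 0)" by (simp add: Lebesgue_Measure.integrable_restrict_UNIV[OF Ks])
    also have "(\<lambda>x. if x \<in> K then (norm (f x))\<^sup>2 else 0) = (\<lambda>x. if x \<in> D then (norm (f x))\<^sup>2 else 0)"
      using K(3) that(3) by (auto simp: fun_eq_iff)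
    finally have "integrable (lebesgue_on D) (\<lambda>x. (norm (f x))\<^sup>2)" by (simp add: Lebesgue_Measure.integrable_restrict_UNIV[OF assms(2)])
    then show ?thesis using that(2) by (simp add: L2_def)
  qed
  show "\<phi> \<in> L2 D" by (intro L2 smooth_L2 K Ks compact_imp_bounded continuous_imp_measurable_on_sets_lebesgue smooth_continuous assms)
  show g: "grad \<phi> \<in> L2 D" by (intro L2 smooth_L2 K Ks compact_imp_bounded continuous_imp_measurable_on_sets_lebesgue smooth_grad_continuous assms)
  show "(\<lambda>x. grad \<phi> x $ i) \<in> L2 D" by (rule L2_component(1)[OF g])
qed

lemma wgrad_AE_cong:
  assumes "D \<in> sets lebesgue" "wgrad D u g"
    and u: "AE x in lebesgue_on D. u x = u' x" "u' \<in> borel_measurable (lebesgue_on D)"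
    and g: "AE x in lebesgue_on D. g x = g' x" "g' \<in> borel_measurable (lebesgue_on D)"
  shows "wgrad D u' g'"
  using has_weak_gradient_AE_cong[OF assms(1) wgradD(3)[OF assms(2)] u g]
    L2_AE_cong(1)[OF wgradD(1)[OF assms(2)] u(2,1)] L2_AE_cong(1)[OF wgradD(2)[OF assms(2)] g(2,1)] by (simp add: wgrad_def)

lemma wgrad_unique:
  "open D \<Longrightarrow> wgrad D u g \<Longrightarrow> wgrad D u h \<Longrightarrow> AE x in lebesgue_on D. g x = h x"
  by (rule weak_gradient_unique) (auto simp: wgrad_def)

text \<open>Completeness of Lebesgue measure. It transfers measurability from an explicit gradient
  to the function chosen by \<open>weak_grad\<close>, which is then known to lie in
  \<open>L2\<close>.\<close>

lemma AE_eq_measurable: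
  fixes f g :: "real^'d \<Rightarrow> 'b::euclidean_space"
  assumes "D \<in> sets lebesgue" "f \<in> borel_measurable (lebesgue_on D)" "AE x in lebesgue_on D. f x = g x"
  shows "g \<in> borel_measurable (lebesgue_on D)"
proof -
  have "(\<lambda>x. if x \<in> D then f x else 0) \<in> borel_measurable lebesgue" using assms(1,2) by (simp add: borel_measurable_if)
  moreover have "AE x in lebesgue. (if x \<in> D then f x else 0) = (if x \<in> D then g x else 0)"
    using assms(1,3) by (auto simp: AE_restrict_space_iff elim!: eventually_mono)
  ultimately have "(\<lambda>x. if x \<in> D then g x else 0) \<in> borel_measurable lebesgue" by (rule borel_measurable_AE)
  then show ?thesis using assms(1) by (simp add: borel_measurable_if)
qed

lemma wgrad_weak_grad_AE:
  assumes D: "open D" and u: "wgrad D u g"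
  shows "AE x in lebesgue_on D. g x = weak_grad D u x"
proof -
  have "has_weak_gradient D u (weak_grad D u)" unfolding weak_grad_def by (rule someI[of _ g]) (rule wgradD(3)[OF u])
  then show ?thesis by (rule weak_gradient_unique[OF D wgradD(3)[OF u]])
qed

lemma wgrad_weak_grad:
  assumes D: "open D" and u: "wgrad D u g"
  shows "wgrad D u (weak_grad D u)"
proof -
  have Ds: "D \<in> sets lebesgue" using D by auto
  have "AE x in lebesgue_on D. g x = weak_grad D u x" by (rule wgrad_weak_grad_AE[OF assms])
  then show ?thesis by (intro wgrad_AE_cong[OF Ds u _ L2_measurable[OF wgradD(1)[OF u]]]
        AE_eq_measurable[OF Ds L2_measurable[OF wgradD(2)[OF u]]]) auto
qed

lemma H1_wgrad: "open D \<Longrightarrow> u \<in> H1 D \<Longrightarrow> wgrad D u (weak_grad D u)"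
  using wgrad_weak_grad by (auto simp: H1_iff_wgrad)

lemma wgrad_add:
  assumes D: "D \<in> sets lebesgue" and u: "wgrad D u g" and v: "wgrad D v h"
  shows "wgrad D (\<lambda>x. u x + v x) (\<lambda>x. g x + h x)"
proof (rule wgradI[OF D L2_add L2_add])
  fix \<phi> i assume phi: "\<phi> \<in> test_functions D"
  note t = test_function_L2[OF phi D]
  note L = wgradD[OF u] wgradD[OF v]
  show "(\<integral>x. (u x + v x) * grad \<phi> x $ i \<partial>lebesgue_on D) = - (\<integral>x. (g x + h x) $ i * \<phi> x \<partial>lebesgue_on D)"
    using wgrad_test[OF u phi, of i] wgrad_test[OF v phi, of i]
      L2_mult(1)[OF L(1) t(3), of i] L2_mult(1)[OF L(4) t(3), of i]
      L2_mult(1)[OF L2_component(1)[OF L(2)] t(1), of i] L2_mult(1)[OF L2_component(1)[OF L(5)] t(1), of i] by (simp add: distrib_right)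
qed (use u v in \<open>auto simp: wgrad_def\<close>)

lemma wgrad_cmult:
  assumes D: "D \<in> sets lebesgue" and u: "wgrad D u g"
  shows "wgrad D (\<lambda>x. c * u x) (\<lambda>x. c *\<^sub>R g x)"
proof (rule wgradI[OF D L2_cmult L2_scale])
  fix \<phi> i assume phi: "\<phi> \<in> test_functions D"
  show "(\<integral>x. c * u x * grad \<phi> x $ i \<partial>lebesgue_on D) = - (\<integral>x. (c *\<^sub>R g x) $ i * \<phi> x \<partial>lebesgue_on D)"
    using wgrad_test[OF u phi, of i] by (simp add: mult.assoc)
qed (use u in \<open>auto simp: wgrad_def\<close>)

lemma wgrad_diff:
  assumes "D \<in> sets lebesgue" "wgrad D u g" "wgrad D v h"
  shows "wgrad D (\<lambda>x. u x - v x) (\<lambda>x. g x - h x)"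
  using wgrad_add[OF assms(1,2) wgrad_cmult[OF assms(1,3), of "-1"]] by simp

lemma wgrad_zero: "D \<in> sets lebesgue \<Longrightarrow> wgrad D (\<lambda>x. 0) (\<lambda>x. 0)"
  by (rule wgradI) auto

text \<open>For a fixed test function both sides of the defining identity are continuous with
  respect to the \<open>L2\<close> norms, so the graph of the weak gradient is closed.\<close>

lemma wgrad_limit:
  assumes D: "D \<in> sets lebesgue" and u: "u \<in> L2 D" and g: "g \<in> L2 D"
    and lim: "\<And>e. e > 0 \<Longrightarrow> \<exists>u' g'. wgrad D u' g' \<and> nrm D (\<lambda>x. u' x - u x) < e \<and> nrm D (\<lambda>x. g' x - g x) < e"
  shows "wgrad D u g"
proof (rule wgradI[OF D u g])
  fix \<phi> i assume phi: "\<phi> \<in> test_functions D"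
  note t = test_function_L2[OF phi D]
  let ?a = "(\<integral>x. u x * grad \<phi> x $ i \<partial>lebesgue_on D) + (\<integral>x. g x $ i * \<phi> x \<partial>lebesgue_on D)"
  let ?N = "nrm D (\<lambda>x. grad \<phi> x $ i) + nrm D \<phi>"
  have bd: "\<bar>?a\<bar> \<le> e * ?N" if e: "e > 0" for e
  proof -
    obtain u' g' where w: "wgrad D u' g'" and c: "nrm D (\<lambda>x. u' x - u x) < e" "nrm D (\<lambda>x. g' x - g x) < e" using lim[OF e] by blast
    have "?a = - ((\<integral>x. (u' x - u x) * grad \<phi> x $ i \<partial>lebesgue_on D) + (\<integral>x. (g' x - g x) $ i * \<phi> x \<partial>lebesgue_on D))"
      using wgrad_test[OF w phi, of i] L2_mult(1)[OF u t(3), of i] L2_mult(1)[OF wgradD(1)[OF w] t(3), of i]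
        L2_mult(1)[OF L2_component(1)[OF g] t(1), of i] L2_mult(1)[OF L2_component(1)[OF wgradD(2)[OF w]] t(1), of i] by (simp add: left_diff_distrib)
    then have "\<bar>?a\<bar> \<le> \<bar>\<integral>x. (u' x - u x) * grad \<phi> x $ i \<partial>lebesgue_on D\<bar> + \<bar>\<integral>x. (g' x - g x) $ i * \<phi> x \<partial>lebesgue_on D\<bar>"
      by linarith
    also have "\<dots> \<le> nrm D (\<lambda>x. u' x - u x) * nrm D (\<lambda>x. grad \<phi> x $ i) + nrm D (\<lambda>x. (g' x - g x) $ i) * nrm D \<phi>"
      by (intro add_mono L2_mult(2) L2_diff L2_component(1)[OF L2_diff] t u g wgradD[OF w])
    also have "\<dots> \<le> e * nrm D (\<lambda>x. grad \<phi> x $ i) + e * nrm D \<phi>" using c L2_component(2)[OF L2_diff[OF wgradD(2)[OF w] g], of i]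
      by (intro add_mono mult_right_mono) auto
    finally show ?thesis by (simp add: distrib_left)
  qed
  have "\<bar>?a\<bar> \<le> 0"
  proof (rule field_le_epsilon)
    fix e :: real assume e: "e > 0"
    have N: "?N \<ge> 0" by simp
    have "e / (?N + 1) > 0" using e N by (intro divide_pos_pos) linarith+
    then have "\<bar>?a\<bar> \<le> e / (?N + 1) * ?N" by (rule bd)
    also have "\<dots> = e * (?N / (?N + 1))" by simp
    also have "\<dots> \<le> e * 1"
    proof (rule mult_left_mono)
      show "?N / (?N + 1) \<le> 1" using N by (subst divide_le_eq_1_pos) linarith+
    qed (use e in simp)
    finally show "\<bar>?a\<bar> \<le> 0 + e" by simp
  qed
  then show "(\<integral>x. u x * grad \<phi> x $ i \<partial>lebesgue_on D) = - (\<integral>x. g x $ i * \<phi> x \<partial>lebesgue_on D)" by linarith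
qed

lemma wgrad_restrict:
  fixes D :: "(real^'d) set"
  assumes D: "D \<in> sets lebesgue" "D' \<in> sets lebesgue" "D' \<subseteq> D" and u: "wgrad D u g"
  shows "wgrad D' u g"
proof (rule wgradI[OF D(2) L2_subset(1)[OF D(3,2,1)] L2_subset(1)[OF D(3,2,1)]])
  fix \<phi> i assume phi: "\<phi> \<in> test_functions D'"
  then have phi': "\<phi> \<in> test_functions D" using test_functions_mono[OF D(3)] by blast
  obtain K where K: "K \<subseteq> D'" "\<And>x. x \<notin> K \<Longrightarrow> \<phi> x = 0" "\<And>x. x \<notin> K \<Longrightarrow> grad \<phi> x = 0"
    using test_functionD[OF phi] by metis
  have r: "(\<integral>x. f x \<partial>lebesgue_on D') = (\<integral>x. f x \<partial>lebesgue_on D)" if "\<And>x. x \<notin> D' \<Longrightarrow> f x = 0" for f :: "real^'d \<Rightarrow> real"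
  proof -
    have "(\<lambda>x. if x \<in> D' then f x else 0) = f" using that by auto
    then show ?thesis using Lebesgue_Measure.integral_restrict[OF D(3,2,1), of f] by simp
  qed
  have z: "\<phi> x = 0" "grad \<phi> x = 0" if "x \<notin> D'" for x using that K by blast+
  show "(\<integral>x. u x * grad \<phi> x $ i \<partial>lebesgue_on D') = - (\<integral>x. g x $ i * \<phi> x \<partial>lebesgue_on D')"
    using wgrad_test[OF u phi', of i] r[of "\<lambda>x. u x * grad \<phi> x $ i"] r[of "\<lambda>x. g x $ i * \<phi> x"] z by simp
qed (use u in \<open>auto simp: wgrad_def\<close>)

lemma lebesgue_on_integral_compact_support:
  fixes f :: "real^'d \<Rightarrow> real"
  assumes "D \<in> sets lebesgue" "f \<in> borel_measurable borel" "\<And>x. x \<notin> D \<Longrightarrow> f x = 0"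
  shows "(\<integral>x. f x \<partial>lebesgue_on D) = (\<integral>x. f x \<partial>lborel)"
proof -
  have e: "(\<lambda>x. if x \<in> D then f x else 0) = f" using assms(3) by auto
  have "(\<integral>x. f x \<partial>lebesgue_on D) = (\<integral>x. f x \<partial>lebesgue)" using Lebesgue_Measure.integral_restrict_UNIV[OF assms(1), of f] e by simp
  also have "\<dots> = (\<integral>x. f x \<partial>lborel)" using assms(2) by (intro integral_completion) simp
  finally show ?thesis .
qed

text \<open>Integration by parts in the form that the gradient of the compactly supported product
  \<open>s \<phi>\<close> integrates to zero.\<close>

lemma wgrad_smooth:
  assumes D: "D \<in> sets lebesgue" "bounded D" and s: "smooth s"
  shows "wgrad D s (grad s)"
proof (rule wgradI[OF D(1) smooth_L2[OF s D(2,1)]])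
  fix \<phi> i assume phi: "\<phi> \<in> test_functions D"
  obtain K where K: "smooth \<phi>" "compact K" "K \<subseteq> D" "\<And>x. x \<notin> K \<Longrightarrow> \<phi> x = 0" "\<And>x. x \<notin> K \<Longrightarrow> grad \<phi> x = 0"
    using test_functionD[OF phi] by metis
  have p: "(\<lambda>x. s x * \<phi> x) \<in> test_functions D" by (rule test_function_mult[OF phi s])
  then have c: "csmooth (\<lambda>x. s x * \<phi> x)" by (simp add: test_function_csmooth)
  have g: "grad (\<lambda>x. s x * \<phi> x) x = s x *\<^sub>R grad \<phi> x + \<phi> x *\<^sub>R grad s x" for x by (intro grad_mult smooth_differentiable s K)
  note t = test_function_L2[OF phi D(1)]
  note sL = smooth_L2[OF s D(2,1)]
  have "0 = (\<integral>x. grad (\<lambda>x. s x * \<phi> x) x $ i \<partial>lborel)" using csmooth_integral_grad[OF c, of i] by simp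
  also have "\<dots> = (\<integral>x. grad (\<lambda>x. s x * \<phi> x) x $ i \<partial>lebesgue_on D)"
  proof (rule lebesgue_on_integral_compact_support[OF D(1), symmetric])
    show "(\<lambda>x. grad (\<lambda>x. s x * \<phi> x) x $ i) \<in> borel_measurable borel" by (rule test_function_grad_measurable[OF p])
    show "grad (\<lambda>x. s x * \<phi> x) x $ i = 0" if "x \<notin> D" for x
    proof -
      have "x \<notin> K" using that K(3) by blast
      then show ?thesis using K(4,5) by (simp add: g)
    qed
  qed
  also have "\<dots> = (\<integral>x. s x * grad \<phi> x $ i \<partial>lebesgue_on D) + (\<integral>x. grad s x $ i * \<phi> x \<partial>lebesgue_on D)"
    using L2_mult(1)[OF sL(1) t(3), of i] L2_mult(1)[OF L2_component(1)[OF sL(2)] t(1), of i] unfolding g by (simp add: mult.commute)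
  finally show "(\<integral>x. s x * grad \<phi> x $ i \<partial>lebesgue_on D) = - (\<integral>x. grad s x $ i * \<phi> x \<partial>lebesgue_on D)" by linarith
qed

lemma L2_mult_smooth:
  fixes g :: "real^'d \<Rightarrow> 'b::euclidean_space"
  assumes D: "D \<in> sets lebesgue" "bounded D" and s: "smooth s"
  shows "g \<in> L2 D \<Longrightarrow> (\<lambda>x. s x *\<^sub>R g x) \<in> L2 D" "f \<in> L2 D \<Longrightarrow> (\<lambda>x. f x *\<^sub>R grad s x) \<in> L2 D"
proof -
  obtain B where B: "B > 0" "\<And>x. x \<in> D \<Longrightarrow> \<bar>s x\<bar> \<le> B" "\<And>x. x \<in> D \<Longrightarrow> norm (grad s x) \<le> B"
    using smooth_bounded_on[OF s D(2)] by blast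
  have m: "s \<in> borel_measurable (lebesgue_on D)" by (intro continuous_imp_measurable_on_sets_lebesgue smooth_continuous s D)
  have m2: "grad s \<in> borel_measurable (lebesgue_on D)" by (intro continuous_imp_measurable_on_sets_lebesgue smooth_grad_continuous s D)
  show "(\<lambda>x. s x *\<^sub>R g x) \<in> L2 D" if "g \<in> L2 D" by (rule L2_bmult(1)[OF m _ that, of B]) (use B in \<open>auto intro!: AE_I2\<close>)
  show "(\<lambda>x. f x *\<^sub>R grad s x) \<in> L2 D" if f: "f \<in> L2 D"
  proof (rule L2_bound(1)[of _ _ "\<lambda>x. B\<^sup>2 * (norm (f x))\<^sup>2"])
    show "(\<lambda>x. f x *\<^sub>R grad s x) \<in> borel_measurable (lebesgue_on D)" using m2 L2_measurable[OF f] by measurable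
    show "integrable (lebesgue_on D) (\<lambda>x. B\<^sup>2 * (norm (f x))\<^sup>2)" using L2_integrable[OF f] by auto
    show "AE x in lebesgue_on D. (norm (f x *\<^sub>R grad s x))\<^sup>2 \<le> B\<^sup>2 * (norm (f x))\<^sup>2"
    proof (rule AE_I2)
      fix x assume "x \<in> space (lebesgue_on D)"
      then have "(norm (grad s x))\<^sup>2 \<le> B\<^sup>2" using B(3)[of x] by (intro power_mono) auto
      from mult_right_mono[OF this, of "(norm (f x))\<^sup>2"]
      show "(norm (f x *\<^sub>R grad s x))\<^sup>2 \<le> B\<^sup>2 * (norm (f x))\<^sup>2" by (simp add: power_mult_distrib mult.commute)
    qed
  qed
qed

text \<open>The identity for \<open>u\<close> is tested with \<open>s \<phi>\<close>, and the term
  that contains \<open>grad s\<close> changes sides.\<close>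

lemma wgrad_smooth_mult:
  assumes D: "D \<in> sets lebesgue" "bounded D" and s: "smooth s" and u: "wgrad D u g"
  shows "wgrad D (\<lambda>x. s x * u x) (\<lambda>x. s x *\<^sub>R g x + u x *\<^sub>R grad s x)"
proof (rule wgradI[OF D(1)])
  note L = wgradD(1,2)[OF u]
  note ms = L2_mult_smooth[OF D s]
  show "(\<lambda>x. s x * u x) \<in> L2 D" using ms(1)[OF L(1)] by simp
  show "(\<lambda>x. s x *\<^sub>R g x + u x *\<^sub>R grad s x) \<in> L2 D" by (intro L2_add ms L)
  fix \<phi> i assume phi: "\<phi> \<in> test_functions D"
  have ph: "smooth \<phi>" using phi by (simp add: test_functions_def)
  have p: "(\<lambda>x. s x * \<phi> x) \<in> test_functions D" by (rule test_function_mult[OF phi s])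
  have gp: "grad (\<lambda>x. s x * \<phi> x) x = s x *\<^sub>R grad \<phi> x + \<phi> x *\<^sub>R grad s x" for x by (intro grad_mult smooth_differentiable s ph)
  note t = test_function_L2[OF phi D(1)]
  have i1: "integrable (lebesgue_on D) (\<lambda>x. u x * (s x * grad \<phi> x $ i))"
    using L2_mult(1)[OF L(1), of "\<lambda>x. s x * grad \<phi> x $ i"] ms(1)[OF t(3), of i] by simp
  have i2: "integrable (lebesgue_on D) (\<lambda>x. \<phi> x * (u x * grad s x $ i))" using L2_mult(1)[OF t(1) L2_component(1)[OF ms(2)[OF L(1)]], of i] by simp
  have i3: "integrable (lebesgue_on D) (\<lambda>x. \<phi> x * (s x * g x $ i))" using L2_mult(1)[OF t(1) L2_component(1)[OF ms(1)[OF L(2)]], of i] by simp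
  have "(\<integral>x. s x * u x * grad \<phi> x $ i \<partial>lebesgue_on D) + (\<integral>x. \<phi> x * (u x * grad s x $ i) \<partial>lebesgue_on D)
     = (\<integral>x. u x * grad (\<lambda>x. s x * \<phi> x) x $ i \<partial>lebesgue_on D)"
    using i1 i2 unfolding gp by (subst Bochner_Integration.integral_add[symmetric]) (auto simp: algebra_simps)
  also have "\<dots> = - (\<integral>x. \<phi> x * (s x * g x $ i) \<partial>lebesgue_on D)" using wgrad_test[OF u p, of i] by (simp add: mult_ac)
  finally have "(\<integral>x. s x * u x * grad \<phi> x $ i \<partial>lebesgue_on D)
    = - ((\<integral>x. \<phi> x * (s x * g x $ i) \<partial>lebesgue_on D) + (\<integral>x. \<phi> x * (u x * grad s x $ i) \<partial>lebesgue_on D))" by linarith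
  also have "(\<integral>x. \<phi> x * (s x * g x $ i) \<partial>lebesgue_on D) + (\<integral>x. \<phi> x * (u x * grad s x $ i) \<partial>lebesgue_on D)
    = (\<integral>x. (s x *\<^sub>R g x + u x *\<^sub>R grad s x) $ i * \<phi> x \<partial>lebesgue_on D)"
    using i3 i2 by (subst Bochner_Integration.integral_add[symmetric]) (auto simp: algebra_simps)
  finally show "(\<integral>x. s x * u x * grad \<phi> x $ i \<partial>lebesgue_on D) = - (\<integral>x. (s x *\<^sub>R g x + u x *\<^sub>R grad s x) $ i * \<phi> x \<partial>lebesgue_on D)" .
qed

text \<open>In contrast to \<open>H10\<close> no choice of the weak gradient is involved.\<close>

definition H10w :: "(real^'d) set \<Rightarrow> (real^'d \<Rightarrow> real) \<Rightarrow> (real^'d \<Rightarrow> real^'d) \<Rightarrow> bool" where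
  "H10w D u g \<longleftrightarrow> u \<in> L2 D \<and> g \<in> L2 D \<and>
     (\<forall>e>0. \<exists>\<phi>\<in>test_functions D. nrm D (\<lambda>x. \<phi> x - u x) < e \<and> nrm D (\<lambda>x. grad \<phi> x - g x) < e)"

lemma H10w_test:
  assumes "D \<in> sets lebesgue" "\<phi> \<in> test_functions D" shows "H10w D \<phi> (grad \<phi>)"
  unfolding H10w_def using test_function_L2(1,2)[OF assms(2,1)] assms(2) by (auto simp: nrm_def intro!: bexI[of _ \<phi>])

lemma H10w_limit:
  assumes u: "u \<in> L2 D" and g: "g \<in> L2 D" and D: "D \<in> sets lebesgue"
    and lim: "\<And>e. e > 0 \<Longrightarrow> \<exists>u' g'. H10w D u' g' \<and> nrm D (\<lambda>x. u' x - u x) < e \<and> nrm D (\<lambda>x. g' x - g x) < e"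
  shows "H10w D u g"
  unfolding H10w_def
proof (intro conjI u g allI impI)
  fix e :: real assume "e > 0"
  then have e: "e / 2 > 0" by simp
  obtain u' g' where w: "H10w D u' g'" and c: "nrm D (\<lambda>x. u' x - u x) < e / 2" "nrm D (\<lambda>x. g' x - g x) < e / 2" using lim[OF e] by blast
  obtain \<phi> where phi: "\<phi> \<in> test_functions D" "nrm D (\<lambda>x. \<phi> x - u' x) < e / 2" "nrm D (\<lambda>x. grad \<phi> x - g' x) < e / 2"
    using w e unfolding H10w_def by blast
  note t = test_function_L2[OF phi(1) D]
  have uL: "u' \<in> L2 D" "g' \<in> L2 D" using w by (auto simp: H10w_def)
  have "nrm D (\<lambda>x. \<phi> x - u x) < e" "nrm D (\<lambda>x. grad \<phi> x - g x) < e"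
    using nrm_triangle3[OF t(1) uL(1) u] nrm_triangle3[OF t(2) uL(2) g] phi c by linarith+
  then show "\<exists>\<phi>\<in>test_functions D. nrm D (\<lambda>x. \<phi> x - u x) < e \<and> nrm D (\<lambda>x. grad \<phi> x - g x) < e" using phi(1) by blast
qed

lemma test_function_wgrad:
  assumes "D \<in> sets lebesgue" "bounded D" "\<phi> \<in> test_functions D" shows "wgrad D \<phi> (grad \<phi>)"
  using assms by (intro wgrad_smooth) (auto simp: test_functions_def)

lemma H10w_wgrad:
  assumes D: "D \<in> sets lebesgue" "bounded D" and u: "H10w D u g"
  shows "wgrad D u g"
  using u test_function_wgrad[OF D] by (intro wgrad_limit[OF D(1)]) (auto simp: H10w_def, blast)

lemma H1_norm_wgrad:
  assumes "open D" "wgrad D u g"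
  shows "H1_norm D u = sqrt ((nrm D u)\<^sup>2 + (nrm D g)\<^sup>2)"
proof -
  have Ds: "D \<in> sets lebesgue" using assms by auto
  have "nrm D (weak_grad D u) = nrm D g"
    using wgrad_weak_grad_AE[OF assms] L2_AE_cong(2)[OF wgradD(2)[OF assms(2)] L2_measurable[OF wgradD(2)[OF wgrad_weak_grad[OF assms]]]] by blast
  then show ?thesis by (simp add: H1_norm_def nrm_sq[symmetric])
      (simp add: nrm_sq)
qed

lemma sqrt_sum_sq_bounds:
  fixes a b :: real
  assumes "a \<ge> 0" "b \<ge> 0"
  shows "a \<le> sqrt (a\<^sup>2 + b\<^sup>2)" "b \<le> sqrt (a\<^sup>2 + b\<^sup>2)" "sqrt (a\<^sup>2 + b\<^sup>2) \<le> a + b"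
  using assms by (auto intro!: real_le_rsqrt real_le_lsqrt simp: power2_sum)

lemma H1_norm_small:
  assumes "open D" "wgrad D u g" "wgrad D v h"
  shows "nrm D (\<lambda>x. u x - v x) \<le> H1_norm D (\<lambda>x. u x - v x)" "nrm D (\<lambda>x. g x - h x) \<le> H1_norm D (\<lambda>x. u x - v x)"
    "H1_norm D (\<lambda>x. u x - v x) \<le> nrm D (\<lambda>x. u x - v x) + nrm D (\<lambda>x. g x - h x)"
proof -
  have Ds: "D \<in> sets lebesgue" using assms by auto
  show "nrm D (\<lambda>x. u x - v x) \<le> H1_norm D (\<lambda>x. u x - v x)" "nrm D (\<lambda>x. g x - h x) \<le> H1_norm D (\<lambda>x. u x - v x)"
    "H1_norm D (\<lambda>x. u x - v x) \<le> nrm D (\<lambda>x. u x - v x) + nrm D (\<lambda>x. g x - h x)"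
    unfolding H1_norm_wgrad[OF assms(1) wgrad_diff[OF Ds assms(2,3)]] by (auto intro: sqrt_sum_sq_bounds)
qed

lemma H10_imp_H10w:
  assumes D: "open D" "bounded D" and u: "u \<in> H10 D" and g: "wgrad D u g"
  shows "H10w D u g"
  unfolding H10w_def
proof (intro conjI wgradD(1)[OF g] wgradD(2)[OF g] allI impI)
  have Ds: "D \<in> sets lebesgue" using D by auto
  fix e :: real assume "e > 0"
  obtain \<phi> where phi: "\<And>k::nat. \<phi> k \<in> test_functions D" "(\<lambda>k. H1_norm D (\<lambda>x. \<phi> k x - u x)) \<longlonglongrightarrow> 0"
    using u by (auto simp: H10_def)
  obtain k where k: "H1_norm D (\<lambda>x. \<phi> k x - u x) < e" using order_tendstoD(2)[OF phi(2) \<open>e > 0\<close>] by (auto simp: eventually_sequentially)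
  have "nrm D (\<lambda>x. \<phi> k x - u x) < e" "nrm D (\<lambda>x. grad (\<phi> k) x - g x) < e"
    using H1_norm_small(1,2)[OF D(1) test_function_wgrad[OF Ds D(2) phi(1)[of k]] g] k by linarith+
  then show "\<exists>\<phi>\<in>test_functions D. nrm D (\<lambda>x. \<phi> x - u x) < e \<and> nrm D (\<lambda>x. grad \<phi> x - g x) < e" using phi(1) by blast
qed

lemma H10w_imp_H10:
  assumes D: "open D" "bounded D" and u: "H10w D u g"
  shows "u \<in> H10 D"
proof -
  have Ds: "D \<in> sets lebesgue" using D by auto
  note w = H10w_wgrad[OF Ds D(2) u]
  have "\<forall>k. \<exists>\<phi>. \<phi> \<in> test_functions D \<and> nrm D (\<lambda>x. \<phi> x - u x) < 1 / Suc k \<and> nrm D (\<lambda>x. grad \<phi> x - g x) < 1 / Suc k"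
    using u unfolding H10w_def Bex_def by simp
  from choice[OF this] obtain \<phi> where phi: "\<And>k. \<phi> k \<in> test_functions D" "\<And>k. nrm D (\<lambda>x. \<phi> k x - u x) < 1 / Suc k"
    "\<And>k. nrm D (\<lambda>x. grad (\<phi> k) x - g x) < 1 / Suc k" by blast
  have "(\<lambda>k. H1_norm D (\<lambda>x. \<phi> k x - u x)) \<longlonglongrightarrow> 0"
  proof (rule tendsto_sandwich[OF _ _ tendsto_const])
    show "\<forall>\<^sub>F k in sequentially. 0 \<le> H1_norm D (\<lambda>x. \<phi> k x - u x)"  by (rule always_eventually) (auto simp: H1_norm_def)
    show "\<forall>\<^sub>F k in sequentially. H1_norm D (\<lambda>x. \<phi> k x - u x) \<le> 2 * inverse (real (Suc k))"
    proof (rule always_eventually, rule allI)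
      fix k
      show "H1_norm D (\<lambda>x. \<phi> k x - u x) \<le> 2 * inverse (real (Suc k))"
        using H1_norm_small(3)[OF D(1) test_function_wgrad[OF Ds D(2) phi(1)[of k]] w] phi(2,3)[of k] by (simp add: inverse_eq_divide)
    qed
    show "(\<lambda>k. 2 * inverse (real (Suc k))) \<longlonglongrightarrow> 0" using tendsto_mult[OF tendsto_const[of 2] LIMSEQ_inverse_real_of_nat] by simp
  qed
  then show ?thesis using phi(1) w by (auto simp: H10_def H1_iff_wgrad)
qed

lemma H10w_add:
  assumes D: "D \<in> sets lebesgue" and u: "H10w D u g" and v: "H10w D v h"
  shows "H10w D (\<lambda>x. u x + v x) (\<lambda>x. g x + h x)"
  unfolding H10w_def
proof (intro conjI L2_add allI impI)
  fix e :: real assume "e > 0"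
  then have e: "e / 2 > 0" by simp
  obtain \<phi> where p: "\<phi> \<in> test_functions D" "nrm D (\<lambda>x. \<phi> x - u x) < e / 2" "nrm D (\<lambda>x. grad \<phi> x - g x) < e / 2"
    using u e unfolding H10w_def by blast
  obtain \<psi> where q: "\<psi> \<in> test_functions D" "nrm D (\<lambda>x. \<psi> x - v x) < e / 2" "nrm D (\<lambda>x. grad \<psi> x - h x) < e / 2"
    using v e unfolding H10w_def by blast
  note t = test_function_L2(1,2)[OF p(1) D] test_function_L2(1,2)[OF q(1) D]
  have uL: "u \<in> L2 D" "g \<in> L2 D" "v \<in> L2 D" "h \<in> L2 D" using u v by (auto simp: H10w_def)
  have g: "grad (\<lambda>x. \<phi> x + \<psi> x) x = grad \<phi> x + grad \<psi> x" for x
    using p q by (intro grad_add smooth_differentiable) (auto simp: test_functions_def)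
  have "nrm D (\<lambda>x. (\<phi> x - u x) + (\<psi> x - v x)) < e" "nrm D (\<lambda>x. (grad \<phi> x - g x) + (grad \<psi> x - h x)) < e"
    using nrm_triangle[OF L2_diff[OF t(1) uL(1)] L2_diff[OF t(3) uL(3)]]
      nrm_triangle[OF L2_diff[OF t(2) uL(2)] L2_diff[OF t(4) uL(4)]] p q by linarith+
  then show "\<exists>\<phi>\<in>test_functions D. nrm D (\<lambda>x. \<phi> x - (u x + v x)) < e \<and> nrm D (\<lambda>x. grad \<phi> x - (g x + h x)) < e"
    by (intro bexI[OF _ test_function_add[OF p(1) q(1)]]) (simp add: g algebra_simps)
qed (use u v in \<open>auto simp: H10w_def\<close>)

lemma H10w_cmult:
  assumes D: "D \<in> sets lebesgue" and u: "H10w D u g"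
  shows "H10w D (\<lambda>x. c * u x) (\<lambda>x. c *\<^sub>R g x)"
  unfolding H10w_def
proof (intro conjI L2_scale L2_cmult allI impI)
  fix e :: real assume e: "e > 0"
  then have "e / (\<bar>c\<bar> + 1) > 0" by (intro divide_pos_pos) auto
  then obtain \<phi> where p: "\<phi> \<in> test_functions D" "nrm D (\<lambda>x. \<phi> x - u x) < e / (\<bar>c\<bar> + 1)" "nrm D (\<lambda>x. grad \<phi> x - g x) < e / (\<bar>c\<bar> + 1)"
    using u unfolding H10w_def by blast
  have g: "grad (\<lambda>x. c * \<phi> x) x = c *\<^sub>R grad \<phi> x" for x
    using p by (subst grad_mult) (auto simp: test_functions_def smooth_differentiable grad_const)
  have k: "\<bar>c\<bar> * a < e" if "a < e / (\<bar>c\<bar> + 1)" "a \<ge> 0" for a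
  proof -
    have "(\<bar>c\<bar> + 1) * a < e" using that(1) by (simp add: pos_less_divide_eq mult.commute)
    then show ?thesis using that(2) by (simp add: distrib_right)
  qed
  have "nrm D (\<lambda>x. c * (\<phi> x - u x)) < e" "nrm D (\<lambda>x. c *\<^sub>R (grad \<phi> x - g x)) < e" unfolding nrm_cmult nrm_scale using p by (auto intro: k)
  then show "\<exists>\<phi>\<in>test_functions D. nrm D (\<lambda>x. \<phi> x - c * u x) < e \<and> nrm D (\<lambda>x. grad \<phi> x - c *\<^sub>R g x) < e"
    by (intro bexI[OF _ test_function_mult[OF p(1) smooth_const[of c]]]) (simp add: g algebra_simps)
qed (use u in \<open>auto simp: H10w_def\<close>)

lemma H10w_AE_cong:
  assumes D: "D \<in> sets lebesgue" and u: "H10w D u g" and e: "AE x in lebesgue_on D. u x = u' x" "AE x in lebesgue_on D. g x = g' x"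
  shows "H10w D u' g'"
proof -
  have L: "u \<in> L2 D" "g \<in> L2 D" using u by (auto simp: H10w_def)
  have m: "u' \<in> borel_measurable (lebesgue_on D)" "g' \<in> borel_measurable (lebesgue_on D)"
    by (rule AE_eq_measurable[OF D L2_measurable[OF L(1)] e(1)], rule AE_eq_measurable[OF D L2_measurable[OF L(2)] e(2)])
  have L': "u' \<in> L2 D" "g' \<in> L2 D" using L2_AE_cong(1)[OF L(1) m(1) e(1)] L2_AE_cong(1)[OF L(2) m(2) e(2)] by auto
  show ?thesis
  proof (rule H10w_limit[OF L' D])
    fix d :: real assume d: "d > 0"
    have "nrm D (\<lambda>x. u x - u' x) = nrm D (\<lambda>x. 0::real)"
      by (rule L2_AE_cong(2)[OF L2_zero]) (use e L L' in \<open>auto intro!: L2_measurable L2_diff\<close>)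
    moreover have "nrm D (\<lambda>x. g x - g' x) = nrm D (\<lambda>x. 0::real^'a)"
      by (rule L2_AE_cong(2)[OF L2_zero]) (use e L L' in \<open>auto intro!: L2_measurable L2_diff\<close>)
    ultimately show "\<exists>u'' g''. H10w D u'' g'' \<and> nrm D (\<lambda>x. u'' x - u' x) < d \<and> nrm D (\<lambda>x. g'' x - g' x) < d"
      using u d by (intro exI[of _ u] exI[of _ g]) (simp add: nrm_def)
  qed
qed

text \<open>Extension by zero. Functions carry values on the whole space, so the vanishing outside
  \<open>D'\<close> has to be a hypothesis on \<open>u\<close> and \<open>g\<close>
  themselves.\<close>

lemma H10w_mono:
  fixes D :: "(real^'d) set"
  assumes D: "D \<in> sets lebesgue" "D' \<in> sets lebesgue" "D' \<subseteq> D" and u: "H10w D' u g"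
    and z: "\<And>x. x \<notin> D' \<Longrightarrow> u x = 0" "\<And>x. x \<notin> D' \<Longrightarrow> g x = 0"
  shows "H10w D u g"
proof -
  have L2: "f \<in> L2 D \<and> nrm D f = nrm D' f" if "f \<in> L2 D'" "\<And>x. x \<notin> D' \<Longrightarrow> f x = 0" for f :: "real^'d \<Rightarrow> 'c::euclidean_space"
  proof -
    have fe: "(\<lambda>x. if x \<in> D' then f x else 0) = f" "(\<lambda>x. if x \<in> D' then (norm (f x))\<^sup>2 else 0) = (\<lambda>x. (norm (f x))\<^sup>2)"
      "(\<lambda>x. if x \<in> D then (norm (f x))\<^sup>2 else 0) = (\<lambda>x. (norm (f x))\<^sup>2)" using that(2) D(3) by (auto simp: fun_eq_iff)
    have "f \<in> borel_measurable (lebesgue_on D)" using borel_measurable_if_lebesgue_on[OF D(2,1,3), of f] L2_measurable[OF that(1)] fe by simp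
    moreover have "integrable (lebesgue_on D) (\<lambda>x. (norm (f x))\<^sup>2)"
      using Lebesgue_Measure.integrable_restrict_UNIV[OF D(2), of "\<lambda>x. (norm (f x))\<^sup>2"]
        Lebesgue_Measure.integrable_restrict_UNIV[OF D(1), of "\<lambda>x. (norm (f x))\<^sup>2"] fe L2_integrable[OF that(1)] by simp
    moreover have "nrm D f = nrm D' f" unfolding nrm_def using Lebesgue_Measure.integral_restrict[OF D(3,2,1), of "\<lambda>x. (norm (f x))\<^sup>2"] fe by simp
    ultimately show ?thesis by (simp add: L2_def)
  qed
  have uL: "u \<in> L2 D'" "g \<in> L2 D'" using u by (auto simp: H10w_def)
  show ?thesis unfolding H10w_def
  proof (intro conjI allI impI)
    show "u \<in> L2 D" "g \<in> L2 D" using L2[OF uL(1) z(1)] L2[OF uL(2) z(2)] by auto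
    fix e :: real assume "e > 0"
    then obtain \<phi> where p: "\<phi> \<in> test_functions D'" "nrm D' (\<lambda>x. \<phi> x - u x) < e" "nrm D' (\<lambda>x. grad \<phi> x - g x) < e"
      using u unfolding H10w_def by blast
    obtain K where K: "K \<subseteq> D'" "\<And>x. x \<notin> K \<Longrightarrow> \<phi> x = 0" "\<And>x. x \<notin> K \<Longrightarrow> grad \<phi> x = 0"
      using test_functionD[OF p(1)] by metis
    have zp: "\<phi> x = 0" "grad \<phi> x = 0" if "x \<notin> D'" for x using that K by blast+
    note t = test_function_L2[OF p(1) D(2)]
    have "nrm D (\<lambda>x. \<phi> x - u x) = nrm D' (\<lambda>x. \<phi> x - u x)" "nrm D (\<lambda>x. grad \<phi> x - g x) = nrm D' (\<lambda>x. grad \<phi> x - g x)"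
      using L2[OF L2_diff[OF t(1) uL(1)]] L2[OF L2_diff[OF t(2) uL(2)]] z zp by auto
    then show "\<exists>\<phi>\<in>test_functions D. nrm D (\<lambda>x. \<phi> x - u x) < e \<and> nrm D (\<lambda>x. grad \<phi> x - g x) < e"
      using p test_functions_mono[OF D(3)] by (intro bexI[of _ \<phi>]) auto
  qed
qed

section \<open>Mollification in \<open>L\<^sup>2\<close>\<close>

lemma bounded_support_integrable:
  fixes h :: "real^'d \<Rightarrow> real"
  assumes "h \<in> borel_measurable borel" "\<And>x. \<bar>h x\<bar> \<le> B" "\<And>x. norm x > R \<Longrightarrow> h x = 0"
  shows "integrable lborel h"
proof (rule Bochner_Integration.integrable_bound[of lborel "\<lambda>x. B * indicator (cball 0 R) x"])
  show "integrable lborel (\<lambda>x::real^'d. B * indicator (cball 0 R) x)" by (intro integrable_mult_right integrable_real_indicator)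
       (auto simp: emeasure_lborel_cball_finite[unfolded infinity_ennreal_def])
  show "AE x in lborel. norm (h x) \<le> norm (B * indicator (cball 0 R) x)"
  proof (rule AE_I2)
    fix x show "norm (h x) \<le> norm (B * indicator (cball 0 R) x)" using assms(2)[of x] assms(3)[of x] by (cases "norm x \<le> R") auto
  qed
qed (use assms in auto)

text \<open>The mollifier has mass one also as a function of \<open>x\<close>, so the bound follows
  by exchanging the integrals.\<close>

lemma moll_L1_contraction:
  fixes k :: "real^'d \<Rightarrow> real"
  assumes k: "integrable lborel k" and r: "r > 0"
  shows "(\<integral>\<^sup>+x. ennreal \<bar>conv k (moll r) x\<bar> \<partial>lborel) \<le> ennreal (\<integral>x. \<bar>k x\<bar> \<partial>lborel)"
proof -
  note cm = csmooth_moll[where 'd='d, OF r]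
  have [measurable]: "moll r \<in> borel_measurable (borel :: (real^'d) measure)" using cm smooth_measurable csmooth_def by blast
  have [measurable]: "k \<in> borel_measurable borel" using borel_measurable_integrable[OF k] by simp
  have m1: "(\<integral>\<^sup>+x. ennreal (moll r (x - y)) \<partial>lborel) = 1" for y :: "real^'d"
    using lborel_nn_integral_affine[of "\<lambda>x. ennreal (moll r x)" 1 "- y"] nn_integral_eq_integral[OF csmooth_integrable[OF cm] AE_I2[OF moll_nonneg[OF r]]]
      moll_integral[OF r, where 'd='d] by simp
  have "(\<integral>\<^sup>+x. ennreal \<bar>conv k (moll r) x\<bar> \<partial>lborel) \<le> (\<integral>\<^sup>+x. (\<integral>\<^sup>+y. ennreal \<bar>k y\<bar> * ennreal (moll r (x - y)) \<partial>lborel) \<partial>lborel)"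
  proof (rule nn_integral_mono)
    fix x
    have "ennreal \<bar>conv k (moll r) x\<bar> \<le> (\<integral>\<^sup>+y. ennreal (norm (k y * moll r (x - y))) \<partial>lborel)"
      using integral_norm_bound_ennreal[OF conv_integrable[OF k cm, of x]] by (simp add: conv_def)
    then show "ennreal \<bar>conv k (moll r) x\<bar> \<le> (\<integral>\<^sup>+y. ennreal \<bar>k y\<bar> * ennreal (moll r (x - y)) \<partial>lborel)"
      by (simp add: abs_mult ennreal_mult' abs_of_nonneg[OF moll_nonneg[OF r]])
  qed
  also have "\<dots> = (\<integral>\<^sup>+y. (\<integral>\<^sup>+x. ennreal \<bar>k y\<bar> * ennreal (moll r (x - y)) \<partial>lborel) \<partial>lborel)"
    by (rule lborel_pair.Fubini'[symmetric]) measurable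
  also have "\<dots> = (\<integral>\<^sup>+y. ennreal \<bar>k y\<bar> \<partial>lborel)" by (simp add: nn_integral_cmult m1)
  also have "\<dots> = ennreal (\<integral>x. \<bar>k x\<bar> \<partial>lborel)" using k by (intro nn_integral_eq_integral) auto
  finally show ?thesis .
qed

lemma continuous_approx_L1:
  fixes h :: "real^'d \<Rightarrow> real"
  assumes h: "h \<in> borel_measurable borel" "\<And>x. \<bar>h x\<bar> \<le> B" "\<And>x. norm x > R \<Longrightarrow> h x = 0" and e: "e > 0"
  obtains c where "continuous_on UNIV c" "\<And>x. \<bar>c x\<bar> \<le> B" "\<And>x. norm x > R + 1 \<Longrightarrow> c x = 0" "(\<integral>x. \<bar>h x - c x\<bar> \<partial>lborel) < e"
proof -
  have B0: "B \<ge> 0" using h(2)[of 0] by linarith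
  have "h measurable_on UNIV" using h(1) by (intro lebesgue_measurable_imp_measurable_on_real measurable_completion) auto
  then obtain N g where N: "negligible N" and g: "\<And>n::nat. continuous_on UNIV (g n)" "\<And>x. x \<notin> N \<Longrightarrow> (\<lambda>n. g n x) \<longlonglongrightarrow> h x"
    unfolding measurable_on_def by auto
  \<comment> \<open>\<open>p\<close> is \<open>1\<close> on the ball of radius \<open>R\<close> and
    brings the supports of the continuous approximations into the ball of radius
    \<open>R + 1\<close>. Together with the clipping at \<open>B\<close> this provides an integrable
    majorant.\<close>
  define p where "p x = max 0 (min 1 (R + 1 - norm x))" for x :: "real^'d"
  define c where "c n x = p x * max (- B) (min B (g n x))" for n x
  have cc: "continuous_on UNIV (c n)" for n unfolding c_def p_def by (intro continuous_intros g)
  have cB: "\<bar>c n x\<bar> \<le> B" for n x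
  proof -
    have "\<bar>c n x\<bar> \<le> 1 * B" unfolding c_def abs_mult using B0 by (intro mult_mono) (auto simp: p_def)
    then show ?thesis by simp
  qed
  have c0: "c n x = 0" if "norm x > R + 1" for n x using that by (simp add: c_def p_def)
  have lim: "(\<lambda>n. c n x) \<longlonglongrightarrow> h x" if "x \<notin> N" for x
  proof -
    have "(\<lambda>n. c n x) \<longlonglongrightarrow> p x * max (- B) (min B (h x))" unfolding c_def by (intro tendsto_intros g that)
    moreover have "max (- B) (min B (h x)) = h x" using h(2)[of x] by (auto simp: max_def min_def)
    moreover have "p x * h x = h x" using h(3)[of x] by (cases "norm x > R") (auto simp: p_def)
    ultimately show ?thesis by simp
  qed
  have [measurable]: "c n \<in> borel_measurable borel" for n by (rule borel_measurable_continuous_onI[OF cc])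
  note h(1)[measurable]
  have "(\<lambda>n. \<integral>x. \<bar>h x - c n x\<bar> \<partial>lborel) \<longlonglongrightarrow> (\<integral>x. 0 \<partial>(lborel :: (real^'d) measure))"
  proof (rule integral_dominated_convergence[where w="\<lambda>x. 2 * B * indicator (cball 0 (R + 1)) x"])
    show "integrable lborel (\<lambda>x::real^'d. 2 * B * indicator (cball 0 (R + 1)) x)"
      by (rule bounded_support_integrable[of _ "2 * B" "R + 1"]) (use B0 in \<open>auto simp: indicator_def\<close>)
    have "AE x in lebesgue. x \<notin> N" using N by (simp add: negligible_iff_null_sets AE_not_in)
    then have "AE x in lborel. x \<notin> N" by (simp add: AE_completion_iff)
    then show "AE x in lborel. (\<lambda>n. \<bar>h x - c n x\<bar>) \<longlonglongrightarrow> 0"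
    proof eventually_elim
      case (elim x)
      have "(\<lambda>n. \<bar>h x - c n x\<bar>) \<longlonglongrightarrow> \<bar>h x - h x\<bar>" by (intro tendsto_intros lim elim)
      then show ?case by simp
    qed
    show "AE x in lborel. norm \<bar>h x - c n x\<bar> \<le> 2 * B * indicator (cball 0 (R + 1)) x" for n
    proof (rule AE_I2)
      fix x show "norm \<bar>h x - c n x\<bar> \<le> 2 * B * indicator (cball 0 (R + 1)) x"
      proof (cases "norm x \<le> R + 1")
        case True
        then show ?thesis using h(2)[of x] cB[of n x] by simp
      qed (use h(3)[of x] c0[of x n] in simp)
    qed
  qed measurable
  then obtain n where "(\<integral>x. \<bar>h x - c n x\<bar> \<partial>lborel) < e" using order_tendstoD(2)[OF _ e] by (fastforce simp: eventually_sequentially)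
  then show ?thesis using that[OF cc cB c0] by blast
qed

text \<open>For bounded functions convergence in \<open>L\<^sup>1\<close> implies convergence in \<open>L\<^sup>2\<close>.\<close>

lemma moll_L2_approx:
  fixes h :: "real^'d \<Rightarrow> real"
  assumes h: "h \<in> borel_measurable borel" "\<And>x. \<bar>h x\<bar> \<le> B" "\<And>x. norm x > R \<Longrightarrow> h x = 0" and e: "e > 0"
  obtains r0 where "r0 > 0" "\<And>r. 0 < r \<Longrightarrow> r < r0 \<Longrightarrow> (\<integral>\<^sup>+x. ennreal ((conv h (moll r) x - h x)\<^sup>2) \<partial>lborel) < ennreal e"
proof -
  \<comment> \<open>Both \<open>h\<close> and its mollification are bounded by \<open>B\<close>, so
    \<open>M\<close> bounds their difference and the squared error is at most \<open>M\<close> times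
    the error.\<close>
  define M where "M = 2 * B + 1"
  have M: "M > 0" using h(2)[of 0] unfolding M_def by linarith
  let ?V = "measure lborel (cball (0::real^'d) (R + 2))"
  have V: "?V \<ge> 0" by (rule measure_nonneg)
  have V1: "?V + 1 > 0" using V by linarith
  \<comment> \<open>The \<open>L\<^sup>1\<close> error has three parts, each at most
    \<open>e / (4 * M)\<close>: the distance of \<open>h\<close> from \<open>c\<close>, the same
    distance after mollification, and \<open>q\<close> times the volume of the ball outside which
    \<open>c\<close> and its mollification vanish.\<close>
  define q where "q = e / (4 * M) / (?V + 1)"
  have q: "q > 0" using e V1 M unfolding q_def by (intro divide_pos_pos mult_pos_pos) auto
  have e4: "e / (4 * M) > 0" using e M by simp
  obtain c where c: "continuous_on UNIV c" "\<And>x. \<bar>c x\<bar> \<le> B" "\<And>x. norm x > R + 1 \<Longrightarrow> c x = 0" "(\<integral>x. \<bar>h x - c x\<bar> \<partial>lborel) < e / (4 * M)"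
    using continuous_approx_L1[OF h e4] by blast
  obtain d where d: "d > 0" "\<And>x y. dist x y < d \<Longrightarrow> norm (c y - c x) < q" using continuous_support_uniform[OF c(1,3) q] by blast
  have ci: "integrable lborel c" by (rule bounded_support_integrable[OF borel_measurable_continuous_onI[OF c(1)] c(2,3)])
  have hi: "integrable lborel h" by (rule bounded_support_integrable[OF h(1-3)])
  let ?k = "\<lambda>x. h x - c x" and ?I = "\<integral>x. \<bar>h x - c x\<bar> \<partial>lborel" and ?K = "cball (0::real^'d) (R + 2)"
  have ki: "integrable lborel ?k" using hi ci by simp
  note [measurable] = h(1) borel_measurable_continuous_onI[OF c(1)]
  show ?thesis
  proof (rule that[of "min d 1"])
    show "min d 1 > 0" using d by simp
    fix r :: real assume r: "0 < r" "r < min d 1"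
    note cm = csmooth_moll[where 'd='d, OF r(1)]
    have [measurable]: "conv ?k (moll r) \<in> borel_measurable borel" by (rule smooth_measurable[OF smooth_conv[OF ki cm]])
    have cc: "\<bar>conv c (moll r) x - c x\<bar> \<le> q * indicator ?K x" for x
    proof (cases "norm x \<le> R + 2")
      case True
      have "\<bar>conv c (moll r) x - c x\<bar> \<le> q"
        by (rule moll_conv_close[OF ci r(1)]) (use d(2) r(2) in \<open>force intro: less_imp_le\<close>)
      then show ?thesis using True by simp
    next
      case False
      have "c y = 0" if "dist x y < 1" for y using False that norm_triangle_ineq2[of x y] by (intro c(3)) (simp add: dist_norm)
      then have "\<bar>conv c (moll r) x - c x\<bar> \<le> 0" using r by (intro moll_conv_close[OF ci r(1)]) auto
      then show ?thesis using False by simp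
    qed
    have "(\<integral>\<^sup>+x. ennreal ((conv h (moll r) x - h x)\<^sup>2) \<partial>lborel)
      \<le> (\<integral>\<^sup>+x. ennreal M * (ennreal \<bar>conv ?k (moll r) x\<bar> + ennreal q * indicator ?K x + ennreal \<bar>?k x\<bar>) \<partial>lborel)"
    proof (rule nn_integral_mono)
      fix x
      have "\<bar>conv h (moll r) x\<bar> \<le> B" unfolding conv_def by (rule moll_average_le[OF r(1) conv_integrable[OF hi cm] h(2)])
      then have "\<bar>conv h (moll r) x - h x\<bar> \<le> M" using h(2)[of x] by (simp add: M_def)
      then have "\<bar>conv h (moll r) x - h x\<bar> * \<bar>conv h (moll r) x - h x\<bar> \<le> M * \<bar>conv h (moll r) x - h x\<bar>" by (rule mult_right_mono) simp
      also have "\<dots> \<le> M * (\<bar>conv ?k (moll r) x\<bar> + q * indicator ?K x + \<bar>?k x\<bar>)"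
      proof (rule mult_left_mono)
        have "conv h (moll r) x = conv ?k (moll r) x + conv c (moll r) x"
          using conv_integrable[OF hi cm, of x] conv_integrable[OF ci cm, of x] by (simp add: conv_def left_diff_distrib)
        then show "\<bar>conv h (moll r) x - h x\<bar> \<le> \<bar>conv ?k (moll r) x\<bar> + q * indicator ?K x + \<bar>?k x\<bar>" using cc[of x] by linarith
      qed (use M in simp)
      finally have "(conv h (moll r) x - h x)\<^sup>2 \<le> M * (\<bar>conv ?k (moll r) x\<bar> + q * indicator ?K x + \<bar>?k x\<bar>)" by (simp add: power2_eq_square)
      then show "ennreal ((conv h (moll r) x - h x)\<^sup>2) \<le> ennreal M * (ennreal \<bar>conv ?k (moll r) x\<bar> + ennreal q * indicator ?K x + ennreal \<bar>?k x\<bar>)"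
        using q M by (subst (asm) ennreal_le_iff[symmetric]) (auto simp: ennreal_mult'' ennreal_plus indicator_def split: if_splits)
    qed
    also have "\<dots> = ennreal M * ((\<integral>\<^sup>+x. ennreal \<bar>conv ?k (moll r) x\<bar> \<partial>lborel) + ennreal q * emeasure lborel ?K + (\<integral>\<^sup>+x. ennreal \<bar>?k x\<bar> \<partial>lborel))"
    proof -
      have [measurable]: "?K \<in> sets borel" by simp
      have m: "(\<lambda>x. ennreal \<bar>conv ?k (moll r) x\<bar>) \<in> borel_measurable lborel" "(\<lambda>x. ennreal q * indicator ?K x) \<in> borel_measurable lborel"
        "(\<lambda>x. ennreal \<bar>?k x\<bar>) \<in> borel_measurable lborel" by measurable
      show ?thesis
        unfolding nn_integral_cmult[OF borel_measurable_add[OF borel_measurable_add[OF m(1,2)] m(3)]]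
          nn_integral_add[OF borel_measurable_add[OF m(1,2)] m(3)] nn_integral_add[OF m(1,2)] by (simp add: nn_integral_cmult_indicator)
    qed
    also have "\<dots> \<le> ennreal M * (ennreal ?I + ennreal q * ennreal ?V + ennreal ?I)"
      using nn_integral_eq_integral[of lborel "\<lambda>x. \<bar>?k x\<bar>"] ki emeasure_eq_ennreal_measure[of lborel ?K] emeasure_lborel_cball_finite[of "0::real^'d" "R + 2"]
      by (intro mult_left_mono add_mono moll_L1_contraction[OF ki r(1)]) auto
    also have "ennreal ?I + ennreal q * ennreal ?V + ennreal ?I = ennreal (?I + q * ?V + ?I)"
    proof -
      have "0 \<le> ?I" by (rule Bochner_Integration.integral_nonneg) simp
      moreover have "0 \<le> q * ?V" using q V by simp
      moreover have "ennreal (q * ?V) = ennreal q * ennreal ?V" using q by (intro ennreal_mult') simp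
      ultimately show ?thesis by (simp only: ennreal_plus add_nonneg_nonneg)
    qed
    also have "ennreal M * ennreal (?I + q * ?V + ?I) = ennreal (M * (?I + q * ?V + ?I))" using M by (simp add: ennreal_mult')
    also have "\<dots> < ennreal e"
    proof (rule ennreal_lessI[OF e])
      have "q * ?V \<le> q * (?V + 1)" using q by simp
      also have "\<dots> = e / (4 * M)" unfolding q_def using V1 by (metis less_irrefl nonzero_mult_div_cancel_right times_divide_eq_left)
      finally have "?I + q * ?V + ?I < 3 * (e / (4 * M))" using c(4) by linarith
      from mult_strict_left_mono[OF this M] have "M * (?I + q * ?V + ?I) < 3 / 4 * e" using M by simp
      then show "M * (?I + q * ?V + ?I) < e" using e by linarith
    qed
    finally show "(\<integral>\<^sup>+x. ennreal ((conv h (moll r) x - h x)\<^sup>2) \<partial>lborel) < ennreal e" .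
  qed
qed

lemma nrm_le_nn:
  fixes f :: "real^'d \<Rightarrow> real"
  assumes D: "D \<in> sets lebesgue" and f: "f \<in> borel_measurable borel" "(\<integral>\<^sup>+x. ennreal ((f x)\<^sup>2) \<partial>lborel) < ennreal (e\<^sup>2)"
    and g: "g \<in> borel_measurable (lebesgue_on D)" "AE x in lebesgue_on D. f x = g x" and e: "e > 0"
  shows "nrm D g < e"
proof -
  have m: "f \<in> borel_measurable (lebesgue_on D)" using f(1) by (intro measurable_restrict_space1 measurable_completion) simp
  have "(\<integral>x. (norm (g x))\<^sup>2 \<partial>lebesgue_on D) = (\<integral>x. (norm (f x))\<^sup>2 \<partial>lebesgue_on D)"
    using g m by (intro integral_cong_AE) auto
  also have "\<dots> = enn2real (\<integral>\<^sup>+x. ennreal ((norm (f x))\<^sup>2) \<partial>lebesgue_on D)" using m by (intro integral_eq_nn_integral) auto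
  also have "\<dots> < e\<^sup>2"
  proof -
    have "(\<integral>\<^sup>+x. ennreal ((norm (f x))\<^sup>2) \<partial>lebesgue_on D) = (\<integral>\<^sup>+x. ennreal ((norm (f x))\<^sup>2) * indicator D x \<partial>lebesgue)"
      using D by (simp add: nn_integral_restrict_space)
    also have "\<dots> \<le> (\<integral>\<^sup>+x. ennreal ((f x)\<^sup>2) \<partial>lebesgue)" by (intro nn_integral_mono) (auto simp: indicator_def)
    also have "\<dots> = (\<integral>\<^sup>+x. ennreal ((f x)\<^sup>2) \<partial>lborel)" by (simp add: nn_integral_completion)
    finally have "(\<integral>\<^sup>+x. ennreal ((norm (f x))\<^sup>2) \<partial>lebesgue_on D) < ennreal (e\<^sup>2)" using f(2) by (rule le_less_trans)
    then show ?thesis by (cases "\<integral>\<^sup>+x. ennreal ((norm (f x))\<^sup>2) \<partial>lebesgue_on D") (auto simp: ennreal_less_iff)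
  qed
  finally have "(nrm D g)\<^sup>2 < e\<^sup>2" unfolding nrm_sq by simp
  then show ?thesis using e by (simp add: power2_less_imp_less)
qed

lemma L2_dct:
  fixes F :: "nat \<Rightarrow> real^'d \<Rightarrow> 'b::euclidean_space"
  assumes m: "\<And>n. F n \<in> borel_measurable (lebesgue_on D)"
    and w: "integrable (lebesgue_on D) w" "\<And>n. AE x in lebesgue_on D. (norm (F n x))\<^sup>2 \<le> w x"
    and lim: "AE x in lebesgue_on D. (\<lambda>n. F n x) \<longlonglongrightarrow> 0"
  shows "(\<lambda>n. nrm D (F n)) \<longlonglongrightarrow> 0"
proof -
  have "(\<lambda>n. \<integral>x. (norm (F n x))\<^sup>2 \<partial>lebesgue_on D) \<longlonglongrightarrow> (\<integral>x. 0 \<partial>lebesgue_on D)"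
  proof (rule integral_dominated_convergence[where w=w])
    show "AE x in lebesgue_on D. (\<lambda>n. (norm (F n x))\<^sup>2) \<longlonglongrightarrow> 0" using lim
    proof eventually_elim
      case (elim x)
      have "(\<lambda>n. (norm (F n x))\<^sup>2) \<longlonglongrightarrow> (norm (0::'b))\<^sup>2" by (intro tendsto_intros elim)
      then show ?case by simp
    qed
    show "AE x in lebesgue_on D. norm ((norm (F n x))\<^sup>2) \<le> w x" for n using w(2)[of n] by simp
  qed (use m w in auto)
  from tendsto_real_sqrt[OF this] show ?thesis by (simp add: nrm_def)
qed

lemma nrm_le_sum_components:
  fixes g :: "real^'d \<Rightarrow> real^'d"
  assumes "g \<in> L2 D" shows "nrm D g \<le> (\<Sum>i\<in>UNIV. nrm D (\<lambda>x. g x $ i))"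
proof -
  have "(nrm D g)\<^sup>2 = (\<integral>x. (\<Sum>i\<in>UNIV. (norm (g x $ i))\<^sup>2) \<partial>lebesgue_on D)"
    unfolding nrm_sq by (intro Bochner_Integration.integral_cong refl) (simp add: norm_vec_def L2_set_def sum_nonneg)
  also have "\<dots> = (\<Sum>i\<in>UNIV. (nrm D (\<lambda>x. g x $ i))\<^sup>2)"
    unfolding nrm_sq by (intro Bochner_Integration.integral_sum L2_integrable L2_component assms)
  finally have "nrm D g = L2_set (\<lambda>i. nrm D (\<lambda>x. g x $ i)) UNIV" unfolding L2_set_def by (metis nrm_nonneg real_sqrt_abs abs_of_nonneg)
  then show ?thesis by (simp add: L2_set_le_sum)
qed

section \<open>Products with Lipschitz functions\<close>

text \<open>Convolutions and iterated integrals are formed with Borel functions that are bounded at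
  every point, whereas elements of the spaces are only Lebesgue measurable and bounded almost
  everywhere. Clipping a Borel representative repairs both.\<close>

lemma borel_rep_bounded:
  fixes f :: "real^'d \<Rightarrow> real"
  assumes D: "D \<in> sets lebesgue" and f: "f \<in> borel_measurable (lebesgue_on D)" "AE x in lebesgue_on D. \<bar>f x\<bar> \<le> B"
    and K: "closed K" "K \<subseteq> D" "\<And>x. x \<notin> K \<Longrightarrow> f x = 0" and B: "B \<ge> 0"
  obtains h where "h \<in> borel_measurable borel" "\<And>x. \<bar>h x\<bar> \<le> B" "\<And>x. x \<notin> K \<Longrightarrow> h x = 0"
    "AE x in lebesgue. f x = h x"
proof -
  have "f x = 0" if "x \<notin> D" for x using that K by blast
  then have "(\<lambda>x. if x \<in> D then f x else 0) = f" by auto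
  then have "f \<in> borel_measurable lebesgue" using borel_measurable_if[OF D, of f] f(1) by simp
  then obtain h where h: "h \<in> borel_measurable lborel" "AE x in lborel. f x = h x" using completion_ex_borel_measurable_real[of f lborel] by auto
  let ?h = "\<lambda>x. if x \<in> K then max (- B) (min B (h x)) else 0"
  show ?thesis
  proof (rule that[of ?h])
    have [measurable]: "h \<in> borel_measurable borel" using h(1) by simp
    have [measurable]: "K \<in> sets borel" using K(1) by simp
    show "?h \<in> borel_measurable borel" by measurable
    show "\<bar>?h x\<bar> \<le> B" for x using B by (auto simp: max_def min_def)
    show "?h x = 0" if "x \<notin> K" for x using that by simp
    have "AE x in lebesgue. f x = h x" using h(2) by (rule AE_completion)
    moreover have "AE x in lebesgue. x \<in> D \<longrightarrow> \<bar>f x\<bar> \<le> B" using f(2) D by (simp add: AE_restrict_space_iff)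
    ultimately show "AE x in lebesgue. f x = ?h x"
    proof eventually_elim
      case (elim x)
      show ?case
      proof (cases "x \<in> K")
        case True
        then have "\<bar>h x\<bar> \<le> B" using elim K(2) by auto
        then show ?thesis using True elim(1) by (auto simp: max_def min_def)
      qed (use K(3) in auto)
    qed
  qed
qed

text \<open>\<open>f\<close> vanishes off a compact \<open>K\<close> and has the weak gradient \<open>g\<close> when tested against arbitrary smooth
  functions; both are bounded.\<close>

definition cpt_wgrad :: "(real^'d) set \<Rightarrow> (real^'d) set \<Rightarrow> real \<Rightarrow> (real^'d \<Rightarrow> real) \<Rightarrow> (real^'d \<Rightarrow> real^'d) \<Rightarrow> bool" where
  "cpt_wgrad E K B f g \<longleftrightarrow> compact K \<and> K \<subseteq> E \<and> B \<ge> 0 \<and>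
     f \<in> borel_measurable (lebesgue_on E) \<and> g \<in> borel_measurable (lebesgue_on E) \<and>
     (AE x in lebesgue_on E. \<bar>f x\<bar> \<le> B) \<and> (AE x in lebesgue_on E. norm (g x) \<le> B) \<and>
     (\<forall>x. x \<notin> K \<longrightarrow> f x = 0 \<and> g x = 0) \<and>
     (\<forall>\<psi> i. smooth \<psi> \<longrightarrow> (\<integral>x. f x * grad \<psi> x $ i \<partial>lebesgue_on E) = - (\<integral>x. g x $ i * \<psi> x \<partial>lebesgue_on E))"

text \<open>The passage to Borel representatives also moves the integrals from \<open>E\<close> to
  the whole space, where translates of the mollifier are available as test functions.\<close>

lemma cpt_wgrad_reps:
  fixes E :: "(real^'d) set"
  assumes E: "E \<in> sets lebesgue" and c: "cpt_wgrad E K B f g"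
  obtains h k where "h \<in> borel_measurable borel" "\<And>x. \<bar>h x\<bar> \<le> B" "\<And>x. x \<notin> K \<Longrightarrow> h x = 0" "AE x in lebesgue. f x = h x"
    "\<And>i. k i \<in> borel_measurable borel" "\<And>i x. \<bar>k i x\<bar> \<le> B" "\<And>i x. x \<notin> K \<Longrightarrow> k i x = 0" "\<And>i. AE x in lebesgue. g x $ i = k i x"
    "\<And>\<psi> i. smooth \<psi> \<Longrightarrow> (\<integral>x. h x * grad \<psi> x $ i \<partial>lborel) = - (\<integral>x. k i x * \<psi> x \<partial>lborel)"
proof -
  note c' = c[unfolded cpt_wgrad_def]
  have K: "closed K" "K \<subseteq> E" using c' compact_imp_closed by auto
  obtain h where h: "h \<in> borel_measurable borel" "\<And>x. \<bar>h x\<bar> \<le> B" "\<And>x. x \<notin> K \<Longrightarrow> h x = 0" "AE x in lebesgue. f x = h x"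
    by (rule borel_rep_bounded[OF E _ _ K, of f B]) (use c' in auto)
  have "\<exists>h. h \<in> borel_measurable borel \<and> (\<forall>x. \<bar>h x\<bar> \<le> B) \<and> (\<forall>x. x \<notin> K \<longrightarrow> h x = 0) \<and> (AE x in lebesgue. g x $ i = h x)" for i
  proof -
    have gm: "(\<lambda>x. g x $ i) \<in> borel_measurable (lebesgue_on E)" using c' by (simp add: measurable_component)
    have gB: "AE x in lebesgue_on E. \<bar>g x $ i\<bar> \<le> B"
    proof -
      have "AE x in lebesgue_on E. norm (g x) \<le> B" using c' by blast
      then show ?thesis by eventually_elim (use component_le_norm_cart order_trans in blast)
    qed
    show ?thesis by (rule borel_rep_bounded[OF E gm gB K]) (use c' in auto)
  qed
  then have "\<forall>i. \<exists>h. h \<in> borel_measurable borel \<and> (\<forall>x. \<bar>h x\<bar> \<le> B) \<and> (\<forall>x. x \<notin> K \<longrightarrow> h x = 0) \<and> (AE x in lebesgue. g x $ i = h x)" by blast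
  from choice[OF this] obtain k where k: "\<And>i. k i \<in> borel_measurable borel" "\<And>i x. \<bar>k i x\<bar> \<le> B" "\<And>i x. x \<notin> K \<Longrightarrow> k i x = 0" "\<And>i. AE x in lebesgue. g x $ i = k i x"
    by blast
  have tr: "(\<integral>x. u x * s x \<partial>lebesgue_on E) = (\<integral>x. v x * s x \<partial>lborel)"
    if "AE x in lebesgue. u x = v x" "\<And>x. x \<notin> K \<Longrightarrow> u x = 0" "v \<in> borel_measurable borel" "u \<in> borel_measurable (lebesgue_on E)" "continuous_on UNIV s"
    for u v s :: "real^'d \<Rightarrow> real"
  proof -
    have s: "s \<in> borel_measurable borel" by (rule borel_measurable_continuous_onI[OF that(5)])
    have uz: "u x = 0" if "x \<notin> E" for x using that \<open>\<And>x. x \<notin> K \<Longrightarrow> u x = 0\<close> K by blast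
    have e: "(\<lambda>x. if x \<in> E then u x else 0) = u" using uz by auto
    then have um: "u \<in> borel_measurable lebesgue" using borel_measurable_if[OF E, of u] that(4) by simp
    have "(\<lambda>x. if x \<in> E then u x * s x else 0) = (\<lambda>x. u x * s x)" using uz by auto
    then have "(\<integral>x. u x * s x \<partial>lebesgue_on E) = (\<integral>x. u x * s x \<partial>lebesgue)"
      using Lebesgue_Measure.integral_restrict_UNIV[OF E, of "\<lambda>x. u x * s x"] by simp
    also have "\<dots> = (\<integral>x. v x * s x \<partial>lebesgue)"
    proof (rule integral_cong_AE)
      have [measurable]: "s \<in> borel_measurable lebesgue" "v \<in> borel_measurable lebesgue" using s that(3) by (auto intro: measurable_completion)
      note um[measurable]
      show "(\<lambda>x. u x * s x) \<in> borel_measurable lebesgue" "(\<lambda>x. v x * s x) \<in> borel_measurable lebesgue" by measurable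
    qed (use that(1) in auto)
    also have "\<dots> = (\<integral>x. v x * s x \<partial>lborel)" using s that(3) by (intro integral_completion) simp
    finally show ?thesis .
  qed
  have "(\<integral>x. h x * grad \<psi> x $ i \<partial>lborel) = - (\<integral>x. k i x * \<psi> x \<partial>lborel)" if "smooth \<psi>" for \<psi> i
  proof -
    have "(\<integral>x. f x * grad \<psi> x $ i \<partial>lebesgue_on E) = (\<integral>x. h x * grad \<psi> x $ i \<partial>lborel)"
      by (rule tr[OF h(4) _ h(1)]) (use c' that in \<open>auto intro: smooth_continuous smooth_grad\<close>)
    moreover have "(\<integral>x. g x $ i * \<psi> x \<partial>lebesgue_on E) = (\<integral>x. k i x * \<psi> x \<partial>lborel)"
    proof (rule tr[OF k(4) _ k(1)])
      show "(\<lambda>x. g x $ i) \<in> borel_measurable (lebesgue_on E)" using c' by (simp add: measurable_component)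
    qed (use c' that in \<open>auto intro: smooth_continuous\<close>)
    ultimately show ?thesis using c' that by simp
  qed
  then show ?thesis using that[of h k] h k by simp
qed

text \<open>The test function is a reflected translate of the mollifier, whose support may leave the
  domain. This is why \<open>cpt_wgrad\<close> tests with arbitrary smooth functions.\<close>

lemma conv_grad_weak:
  fixes h k :: "real^'d \<Rightarrow> real"
  assumes w: "\<And>\<psi>. smooth \<psi> \<Longrightarrow> (\<integral>x. h x * grad \<psi> x $ i \<partial>lborel) = - (\<integral>x. k x * \<psi> x \<partial>lborel)"
    and h: "integrable lborel h" and r: "r > 0"
  shows "grad (conv h (moll r)) x $ i = conv k (moll r) x"
proof -
  note cm = csmooth_moll[where 'd='d, OF r]
  have sm: "smooth (moll r :: real^'d \<Rightarrow> real)" using cm csmooth_def by blast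
  let ?\<psi> = "\<lambda>y. moll r ((-1) *\<^sub>R y + x)"
  have s: "smooth ?\<psi>" by (rule smooth_affine(1)[OF sm])
  have g: "grad ?\<psi> y $ i = - grad (moll r) (x - y) $ i" for y by (subst smooth_affine(2)[OF sm]) simp
  have "grad (conv h (moll r)) x $ i = (\<integral>y. h y * grad (moll r) (x - y) $ i \<partial>lborel)" by (simp add: grad_conv[OF h cm] conv_def)
  also have "\<dots> = - (\<integral>y. h y * grad ?\<psi> y $ i \<partial>lborel)" unfolding g by simp
  also have "\<dots> = (\<integral>y. k y * ?\<psi> y \<partial>lborel)" by (simp only: w[OF s] minus_minus)
  also have "\<dots> = conv k (moll r) x" by (simp add: conv_def)
  finally show ?thesis .
qed

text \<open>Mollification at a scale below the distance from \<open>K\<close> to the complement of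
  \<open>D\<close> yields test functions of \<open>D\<close>. The components of their gradients are
  the mollified components of \<open>g\<close>.\<close>

lemma cpt_wgrad_H10w:
  fixes D :: "(real^'d) set"
  assumes E: "open E" "bounded E" and D: "open D" "K \<subseteq> D" "D \<subseteq> E" and c: "cpt_wgrad E K B f g"
  shows "H10w D f g"
proof -
  note c' = c[unfolded cpt_wgrad_def]
  have Es: "E \<in> sets lebesgue" and Ds: "D \<in> sets lebesgue" using E D by auto
  obtain h k where h: "h \<in> borel_measurable borel" "\<And>x. \<bar>h x\<bar> \<le> B" "\<And>x. x \<notin> K \<Longrightarrow> h x = 0" "AE x in lebesgue. f x = h x"
    and k: "\<And>i. k i \<in> borel_measurable borel" "\<And>i x. \<bar>k i x\<bar> \<le> B" "\<And>i x. x \<notin> K \<Longrightarrow> k i x = 0" "\<And>i. AE x in lebesgue. g x $ i = k i x"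
    and w: "\<And>\<psi> i. smooth \<psi> \<Longrightarrow> (\<integral>x. h x * grad \<psi> x $ i \<partial>lborel) = - (\<integral>x. k i x * \<psi> x \<partial>lborel)"
    by (rule cpt_wgrad_reps[OF Es c]) (rule that, assumption+)
  have K: "compact K" using c' by blast
  obtain r1 where r1: "r1 > 0" "\<And>x y. x \<in> K \<Longrightarrow> dist x y \<le> r1 \<Longrightarrow> y \<in> D" using compact_nbhd[OF K D(2,1)] by blast
  obtain R where R: "\<And>x. x \<in> K \<Longrightarrow> norm x \<le> R" using K unfolding compact_eq_bounded_closed bounded_iff by blast
  have h0: "h x = 0" if "norm x > R" for x using h(3) R that by force
  have k0: "k i x = 0" if "norm x > R" for x i using k(3) R that by force
  have hi: "integrable lborel h" by (rule bounded_support_integrable[OF h(1,2) h0])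
  have ki: "integrable lborel (k i)" for i by (rule bounded_support_integrable[OF k(1,2) k0])
  have fin: "finite_measure (lebesgue_on D)" by (intro emeasure_bounded_lebesgue bounded_subset[OF E(2) D(3)] Ds)
  have fm: "f \<in> borel_measurable (lebesgue_on D)" "g \<in> borel_measurable (lebesgue_on D)" using c' measurable_restrict_mono[OF _ D(3)] by blast+
  have fL: "f \<in> L2 D" by (rule L2_bounded[OF fm(1) _ fin, of B]) (use c' AE_lebesgue_on_subset[OF D(3) Ds Es] in auto)
  have gL: "g \<in> L2 D" by (rule L2_bounded[OF fm(2) _ fin, of B]) (use c' AE_lebesgue_on_subset[OF D(3) Ds Es] in auto)
  show ?thesis unfolding H10w_def
  proof (intro conjI fL gL allI impI)
    fix e :: real assume e: "e > 0"
    \<comment> \<open>The norm of the gradient error is bounded by the sum of the norms of its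
      components, so each component is granted the share \<open>e'\<close>.\<close>
    define e' where "e' = e / (2 * real CARD('d))"
    have e': "e' > 0" using e by (simp add: e'_def)
    then have e2: "e'\<^sup>2 > 0" by simp
    obtain rh where rh: "rh > 0" "\<And>r. 0 < r \<Longrightarrow> r < rh \<Longrightarrow> (\<integral>\<^sup>+x. ennreal ((conv h (moll r) x - h x)\<^sup>2) \<partial>lborel) < ennreal (e'\<^sup>2)"
      using moll_L2_approx[OF h(1,2) h0 e2] by blast
    have "\<forall>i. \<exists>r0>0. \<forall>r. 0 < r \<longrightarrow> r < r0 \<longrightarrow> (\<integral>\<^sup>+x. ennreal ((conv (k i) (moll r) x - k i x)\<^sup>2) \<partial>lborel) < ennreal (e'\<^sup>2)"
    proof
      fix i
      obtain r0 where "r0 > 0" "\<And>r. 0 < r \<Longrightarrow> r < r0 \<Longrightarrow> (\<integral>\<^sup>+x. ennreal ((conv (k i) (moll r) x - k i x)\<^sup>2) \<partial>lborel) < ennreal (e'\<^sup>2)"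
        using moll_L2_approx[OF k(1)[of i] k(2)[of i] k0 e2] by blast
      then show "\<exists>r0>0. \<forall>r. 0 < r \<longrightarrow> r < r0 \<longrightarrow> (\<integral>\<^sup>+x. ennreal ((conv (k i) (moll r) x - k i x)\<^sup>2) \<partial>lborel) < ennreal (e'\<^sup>2)"
        by blast
    qed
    from choice[OF this] obtain rk where rk: "\<And>i. rk i > 0" "\<And>i r. 0 < r \<Longrightarrow> r < rk i \<Longrightarrow> (\<integral>\<^sup>+x. ennreal ((conv (k i) (moll r) x - k i x)\<^sup>2) \<partial>lborel) < ennreal (e'\<^sup>2)"
      by blast
    define r where "r = Min (insert rh (insert r1 (range rk))) / 2"
    have m: "Min (insert rh (insert r1 (range rk))) > 0" using rh(1) r1(1) rk(1) by (subst Min_gr_iff) auto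
    have r: "r > 0" "r < rh" "r < r1" "\<And>i. r < rk i"
    proof -
      have le: "Min (insert rh (insert r1 (range rk))) \<le> z" if "z \<in> insert rh (insert r1 (range rk))" for z using that by (intro Min_le) auto
      show "r > 0" using m by (simp add: r_def)
      have lt: "r < z" if "z \<in> insert rh (insert r1 (range rk))" for z using le[OF that] m unfolding r_def by linarith
      show "r < rh" "r < r1" "\<And>i. r < rk i" by (rule lt, simp)+
    qed
    note cm = csmooth_moll[where 'd='d, OF r(1)]
    let ?\<phi> = "conv h (moll r)"
    have sp: "smooth ?\<phi>" by (rule smooth_conv[OF hi cm])
    have gp: "grad ?\<phi> x $ i = conv (k i) (moll r) x" for x i by (rule conv_grad_weak[OF w hi r(1)])
    have phi: "?\<phi> \<in> test_functions D"
    proof (rule test_functionI[OF sp compact_minkowski_sum_cball[OF K]])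
      show "(\<Union>x\<in>K. cball x r) \<subseteq> D" using r1(2) r(3) by (auto simp: dist_norm)
      fix x assume x: "x \<notin> (\<Union>x\<in>K. cball x r)"
      have "\<bar>conv h (moll r) x\<bar> \<le> 0"
        unfolding conv_def
      proof (rule moll_average_le[OF r(1) conv_integrable[OF hi cm]])
        show "\<bar>h y\<bar> \<le> 0" if "dist x y < r" for y using x that h(3)[of y] by (force simp: dist_commute)
      qed
      then show "?\<phi> x = 0" by simp
    qed
    note t = test_function_L2[OF phi Ds]
    have AEr: "AE x in lebesgue_on D. P x" if "AE x in lebesgue. P x" for P using that Ds by (auto simp: AE_restrict_space_iff elim!: eventually_mono)
    have cb: "conv u (moll r) \<in> borel_measurable borel" if "integrable lborel u" for u :: "real^'d \<Rightarrow> real"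
      by (rule smooth_measurable[OF smooth_conv[OF that cm]])
    have "nrm D (\<lambda>x. ?\<phi> x - f x) < e'"
    proof (rule nrm_le_nn[OF Ds _ rh(2)[OF r(1,2)] _ _ e'])
      show "(\<lambda>x. conv h (moll r) x - h x) \<in> borel_measurable borel" by (intro borel_measurable_diff cb hi h(1))
      show "(\<lambda>x. ?\<phi> x - f x) \<in> borel_measurable (lebesgue_on D)" by (intro L2_measurable L2_diff t fL)
      show "AE x in lebesgue_on D. conv h (moll r) x - h x = ?\<phi> x - f x" using AEr[OF h(4)] by eventually_elim simp
    qed
    moreover have "e' \<le> e"
    proof -
      have "1 \<le> real CARD('d)" by (simp add: Suc_leI)
      then have "1 \<le> 2 * real CARD('d)" by linarith
      from divide_left_mono[OF this] e have "e / (2 * real CARD('d)) \<le> e / 1" by simp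
      then show ?thesis by (simp add: e'_def)
    qed
    ultimately have n1: "nrm D (\<lambda>x. ?\<phi> x - f x) < e" by linarith
    have "nrm D (\<lambda>x. (grad ?\<phi> x - g x) $ i) < e'" for i
    proof (rule nrm_le_nn[OF Ds _ rk(2)[OF r(1) r(4)[of i]] _ _ e'])
      show "(\<lambda>x. conv (k i) (moll r) x - k i x) \<in> borel_measurable borel" by (intro borel_measurable_diff cb ki k(1))
      show "(\<lambda>x. (grad ?\<phi> x - g x) $ i) \<in> borel_measurable (lebesgue_on D)" by (intro L2_measurable L2_component(1) L2_diff t gL)
      show "AE x in lebesgue_on D. conv (k i) (moll r) x - k i x = (grad ?\<phi> x - g x) $ i" using AEr[OF k(4)[of i]] by eventually_elim (simp add: gp)
    qed
    then have "(\<Sum>i\<in>UNIV. nrm D (\<lambda>x. (grad ?\<phi> x - g x) $ i)) \<le> (\<Sum>i\<in>(UNIV::'d set). e')" by (intro sum_mono less_imp_le)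
    also have "\<dots> = e / 2" by (simp add: e'_def)
    finally have n2: "nrm D (\<lambda>x. grad ?\<phi> x - g x) < e" using nrm_le_sum_components[OF L2_diff[OF t(2) gL]] e by linarith
    show "\<exists>\<phi>\<in>test_functions D. nrm D (\<lambda>x. \<phi> x - f x) < e \<and> nrm D (\<lambda>x. grad \<phi> x - g x) < e" using phi n1 n2 by blast
  qed
qed

text \<open>The identity for \<open>f\<close> is required only against products
  \<open>s \<psi>\<close>. So either \<open>f\<close> has compact support and \<open>s\<close> is
  any smooth function, or \<open>f\<close> has a weak gradient on \<open>E\<close> and
  \<open>s\<close> is a test function of \<open>E\<close>.\<close>

lemma cpt_wgrad_mult:
  fixes E :: "(real^'d) set"
  assumes E: "open E" "bounded E" and f: "f \<in> L2 E" and g: "g \<in> L2 E" and B: "B \<ge> 0"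
    and fB: "AE x in lebesgue_on E. \<bar>f x\<bar> \<le> B" and gB: "AE x in lebesgue_on E. norm (g x) \<le> B" and s: "smooth s"
    and w: "\<And>\<psi> i. smooth \<psi> \<Longrightarrow> (\<integral>x. f x * grad (\<lambda>x. s x * \<psi> x) x $ i \<partial>lebesgue_on E) = - (\<integral>x. g x $ i * (s x * \<psi> x) \<partial>lebesgue_on E)"
    and L: "compact L" "L \<subseteq> E" "\<And>x. x \<notin> L \<Longrightarrow> s x * f x = 0" "\<And>x. x \<notin> L \<Longrightarrow> s x *\<^sub>R g x + f x *\<^sub>R grad s x = 0"
  obtains B' where "cpt_wgrad E L B' (\<lambda>x. s x * f x) (\<lambda>x. s x *\<^sub>R g x + f x *\<^sub>R grad s x)"
proof -
  have Es: "E \<in> sets lebesgue" using E by auto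
  obtain S where S: "S > 0" "\<And>x. x \<in> E \<Longrightarrow> \<bar>s x\<bar> \<le> S" "\<And>x. x \<in> E \<Longrightarrow> norm (grad s x) \<le> S"
    using smooth_bounded_on[OF s E(2)] by blast
  have b1: "AE x in lebesgue_on E. \<bar>s x * f x\<bar> \<le> 2 * (S * B)" using fB AE_space
  proof eventually_elim
    case (elim x)
    then have "\<bar>s x * f x\<bar> \<le> S * B" unfolding abs_mult using S(2)[of x] by (intro mult_mono) (auto simp: B)
    moreover have "0 \<le> S * B" using S(1) B by simp
    ultimately show ?case by linarith
  qed
  have b2: "AE x in lebesgue_on E. norm (s x *\<^sub>R g x + f x *\<^sub>R grad s x) \<le> 2 * (S * B)" using fB gB AE_space
  proof eventually_elim
    case (elim x)
    have "norm (s x *\<^sub>R g x + f x *\<^sub>R grad s x) \<le> norm (s x *\<^sub>R g x) + norm (f x *\<^sub>R grad s x)" by (rule norm_triangle_ineq)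
    also have "\<dots> = \<bar>s x\<bar> * norm (g x) + \<bar>f x\<bar> * norm (grad s x)" by simp
    also have "\<dots> \<le> S * B + B * S" using elim S(2,3)[of x] S(1) B by (intro add_mono mult_mono) auto
    finally show ?case by (simp add: mult.commute[of B S])
  qed
  note ms = L2_mult_smooth[OF Es E(2)]
  have t: "(\<integral>x. s x * f x * grad \<psi> x $ i \<partial>lebesgue_on E) = - (\<integral>x. (s x *\<^sub>R g x + f x *\<^sub>R grad s x) $ i * \<psi> x \<partial>lebesgue_on E)"
    if psi: "smooth \<psi>" for \<psi> i
  proof -
    have gp: "grad (\<lambda>x. s x * \<psi> x) x = s x *\<^sub>R grad \<psi> x + \<psi> x *\<^sub>R grad s x" for x by (intro grad_mult smooth_differentiable s psi)
    note p = smooth_L2[OF psi E(2) Es]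
    have i: "integrable (lebesgue_on E) (\<lambda>x. f x * (s x * grad \<psi> x $ i))" "integrable (lebesgue_on E) (\<lambda>x. \<psi> x * (f x * grad s x $ i))"
      "integrable (lebesgue_on E) (\<lambda>x. \<psi> x * (s x * g x $ i))"
      using L2_mult(1)[OF f L2_component(1)[OF ms(1)[OF s p(2)]], of i] L2_mult(1)[OF p(1) L2_component(1)[OF ms(2)[OF s f]], of i]
        L2_mult(1)[OF p(1) L2_component(1)[OF ms(1)[OF s g]], of i] by simp_all
    have "(\<integral>x. s x * f x * grad \<psi> x $ i \<partial>lebesgue_on E) + (\<integral>x. \<psi> x * (f x * grad s x $ i) \<partial>lebesgue_on E)
       = (\<integral>x. f x * grad (\<lambda>x. s x * \<psi> x) x $ i \<partial>lebesgue_on E)"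
      using i(1,2) unfolding gp by (subst Bochner_Integration.integral_add[symmetric]) (auto simp: algebra_simps)
    moreover have "(\<integral>x. \<psi> x * (s x * g x $ i) \<partial>lebesgue_on E) + (\<integral>x. \<psi> x * (f x * grad s x $ i) \<partial>lebesgue_on E)
      = (\<integral>x. (s x *\<^sub>R g x + f x *\<^sub>R grad s x) $ i * \<psi> x \<partial>lebesgue_on E)"
      using i(3,2) by (subst Bochner_Integration.integral_add[symmetric]) (auto simp: algebra_simps)
    moreover have "(\<integral>x. g x $ i * (s x * \<psi> x) \<partial>lebesgue_on E) = (\<integral>x. \<psi> x * (s x * g x $ i) \<partial>lebesgue_on E)" by (simp add: mult_ac)
    ultimately show ?thesis using w[OF psi, of i] by linarith
  qed
  have m: "(\<lambda>x. s x * f x) \<in> borel_measurable (lebesgue_on E)" "(\<lambda>x. s x *\<^sub>R g x + f x *\<^sub>R grad s x) \<in> borel_measurable (lebesgue_on E)"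
    using L2_measurable[OF L2_add[OF ms(1)[OF s g] ms(2)[OF s f]]] L2_measurable[OF ms(1)[OF s f]] by simp_all
  show ?thesis by (rule that[of "2 * (S * B)"], unfold cpt_wgrad_def, intro conjI m b1 b2 L(1,2) allI impI t)
       (use S B L(3,4) in auto)
qed

definition winf :: "(real^'d) set \<Rightarrow> real \<Rightarrow> (real^'d \<Rightarrow> real) \<Rightarrow> (real^'d \<Rightarrow> real^'d) \<Rightarrow> bool" where
  "winf E B u g \<longleftrightarrow> wgrad E u g \<and> B \<ge> 0 \<and> (AE x in lebesgue_on E. \<bar>u x\<bar> \<le> B) \<and> (AE x in lebesgue_on E. norm (g x) \<le> B)"

lemma Linf_AE_bound:
  fixes f :: "real^'d \<Rightarrow> 'b::euclidean_space"
  assumes "f \<in> Linf D" obtains B where "B \<ge> 0" "AE x in lebesgue_on D. norm (f x) \<le> B"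
proof -
  have fin: "Linf_norm D f < \<infinity>" using assms by (simp add: Linf_def)
  have "AE x in lebesgue_on D. ennreal (norm (f x)) \<le> Linf_norm D f" unfolding Linf_norm_def by (rule esssup_AE)
  then have "AE x in lebesgue_on D. norm (f x) \<le> enn2real (Linf_norm D f)"
    by eventually_elim (use fin in \<open>cases "Linf_norm D f"; auto simp: ennreal_le_iff2\<close>)
  then show ?thesis using that[OF enn2real_nonneg] by blast
qed

lemma W1inf_winf:
  assumes E: "open E" "bounded E" and u: "u \<in> W1inf E"
  obtains B where "winf E B u (weak_grad E u)"
proof -
  have Es: "E \<in> sets lebesgue" using E by auto
  have fin: "finite_measure (lebesgue_on E)" by (intro emeasure_bounded_lebesgue E Es)
  obtain g where g: "g \<in> Linf E" "has_weak_gradient E u g" and ul: "u \<in> Linf E" using u by (auto simp: W1inf_def)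
  obtain B1 where B1: "B1 \<ge> 0" "AE x in lebesgue_on E. norm (u x) \<le> B1" by (rule Linf_AE_bound[OF ul])
  obtain B2 where B2: "B2 \<ge> 0" "AE x in lebesgue_on E. norm (g x) \<le> B2" by (rule Linf_AE_bound[OF g(1)])
  have w: "wgrad E u g" unfolding wgrad_def using L2_bounded[OF _ B1(2) fin] L2_bounded[OF _ B2(2) fin] ul g by (auto simp: Linf_def)
  have "AE x in lebesgue_on E. norm (weak_grad E u x) \<le> max B1 B2" using wgrad_weak_grad_AE[OF E(1) w] B2(2) by eventually_elim auto
  moreover have "AE x in lebesgue_on E. \<bar>u x\<bar> \<le> max B1 B2" using B1(2) by eventually_elim auto
  ultimately show ?thesis using wgrad_weak_grad[OF E(1) w] B1(1) by (intro that[of "max B1 B2"]) (auto simp: winf_def)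
qed

lemma L2_bmult_vec:
  assumes g: "g \<in> borel_measurable (lebesgue_on D)" "AE x in lebesgue_on D. norm (g x) \<le> B" "B \<ge> 0"
    and f: "f \<in> L2 D"
  shows "(\<lambda>x. f x *\<^sub>R g x) \<in> L2 D" "nrm D (\<lambda>x. f x *\<^sub>R g x) \<le> B * nrm D f"
proof -
  have m: "(\<lambda>x. f x *\<^sub>R g x) \<in> borel_measurable (lebesgue_on D)" using g L2_measurable[OF f] by measurable
  have i: "integrable (lebesgue_on D) (\<lambda>x. B\<^sup>2 * (norm (f x))\<^sup>2)" using L2_integrable[OF f] by auto
  have le: "AE x in lebesgue_on D. (norm (f x *\<^sub>R g x))\<^sup>2 \<le> B\<^sup>2 * (norm (f x))\<^sup>2" using g(2)
  proof eventually_elim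
    case (elim x)
    then show ?case using mult_right_mono[OF power_mono[OF elim, of 2], of "(f x)\<^sup>2"] by (simp add: power_mult_distrib mult.commute)
  qed
  show "(\<lambda>x. f x *\<^sub>R g x) \<in> L2 D" by (rule L2_bound(1)[OF m i le])
  have "(nrm D (\<lambda>x. f x *\<^sub>R g x))\<^sup>2 \<le> (B * nrm D f)\<^sup>2" using L2_bound(2)[OF m i le] by (simp add: nrm_sq power_mult_distrib)
  then show "nrm D (\<lambda>x. f x *\<^sub>R g x) \<le> B * nrm D f" by (rule power2_le_imp_le) (simp add: g(3))
qed

text \<open>The mollifications have gradients bounded by \<open>CARD('d) * B\<close> uniformly in
  the radius, as each component is an average of values bounded by \<open>B\<close>; and they
  converge to the continuous \<open>f\<close> at every point.\<close>

lemma cpt_wgrad_lipschitz: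
  fixes E :: "(real^'d) set"
  assumes E: "open E" "bounded E" and c: "cpt_wgrad E K B f g" and f: "continuous_on UNIV f"
  obtains L where "L > 0" "\<And>x y. \<bar>f x - f y\<bar> \<le> L * dist x y"
proof -
  note c' = c[unfolded cpt_wgrad_def]
  have Es: "E \<in> sets lebesgue" using E by auto
  have B: "B \<ge> 0" and K: "compact K" using c' by auto
  obtain h k where h: "h \<in> borel_measurable borel" "\<And>x. \<bar>h x\<bar> \<le> B" "\<And>x. x \<notin> K \<Longrightarrow> h x = 0" "AE x in lebesgue. f x = h x"
    and k: "\<And>i. k i \<in> borel_measurable borel" "\<And>i x. \<bar>k i x\<bar> \<le> B" "\<And>i x. x \<notin> K \<Longrightarrow> k i x = 0" "\<And>i. AE x in lebesgue. g x $ i = k i x"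
    and w: "\<And>\<psi> i. smooth \<psi> \<Longrightarrow> (\<integral>x. h x * grad \<psi> x $ i \<partial>lborel) = - (\<integral>x. k i x * \<psi> x \<partial>lborel)"
    by (rule cpt_wgrad_reps[OF Es c]) (rule that, assumption+)
  obtain R where R: "\<And>x. x \<in> K \<Longrightarrow> norm x \<le> R" using K unfolding compact_eq_bounded_closed bounded_iff by blast
  have h0: "h x = 0" if "norm x > R" for x using h(3) R that by force
  have k0: "k i x = 0" if "norm x > R" for x i using k(3) R that by force
  have f0: "f x = 0" if "norm x > R" for x using c' R that by force
  have hi: "integrable lborel h" by (rule bounded_support_integrable[OF h(1,2) h0])
  have ki: "integrable lborel (k i)" for i by (rule bounded_support_integrable[OF k(1,2) k0])
  have fi: "integrable lborel f" by (rule continuous_integrable[OF f f0])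
  define L where "L = real CARD('d) * B + 1"
  have L: "L > 0" using B by (simp add: L_def add_nonneg_pos)
  have moll_lip: "\<bar>conv f (moll r) x - conv f (moll r) y\<bar> \<le> L * dist x y" if r: "r > 0" for r x y
  proof -
    note cm = csmooth_moll[where 'd='d, OF r]
    have [measurable]: "moll r \<in> borel_measurable (borel :: (real^'d) measure)" using cm smooth_measurable csmooth_def by blast
    have fh: "conv f (moll r) x = conv h (moll r) x" for x
    proof -
      have "AE x in lborel. f x = h x" using h(4) by (simp add: AE_completion_iff)
      note [measurable] = h(1) borel_measurable_continuous_onI[OF f]
      show ?thesis unfolding conv_def using \<open>AE x in lborel. f x = h x\<close> by (intro integral_cong_AE) auto
    qed
    have sp: "smooth (conv h (moll r))" by (rule smooth_conv[OF hi cm])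
    have gb: "norm (grad (conv h (moll r)) x) \<le> L" for x
    proof -
      have "\<bar>conv (k i) (moll r) x\<bar> \<le> B" for i unfolding conv_def by (rule moll_average_le[OF r conv_integrable[OF ki cm] k(2)])
      then have "(\<Sum>i\<in>UNIV. \<bar>grad (conv h (moll r)) x $ i\<bar>) \<le> (\<Sum>i\<in>(UNIV::'d set). B)"
        by (intro sum_mono) (simp add: conv_grad_weak[OF w hi r])
      then show ?thesis using norm_le_l1_cart[of "grad (conv h (moll r)) x"] by (simp add: L_def)
    qed
    have "norm (conv h (moll r) x - conv h (moll r) y) \<le> L * norm (x - y)"
    proof (rule differentiable_bound[of UNIV _ "\<lambda>x h'. grad (conv h (moll r)) x \<bullet> h'"])
      show "(conv h (moll r) has_derivative (\<lambda>h'. grad (conv h (moll r)) x \<bullet> h')) (at x within UNIV)" for x using smooth_has_derivative[OF sp] by simp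
      show "onorm (\<lambda>h'. grad (conv h (moll r)) x \<bullet> h') \<le> L" for x
      proof (rule onorm_le)
        fix z show "norm (grad (conv h (moll r)) x \<bullet> z) \<le> L * norm z"
          using Cauchy_Schwarz_ineq2[of "grad (conv h (moll r)) x" z] mult_right_mono[OF gb[of x] norm_ge_zero[of z]] by simp
      qed
    qed auto
    then show ?thesis by (simp add: fh dist_norm)
  qed
  show ?thesis
  proof (rule that[OF L])
    fix x y
    show "\<bar>f x - f y\<bar> \<le> L * dist x y"
    proof (rule field_le_epsilon)
      fix e :: real assume "e > 0"
      then have e: "e / 3 > 0" by simp
      obtain d where d: "d > 0" "\<And>x y. dist x y < d \<Longrightarrow> norm (f y - f x) < e / 3" using continuous_support_uniform[OF f f0 e] by blast
      have "\<bar>conv f (moll d) z - f z\<bar> \<le> e / 3" for z by (rule moll_conv_close[OF fi d(1)]) (rule less_imp_le[OF d(2)[unfolded real_norm_def]])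
      from this[of x] this[of y] moll_lip[OF d(1), of x y] \<open>e > 0\<close>
      show "\<bar>f x - f y\<bar> \<le> L * dist x y + e" by linarith
    qed
  qed
qed

lemma cpt_wgrad_wgrad:
  fixes E :: "(real^'d) set"
  assumes E: "open E" "bounded E" and c: "cpt_wgrad E K B f g"
  shows "wgrad E f g"
proof -
  have "K \<subseteq> E" using c by (simp add: cpt_wgrad_def)
  then show ?thesis using H10w_wgrad[OF _ E(2) cpt_wgrad_H10w[OF E E(1) _ order_refl c]] E(1) by simp
qed

text \<open>Cutting \<open>f\<close> off where \<open>\<bar>f\<bar>\<close> is small loses only the gradient on \<open>{f = 0}\<close>; as the limit of the
  cut-off functions is \<open>f\<close> itself, that part of the gradient vanishes by uniqueness.\<close>

lemma cpt_wgrad_vanishing_H10w: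
  fixes E :: "(real^'d) set"
  assumes E: "open E" "bounded E" and c: "cpt_wgrad E K B f g" and f: "continuous_on UNIV f"
    and W: "open W" "W \<subseteq> E" "\<And>x. x \<notin> W \<Longrightarrow> f x = 0"
  shows "H10w W f g"
proof -
  note c' = c[unfolded cpt_wgrad_def]
  have Es: "E \<in> sets lebesgue" and Ws: "W \<in> sets lebesgue" using E W by auto
  have B: "B \<ge> 0" and K: "compact K" "K \<subseteq> E" and z: "\<And>x. x \<notin> K \<Longrightarrow> f x = 0" "\<And>x. x \<notin> K \<Longrightarrow> g x = 0" using c' by auto
  obtain L where L: "L > 0" "\<And>x y. \<bar>f x - f y\<bar> \<le> L * dist x y" using cpt_wgrad_lipschitz[OF E c f] by blast
  have bK: "bounded K" using K compact_imp_bounded by blast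
  \<comment> \<open>\<open>s\<close> is a smooth function of the point, obtained by mollifying a
    ramp in the absolute value of \<open>f\<close>. Composing a smooth profile with the values of
    \<open>f\<close> would only give a Lipschitz function.\<close>
  have ex: "\<exists>s. cutoff (L / d) s \<and> (\<forall>x. \<bar>f x\<bar> \<ge> 3 * d \<longrightarrow> s x = 1) \<and> (\<forall>x. \<bar>f x\<bar> \<le> d \<longrightarrow> s x = 0)" if d: "d > 0" for d
  proof -
    have "{x. d < \<bar>f x\<bar>} \<subseteq> K" using z(1) d by force
    then have b: "bounded {x. d < \<bar>f x\<bar>}" using bK bounded_subset by blast
    have "\<bar>\<bar>f x\<bar> - \<bar>f y\<bar>\<bar> \<le> L * dist x y" for x y using L(2)[of x y] by linarith
    then obtain s where "cutoff (2 * L / (3 * d - d)) s" "\<And>x. 3 * d \<le> \<bar>f x\<bar> \<Longrightarrow> s x = 1" "\<And>x. \<bar>f x\<bar> \<le> d \<Longrightarrow> s x = 0"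
      using lipschitz_cutoff[OF L(1) _ _ b, of "3 * d"] d by auto
    moreover have "2 * L / (3 * d - d) = L / d" by simp
    ultimately show ?thesis by metis
  qed
  define d where "d n = 1 / real (Suc n)" for n
  have d: "d n > 0" for n by (simp add: d_def)
  have d0: "d \<longlonglongrightarrow> 0" unfolding d_def using LIMSEQ_inverse_real_of_nat by (simp add: inverse_eq_divide)
  have "\<forall>n. \<exists>s. cutoff (L / d n) s \<and> (\<forall>x. \<bar>f x\<bar> \<ge> 3 * d n \<longrightarrow> s x = 1) \<and> (\<forall>x. \<bar>f x\<bar> \<le> d n \<longrightarrow> s x = 0)" using ex[OF d] by blast
  from choice[OF this] obtain s where cs: "\<And>n. cutoff (L / d n) (s n)" and s45: "\<And>n x. \<bar>f x\<bar> \<ge> 3 * d n \<Longrightarrow> s n x = 1"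
    "\<And>n x. \<bar>f x\<bar> \<le> d n \<Longrightarrow> s n x = 0" by blast
  note s = cutoffD(1-3)[OF cs] s45 cutoffD(4)[OF cs]
  have gs: "grad (s n) x = 0" if "\<bar>f x\<bar> < d n \<or> \<bar>f x\<bar> > 3 * d n" for n x
    using cutoffD(5)[OF cs[of n], of x] s45[where n = n and x = x] that by force
  let ?Kn = "\<lambda>n. {x. \<bar>f x\<bar> \<ge> d n}"
  have KnK: "?Kn n \<subseteq> K" for n
  proof
    fix x assume "x \<in> ?Kn n"
    then show "x \<in> K" using z(1)[of x] d[of n] by (cases "x \<in> K") auto
  qed
  have KnW: "?Kn n \<subseteq> W" for n
  proof
    fix x assume "x \<in> ?Kn n"
    then show "x \<in> W" using W(3)[of x] d[of n] by (cases "x \<in> W") auto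
  qed
  have Knc: "compact (?Kn n)" for n
  proof -
    have "closed (?Kn n)" by (intro closed_Collect_le continuous_intros f)
    then show ?thesis using bounded_subset[OF bK KnK[of n]] by (simp add: compact_eq_bounded_closed)
  qed
  let ?G = "\<lambda>n x. s n x *\<^sub>R g x + f x *\<^sub>R grad (s n) x"
  have Hn: "H10w W (\<lambda>x. s n x * f x) (?G n)" for n
  proof -
    have z1: "s n x * f x = 0" if "x \<notin> ?Kn n" for x using that s(5)[of x n] by simp
    have z2: "?G n x = 0" if "x \<notin> ?Kn n" for x using that s(5)[of x n] gs[of x n] by simp
    have KE: "?Kn n \<subseteq> E" using KnK K(2) by blast
    obtain B' where "cpt_wgrad E (?Kn n) B' (\<lambda>x. s n x * f x) (?G n)"
    proof (rule cpt_wgrad_mult[OF E _ _ B _ _ s(1) _ Knc KE z1 z2])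
      show "f \<in> L2 E" "g \<in> L2 E" using wgradD(1,2)[OF cpt_wgrad_wgrad[OF E c]] by auto
    qed (use c' smooth_mult[OF s(1)] in auto)
    then show ?thesis by (rule cpt_wgrad_H10w[OF E W(1) KnW W(2)])
  qed
  \<comment> \<open>The pointwise limit of \<open>?G n\<close>: where \<open>f\<close> vanishes
    every \<open>?G n\<close> is zero, and elsewhere \<open>?G n\<close> eventually equals
    \<open>g\<close>.\<close>
  define g' where "g' x = (if f x = 0 then 0 else g x)" for x
  have fm: "f \<in> borel_measurable (lebesgue_on W)" and gm: "g \<in> borel_measurable (lebesgue_on W)" using c' measurable_restrict_mono[OF _ W(2)] by blast+
  have fB: "AE x in lebesgue_on W. \<bar>f x\<bar> \<le> B" and gB: "AE x in lebesgue_on W. norm (g x) \<le> B" using c' AE_lebesgue_on_subset[OF W(2) Ws Es] by auto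
  have g'm: "g' \<in> borel_measurable (lebesgue_on W)" using fm gm unfolding g'_def[abs_def] by measurable
  have g'B: "AE x in lebesgue_on W. norm (g' x) \<le> B" using gB by eventually_elim (use B in \<open>auto simp: g'_def\<close>)
  have fin: "finite_measure (lebesgue_on W)" by (intro emeasure_bounded_lebesgue bounded_subset[OF E(2) W(2)] Ws)
  have fL: "f \<in> L2 W" by (rule L2_bounded[OF fm _ fin, of B]) (use fB in simp)
  have g'L: "g' \<in> L2 W" by (rule L2_bounded[OF g'm g'B fin])
  have HL: "(\<lambda>x. s n x * f x) \<in> L2 W" "?G n \<in> L2 W" for n using Hn[of n] by (auto simp: H10w_def)
  have ev: "\<forall>\<^sub>F n in sequentially. 3 * d n < a" if "a > 0" for a using order_tendstoD(2)[OF d0, of "a / 3"] that by (auto elim!: eventually_mono)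
  have l1: "(\<lambda>n. nrm W (\<lambda>x. s n x * f x - f x)) \<longlonglongrightarrow> 0"
  proof (rule L2_dct)
    show "(\<lambda>x. s n x * f x - f x) \<in> borel_measurable (lebesgue_on W)" for n by (intro L2_measurable L2_diff HL fL)
    show "integrable (lebesgue_on W) (\<lambda>x. (norm (f x))\<^sup>2)" by (rule L2_integrable[OF fL])
    show "AE x in lebesgue_on W. (norm (s n x * f x - f x))\<^sup>2 \<le> (norm (f x))\<^sup>2" for n
    proof (rule AE_I2)
      fix x
      have "\<bar>(s n x - 1) * f x\<bar> \<le> 1 * \<bar>f x\<bar>" unfolding abs_mult using s(2,3)[of n x] by (intro mult_right_mono) auto
      then have "\<bar>s n x * f x - f x\<bar> \<le> \<bar>f x\<bar>" by (simp add: left_diff_distrib)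
      from power_mono[OF this, of 2] show "(norm (s n x * f x - f x))\<^sup>2 \<le> (norm (f x))\<^sup>2" by simp
    qed
    show "AE x in lebesgue_on W. (\<lambda>n. s n x * f x - f x) \<longlonglongrightarrow> 0"
    proof (rule AE_I2)
      fix x
      show "(\<lambda>n. s n x * f x - f x) \<longlonglongrightarrow> 0"
      proof (cases "f x = 0")
        case False
        then have "\<forall>\<^sub>F n in sequentially. 3 * d n < \<bar>f x\<bar>" by (intro ev) simp
        then have "\<forall>\<^sub>F n in sequentially. s n x * f x - f x = 0" by eventually_elim (use s(4) in simp)
        then show ?thesis by (rule tendsto_eventually)
      qed simp
    qed
  qed
  have l2: "(\<lambda>n. nrm W (\<lambda>x. ?G n x - g' x)) \<longlonglongrightarrow> 0"
  proof (rule L2_dct)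
    show "(\<lambda>x. ?G n x - g' x) \<in> borel_measurable (lebesgue_on W)" for n by (intro L2_measurable L2_diff HL g'L)
    show "integrable (lebesgue_on W) (\<lambda>x. (2 * B + 3 * L)\<^sup>2)" using fin by (rule finite_measure.integrable_const)
    show "AE x in lebesgue_on W. (norm (?G n x - g' x))\<^sup>2 \<le> (2 * B + 3 * L)\<^sup>2" for n using gB g'B
    proof eventually_elim
      case (elim x)
      have 1: "\<bar>s n x\<bar> * norm (g x) \<le> 1 * B" using elim s(2,3)[of n x] by (intro mult_mono) auto
      \<comment> \<open>The gradient of \<open>s n\<close> grows like \<open>1 / d n\<close>, but it
        lives where the absolute value of \<open>f\<close> is at most \<open>3 * d n\<close>, so the
        product stays bounded.\<close>
      have 2: "\<bar>f x\<bar> * norm (grad (s n) x) \<le> 3 * L"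
      proof (cases "\<bar>f x\<bar> > 3 * d n")
        case True
        then show ?thesis using gs[of x n] L by simp
      next
        case False
        then have "\<bar>f x\<bar> * norm (grad (s n) x) \<le> (3 * d n) * (L / d n)" using s(6)[of n x] d[of n] by (intro mult_mono) auto
        then show ?thesis using d[of n] by simp
      qed
      have "norm (?G n x - g' x) \<le> norm (s n x *\<^sub>R g x) + norm (f x *\<^sub>R grad (s n) x) + norm (g' x)"
        using norm_triangle_ineq4[of "?G n x" "g' x"] norm_triangle_ineq[of "s n x *\<^sub>R g x" "f x *\<^sub>R grad (s n) x"] by linarith
      also have "\<dots> \<le> 2 * B + 3 * L" using 1 2 elim(2) by simp
      finally show ?case by (intro power_mono) auto
    qed
    show "AE x in lebesgue_on W. (\<lambda>n. ?G n x - g' x) \<longlonglongrightarrow> 0"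
    proof (rule AE_I2)
      fix x
      show "(\<lambda>n. ?G n x - g' x) \<longlonglongrightarrow> 0"
      proof (cases "f x = 0")
        case True
        then have "?G n x - g' x = 0" for n using s(5)[of x n] d[of n] by (simp add: g'_def)
        then show ?thesis by simp
      next
        case False
        then have "\<forall>\<^sub>F n in sequentially. 3 * d n < \<bar>f x\<bar>" by (intro ev) simp
        then have "\<forall>\<^sub>F n in sequentially. ?G n x - g' x = 0" by eventually_elim (use s(4) gs False in \<open>simp add: g'_def\<close>)
        then show ?thesis by (rule tendsto_eventually)
      qed
    qed
  qed
  have H: "H10w W f g'"
  proof (rule H10w_limit[OF fL g'L Ws])
    fix e :: real assume e: "e > 0"
    have "\<forall>\<^sub>F n in sequentially. nrm W (\<lambda>x. s n x * f x - f x) < e \<and> nrm W (\<lambda>x. ?G n x - g' x) < e"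
      using order_tendstoD(2)[OF l1 e] order_tendstoD(2)[OF l2 e] by eventually_elim simp
    then obtain n where "nrm W (\<lambda>x. s n x * f x - f x) < e" "nrm W (\<lambda>x. ?G n x - g' x) < e" by (auto simp: eventually_sequentially)
    then show "\<exists>u' h. H10w W u' h \<and> nrm W (\<lambda>x. u' x - f x) < e \<and> nrm W (\<lambda>x. h x - g' x) < e" using Hn by blast
  qed
  have "g' x = 0" if "x \<notin> W" for x using W(3)[OF that] by (simp add: g'_def)
  with W(3) have "H10w E f g'" by (intro H10w_mono[OF Es Ws W(2) H])
  then have "wgrad E f g'" by (rule H10w_wgrad[OF Es E(2)])
  then have "AE x in lebesgue_on E. g' x = g x" by (rule wgrad_unique[OF E(1) _ cpt_wgrad_wgrad[OF E c]])
  then have "AE x in lebesgue_on W. g' x = g x" by (rule AE_lebesgue_on_subset[OF W(2) Ws Es])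
  then show ?thesis by (intro H10w_AE_cong[OF Ws H]) auto
qed

text \<open>This reduces \<open>v\<close> to a test function \<open>\<phi>\<close>, for which
  \<open>u \<phi>\<close> has compact support in \<open>D\<close>. What remains is the hypothesis
  \<open>H\<close>: it follows by mollification if \<open>W = D\<close>, and by cutting off small
  values if \<open>u\<close> vanishes on \<open>D - W\<close>.\<close>

lemma H10w_winf_mult_approx:
  fixes E :: "(real^'d) set"
  assumes E: "open E" "bounded E" and D: "open D" "D \<subseteq> E" and u: "winf E B u g" and v: "H10w D v h"
    and W: "open W" "W \<subseteq> D"
    and H: "\<And>\<phi> K B'. \<phi> \<in> test_functions D \<Longrightarrow> compact K \<Longrightarrow> K \<subseteq> D \<Longrightarrow> (\<And>x. x \<notin> K \<Longrightarrow> \<phi> x = 0) \<Longrightarrow>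
      cpt_wgrad E K B' (\<lambda>x. u x * \<phi> x) (\<lambda>x. u x *\<^sub>R grad \<phi> x + \<phi> x *\<^sub>R g x) \<Longrightarrow> H10w W (\<lambda>x. u x * \<phi> x) (\<lambda>x. u x *\<^sub>R grad \<phi> x + \<phi> x *\<^sub>R g x)"
  shows "H10w W (\<lambda>x. u x * v x) (\<lambda>x. u x *\<^sub>R h x + v x *\<^sub>R g x)"
proof -
  have Es: "E \<in> sets lebesgue" and Ds: "D \<in> sets lebesgue" and Ws: "W \<in> sets lebesgue" using E D W by auto
  have WE: "W \<subseteq> E" using W D by blast
  have w: "wgrad E u g" and B: "B \<ge> 0" using u by (auto simp: winf_def)
  have uB: "AE x in lebesgue_on W. \<bar>u x\<bar> \<le> B" and gB: "AE x in lebesgue_on W. norm (g x) \<le> B"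
    using u AE_lebesgue_on_subset[OF WE Ws Es] by (auto simp: winf_def)
  have um: "u \<in> borel_measurable (lebesgue_on W)" and gm: "g \<in> borel_measurable (lebesgue_on W)"
    using L2_measurable[OF L2_subset(1)[OF WE Ws Es wgradD(1)[OF w]]] L2_measurable[OF L2_subset(1)[OF WE Ws Es wgradD(2)[OF w]]] by auto
  have vD: "v \<in> L2 D" "h \<in> L2 D" using v by (auto simp: H10w_def)
  note sub = L2_subset[OF W(2) Ws Ds]
  have vL: "v \<in> L2 W" "h \<in> L2 W" using sub(1) vD by auto
  have m1: "(\<lambda>x. u x * f x) \<in> L2 W" "nrm W (\<lambda>x. u x * f x) \<le> B * nrm W f" if "f \<in> L2 W" for f :: "real^'d \<Rightarrow> real"
    using L2_bmult[OF um uB that B] by auto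
  note m2 = L2_bmult[OF um uB _ B]
  note m3 = L2_bmult_vec[OF gm gB B]
  show ?thesis
  proof (rule H10w_limit[OF m1(1)[OF vL(1)] L2_add[OF m2(1)[OF vL(2)] m3(1)[OF vL(1)]] Ws])
    fix e :: real assume e: "e > 0"
    define e' where "e' = e / 2 * inverse (B + 1)"
    have nz: "B + 1 \<noteq> 0" using B by linarith
    have "(B + 1) * e' = e / 2" by (simp only: e'_def mult.left_commute[of "B + 1"] right_inverse[OF nz] mult_1_right)
    then have e': "e' > 0" "2 * ((B + 1) * e') = e" using e B by (simp_all add: e'_def)
    obtain \<phi> where p: "\<phi> \<in> test_functions D" "nrm D (\<lambda>x. \<phi> x - v x) < e'" "nrm D (\<lambda>x. grad \<phi> x - h x) < e'"
      using v e'(1) unfolding H10w_def by blast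
    obtain K where K: "compact K" "K \<subseteq> D" "\<And>x. x \<notin> K \<Longrightarrow> \<phi> x = 0" "\<And>x. x \<notin> K \<Longrightarrow> grad \<phi> x = 0"
      using test_functionD[OF p(1)] by metis
    have sp: "smooth \<phi>" using p(1) by (simp add: test_functions_def)
    have pE: "\<phi> \<in> test_functions E" using p(1) test_functions_mono[OF D(2)] by blast
    have KE: "K \<subseteq> E" using K D by blast
    obtain B' where "cpt_wgrad E K B' (\<lambda>x. \<phi> x * u x) (\<lambda>x. \<phi> x *\<^sub>R g x + u x *\<^sub>R grad \<phi> x)"
    proof (rule cpt_wgrad_mult[OF E wgradD(1,2)[OF w] B _ _ sp _ K(1) KE])
      show "(\<integral>x. u x * grad (\<lambda>x. \<phi> x * \<psi> x) x $ i \<partial>lebesgue_on E) = - (\<integral>x. g x $ i * (\<phi> x * \<psi> x) \<partial>lebesgue_on E)" if "smooth \<psi>" for \<psi> i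
        using wgrad_test[OF w test_function_mult[OF pE that], of i] by (simp add: mult.commute)
    qed (use u K(3,4) in \<open>auto simp: winf_def\<close>)
    then have H': "H10w W (\<lambda>x. u x * \<phi> x) (\<lambda>x. u x *\<^sub>R grad \<phi> x + \<phi> x *\<^sub>R g x)"
      using H[OF p(1) K(1-3)] by (simp add: mult.commute add.commute)
    note t = test_function_L2(1,2)[OF p(1) Ds]
    have d1: "(\<lambda>x. \<phi> x - v x) \<in> L2 W" "nrm W (\<lambda>x. \<phi> x - v x) < e'" using sub[OF L2_diff[OF t(1) vD(1)]] p(2) by auto
    have d2: "(\<lambda>x. grad \<phi> x - h x) \<in> L2 W" "nrm W (\<lambda>x. grad \<phi> x - h x) < e'" using sub[OF L2_diff[OF t(2) vD(2)]] p(3) by auto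
    have "nrm W (\<lambda>x. u x * (\<phi> x - v x)) \<le> B * nrm W (\<lambda>x. \<phi> x - v x)" by (rule m1(2)[OF d1(1)])
    also have "\<dots> \<le> (B + 1) * e'" using d1(2) B e' by (intro mult_mono) auto
    finally have n1: "nrm W (\<lambda>x. u x * (\<phi> x - v x)) < e" using e e' by linarith
    have "nrm W (\<lambda>x. u x *\<^sub>R (grad \<phi> x - h x) + (\<phi> x - v x) *\<^sub>R g x) \<le> nrm W (\<lambda>x. u x *\<^sub>R (grad \<phi> x - h x)) + nrm W (\<lambda>x. (\<phi> x - v x) *\<^sub>R g x)"
      by (intro nrm_triangle m2 m3 d1 d2)
    also have "\<dots> \<le> B * nrm W (\<lambda>x. grad \<phi> x - h x) + B * nrm W (\<lambda>x. \<phi> x - v x)" by (intro add_mono L2_bmult(2)[OF um uB _ B] m3 d1 d2)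
    also have "\<dots> \<le> B * e' + B * e'" using d1 d2 B by (intro add_mono mult_left_mono) auto
    also have "\<dots> < e" using e' by (simp add: distrib_right)
    finally have n2: "nrm W (\<lambda>x. u x *\<^sub>R (grad \<phi> x - h x) + (\<phi> x - v x) *\<^sub>R g x) < e" .
    show "\<exists>u' g'. H10w W u' g' \<and> nrm W (\<lambda>x. u' x - u x * v x) < e \<and> nrm W (\<lambda>x. g' x - (u x *\<^sub>R h x + v x *\<^sub>R g x)) < e"
      using H' n1 n2
      by (intro exI[of _ "\<lambda>x. u x * \<phi> x"] exI[of _ "\<lambda>x. u x *\<^sub>R grad \<phi> x + \<phi> x *\<^sub>R g x"]) (simp add: algebra_simps)
  qed
qed

lemma H10w_winf_mult:
  fixes E :: "(real^'d) set"
  assumes E: "open E" "bounded E" and D: "open D" "D \<subseteq> E" and u: "winf E B u g" and v: "H10w D v h"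
  shows "H10w D (\<lambda>x. u x * v x) (\<lambda>x. u x *\<^sub>R h x + v x *\<^sub>R g x)"
  by (rule H10w_winf_mult_approx[OF E D u v D(1) order_refl]) (rule cpt_wgrad_H10w[OF E D(1) _ D(2)])

lemma H10w_winf_mult_vanishing:
  fixes E :: "(real^'d) set"
  assumes E: "open E" "bounded E" and D: "open D" "D \<subseteq> E" and u: "winf E B u g" and v: "H10w D v h"
    and uc: "continuous_on E u" and W: "open W" "W \<subseteq> D" "\<And>x. x \<in> D - W \<Longrightarrow> u x = 0"
  shows "H10w W (\<lambda>x. u x * v x) (\<lambda>x. u x *\<^sub>R h x + v x *\<^sub>R g x)"
proof (rule H10w_winf_mult_approx[OF E D u v W(1,2)])
  fix \<phi> K B' assume p: "\<phi> \<in> test_functions D" and K: "compact K" "K \<subseteq> D" "\<And>x. x \<notin> K \<Longrightarrow> \<phi> x = 0"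
    and c: "cpt_wgrad E K B' (\<lambda>x. u x * \<phi> x) (\<lambda>x. u x *\<^sub>R grad \<phi> x + \<phi> x *\<^sub>R g x)"
  have sp: "smooth \<phi>" using p by (simp add: test_functions_def)
  have KE: "K \<subseteq> E" using K D by blast
  have cont: "continuous_on UNIV (\<lambda>x. u x * \<phi> x)"
  proof -
    \<comment> \<open>\<open>u\<close> may be discontinuous outside \<open>E\<close>. The product is
      continuous on each of the open sets \<open>E\<close> and \<open>- K\<close>, which cover the
      space.\<close>
    have "continuous_on E (\<lambda>x. u x * \<phi> x)" by (intro continuous_intros uc smooth_continuous sp)
    moreover have "continuous_on (- K) (\<lambda>x. u x * \<phi> x)" by (rule continuous_on_cong[THEN iffD2, OF refl _ continuous_on_const[of _ 0]]) (simp add: K(3))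
    moreover have "E \<union> - K = UNIV" using KE by blast
    moreover have "open (- K)" using K(1) compact_imp_closed by blast
    ultimately show ?thesis using continuous_on_open_Un[of E "- K"] E(1) by metis
  qed
  have "u x * \<phi> x = 0" if "x \<notin> W" for x using that W(3)[of x] K(2,3) by (cases "x \<in> D") auto
  then show "H10w W (\<lambda>x. u x * \<phi> x) (\<lambda>x. u x *\<^sub>R grad \<phi> x + \<phi> x *\<^sub>R g x)"
    using W(2) D(2) by (intro cpt_wgrad_vanishing_H10w[OF E c cont W(1)]) auto
qed

section \<open>Hausdorff measure\<close>

definition hcover :: "real \<Rightarrow> 'a::metric_space set \<Rightarrow> (nat \<Rightarrow> 'a set) set" where
  "hcover d S = {U. S \<subseteq> (\<Union>k::nat. U k) \<and> (\<forall>k. bounded (U k) \<and> diameter (U k) \<le> d)}"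

definition hcost :: "nat \<Rightarrow> 'a::metric_space set \<Rightarrow> ennreal" where
  "hcost s U = ennreal (unit_ball_vol (real s) * (diameter U / 2) ^ s)"

lemma hausdorff_pre_alt: "hausdorff_pre d s S = (INF U\<in>hcover d S. \<Sum>k. hcost s (U k))"
  by (simp add: hausdorff_pre_def hcover_def hcost_def)

lemma hcost_empty: "s \<ge> 1 \<Longrightarrow> hcost s {} = 0" by (simp add: hcost_def)

lemma hausdorff_pre_mono: "A \<subseteq> B \<Longrightarrow> hausdorff_pre d s A \<le> hausdorff_pre d s B"
  unfolding hausdorff_pre_alt by (rule INF_superset_mono) (auto simp: hcover_def)

lemma hausdorff_pre_antimono: "d \<le> d' \<Longrightarrow> hausdorff_pre d' s A \<le> hausdorff_pre d s A"
  unfolding hausdorff_pre_alt by (rule INF_superset_mono) (auto simp: hcover_def intro: order_trans)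

lemma hausdorff_pre_le_outer: "d > 0 \<Longrightarrow> hausdorff_pre d s A \<le> hausdorff_outer s A"
  unfolding hausdorff_outer_def by (rule SUP_upper) simp

lemma hausdorff_outer_mono: "A \<subseteq> B \<Longrightarrow> hausdorff_outer s A \<le> hausdorff_outer s B"
  unfolding hausdorff_outer_def by (intro SUP_mono) (auto intro: hausdorff_pre_mono)

lemma hausdorff_pre_empty:
  assumes "s \<ge> 1" "d > 0" shows "hausdorff_pre d s ({} :: 'a::metric_space set) = 0"
proof -
  have "hausdorff_pre d s ({} :: 'a set) \<le> (\<Sum>k. hcost s ((\<lambda>k. {} :: 'a set) k))"
    unfolding hausdorff_pre_alt by (rule INF_lower) (use assms in \<open>auto simp: hcover_def\<close>)
  then show ?thesis using assms by (simp add: hcost_empty)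
qed

lemma hausdorff_outer_empty: "s \<ge> 1 \<Longrightarrow> hausdorff_outer s ({} :: 'a::metric_space set) = 0"
  unfolding hausdorff_outer_def by (auto simp: hausdorff_pre_empty intro!: antisym SUP_least)

lemma hausdorff_pre_UN:
  fixes A :: "nat \<Rightarrow> 'a::metric_space set"
  shows "hausdorff_pre d s (\<Union>n. A n) \<le> (\<Sum>n. hausdorff_pre d s (A n))"
proof (cases "(\<Sum>n. hausdorff_pre d s (A n)) = \<infinity>")
  case False
  then have fin: "hausdorff_pre d s (A n) < \<infinity>" for n by (metis ennreal_suminf_lessD infinity_ennreal_def less_top)
  show ?thesis
  proof (rule ennreal_le_epsilon)
    fix e :: real assume e: "0 < e"
    have "\<forall>n. \<exists>U. U \<in> hcover d (A n) \<and> (\<Sum>k. hcost s (U k)) \<le> hausdorff_pre d s (A n) + ennreal (e * (1/2) ^ Suc n)"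
    proof
      fix n
      have "(INF U\<in>hcover d (A n). \<Sum>k. hcost s (U k)) < hausdorff_pre d s (A n) + ennreal (e * (1/2) ^ Suc n)"
        unfolding hausdorff_pre_alt[symmetric] using fin[of n] e
        by (cases "hausdorff_pre d s (A n)") (auto simp: ennreal_plus[symmetric] simp del: ennreal_plus intro!: ennreal_lessI add_nonneg_pos)
      then show "\<exists>U. U \<in> hcover d (A n) \<and> (\<Sum>k. hcost s (U k)) \<le> hausdorff_pre d s (A n) + ennreal (e * (1/2) ^ Suc n)"
        unfolding INF_less_iff by (auto intro: less_imp_le)
    qed
    from choice[OF this] obtain U where U: "\<And>n. U n \<in> hcover d (A n)"
      "\<And>n. (\<Sum>k. hcost s (U n k)) \<le> hausdorff_pre d s (A n) + ennreal (e * (1/2) ^ Suc n)" by blast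
    define V where "V j = (case prod_decode j of (n, k) \<Rightarrow> U n k)" for j
    have V: "V (prod_encode (n, k)) = U n k" for n k by (simp add: V_def)
    have "V \<in> hcover d (\<Union>n. A n)"
    proof -
      have "x \<in> (\<Union>k. V k)" if x: "x \<in> A n" for x n
      proof -
        obtain k where "x \<in> U n k" using U(1)[of n] x unfolding hcover_def by blast
        then show ?thesis using V[of n k] by blast
      qed
      moreover have "bounded (V j) \<and> diameter (V j) \<le> d" for j using U(1) by (auto simp: V_def hcover_def split: prod.split)
      ultimately show ?thesis by (auto simp: hcover_def)
    qed
    then have "hausdorff_pre d s (\<Union>n. A n) \<le> (\<Sum>j. hcost s (V j))" unfolding hausdorff_pre_alt by (rule INF_lower)
    also have "\<dots> = (\<Sum>n. \<Sum>k. hcost s (U n k))"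
    proof -
      have "hcost s (V j) = (case prod_decode j of (n, k) \<Rightarrow> hcost s (U n k))" for j by (simp add: V_def split: prod.split)
      then show ?thesis using suminf_ennreal_2dimen[of "\<lambda>n. \<Sum>k. hcost s (U n k)" "\<lambda>(n, k). hcost s (U n k)"] by simp
    qed
    also have "\<dots> \<le> (\<Sum>n. hausdorff_pre d s (A n) + ennreal (e * (1/2) ^ Suc n))" by (intro suminf_le U(2)) auto
    also have "\<dots> = (\<Sum>n. hausdorff_pre d s (A n)) + (\<Sum>n. ennreal (e * (1/2) ^ Suc n))" by (intro suminf_add[symmetric]) auto
    also have "(\<Sum>n. ennreal (e * (1/2) ^ Suc n)) = ennreal e"
    proof -
      have "(\<lambda>n. e * (1/2) ^ Suc n) sums (e * 1)" by (intro sums_mult power_half_series)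
      then show ?thesis using e by (intro sums_unique[symmetric] sums_ennreal[THEN iffD2]) auto
    qed
    finally show "hausdorff_pre d s (\<Union>n. A n) \<le> (\<Sum>n. hausdorff_pre d s (A n)) + ennreal e" .
  qed
qed simp

lemma hausdorff_outer_UN:
  fixes A :: "nat \<Rightarrow> 'a::metric_space set"
  shows "hausdorff_outer s (\<Union>n. A n) \<le> (\<Sum>n. hausdorff_outer s (A n))"
  unfolding hausdorff_outer_def[of s "\<Union>n. A n"]
proof (rule SUP_least)
  fix d :: real assume d: "d \<in> {0<..}"
  have "hausdorff_pre d s (\<Union>n. A n) \<le> (\<Sum>n. hausdorff_pre d s (A n))" by (rule hausdorff_pre_UN)
  also have "\<dots> \<le> (\<Sum>n. hausdorff_outer s (A n))" using d by (intro suminf_le hausdorff_pre_le_outer) auto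
  finally show "hausdorff_pre d s (\<Union>n. A n) \<le> (\<Sum>n. hausdorff_outer s (A n))" .
qed

lemma hausdorff_outer_Un:
  assumes "s \<ge> 1"
  shows "hausdorff_outer s (A \<union> B) \<le> hausdorff_outer s A + hausdorff_outer s (B :: 'a::metric_space set)"
proof -
  have "hausdorff_outer s (\<Union>n. binaryset A B n) \<le> (\<Sum>n. hausdorff_outer s (binaryset A B n))" by (rule hausdorff_outer_UN)
  also have "\<dots> = hausdorff_outer s A + hausdorff_outer s B" by (rule suminf_binaryset_eq) (simp add: hausdorff_outer_empty[OF assms])
  finally show ?thesis by (simp add: UN_binaryset_eq)
qed

text \<open>No set of diameter at most \<open>d\<close> meets both \<open>A\<close> and
  \<open>B\<close>, so every cover of the union splits into a cover of \<open>A\<close> and one of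
  \<open>B\<close>.\<close>

lemma hausdorff_pre_separated:
  fixes A B :: "'a::metric_space set"
  assumes s: "s \<ge> 1" and sep: "\<And>a b. a \<in> A \<Longrightarrow> b \<in> B \<Longrightarrow> d < dist a b" and d: "d \<ge> 0"
  shows "hausdorff_pre d s A + hausdorff_pre d s B \<le> hausdorff_pre d s (A \<union> B)"
  unfolding hausdorff_pre_alt[of d s "A \<union> B"]
proof (rule INF_greatest)
  fix U assume U: "U \<in> hcover d (A \<union> B)"
  \<comment> \<open>Sets that miss \<open>S\<close> are replaced by the empty set in order to keep
    the index set; the empty set has cost zero because \<open>s \<ge> 1\<close>.\<close>
  define V where "V S k = (if U k \<inter> S = {} then {} else U k)" for S k
  have cov: "V S \<in> hcover d S" if "S \<subseteq> A \<union> B" for S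
  proof -
    have "x \<in> (\<Union>k. V S k)" if x: "x \<in> S" for x
    proof -
      obtain k where "x \<in> U k" using U x \<open>S \<subseteq> A \<union> B\<close> unfolding hcover_def by blast
      then have "x \<in> V S k" using x by (auto simp: V_def)
      then show ?thesis by blast
    qed
    then show ?thesis using U d by (auto simp: hcover_def V_def)
  qed
  have "hausdorff_pre d s A + hausdorff_pre d s B \<le> (\<Sum>k. hcost s (V A k)) + (\<Sum>k. hcost s (V B k))"
    unfolding hausdorff_pre_alt using cov[of A] cov[of B] by (intro add_mono INF_lower) auto
  also have "\<dots> = (\<Sum>k. hcost s (V A k) + hcost s (V B k))" by (intro suminf_add) auto
  also have "\<dots> \<le> (\<Sum>k. hcost s (U k))"
  proof (intro suminf_le)
    fix k
    have "V A k = {} \<or> V B k = {}"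
    proof (rule ccontr)
      assume "\<not> ?thesis"
      then obtain a b where ab: "a \<in> U k" "a \<in> A" "b \<in> U k" "b \<in> B" by (auto simp: V_def split: if_splits)
      have "dist a b \<le> diameter (U k)" using U ab by (intro diameter_bounded_bound) (auto simp: hcover_def)
      also have "\<dots> \<le> d" using U by (auto simp: hcover_def)
      finally show False using sep[OF ab(2,4)] by simp
    qed
    moreover have "hcost s (V S k) \<le> hcost s (U k)" for S by (simp add: V_def hcost_empty[OF s])
    ultimately show "hcost s (V A k) + hcost s (V B k) \<le> hcost s (U k)" by (auto simp: hcost_empty[OF s])
  qed auto
  finally show "hausdorff_pre d s A + hausdorff_pre d s B \<le> (\<Sum>k. hcost s (U k))" .
qed

text \<open>The two scales \<open>d1\<close> and \<open>d2\<close> are lowered to a common one below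
  \<open>r\<close>, where the covers split; then the suprema are taken one after the other.\<close>

lemma hausdorff_outer_separated:
  fixes A B :: "'a::metric_space set"
  assumes s: "s \<ge> 1" and sep: "\<And>a b. a \<in> A \<Longrightarrow> b \<in> B \<Longrightarrow> r \<le> dist a b" and r: "r > 0"
  shows "hausdorff_outer s A + hausdorff_outer s B \<le> hausdorff_outer s (A \<union> B)"
proof -
  have 1: "hausdorff_pre d1 s A + hausdorff_pre d2 s B \<le> hausdorff_outer s (A \<union> B)" if "d1 > 0" "d2 > 0" for d1 d2
  proof -
    define d where "d = min (min d1 d2) (r / 2)"
    have d: "d > 0" "d \<le> d1" "d \<le> d2" "d < r" using that r by (auto simp: d_def)
    have "hausdorff_pre d1 s A + hausdorff_pre d2 s B \<le> hausdorff_pre d s A + hausdorff_pre d s B" by (intro add_mono hausdorff_pre_antimono d)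
    also have "\<dots> \<le> hausdorff_pre d s (A \<union> B)" using d by (intro hausdorff_pre_separated s less_le_trans[OF d(4) sep]) auto
    also have "\<dots> \<le> hausdorff_outer s (A \<union> B)" by (rule hausdorff_pre_le_outer[OF d(1)])
    finally show ?thesis .
  qed
  have 2: "hausdorff_pre d1 s A + hausdorff_outer s B \<le> hausdorff_outer s (A \<union> B)" if "d1 > 0" for d1 unfolding hausdorff_outer_def[of s B]
    using 1[OF that] by (subst ennreal_SUP_add_right) (auto intro!: SUP_least)
  show ?thesis unfolding hausdorff_outer_def[of s A] using 2 by (subst ennreal_SUP_add_left[symmetric]) (auto intro!: SUP_least)
qed

text \<open>A 1-Lipschitz function turns gaps between its values into distances between sets. The
  layers are added in the order of decreasing values of \<open>f\<close>.\<close>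

lemma hausdorff_outer_layers:
  fixes R :: "nat \<Rightarrow> 'a::metric_space set" and f :: "'a \<Rightarrow> real"
  assumes s: "s \<ge> 1" and f: "\<And>x y. \<bar>f x - f y\<bar> \<le> dist x y"
    and lo: "\<And>k x. x \<in> R k \<Longrightarrow> lo k \<le> f x" and hi: "\<And>k x. x \<in> R k \<Longrightarrow> f x \<le> hi k"
    and gap: "\<And>k m. k < m \<Longrightarrow> hi m < lo (m - 1)" and dec: "\<And>k m. k \<le> m \<Longrightarrow> lo m \<le> lo k"
  shows "(\<Sum>k<m. hausdorff_outer s (R k)) \<le> hausdorff_outer s (\<Union>k<m. R k)"
proof (induction m)
  case (Suc m)
  have "(\<Sum>k<Suc m. hausdorff_outer s (R k)) \<le> hausdorff_outer s (\<Union>k<m. R k) + hausdorff_outer s (R m)" using Suc by (simp add: add_mono)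
  also have "\<dots> \<le> hausdorff_outer s ((\<Union>k<m. R k) \<union> R m)"
  proof (cases "m = 0")
    case True
    then show ?thesis by (simp add: hausdorff_outer_empty[OF s])
  next
    case False
    show ?thesis
    proof (rule hausdorff_outer_separated[OF s, of _ _ "lo (m - 1) - hi m"])
      show "lo (m - 1) - hi m > 0" using gap[of 0 m] False by simp
      fix a b assume "a \<in> (\<Union>k<m. R k)" "b \<in> R m"
      then obtain k where k: "k < m" "a \<in> R k" by blast
      then have "k \<le> m - 1" by simp
      from dec[OF this] lo[OF k(2)] have "lo (m - 1) \<le> f a" by linarith
      then show "lo (m - 1) - hi m \<le> dist a b" using hi[OF \<open>b \<in> R m\<close>] f[of a b] by linarith
    qed
  qed
  also have "(\<Union>k<m. R k) \<union> R m = (\<Union>k<Suc m. R k)" by (auto simp: less_Suc_eq)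
  finally show ?case .
qed (simp add: hausdorff_outer_empty[OF s])

text \<open>The shells at distance about \<open>1/k\<close> from \<open>C\<close>: those of equal parity are separated, so their total
  measure is finite and the shells close to \<open>C\<close> are negligible.\<close>

lemma hausdorff_caratheodory_closed:
  fixes C X :: "'a::metric_space set"
  assumes s: "s \<ge> 1" and C: "closed C"
  shows "hausdorff_outer s (C \<inter> X) + hausdorff_outer s (X - C) \<le> hausdorff_outer s X"
proof (cases "C = {} \<or> hausdorff_outer s X = \<infinity>")
  case True
  then show ?thesis by (auto simp: hausdorff_outer_empty[OF s])
next
  case False
  let ?H = "hausdorff_outer s :: 'a set \<Rightarrow> ennreal"
  let ?f = "\<lambda>x. infdist x C"
  define A where "A n = {x \<in> X. 1 / real (Suc n) \<le> ?f x}" for n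
  define R where "R n = {x \<in> X. 1 / real (Suc (Suc n)) \<le> ?f x \<and> ?f x \<le> 1 / real (Suc n)}" for n
  have lip: "\<bar>?f x - ?f y\<bar> \<le> dist x y" for x y by (rule infdist_triangle_abs)
  have fin: "?H X < \<infinity>" using False by (simp add: less_top)
  have parity: "(\<Sum>k<m. ?H (R (2 * k + p))) \<le> ?H X" for m p
  proof -
    have "(\<Sum>k<m. ?H (R (2 * k + p))) \<le> ?H (\<Union>k<m. R (2 * k + p))"
    \<comment> \<open>Neighbouring shells share a value of the distance to \<open>C\<close>. Between
      two shells of the same parity lies a whole shell, which provides the gap.\<close>
    proof (rule hausdorff_outer_layers[OF s lip, where lo="\<lambda>k. 1 / real (2 * k + p + 2)" and hi="\<lambda>k. 1 / real (2 * k + p + 1)"])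
      show "1 / real (2 * m + p + 1) < 1 / real (2 * (m - 1) + p + 2)" if "k < m" for k m :: nat using that by (intro divide_strict_left_mono) auto
      show "1 / real (2 * m + p + 2) \<le> 1 / real (2 * k + p + 2)" if "k \<le> m" for k m :: nat using that by (intro divide_left_mono) auto
    qed (auto simp: R_def add_ac)
    also have "\<dots> \<le> ?H X" by (intro hausdorff_outer_mono) (auto simp: R_def)
    finally show ?thesis .
  qed
  have bd: "(\<Sum>k<m. ?H (R k)) \<le> 2 * ?H X" for m
  proof -
    have "(\<Sum>k<m. ?H (R k)) \<le> (\<Sum>k<2 * m. ?H (R k))" by (intro sum_mono2) auto
    also have "\<dots> = (\<Sum>k<m. ?H (R (2 * k + 0))) + (\<Sum>k<m. ?H (R (2 * k + 1)))" by (induction m) (auto simp: algebra_simps)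
    also have "\<dots> \<le> ?H X + ?H X" by (intro add_mono parity)
    finally show ?thesis by (simp add: mult_2)
  qed
  have sfin: "(\<Sum>k. ?H (R k)) < \<infinity>"
  proof -
    have "(\<Sum>k. ?H (R k)) \<le> 2 * ?H X" using bd by (intro suminf_le_const) auto
    also have "\<dots> < \<infinity>" using fin by (simp add: ennreal_mult_less_top)
    finally show ?thesis .
  qed
  define q where "q k = enn2real (?H (R k))" for k
  have q: "?H (R k) = ennreal (q k)" "q k \<ge> 0" for k
  proof -
    have "?H (R k) < \<infinity>" using ennreal_suminf_lessD[OF sfin] .
    then show "?H (R k) = ennreal (q k)" by (simp add: q_def less_top)
  qed (simp add: q_def)
  have sq: "summable q"
  proof (rule summable_suminf_not_top)
    show "(\<Sum>k. ennreal (q k)) \<noteq> top" using sfin by (simp add: q(1)[symmetric] less_top)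
  qed (rule q)
  have key: "?H (C \<inter> X) + ?H (A n) \<le> ?H X" for n
  proof -
    have "?H (C \<inter> X) + ?H (A n) \<le> ?H ((C \<inter> X) \<union> A n)"
    proof (rule hausdorff_outer_separated[OF s, of _ _ "1 / real (Suc n)"])
      fix a b assume "a \<in> C \<inter> X" "b \<in> A n"
      then show "1 / real (Suc n) \<le> dist a b" using infdist_le[of a C b] by (auto simp: A_def dist_commute)
    qed simp
    also have "\<dots> \<le> ?H X" by (intro hausdorff_outer_mono) (auto simp: A_def)
    finally show ?thesis .
  qed
  have cover: "X - C \<subseteq> A n \<union> (\<Union>k. R (k + n))" for n
  proof
    fix x assume x: "x \<in> X - C"
    then have pos: "?f x > 0" using infdist_pos_not_in_closed[OF C] False by blast
    show "x \<in> A n \<union> (\<Union>k. R (k + n))"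
    proof (cases "1 / real (Suc n) \<le> ?f x")
      case True then show ?thesis using x by (simp add: A_def)
    next
      case False
      let ?P = "\<lambda>m. 1 / real (Suc m) \<le> ?f x"
      obtain m0 where "?P m0" using reals_Archimedean[OF pos] by (auto simp: inverse_eq_divide intro: less_imp_le)
      \<comment> \<open>The least \<open>m\<close> for which \<open>1 / Suc m\<close> is at most the
        distance puts \<open>x\<close> into the shell \<open>m - 1\<close>.\<close>
      define m where "m = (LEAST m. ?P m)"
      have m: "?P m" unfolding m_def by (rule LeastI[of ?P, OF \<open>?P m0\<close>])
      have mn: "m > n"
      proof (rule ccontr)
        assume "\<not> m > n"
        then have "1 / real (Suc n) \<le> 1 / real (Suc m)" by (intro divide_left_mono) auto
        then show False using m False by linarith
      qed
      have "\<not> ?P (m - 1)" unfolding m_def by (rule not_less_Least) (use mn m_def in simp)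
      then have "x \<in> R ((m - 1 - n) + n)" using x m mn by (simp add: R_def)
      then show ?thesis by blast
    qed
  qed
  show ?thesis
  proof (rule ennreal_le_epsilon)
    fix e :: real assume e: "0 < e"
    obtain n where n: "norm (\<Sum>k. q (k + n)) < e" using suminf_exist_split[OF e sq] by blast
    have "?H (X - C) \<le> ?H (A n) + ?H (\<Union>k. R (k + n))" using order_trans[OF hausdorff_outer_mono[OF cover] hausdorff_outer_Un[OF s]] .
    also have "?H (\<Union>k. R (k + n)) \<le> (\<Sum>k. ?H (R (k + n)))" by (rule hausdorff_outer_UN)
    also have "\<dots> = ennreal (\<Sum>k. q (k + n))" unfolding q(1) using sq q(2) by (intro suminf_ennreal2) (auto simp: summable_iff_shift)
    also have "\<dots> \<le> ennreal e" using n by (intro ennreal_leI) simp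
    finally have "?H (X - C) \<le> ?H (A n) + ennreal e" by (simp add: add_left_mono)
    then have "?H (C \<inter> X) + ?H (X - C) \<le> ?H (C \<inter> X) + ?H (A n) + ennreal e" by (simp add: add.assoc add_left_mono)
    also have "\<dots> \<le> ?H X + ennreal e" by (intro add_right_mono key)
    finally show "?H (C \<inter> X) + ?H (X - C) \<le> ?H X + ennreal e" .
  qed
qed

text \<open>Caratheodory's theorem gives a measure on the sets that split every set additively.
  Closed sets do so by \<open>hausdorff_caratheodory_closed\<close>, and they generate the Borel
  sets.\<close>

lemma hausdorff_measure_space:
  assumes s: "s \<ge> 1"
  shows "measure_space UNIV (sets borel) (hausdorff_outer s :: 'a::metric_space set \<Rightarrow> ennreal)"
proof -
  let ?H = "hausdorff_outer s :: 'a set \<Rightarrow> ennreal"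
  have sp: "sigma_algebra UNIV (Pow (UNIV :: 'a set))" by (rule sigma_algebra_Pow)
  have oms: "outer_measure_space (Pow UNIV) ?H" unfolding outer_measure_space_def
  proof (intro conjI)
    show "positive (Pow UNIV) ?H" by (simp add: positive_def hausdorff_outer_empty[OF s])
    show "increasing (Pow UNIV) ?H" by (simp add: increasing_def hausdorff_outer_mono)
    show "countably_subadditive (Pow UNIV) ?H" by (auto simp: countably_subadditive_def intro!: hausdorff_outer_UN)
  qed
  let ?L = "lambda_system UNIV (Pow UNIV) ?H"
  have ms: "measure_space UNIV ?L ?H" by (rule sigma_algebra.caratheodory_lemma[OF sp oms])
  have "C \<in> ?L" if "closed C" for C
  proof -
    have "?H (C \<inter> X) + ?H ((UNIV - C) \<inter> X) = ?H X" for X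
    proof (rule antisym)
      have "(UNIV - C) \<inter> X = X - C" by blast
      then show "?H (C \<inter> X) + ?H ((UNIV - C) \<inter> X) \<le> ?H X" using hausdorff_caratheodory_closed[OF s that, of X] by simp
      have "?H ((C \<inter> X) \<union> ((UNIV - C) \<inter> X)) \<le> ?H (C \<inter> X) + ?H ((UNIV - C) \<inter> X)" by (rule hausdorff_outer_Un[OF s])
      moreover have "(C \<inter> X) \<union> ((UNIV - C) \<inter> X) = X" by blast
      ultimately show "?H X \<le> ?H (C \<inter> X) + ?H ((UNIV - C) \<inter> X)" by simp
    qed
    then show ?thesis by (simp add: lambda_system_def)
  qed
  then have "sigma_sets UNIV (Collect closed) \<subseteq> ?L" using ms by (intro sigma_algebra.sigma_sets_subset) (auto simp: measure_space_def)
  then have "sets (borel :: 'a measure) \<subseteq> ?L" by (simp add: borel_eq_closed)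
  moreover have "sigma_algebra UNIV (sets (borel :: 'a measure))" using sets.sigma_algebra_axioms[of "borel :: 'a measure"] by simp
  ultimately show ?thesis by (intro measure_down[OF ms])
qed

text \<open>\<open>measure_of\<close> assigns zero to every set unless the given set function is a
  measure. Only this verification gives content to integrals over
  \<open>surface_measure\<close>.\<close>

lemma
  assumes "CARD('d) \<ge> 2"
  shows emeasure_surface: "E \<in> sets borel \<Longrightarrow> emeasure (surface_measure :: (real^'d) measure) E = hausdorff_outer (CARD('d) - 1) E"
    and sets_surface [simp]: "sets (surface_measure :: (real^'d) measure) = sets borel"
proof -
  have s: "CARD('d) - 1 \<ge> 1" using assms by simp
  show st: "sets (surface_measure :: (real^'d) measure) = sets borel"
    unfolding surface_measure_def by (simp add: sigma_algebra.sets_measure_of_eq[OF sets.sigma_algebra_axioms[of borel, simplified]])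
  show "emeasure (surface_measure :: (real^'d) measure) E = hausdorff_outer (CARD('d) - 1) E" if "E \<in> sets borel"
  proof (rule emeasure_measure_of[OF surface_measure_def])
    show "positive (sets (surface_measure :: (real^'d) measure)) (hausdorff_outer (CARD('d) - 1))"
      "countably_additive (sets (surface_measure :: (real^'d) measure)) (hausdorff_outer (CARD('d) - 1))"
      using hausdorff_measure_space[OF s, where 'a="real^'d"] unfolding st measure_space_def by auto
  qed (use that st in auto)
qed

text \<open>A set of diameter \<open>r \<le> t\<close> that is moved along a unit vector by up to
  \<open>t\<close> is covered by at most \<open>2 * t / r\<close> balls of radius
  \<open>2 * r\<close>. The constant is the total volume of these balls divided by \<open>t\<close>
  and by the cost \<open>hcost\<close> of the set.\<close>

definition strip_const :: "'d::finite itself \<Rightarrow> real" where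
  "strip_const _ = 2 * 2 ^ CARD('d) * unit_ball_vol (real CARD('d)) * 2 ^ (CARD('d) - 1) / unit_ball_vol (real (CARD('d) - 1))"

lemma strip_const_pos: "strip_const TYPE('d::finite) > 0"
  by (simp add: strip_const_def)

text \<open>The centres lie on the line through \<open>p\<close> in direction \<open>e\<close> with
  spacing \<open>r\<close>. The radius \<open>2 * r\<close> adds the distance of a point of
  \<open>U\<close> from \<open>p\<close> and the rounding along the line.\<close>

lemma translate_cover:
  fixes U :: "(real^'d) set"
  assumes "p \<in> U" "\<And>y. y \<in> U \<Longrightarrow> dist p y \<le> r" and r: "r > 0" "r \<le> t" and e: "norm e = 1"
  obtains Z where "Z \<in> sets borel" "\<And>y a. y \<in> U \<Longrightarrow> 0 \<le> a \<Longrightarrow> a \<le> t \<Longrightarrow> y + a *\<^sub>R e \<in> Z"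
    "emeasure lborel Z \<le> ennreal (2 * t * 2 ^ CARD('d) * unit_ball_vol (real CARD('d)) * r ^ (CARD('d) - 1))"
proof -
  define J where "J = nat \<lfloor>t / r\<rfloor>"
  have Jr: "real J \<le> t / r" unfolding J_def using r by simp
  let ?b = "\<lambda>j. cball (p + (real j * r) *\<^sub>R e) (2 * r)"
  let ?Z = "\<Union>j\<le>J. ?b j"
  show ?thesis
  proof (rule that[of ?Z])
    show "?Z \<in> sets borel" by (intro sets.finite_UN) auto
    fix y :: "real^'d" and a :: real assume y: "y \<in> U" and a: "0 \<le> a" "a \<le> t"
    define j where "j = nat \<lfloor>a / r\<rfloor>"
    have aj: "real j \<le> a / r" "a / r < real j + 1" unfolding j_def using a r by auto
    have "j \<le> J" unfolding j_def J_def using a r by (intro nat_mono floor_mono divide_right_mono) auto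
    moreover have "y + a *\<^sub>R e \<in> ?b j"
    proof -
      have "\<bar>a - real j * r\<bar> \<le> r" using aj r by (simp add: field_simps)
      moreover have "dist (p + (real j * r) *\<^sub>R e) (y + a *\<^sub>R e) \<le> dist p y + \<bar>a - real j * r\<bar>"
      proof -
        have "(p + (real j * r) *\<^sub>R e) - (y + a *\<^sub>R e) = (p - y) - (a - real j * r) *\<^sub>R e" by (simp add: algebra_simps)
        then have "dist (p + (real j * r) *\<^sub>R e) (y + a *\<^sub>R e) = norm ((p - y) - (a - real j * r) *\<^sub>R e)" by (simp only: dist_norm)
        also have "\<dots> \<le> norm (p - y) + norm ((a - real j * r) *\<^sub>R e)" by (rule norm_triangle_ineq4)
        finally show ?thesis using e by (simp add: dist_norm)
      qed
      ultimately show ?thesis using assms(2)[OF y] by simp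
    qed
    ultimately show "y + a *\<^sub>R e \<in> ?Z" by blast
  next
    have r0: "0 \<le> 2 * r" using r by simp
    have "emeasure lborel ?Z \<le> (\<Sum>j\<le>J. emeasure lborel (?b j))" by (intro emeasure_subadditive_finite) auto
    also have "\<dots> = ennreal (real (J + 1) * (unit_ball_vol (real CARD('d)) * (2 * r) ^ CARD('d)))"
      using r by (simp add: emeasure_cball[OF r0] ennreal_of_nat_eq_real_of_nat ennreal_mult')
    also have "\<dots> \<le> ennreal (2 * t * 2 ^ CARD('d) * unit_ball_vol (real CARD('d)) * r ^ (CARD('d) - 1))"
    proof (rule ennreal_leI)
      \<comment> \<open>\<open>J + 1\<close> is at most \<open>t / r + 1\<close>, and
        \<open>1 \<le> t / r\<close>.\<close>
      have "real (J + 1) \<le> 2 * t / r" using Jr r by (simp add: field_simps)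
      then have "real (J + 1) * (unit_ball_vol (real CARD('d)) * (2 * r) ^ CARD('d)) \<le> 2 * t / r * (unit_ball_vol (real CARD('d)) * (2 * r) ^ CARD('d))"
        using r by (intro mult_right_mono) auto
      also have "2 * t / r * (unit_ball_vol (real CARD('d)) * (2 * r) ^ CARD('d)) = 2 * t / r * (unit_ball_vol (real CARD('d)) * (2 ^ CARD('d) * (r * r ^ (CARD('d) - 1))))"
        by (simp add: power_mult_distrib flip: power_Suc)
      also have "\<dots> = 2 * t * 2 ^ CARD('d) * unit_ball_vol (real CARD('d)) * r ^ (CARD('d) - 1)" using r by simp
      finally show "real (J + 1) * (unit_ball_vol (real CARD('d)) * (2 * r) ^ CARD('d)) \<le> 2 * t * 2 ^ CARD('d) * unit_ball_vol (real CARD('d)) * r ^ (CARD('d) - 1)" .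
    qed
    finally show "emeasure lborel ?Z \<le> ennreal (2 * t * 2 ^ CARD('d) * unit_ball_vol (real CARD('d)) * r ^ (CARD('d) - 1))" .
  qed
qed

lemma translate_cover_diameter:
  fixes U :: "(real^'d) set"
  assumes d: "CARD('d) \<ge> 2" and U: "bounded U" "diameter U \<le> t" and t: "t > 0" and e: "norm e = 1"
  obtains Z where "Z \<in> sets borel" "\<And>y a. y \<in> U \<Longrightarrow> 0 \<le> a \<Longrightarrow> a \<le> t \<Longrightarrow> y + a *\<^sub>R e \<in> Z"
    "emeasure lborel Z \<le> ennreal (strip_const TYPE('d) * t) * hcost (CARD('d) - 1) U"
proof -
  let ?V = "unit_ball_vol (real CARD('d))" and ?v = "unit_ball_vol (real (CARD('d) - 1))"
  have cost: "ennreal (strip_const TYPE('d) * t) * hcost (CARD('d) - 1) U = ennreal (2 * t * 2 ^ CARD('d) * ?V * diameter U ^ (CARD('d) - 1))"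
  proof -
    have "ennreal (strip_const TYPE('d) * t) * hcost (CARD('d) - 1) U = ennreal (strip_const TYPE('d) * t * (?v * (diameter U / 2) ^ (CARD('d) - 1)))"
      unfolding hcost_def using t strip_const_pos[where 'd='d] diameter_ge_0[OF U(1)] by (intro ennreal_mult[symmetric]) auto
    also have "strip_const TYPE('d) * t * (?v * (diameter U / 2) ^ (CARD('d) - 1)) = 2 * t * 2 ^ CARD('d) * ?V * diameter U ^ (CARD('d) - 1)"
    proof -
      define v where "v = ?v"
      have "v > 0" by (simp add: v_def)
      moreover have "strip_const TYPE('d) = 2 * 2 ^ CARD('d) * ?V * 2 ^ (CARD('d) - 1) / v" by (simp only: strip_const_def v_def)
      ultimately show ?thesis unfolding v_def[symmetric] by (simp add: power_divide)
    qed
    finally show ?thesis .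
  qed
  consider "U = {}" | p where "p \<in> U" "diameter U > 0" | p where "p \<in> U" "diameter U = 0" using diameter_ge_0[OF U(1)] by fastforce
  then show ?thesis
  proof cases
    case 1
    then show ?thesis using that[of "{}"] by simp
  next
    case 2
    have "dist p y \<le> diameter U" if "y \<in> U" for y using diameter_bounded_bound[OF U(1) 2(1) that] .
    then show ?thesis using translate_cover[OF 2(1) _ 2(2) U(2) e] that unfolding cost by metis
  next
    \<comment> \<open>A single point has cost zero, so the segment that it sweeps out must be shown
      to be a null set. Covers with arbitrarily small \<open>r\<close> do this, because in dimension
      at least two their volume tends to zero with \<open>r\<close>.\<close>
    case 3
    have Up: "U = {p}" using diameter_bounded_bound[OF U(1)] 3 by fastforce
    let ?Z = "(\<lambda>a. p + a *\<^sub>R e) ` {0..t}"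
    have cZ: "compact ?Z" by (intro compact_continuous_image continuous_intros) auto
    have Zb: "?Z \<in> sets borel" using cZ by (simp add: borel_compact)
    have Zq: "emeasure lborel ?Z \<le> 0 + ennreal q" if q: "q > 0" for q
    proof -
      define c where "c = 2 * t * 2 ^ CARD('d) * ?V"
      have c: "c > 0" using t by (simp add: c_def)
      define r where "r = min (min 1 t) (q / c)"
      have r: "r > 0" "r \<le> t" "r \<le> 1" "r \<le> q / c" using t q c by (auto simp: r_def)
      obtain Z where Z: "Z \<in> sets borel" "\<And>y a. y \<in> U \<Longrightarrow> 0 \<le> a \<Longrightarrow> a \<le> t \<Longrightarrow> y + a *\<^sub>R e \<in> Z"
        "emeasure lborel Z \<le> ennreal (2 * t * 2 ^ CARD('d) * ?V * r ^ (CARD('d) - 1))" using translate_cover[OF 3(1) _ r(1,2) e] Up r(1) by auto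
      have "?Z \<subseteq> Z" using Z(2)[OF 3(1)] by auto
      then have "emeasure lborel ?Z \<le> emeasure lborel Z" using Z(1) by (intro emeasure_mono) auto
      also have "\<dots> \<le> ennreal (c * r ^ (CARD('d) - 1))" using Z(3) by (simp add: c_def)
      also have "\<dots> \<le> ennreal q"
      proof (rule ennreal_leI)
        have "r ^ (CARD('d) - 1) \<le> r ^ 1" using r d by (intro power_decreasing) auto
        then have "c * r ^ (CARD('d) - 1) \<le> c * (q / c)" using r c by (intro mult_left_mono) auto
        then show "c * r ^ (CARD('d) - 1) \<le> q" using c by simp
      qed
      finally show ?thesis by simp
    qed
    have "emeasure lborel ?Z \<le> 0" by (rule ennreal_le_epsilon) (rule Zq)
    show ?thesis
    proof (rule that[OF Zb])
      show "y + a *\<^sub>R e \<in> ?Z" if "y \<in> U" "0 \<le> a" "a \<le> t" for y a using that Up by auto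
      show "emeasure lborel ?Z \<le> ennreal (strip_const TYPE('d) * t) * hcost (CARD('d) - 1) U" using \<open>emeasure lborel ?Z \<le> 0\<close> by simp
    qed
  qed
qed

text \<open>Covers by sets of diameter at most \<open>t\<close> suffice, so the bound holds already
  with \<open>hausdorff_pre t\<close>. Each set of such a cover is swept along \<open>e\<close>, and
  the volumes add up.\<close>

lemma strip_measure_le:
  fixes F B :: "(real^'d) set"
  assumes d: "CARD('d) \<ge> 2" and t: "t > 0" and e: "norm e = 1" and B: "B \<in> sets borel"
    and BF: "\<And>z. z \<in> B \<Longrightarrow> \<exists>y\<in>F. \<exists>a. 0 \<le> a \<and> a \<le> t \<and> z = y + a *\<^sub>R e"
  shows "emeasure lborel B \<le> ennreal (strip_const TYPE('d) * t) * hausdorff_outer (CARD('d) - 1) F"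
proof -
  let ?s = "CARD('d) - 1"
  let ?c = "strip_const TYPE('d) * t"
  have c: "?c > 0" using strip_const_pos[where 'd='d] t by simp
  have cov: "emeasure lborel B \<le> ennreal ?c * (\<Sum>k. hcost ?s (U k))" if U: "U \<in> hcover t F" for U
  proof -
    have "\<forall>k. \<exists>Z. Z \<in> sets borel \<and> (\<forall>y a. y \<in> U k \<longrightarrow> 0 \<le> a \<longrightarrow> a \<le> t \<longrightarrow> y + a *\<^sub>R e \<in> Z) \<and>
      emeasure lborel Z \<le> ennreal ?c * hcost ?s (U k)"
    proof
      fix k
      have Uk: "bounded (U k)" "diameter (U k) \<le> t" using U by (auto simp: hcover_def)
      show "\<exists>Z. Z \<in> sets borel \<and> (\<forall>y a. y \<in> U k \<longrightarrow> 0 \<le> a \<longrightarrow> a \<le> t \<longrightarrow> y + a *\<^sub>R e \<in> Z) \<and>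
        emeasure lborel Z \<le> ennreal ?c * hcost ?s (U k)" by (rule translate_cover_diameter[OF d Uk t e]) blast
    qed
    from choice[OF this] obtain Z where Z: "\<And>k. Z k \<in> sets borel" "\<And>k y a. y \<in> U k \<Longrightarrow> 0 \<le> a \<Longrightarrow> a \<le> t \<Longrightarrow> y + a *\<^sub>R e \<in> Z k"
      "\<And>k. emeasure lborel (Z k) \<le> ennreal ?c * hcost ?s (U k)" by blast
    have "B \<subseteq> (\<Union>k. Z k)"
    proof
      fix z assume "z \<in> B"
      then obtain y a where ya: "y \<in> F" "0 \<le> a" "a \<le> t" "z = y + a *\<^sub>R e" using BF by blast
      then obtain k where "y \<in> U k" using U by (auto simp: hcover_def)
      then show "z \<in> (\<Union>k. Z k)" using Z(2) ya by blast
    qed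
    then have "emeasure lborel B \<le> emeasure lborel (\<Union>k. Z k)" using Z(1) by (intro emeasure_mono) auto
    also have "\<dots> \<le> (\<Sum>k. emeasure lborel (Z k))" using Z(1) by (intro emeasure_subadditive_countably) auto
    also have "\<dots> \<le> (\<Sum>k. ennreal ?c * hcost ?s (U k))" by (intro suminf_le Z(3)) auto
    finally show ?thesis by simp
  qed
  have "ennreal (1 / ?c) * emeasure lborel B \<le> hausdorff_pre t ?s F" unfolding hausdorff_pre_alt
  proof (rule INF_greatest)
    fix U assume "U \<in> hcover t F"
    from mult_left_mono[OF cov[OF this], of "ennreal (1 / ?c)"]
    have "ennreal (1 / ?c) * emeasure lborel B \<le> (ennreal (1 / ?c) * ennreal ?c) * (\<Sum>k. hcost ?s (U k))" by (simp add: mult.assoc)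
    also have "ennreal (1 / ?c) * ennreal ?c = 1" using c strip_const_pos[where 'd='d] t by (simp add: ennreal_mult[symmetric])
    finally show "ennreal (1 / ?c) * emeasure lborel B \<le> (\<Sum>k. hcost ?s (U k))" by simp
  qed
  also have "\<dots> \<le> hausdorff_outer ?s F" by (rule hausdorff_pre_le_outer[OF t])
  finally have "ennreal ?c * (ennreal (1 / ?c) * emeasure lborel B) \<le> ennreal ?c * hausdorff_outer ?s F" by (rule mult_left_mono) simp
  moreover have "ennreal ?c * (ennreal (1 / ?c) * emeasure lborel B) = emeasure lborel B"
  proof -
    have "ennreal ?c * ennreal (1 / ?c) = 1" using c strip_const_pos[where 'd='d] t by (simp add: ennreal_mult[symmetric])
    then show ?thesis by (simp add: mult.assoc[symmetric])
  qed
  ultimately show ?thesis by simp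
qed

section \<open>Functions with vanishing trace\<close>

text \<open>Cauchy-Schwarz on a segment: the squared deviation of the derivative from its mean
  \<open>m\<close> has a nonnegative integral. The interval is half open because in
  \<open>strip_trace_estimate\<close> the end point lies on the graph and hence outside the
  strip.\<close>

lemma smooth_line_sq:
  fixes \<psi> :: "real^'d \<Rightarrow> real"
  assumes psi: "smooth \<psi>" and e: "norm e = 1" and t: "t \<ge> 0"
  shows "ennreal ((\<psi> y - \<psi> (y - t *\<^sub>R e))\<^sup>2) \<le>
    ennreal t * (\<integral>\<^sup>+s. ennreal ((norm (grad \<psi> (y - s *\<^sub>R e)))\<^sup>2) * indicator {0..<t} s \<partial>lborel)"
proof (cases "t = 0")
  case False
  then have t0: "t > 0" using t by simp
  let ?F = "\<lambda>s. \<psi> (y - s *\<^sub>R e)" and ?f = "\<lambda>s. - (grad \<psi> (y - s *\<^sub>R e) \<bullet> e)"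
  let ?n = "\<lambda>s. (norm (grad \<psi> (y - s *\<^sub>R e)))\<^sup>2"
  have der: "(?F has_real_derivative ?f s) (at s)" for s
  proof -
    have "((\<lambda>s. y - s *\<^sub>R e) has_derivative (\<lambda>h. - (h *\<^sub>R e))) (at s)" by (auto intro!: derivative_eq_intros)
    from has_derivative_compose[OF this smooth_has_derivative[OF psi]]
    show ?thesis unfolding has_field_derivative_def by (rule has_derivative_eq_rhs) auto
  qed
  have cg: "continuous_on UNIV (\<lambda>s. grad \<psi> (y - s *\<^sub>R e))"
    by (intro continuous_on_compose2[OF smooth_grad_continuous[OF psi, of UNIV]] continuous_intros) auto
  have cf: "continuous_on UNIV ?f" by (intro continuous_intros cg)
  have cn: "continuous_on UNIV ?n" by (intro continuous_intros cg)
  have isf: "isCont ?f s" and isn: "isCont ?n s" for s using cf cn by (auto simp: continuous_on_eq_continuous_at)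
  have I: "has_bochner_integral lborel (\<lambda>s. ?f s * indicator {0..t} s) (?F t - ?F 0)" by (rule has_bochner_integral_FTC_Icc_real[OF t]) (use der isf in auto)
  let ?I = "?F t - ?F 0"
  define m where "m = ?I / t"
  have i1: "integrable lborel (\<lambda>s. ?f s * indicator {0..t} s)" and v1: "(\<integral>s. ?f s * indicator {0..t} s \<partial>lborel) = ?I"
    using I by (auto simp: has_bochner_integral_iff)
  have ib: "integrable lborel (\<lambda>s. q s * indicator {0..t} s)" if "\<And>s. isCont q s" for q :: "real \<Rightarrow> real"
    using borel_integrable_atLeastAtMost[of 0 t q] that by (simp add: mult.commute)
  have i2: "integrable lborel (\<lambda>s. (?f s)\<^sup>2 * indicator {0..t} s)" by (rule ib) (intro continuous_intros isf)
  have i3: "integrable lborel (\<lambda>s. ?n s * indicator {0..t} s)" by (rule ib) (rule isn)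
  have i4: "integrable lborel (\<lambda>s. m\<^sup>2 * indicator {0..t} s)" by (rule ib) simp
  have "0 \<le> (\<integral>s. (?f s - m)\<^sup>2 * indicator {0..t} s \<partial>lborel)" by (intro integral_nonneg_AE AE_I2) simp
  also have "\<dots> = (\<integral>s. (?f s)\<^sup>2 * indicator {0..t} s - 2 * m * (?f s * indicator {0..t} s) + m\<^sup>2 * indicator {0..t} s \<partial>lborel)"
    by (intro Bochner_Integration.integral_cong refl) (simp add: power2_eq_square algebra_simps)
  also have "\<dots> = (\<integral>s. (?f s)\<^sup>2 * indicator {0..t} s \<partial>lborel) - 2 * m * (\<integral>s. ?f s * indicator {0..t} s \<partial>lborel) + (\<integral>s. m\<^sup>2 * indicator {0..t} s \<partial>lborel)"
    using i1 i2 i4 by simp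
  also note v1
  also have "(\<integral>s. m\<^sup>2 * indicator {0..t} s \<partial>lborel) = m\<^sup>2 * t" using t by simp
  finally have "2 * m * ?I - m\<^sup>2 * t \<le> (\<integral>s. (?f s)\<^sup>2 * indicator {0..t} s \<partial>lborel)" by linarith
  moreover have "2 * m * ?I - m\<^sup>2 * t = ?I\<^sup>2 / t" using t0 by (simp add: m_def power2_eq_square field_simps)
  ultimately have "?I\<^sup>2 \<le> t * (\<integral>s. (?f s)\<^sup>2 * indicator {0..t} s \<partial>lborel)" using t0 by (simp add: pos_divide_le_eq mult.commute)
  also have "\<dots> \<le> t * (\<integral>s. ?n s * indicator {0..t} s \<partial>lborel)"
  proof (intro mult_left_mono Bochner_Integration.integral_mono i2 i3 t)
    fix s
    have "\<bar>grad \<psi> (y - s *\<^sub>R e) \<bullet> e\<bar> \<le> norm (grad \<psi> (y - s *\<^sub>R e))"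
      using Cauchy_Schwarz_ineq2[of "grad \<psi> (y - s *\<^sub>R e)" e] e by simp
    from power_mono[OF this, of 2] show "(?f s)\<^sup>2 * indicator {0..t} s \<le> ?n s * indicator {0..t} s" by (intro mult_right_mono) auto
  qed
  finally have "ennreal ((\<psi> y - \<psi> (y - t *\<^sub>R e))\<^sup>2) \<le> ennreal (t * (\<integral>s. ?n s * indicator {0..t} s \<partial>lborel))"
    by (intro ennreal_leI) (simp add: power2_commute)
  also have "\<dots> = ennreal t * (\<integral>\<^sup>+s. ennreal (?n s * indicator {0..t} s) \<partial>lborel)"
    using t by (subst nn_integral_eq_integral[OF i3]) (auto simp: ennreal_mult')
  also have "(\<integral>\<^sup>+s. ennreal (?n s * indicator {0..t} s) \<partial>lborel) = (\<integral>\<^sup>+s. ennreal (?n s) * indicator {0..<t} s \<partial>lborel)"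
    by (intro nn_integral_cong_AE) (use AE_lborel_singleton[of t] in \<open>auto elim!: eventually_mono simp: indicator_def\<close>)
  finally show ?thesis .
qed simp

text \<open>The length \<open>a y\<close> of the descent may vary: a constant on the whole space
  gives the estimate for translations, and the height above a graph leads down to the graph. One
  factor \<open>t\<close> comes from Cauchy-Schwarz on the segments; the other arises when the
  integrals are exchanged, as each shift \<open>s\<close> contributes at most the full gradient
  integral.\<close>

lemma translation_estimate_strip:
  fixes \<psi> :: "real^'d \<Rightarrow> real"
  assumes psi: "smooth \<psi>" and e: "norm e = 1" and t: "t \<ge> 0" and T: "T \<in> sets borel"
    and a: "\<And>y. y \<in> T \<Longrightarrow> 0 \<le> a y \<and> a y \<le> t" "\<And>y s. y \<in> T \<Longrightarrow> 0 \<le> s \<Longrightarrow> s < a y \<Longrightarrow> y - s *\<^sub>R e \<in> T"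
  shows "(\<integral>\<^sup>+y. ennreal ((\<psi> y - \<psi> (y - a y *\<^sub>R e))\<^sup>2) * indicator T y \<partial>lborel)
    \<le> ennreal (t\<^sup>2) * (\<integral>\<^sup>+y. ennreal ((norm (grad \<psi> y))\<^sup>2) * indicator T y \<partial>lborel)"
proof -
  note [measurable] = smooth_measurable[OF psi] smooth_grad_measurable[OF psi] T
  let ?N = "\<lambda>y. ennreal ((norm (grad \<psi> y))\<^sup>2) * indicator T y"
  have "(\<integral>\<^sup>+y. ennreal ((\<psi> y - \<psi> (y - a y *\<^sub>R e))\<^sup>2) * indicator T y \<partial>lborel)
    \<le> (\<integral>\<^sup>+y. ennreal t * (\<integral>\<^sup>+s. ?N (y - s *\<^sub>R e) * indicator {0..<t} s \<partial>lborel) \<partial>lborel)"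
  proof (rule nn_integral_mono)
    fix y
    show "ennreal ((\<psi> y - \<psi> (y - a y *\<^sub>R e))\<^sup>2) * indicator T y \<le> ennreal t * (\<integral>\<^sup>+s. ?N (y - s *\<^sub>R e) * indicator {0..<t} s \<partial>lborel)"
    proof (cases "y \<in> T")
      case True
      have "ennreal ((\<psi> y - \<psi> (y - a y *\<^sub>R e))\<^sup>2) \<le> ennreal (a y) * (\<integral>\<^sup>+s. ennreal ((norm (grad \<psi> (y - s *\<^sub>R e)))\<^sup>2) * indicator {0..<a y} s \<partial>lborel)"
        by (rule smooth_line_sq[OF psi e]) (use a(1)[OF True] in simp)
      also have "\<dots> \<le> ennreal t * (\<integral>\<^sup>+s. ?N (y - s *\<^sub>R e) * indicator {0..<t} s \<partial>lborel)"
      proof (rule mult_mono[OF _ nn_integral_mono])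
        show "ennreal (a y) \<le> ennreal t" using a(1)[OF True] by (intro ennreal_leI) simp
        fix s
        show "ennreal ((norm (grad \<psi> (y - s *\<^sub>R e)))\<^sup>2) * indicator {0..<a y} s \<le> ?N (y - s *\<^sub>R e) * indicator {0..<t} s"
        proof (cases "0 \<le> s \<and> s < a y")
          case s: True
          then have "y - s *\<^sub>R e \<in> T" "s < t" using a[OF True] by auto
          then show ?thesis using s by simp
        qed (auto simp: indicator_def)
      qed auto
      finally show ?thesis using True by simp
    qed simp
  qed
  also have "\<dots> = ennreal t * (\<integral>\<^sup>+y. (\<integral>\<^sup>+s. ?N (y - s *\<^sub>R e) * indicator {0..<t} s \<partial>lborel) \<partial>lborel)"
    by (rule nn_integral_cmult) measurable
  also have "(\<integral>\<^sup>+y. (\<integral>\<^sup>+s. ?N (y - s *\<^sub>R e) * indicator {0..<t} s \<partial>lborel) \<partial>lborel)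
    = (\<integral>\<^sup>+s. (\<integral>\<^sup>+y. ?N (y - s *\<^sub>R e) * indicator {0..<t} s \<partial>lborel) \<partial>lborel)"
    by (rule lborel_pair.Fubini'[symmetric]) measurable
  also have "\<dots> = (\<integral>\<^sup>+s. (\<integral>\<^sup>+y. ?N y \<partial>lborel) * indicator {0..<t} s \<partial>lborel)"
  proof (rule nn_integral_cong)
    fix s :: real
    have "(\<integral>\<^sup>+y. ?N (y - s *\<^sub>R e) * indicator {0..<t} s \<partial>lborel) = (\<integral>\<^sup>+y. ?N (y - s *\<^sub>R e) \<partial>lborel) * indicator {0..<t} s"
      by (rule nn_integral_multc) measurable
    also have "(\<integral>\<^sup>+y. ?N (y - s *\<^sub>R e) \<partial>lborel) = (\<integral>\<^sup>+y. ?N y \<partial>lborel)"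
      using lborel_nn_integral_affine[of ?N 1 "- (s *\<^sub>R e)"] by simp
    finally show "(\<integral>\<^sup>+y. ?N (y - s *\<^sub>R e) * indicator {0..<t} s \<partial>lborel) = (\<integral>\<^sup>+y. ?N y \<partial>lborel) * indicator {0..<t} s" .
  qed
  also have "\<dots> = (\<integral>\<^sup>+y. ?N y \<partial>lborel) * ennreal t" using t by (simp add: nn_integral_cmult_indicator)
  also have "ennreal t * ((\<integral>\<^sup>+y. ?N y \<partial>lborel) * ennreal t) = ennreal (t\<^sup>2) * (\<integral>\<^sup>+y. ?N y \<partial>lborel)"
    using t by (simp add: power2_eq_square ennreal_mult mult_ac)
  finally show ?thesis .
qed

lemma translation_estimate:
  fixes \<psi> :: "real^'d \<Rightarrow> real"
  assumes psi: "smooth \<psi>"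
  shows "(\<integral>\<^sup>+y. ennreal ((\<psi> y - \<psi> (y - z))\<^sup>2) \<partial>lborel) \<le> ennreal ((norm z)\<^sup>2) * (\<integral>\<^sup>+y. ennreal ((norm (grad \<psi> y))\<^sup>2) \<partial>lborel)"
proof (cases "z = 0")
  case False
  then show ?thesis using translation_estimate_strip[OF psi, of "z /\<^sub>R norm z" "norm z" UNIV "\<lambda>_. norm z"] by simp
qed simp

text \<open>The Lipschitz graph is the zero set of \<open>G\<close>.\<close>

definition graph_height :: "real^'d \<Rightarrow> real \<Rightarrow> (real^'d \<Rightarrow> real) \<Rightarrow> bool" where
  "graph_height e L G \<longleftrightarrow> norm e = 1 \<and> L > 0 \<and> (\<forall>y t. G (y + t *\<^sub>R e) = G y + t) \<and>
     (\<forall>x y. \<bar>G x - G y\<bar> \<le> L * dist x y)"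

lemma graph_height_continuous: "graph_height e L G \<Longrightarrow> continuous_on S G"
proof -
  assume "graph_height e L G"
  then have "L-lipschitz_on S G" by (auto simp: graph_height_def lipschitz_on_def dist_real_def)
  then show ?thesis by (rule lipschitz_on_continuous_on)
qed

text \<open>\<open>\<psi>\<close> is compared with its value at the foot point \<open>base y\<close>
  on the graph. The foot point map carries the volume of the strip to a measure on the graph that is
  dominated by a multiple of \<open>t\<close> times the surface measure. For sets this is
  \<open>strip_measure_le\<close>; the comparison of measures extends it to integrals.\<close>

lemma strip_trace_estimate:
  fixes \<psi> :: "real^'d \<Rightarrow> real"
  assumes d: "CARD('d) \<ge> 2" and G: "graph_height e L G" and t: "t > 0" and psi: "smooth \<psi>"
  shows "(\<integral>\<^sup>+y. ennreal ((\<psi> y)\<^sup>2) * indicator {y. 0 < G y \<and> G y < t} y \<partial>lborel) \<le>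
     2 * (ennreal (strip_const TYPE('d) * t) * (\<integral>\<^sup>+y. ennreal ((\<psi> y)\<^sup>2) * indicator {y. G y = 0} y \<partial>surface_measure)) +
     2 * (ennreal (t\<^sup>2) * (\<integral>\<^sup>+y. ennreal ((norm (grad \<psi> y))\<^sup>2) * indicator {y. 0 < G y \<and> G y < t} y \<partial>lborel))"
proof -
  let ?T = "{y. 0 < G y \<and> G y < t}" and ?F = "{y. G y = 0}"
  have e: "norm e = 1" and Ge: "\<And>y a. G (y + a *\<^sub>R e) = G y + a" using G by (auto simp: graph_height_def)
  have Ge': "G (y - a *\<^sub>R e) = G y - a" for y a using Ge[of y "- a"] by simp
  have Gm [measurable]: "G \<in> borel_measurable borel" by (rule borel_measurable_continuous_onI[OF graph_height_continuous[OF G]])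
  note [measurable] = smooth_measurable[OF psi] smooth_grad_measurable[OF psi]
  have T: "?T \<in> sets borel" and F: "?F \<in> sets borel" by measurable
  let ?c = "ennreal (strip_const TYPE('d) * t)"
  define base where "base y = y - G y *\<^sub>R e" for y
  have bm [measurable]: "base \<in> borel_measurable borel" unfolding base_def[abs_def] by measurable
  let ?N = "distr (density lborel (indicator ?T)) borel base"
  let ?M = "density surface_measure (\<lambda>y. ?c * indicator ?F y)"
  have ss [measurable_cong, simp]: "sets (surface_measure :: (real^'d) measure) = sets borel" by (rule sets_surface[OF d])
  have le: "?N \<le> ?M"
  proof (subst le_measure)
    show "sets ?N = sets ?M" by simp
    show "\<forall>E\<in>sets ?N. emeasure ?N E \<le> emeasure ?M E"
    proof
      fix E assume "E \<in> sets ?N"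
      then have E [measurable]: "E \<in> sets borel" by simp
      have B: "?T \<inter> base -` E \<in> sets borel" using measurable_sets_borel[OF bm E] T by blast
      have "emeasure ?N E = emeasure (density lborel (indicator ?T)) (base -` E)" by (subst emeasure_distr) auto
      also have "\<dots> = emeasure lborel (?T \<inter> base -` E)"
      proof (subst emeasure_density)
        show "(\<integral>\<^sup>+x. indicator ?T x * indicator (base -` E) x \<partial>lborel) = emeasure lborel (?T \<inter> base -` E)"
          using B by (simp add: indicator_inter_arith[symmetric])
      qed (use T measurable_sets_borel[OF bm E] in auto)
      also have "\<dots> \<le> ?c * hausdorff_outer (CARD('d) - 1) (E \<inter> ?F)"
      proof (rule strip_measure_le[OF d t e B])
        fix z assume "z \<in> ?T \<inter> base -` E"
        then show "\<exists>y\<in>E \<inter> ?F. \<exists>a. 0 \<le> a \<and> a \<le> t \<and> z = y + a *\<^sub>R e"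
          by (intro bexI[of _ "base z"] exI[of _ "G z"]) (auto simp: base_def Ge')
      qed
      also have "\<dots> = ?c * emeasure surface_measure (E \<inter> ?F)" using E F by (subst emeasure_surface[OF d]) auto
      also have "\<dots> = emeasure ?M E"
      proof -
        have "emeasure ?M E = (\<integral>\<^sup>+x. ?c * indicator ?F x * indicator E x \<partial>surface_measure)" using E F by (subst emeasure_density) auto
        also have "\<dots> = (\<integral>\<^sup>+x. ?c * indicator (E \<inter> ?F) x \<partial>surface_measure)" by (intro nn_integral_cong) (auto simp: indicator_def)
        also have "\<dots> = ?c * emeasure surface_measure (E \<inter> ?F)" using E F by (subst nn_integral_cmult_indicator) auto
        finally show ?thesis by simp
      qed
      finally show "emeasure ?N E \<le> emeasure ?M E" .
    qed
  qed
  have B: "(\<integral>\<^sup>+y. ennreal ((\<psi> (base y))\<^sup>2) * indicator ?T y \<partial>lborel) \<le> ?c * (\<integral>\<^sup>+y. ennreal ((\<psi> y)\<^sup>2) * indicator ?F y \<partial>surface_measure)"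
  proof -
    have "(\<integral>\<^sup>+y. ennreal ((\<psi> (base y))\<^sup>2) * indicator ?T y \<partial>lborel) = (\<integral>\<^sup>+y. ennreal ((\<psi> (base y))\<^sup>2) \<partial>density lborel (indicator ?T))"
      using T by (subst nn_integral_density) (auto simp: mult.commute)
    also have "\<dots> = (\<integral>\<^sup>+y. ennreal ((\<psi> y)\<^sup>2) \<partial>?N)" by (subst nn_integral_distr) auto
    also have "\<dots> \<le> (\<integral>\<^sup>+y. ennreal ((\<psi> y)\<^sup>2) \<partial>?M)" by (rule nn_integral_mono_measure[OF _ le]) simp
    also have "\<dots> = (\<integral>\<^sup>+y. (?c * indicator ?F y) * ennreal ((\<psi> y)\<^sup>2) \<partial>surface_measure)"
      using F by (subst nn_integral_density) auto
    also have "\<dots> = ?c * (\<integral>\<^sup>+y. ennreal ((\<psi> y)\<^sup>2) * indicator ?F y \<partial>surface_measure)"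
      using F by (subst nn_integral_cmult[symmetric]) (auto simp: mult_ac)
    finally show ?thesis .
  qed
  have A: "(\<integral>\<^sup>+y. ennreal ((\<psi> y - \<psi> (base y))\<^sup>2) * indicator ?T y \<partial>lborel)
    \<le> ennreal (t\<^sup>2) * (\<integral>\<^sup>+y. ennreal ((norm (grad \<psi> y))\<^sup>2) * indicator ?T y \<partial>lborel)" unfolding base_def
    by (rule translation_estimate_strip[OF psi e less_imp_le[OF t] T]) (auto simp: Ge')
  have "(\<integral>\<^sup>+y. ennreal ((\<psi> y)\<^sup>2) * indicator ?T y \<partial>lborel) \<le>
    (\<integral>\<^sup>+y. 2 * (ennreal ((\<psi> (base y))\<^sup>2) * indicator ?T y) + 2 * (ennreal ((\<psi> y - \<psi> (base y))\<^sup>2) * indicator ?T y) \<partial>lborel)"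
  proof (rule nn_integral_mono)
    fix y
    have "(\<psi> y)\<^sup>2 \<le> 2 * (\<psi> (base y))\<^sup>2 + 2 * (\<psi> y - \<psi> (base y))\<^sup>2"
      using zero_le_power2[of "2 * \<psi> (base y) - \<psi> y"] by (simp add: power2_eq_square algebra_simps)
    then have "ennreal ((\<psi> y)\<^sup>2) \<le> ennreal (2 * (\<psi> (base y))\<^sup>2 + 2 * (\<psi> y - \<psi> (base y))\<^sup>2)" by (rule ennreal_leI)
    also have "\<dots> = 2 * ennreal ((\<psi> (base y))\<^sup>2) + 2 * ennreal ((\<psi> y - \<psi> (base y))\<^sup>2)" by (simp add: ennreal_mult'')
    finally show "ennreal ((\<psi> y)\<^sup>2) * indicator ?T y \<le> 2 * (ennreal ((\<psi> (base y))\<^sup>2) * indicator ?T y) + 2 * (ennreal ((\<psi> y - \<psi> (base y))\<^sup>2) * indicator ?T y)"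
      by (auto simp: indicator_def)
  qed
  also have "\<dots> = 2 * (\<integral>\<^sup>+y. ennreal ((\<psi> (base y))\<^sup>2) * indicator ?T y \<partial>lborel) + 2 * (\<integral>\<^sup>+y. ennreal ((\<psi> y - \<psi> (base y))\<^sup>2) * indicator ?T y \<partial>lborel)"
  proof -
    have m: "(\<lambda>y. ennreal ((\<psi> (base y))\<^sup>2) * indicator ?T y) \<in> borel_measurable lborel"
      "(\<lambda>y. ennreal ((\<psi> y - \<psi> (base y))\<^sup>2) * indicator ?T y) \<in> borel_measurable lborel" by measurable
    show ?thesis by (subst nn_integral_add) (use m in \<open>auto simp: nn_integral_cmult\<close>)
  qed
  also have "\<dots> \<le> 2 * (?c * (\<integral>\<^sup>+y. ennreal ((\<psi> y)\<^sup>2) * indicator ?F y \<partial>surface_measure)) +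
     2 * (ennreal (t\<^sup>2) * (\<integral>\<^sup>+y. ennreal ((norm (grad \<psi> y))\<^sup>2) * indicator ?T y \<partial>lborel))"
    by (intro add_mono mult_left_mono A B) auto
  finally show ?thesis .
qed

lemma nrm_le_subset:
  fixes f :: "real^'d \<Rightarrow> 'b::euclidean_space" and f' :: "real^'d \<Rightarrow> 'c::euclidean_space"
  assumes D: "D' \<subseteq> D" "D' \<in> sets lebesgue" "D \<in> sets lebesgue" and f: "f' \<in> L2 D'"
    and le: "\<And>x. x \<in> D' \<Longrightarrow> norm (f x) \<le> norm (f' x)" and z: "\<And>x. x \<in> D \<Longrightarrow> x \<notin> D' \<Longrightarrow> f x = 0"
  shows "nrm D f \<le> nrm D' f'"
proof -
  have "(\<integral>x. (norm (f x))\<^sup>2 \<partial>lebesgue_on D) = (\<integral>x. (if x \<in> D' then (norm (f x))\<^sup>2 else 0) \<partial>lebesgue_on D)"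
    using z by (intro Bochner_Integration.integral_cong refl) auto
  also have "\<dots> = (\<integral>x. (norm (f x))\<^sup>2 \<partial>lebesgue_on D')" by (rule Lebesgue_Measure.integral_restrict[OF D])
  also have "\<dots> \<le> (\<integral>x. (norm (f' x))\<^sup>2 \<partial>lebesgue_on D')"
    using L2_integrable[OF f] le by (intro integral_mono_AE' AE_I2) (auto intro!: power_mono)
  finally show ?thesis by (simp add: nrm_def)
qed

lemma nrm_sq_nn:
  fixes f :: "real^'d \<Rightarrow> 'b::euclidean_space"
  assumes D: "D \<in> sets borel" "bounded D" and f: "continuous_on UNIV f"
  shows "ennreal ((nrm D f)\<^sup>2) = (\<integral>\<^sup>+x. ennreal ((norm (f x))\<^sup>2) * indicator D x \<partial>lborel)"
proof -
  have Ds: "D \<in> sets lebesgue" using D(1) by auto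
  have fL: "f \<in> L2 D" by (rule continuous_L2[OF f D(2) Ds])
  note [measurable] = borel_measurable_continuous_onI[OF f] D(1)
  have "ennreal ((nrm D f)\<^sup>2) = (\<integral>\<^sup>+x. ennreal ((norm (f x))\<^sup>2) \<partial>lebesgue_on D)"
    unfolding nrm_sq by (intro nn_integral_eq_integral[symmetric] L2_integrable fL) simp
  also have "\<dots> = (\<integral>\<^sup>+x. ennreal ((norm (f x))\<^sup>2) * indicator D x \<partial>lebesgue)" using Ds by (simp add: nn_integral_restrict_space)
  also have "\<dots> = (\<integral>\<^sup>+x. ennreal ((norm (f x))\<^sup>2) * indicator D x \<partial>lborel)" by (simp add: nn_integral_completion)
  finally show ?thesis .
qed

lemma nrm_tendsto:
  assumes "\<And>k. f k \<in> L2 D" "g \<in> L2 D" "(\<lambda>k. nrm D (\<lambda>x. f k x - g x)) \<longlonglongrightarrow> 0"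
  shows "(\<lambda>k. nrm D (f k)) \<longlonglongrightarrow> nrm D g"
proof -
  have "\<bar>nrm D (f k) - nrm D g\<bar> \<le> nrm D (\<lambda>x. f k x - g x)" for k
    using nrm_le_add[OF assms(1)[of k] assms(2)] nrm_le_add[OF assms(2) assms(1)[of k]] nrm_minus_commute[of D "f k" g] by linarith
  then have "(\<lambda>k. nrm D (f k) - nrm D g) \<longlonglongrightarrow> 0"
    by (intro tendsto_rabs_zero_cancel[OF tendsto_sandwich[OF _ _ tendsto_const assms(3)]] always_eventually) auto
  then show ?thesis by (simp add: LIM_zero_iff)
qed

lemma smooth_mult_converge:
  fixes D :: "(real^'d) set"
  assumes D: "D \<in> sets lebesgue" "bounded D" and s: "smooth s" and u: "u \<in> L2 D" "g \<in> L2 D"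
    and phi: "\<And>k::nat. smooth (\<phi> k)" and lim: "(\<lambda>k. nrm D (\<lambda>x. \<phi> k x - u x)) \<longlonglongrightarrow> 0" "(\<lambda>k. nrm D (\<lambda>x. grad (\<phi> k) x - g x)) \<longlonglongrightarrow> 0"
  shows "(\<lambda>k. nrm D (\<lambda>x. s x * \<phi> k x - s x * u x)) \<longlonglongrightarrow> 0"
    "(\<lambda>k. nrm D (\<lambda>x. grad (\<lambda>x. s x * \<phi> k x) x - (s x *\<^sub>R g x + u x *\<^sub>R grad s x))) \<longlonglongrightarrow> 0"
proof -
  obtain B where B: "B > 0" "\<And>x. x \<in> D \<Longrightarrow> \<bar>s x\<bar> \<le> B" "\<And>x. x \<in> D \<Longrightarrow> norm (grad s x) \<le> B"
    using smooth_bounded_on[OF s D(2)] by blast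
  have m: "s \<in> borel_measurable (lebesgue_on D)" "grad s \<in> borel_measurable (lebesgue_on D)"
    by (intro continuous_imp_measurable_on_sets_lebesgue smooth_continuous smooth_grad_continuous s D)+
  have ae: "AE x in lebesgue_on D. \<bar>s x\<bar> \<le> B" "AE x in lebesgue_on D. norm (grad s x) \<le> B" using B by (auto intro!: AE_I2)
  have B0: "B \<ge> 0" using B by simp
  have p: "\<phi> k \<in> L2 D" "grad (\<phi> k) \<in> L2 D" for k using smooth_L2[OF phi D(2,1)] by auto
  have d1: "(\<lambda>x. \<phi> k x - u x) \<in> L2 D" and d2: "(\<lambda>x. grad (\<phi> k) x - g x) \<in> L2 D" for k by (intro L2_diff p u)+
  have gk: "grad (\<lambda>x. s x * \<phi> k x) x = s x *\<^sub>R grad (\<phi> k) x + \<phi> k x *\<^sub>R grad s x" for k x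
    by (intro grad_mult smooth_differentiable s phi)
  have z: "(\<lambda>k. B * nrm D (\<lambda>x. \<phi> k x - u x)) \<longlonglongrightarrow> 0" "(\<lambda>k. B * nrm D (\<lambda>x. grad (\<phi> k) x - g x) + B * nrm D (\<lambda>x. \<phi> k x - u x)) \<longlonglongrightarrow> 0"
    using tendsto_mult_left[OF lim(1), of B] tendsto_add[OF tendsto_mult_left[OF lim(2), of B] tendsto_mult_left[OF lim(1), of B]] by auto
  show "(\<lambda>k. nrm D (\<lambda>x. s x * \<phi> k x - s x * u x)) \<longlonglongrightarrow> 0"
  proof (rule tendsto_sandwich[OF _ _ tendsto_const z(1)])
    show "\<forall>\<^sub>F k in sequentially. nrm D (\<lambda>x. s x * \<phi> k x - s x * u x) \<le> B * nrm D (\<lambda>x. \<phi> k x - u x)"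
      using L2_bmult(2)[OF m(1) ae(1) d1 B0] by (intro always_eventually allI) (simp add: right_diff_distrib)
  qed simp
  show "(\<lambda>k. nrm D (\<lambda>x. grad (\<lambda>x. s x * \<phi> k x) x - (s x *\<^sub>R g x + u x *\<^sub>R grad s x))) \<longlonglongrightarrow> 0"
  proof (rule tendsto_sandwich[OF _ _ tendsto_const z(2)])
    show "\<forall>\<^sub>F k in sequentially. nrm D (\<lambda>x. grad (\<lambda>x. s x * \<phi> k x) x - (s x *\<^sub>R g x + u x *\<^sub>R grad s x))
      \<le> B * nrm D (\<lambda>x. grad (\<phi> k) x - g x) + B * nrm D (\<lambda>x. \<phi> k x - u x)"
    proof (intro always_eventually allI)
      fix k
      have "grad (\<lambda>x. s x * \<phi> k x) x - (s x *\<^sub>R g x + u x *\<^sub>R grad s x) = s x *\<^sub>R (grad (\<phi> k) x - g x) + (\<phi> k x - u x) *\<^sub>R grad s x" for x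
        by (simp add: gk algebra_simps)
      then have "nrm D (\<lambda>x. grad (\<lambda>x. s x * \<phi> k x) x - (s x *\<^sub>R g x + u x *\<^sub>R grad s x))
        \<le> nrm D (\<lambda>x. s x *\<^sub>R (grad (\<phi> k) x - g x)) + nrm D (\<lambda>x. (\<phi> k x - u x) *\<^sub>R grad s x)"
        using nrm_triangle[OF L2_bmult(1)[OF m(1) ae(1) d2 B0] L2_bmult_vec(1)[OF m(2) ae(2) B0 d1], of k k] by simp
      also have "\<dots> \<le> B * nrm D (\<lambda>x. grad (\<phi> k) x - g x) + B * nrm D (\<lambda>x. \<phi> k x - u x)"
        by (intro add_mono L2_bmult(2)[OF m(1) ae(1) d2 B0] L2_bmult_vec(2)[OF m(2) ae(2) B0 d1])
      finally show "nrm D (\<lambda>x. grad (\<lambda>x. s x * \<phi> k x) x - (s x *\<^sub>R g x + u x *\<^sub>R grad s x))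
        \<le> B * nrm D (\<lambda>x. grad (\<phi> k) x - g x) + B * nrm D (\<lambda>x. \<phi> k x - u x)" .
    qed
  qed simp
qed

lemma H10w_seq_limit:
  assumes D: "D \<in> sets lebesgue" and u: "u \<in> L2 D" "g \<in> L2 D" and H: "\<And>k::nat. H10w D (f k) (h k)"
    and lim: "(\<lambda>k. nrm D (\<lambda>x. f k x - u x)) \<longlonglongrightarrow> 0" "(\<lambda>k. nrm D (\<lambda>x. h k x - g x)) \<longlonglongrightarrow> 0"
  shows "H10w D u g"
proof (rule H10w_limit[OF u D])
  fix e :: real assume e: "e > 0"
  have "\<forall>\<^sub>F k in sequentially. nrm D (\<lambda>x. f k x - u x) < e \<and> nrm D (\<lambda>x. h k x - g x) < e"
    using order_tendstoD(2)[OF lim(1) e] order_tendstoD(2)[OF lim(2) e] by eventually_elim simp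
  then obtain k where "nrm D (\<lambda>x. f k x - u x) < e" "nrm D (\<lambda>x. h k x - g x) < e" by (auto simp: eventually_sequentially)
  then show "\<exists>u' g'. H10w D u' g' \<and> nrm D (\<lambda>x. u' x - u x) < e \<and> nrm D (\<lambda>x. g' x - g x) < e" using H by blast
qed

text \<open>For fixed \<open>t\<close> the surface term disappears as the smooth functions converge,
  and on the strip of height \<open>t\<close> the norm of \<open>v = s u\<close> is at most
  \<open>2 * t\<close> times that of its gradient \<open>h\<close>. A cutoff that removes a
  neighbourhood of the graph has a gradient of order \<open>1 / t\<close>; so it costs only a
  multiple of the norm of \<open>h\<close> on the strip, and this tends to zero with
  \<open>t\<close>.\<close>

lemma chart_H10w:
  fixes D :: "(real^'d) set"
  assumes d: "CARD('d) \<ge> 2" and D: "open D" "bounded D" and G: "graph_height e L G"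
    and chart: "\<And>y. y \<in> ball x0 r \<Longrightarrow> y \<in> D \<longleftrightarrow> 0 < G y"
    and s: "smooth s" and K: "compact K" "K \<subseteq> ball x0 r" "\<And>x. x \<notin> K \<Longrightarrow> s x = 0"
    and u: "wgrad D u g" and phi: "\<And>k::nat. smooth (\<phi> k)"
    and lim: "(\<lambda>k. nrm D (\<lambda>x. \<phi> k x - u x)) \<longlonglongrightarrow> 0" "(\<lambda>k. nrm D (\<lambda>x. grad (\<phi> k) x - g x)) \<longlonglongrightarrow> 0"
    and tr: "(\<lambda>k. \<integral>\<^sup>+y. ennreal ((s y * \<phi> k y)\<^sup>2) * indicator {y. G y = 0} y \<partial>surface_measure) \<longlonglongrightarrow> 0"
  shows "H10w D (\<lambda>x. s x * u x) (\<lambda>x. s x *\<^sub>R g x + u x *\<^sub>R grad s x)"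
proof -
  have Ds: "D \<in> sets lebesgue" using D by auto
  note uL = wgradD(1,2)[OF u]
  have L: "L > 0" and lip: "\<And>x y. \<bar>G x - G y\<bar> \<le> L * dist x y" using G by (auto simp: graph_height_def)
  note Gc = graph_height_continuous[OF G]
  define v where "v x = s x * u x" for x
  define h where "h x = s x *\<^sub>R g x + u x *\<^sub>R grad s x" for x
  have vh: "wgrad D v h" unfolding v_def[abs_def] h_def[abs_def] by (rule wgrad_smooth_mult[OF Ds D(2) s u])
  note vL = wgradD(1,2)[OF vh]
  define \<psi> where "\<psi> k x = s x * \<phi> k x" for k x
  have sp: "smooth (\<psi> k)" for k unfolding \<psi>_def by (rule smooth_mult[OF s phi])
  have pl: "(\<lambda>k. nrm D (\<lambda>x. \<psi> k x - v x)) \<longlonglongrightarrow> 0" "(\<lambda>k. nrm D (\<lambda>x. grad (\<psi> k) x - h x)) \<longlonglongrightarrow> 0"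
    using smooth_mult_converge[OF Ds D(2) s uL phi lim] unfolding \<psi>_def v_def h_def by auto
  have oK: "open (- K)" using K(1) compact_imp_closed by blast
  have gs0: "grad s x = 0" if "x \<notin> K" for x using that K(3) oK by (intro grad_eq_0[of "- K" _ _ 0]) auto
  have v0: "v x = 0" "h x = 0" if "x \<notin> K" for x using that K(3) gs0 by (auto simp: v_def h_def)
  have p0: "\<psi> k x = 0" if "x \<notin> K" for k x using that K(3) by (simp add: \<psi>_def)
  have gp0: "grad (\<psi> k) x = 0" if "x \<notin> K" for k x using that p0 oK by (intro grad_eq_0[of "- K" _ _ 0]) auto
  define T where "T t = {y. 0 < G y \<and> G y < t}" for t
  define DT where "DT t = D \<inter> T t" for t
  have oT: "open (T t)" for t unfolding T_def by (intro open_Collect_conj open_Collect_less Gc continuous_on_const)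
  have DT: "DT t \<subseteq> D" "open (DT t)" "DT t \<in> sets lebesgue" "bounded (DT t)" "DT t \<in> sets borel" for t
    using D oT[of t] bounded_subset[OF D(2)] by (auto simp: DT_def)
  have TK: "y \<in> D" if "y \<in> K" "0 < G y" for y using chart[of y] K(2) that by blast
  have strip: "(nrm (DT t) v)\<^sup>2 \<le> 2 * (t\<^sup>2 * (nrm (DT t) h)\<^sup>2)" if t: "t > 0" for t
  proof -
    have vD: "v \<in> L2 (DT t)" "h \<in> L2 (DT t)" using L2_subset(1)[OF DT(1,3) Ds] vL by auto
    have pD: "\<psi> k \<in> L2 (DT t)" "grad (\<psi> k) \<in> L2 (DT t)" for k using smooth_L2[OF sp DT(4,3)] by auto
    have l1: "(\<lambda>k. nrm (DT t) (\<psi> k)) \<longlonglongrightarrow> nrm (DT t) v"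
    proof (rule nrm_tendsto[OF pD(1) vD(1)], rule tendsto_sandwich[OF _ _ tendsto_const pl(1)])
      show "\<forall>\<^sub>F k in sequentially. nrm (DT t) (\<lambda>x. \<psi> k x - v x) \<le> nrm D (\<lambda>x. \<psi> k x - v x)"
        by (intro always_eventually allI L2_subset(2)[OF DT(1,3) Ds] L2_diff smooth_L2 sp D Ds vL)
    qed simp
    have l2: "(\<lambda>k. nrm (DT t) (grad (\<psi> k))) \<longlonglongrightarrow> nrm (DT t) h"
    proof (rule nrm_tendsto[OF pD(2) vD(2)], rule tendsto_sandwich[OF _ _ tendsto_const pl(2)])
      show "\<forall>\<^sub>F k in sequentially. nrm (DT t) (\<lambda>x. grad (\<psi> k) x - h x) \<le> nrm D (\<lambda>x. grad (\<psi> k) x - h x)"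
        by (intro always_eventually allI L2_subset(2)[OF DT(1,3) Ds] L2_diff smooth_L2 sp D Ds vL)
    qed simp
    let ?c = "ennreal (strip_const TYPE('d) * t)"
    have tr': "(\<lambda>k. \<integral>\<^sup>+y. ennreal ((\<psi> k y)\<^sup>2) * indicator {y. G y = 0} y \<partial>surface_measure) \<longlonglongrightarrow> 0"
      using tr by (simp add: \<psi>_def)
    have le: "ennreal ((nrm (DT t) (\<psi> k))\<^sup>2) \<le> 2 * (?c * (\<integral>\<^sup>+y. ennreal ((\<psi> k y)\<^sup>2) * indicator {y. G y = 0} y \<partial>surface_measure)) + 2 * (ennreal (t\<^sup>2) * ennreal ((nrm (DT t) (grad (\<psi> k)))\<^sup>2))" for k
    proof -
      have "ennreal ((nrm (DT t) (\<psi> k))\<^sup>2) = (\<integral>\<^sup>+y. ennreal ((norm (\<psi> k y))\<^sup>2) * indicator (DT t) y \<partial>lborel)"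
        by (rule nrm_sq_nn[OF DT(5,4) smooth_continuous[OF sp]])
      also have "\<dots> = (\<integral>\<^sup>+y. ennreal ((\<psi> k y)\<^sup>2) * indicator {y. 0 < G y \<and> G y < t} y \<partial>lborel)"
        using p0 TK by (intro nn_integral_cong) (auto simp: indicator_def DT_def T_def)
      also have "\<dots> \<le> 2 * (?c * (\<integral>\<^sup>+y. ennreal ((\<psi> k y)\<^sup>2) * indicator {y. G y = 0} y \<partial>surface_measure)) +
          2 * (ennreal (t\<^sup>2) * (\<integral>\<^sup>+y. ennreal ((norm (grad (\<psi> k) y))\<^sup>2) * indicator {y. 0 < G y \<and> G y < t} y \<partial>lborel))"
        by (rule strip_trace_estimate[OF d G t sp])
      also have "(\<integral>\<^sup>+y. ennreal ((norm (grad (\<psi> k) y))\<^sup>2) * indicator {y. 0 < G y \<and> G y < t} y \<partial>lborel)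
         = (\<integral>\<^sup>+y. ennreal ((norm (grad (\<psi> k) y))\<^sup>2) * indicator (DT t) y \<partial>lborel)"
        using gp0 TK by (intro nn_integral_cong) (auto simp: indicator_def DT_def T_def)
      also have "\<dots> = ennreal ((nrm (DT t) (grad (\<psi> k)))\<^sup>2)" by (rule nrm_sq_nn[OF DT(5,4) smooth_grad_continuous[OF sp], symmetric])
      finally show ?thesis .
    qed
    have "(\<lambda>k. 2 * (?c * (\<integral>\<^sup>+y. ennreal ((\<psi> k y)\<^sup>2) * indicator {y. G y = 0} y \<partial>surface_measure)) + 2 * (ennreal (t\<^sup>2) * ennreal ((nrm (DT t) (grad (\<psi> k)))\<^sup>2)))
      \<longlonglongrightarrow> 2 * (?c * 0) + 2 * (ennreal (t\<^sup>2) * ennreal ((nrm (DT t) h)\<^sup>2))"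
      by (intro tendsto_add ennreal_tendsto_cmult tr' tendsto_ennrealI tendsto_power l2) auto
    moreover have "(\<lambda>k. ennreal ((nrm (DT t) (\<psi> k))\<^sup>2)) \<longlonglongrightarrow> ennreal ((nrm (DT t) v)\<^sup>2)"
      by (intro tendsto_ennrealI tendsto_power l1)
    ultimately have "ennreal ((nrm (DT t) v)\<^sup>2) \<le> 2 * (?c * 0) + 2 * (ennreal (t\<^sup>2) * ennreal ((nrm (DT t) h)\<^sup>2))"
      using le by (intro LIMSEQ_le[where X="\<lambda>k. ennreal ((nrm (DT t) (\<psi> k))\<^sup>2)"]) blast+
    also have "\<dots> = ennreal (2 * (t\<^sup>2 * (nrm (DT t) h)\<^sup>2))" by (simp add: ennreal_mult)
    finally show ?thesis by (subst (asm) ennreal_le_iff) auto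
  qed
  have strip1: "nrm (DT t) v \<le> 2 * t * nrm (DT t) h" if t: "t > 0" for t
  proof (rule power2_le_imp_le)
    have "(nrm (DT t) v)\<^sup>2 \<le> 2 * (t\<^sup>2 * (nrm (DT t) h)\<^sup>2)" by (rule strip[OF t])
    also have "\<dots> \<le> 4 * (t\<^sup>2 * (nrm (DT t) h)\<^sup>2)" by (intro mult_right_mono) auto
    finally show "(nrm (DT t) v)\<^sup>2 \<le> (2 * t * nrm (DT t) h)\<^sup>2" by (simp add: power_mult_distrib)
  qed (use t in simp)
  define t where "t n = 1 / real (Suc n)" for n
  have t: "t n > 0" "t n \<le> 1" for n by (auto simp: t_def)
  have t0: "t \<longlonglongrightarrow> 0" unfolding t_def using LIMSEQ_inverse_real_of_nat by (simp add: inverse_eq_divide)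
  have DTm: "indicator (DT (t n)) \<in> borel_measurable (lebesgue_on D)" for n
    using DT[of "t n"] Ds by (intro borel_measurable_indicator) (auto simp: sets_restrict_space image_iff intro!: bexI[of _ "DT (t n)"])
  have nh: "(\<lambda>n. nrm (DT (t n)) h) \<longlonglongrightarrow> 0"
  proof -
    have "(\<lambda>n. nrm D (\<lambda>x. indicator (DT (t n)) x *\<^sub>R h x)) \<longlonglongrightarrow> 0"
    proof (rule L2_dct[OF _ L2_integrable[OF vL(2)]])
      show "(\<lambda>x. indicator (DT (t n)) x *\<^sub>R h x) \<in> borel_measurable (lebesgue_on D)" for n using DTm[of n] L2_measurable[OF vL(2)] by measurable
      show "AE x in lebesgue_on D. (norm (indicator (DT (t n)) x *\<^sub>R h x))\<^sup>2 \<le> (norm (h x))\<^sup>2" for n by (intro AE_I2) (auto simp: indicator_def)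
      show "AE x in lebesgue_on D. (\<lambda>n. indicator (DT (t n)) x *\<^sub>R h x) \<longlonglongrightarrow> 0"
      proof (rule AE_I2)
        fix x
        show "(\<lambda>n. indicator (DT (t n)) x *\<^sub>R h x) \<longlonglongrightarrow> 0"
        proof (cases "0 < G x")
          case True
          have "\<forall>\<^sub>F n in sequentially. indicator (DT (t n)) x *\<^sub>R h x = 0"
            using order_tendstoD(2)[OF t0 True] by eventually_elim (auto simp: DT_def T_def)
          then show ?thesis by (rule tendsto_eventually)
        qed (simp add: DT_def T_def)
      qed
    qed
    moreover have "nrm D (\<lambda>x. indicator (DT (t n)) x *\<^sub>R h x) = nrm (DT (t n)) h" for n
    proof -
      have "(\<integral>x. (norm (indicator (DT (t n)) x *\<^sub>R h x))\<^sup>2 \<partial>lebesgue_on D) = (\<integral>x. (if x \<in> DT (t n) then (norm (h x))\<^sup>2 else 0) \<partial>lebesgue_on D)"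
        by (intro Bochner_Integration.integral_cong refl) (auto simp: indicator_def)
      also have "\<dots> = (\<integral>x. (norm (h x))\<^sup>2 \<partial>lebesgue_on (DT (t n)))" by (rule Lebesgue_Measure.integral_restrict[OF DT(1,3) Ds])
      finally show ?thesis by (simp add: nrm_def)
    qed
    ultimately show ?thesis by simp
  qed
  obtain R where R: "\<And>x. x \<in> K \<Longrightarrow> norm x \<le> R" using K(1) unfolding compact_eq_bounded_closed bounded_iff by blast
  have ex: "\<exists>q. cutoff (4 * L / t n) q \<and> (\<forall>x\<in>K. G x \<ge> t n \<longrightarrow> q x = 1) \<and> (\<forall>x. G x \<le> t n / 2 \<longrightarrow> q x = 0)" for n
  proof -
    text \<open>The second function makes the support bounded and is inactive on \<open>K\<close>.\<close>
    let ?F = "\<lambda>x. min (G x) (L * (R + 1 / L - norm x))"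
    have "\<bar>?F x - ?F y\<bar> \<le> L * dist x y" for x y
    proof -
      have "\<bar>norm x - norm y\<bar> \<le> dist x y" by (simp add: dist_norm norm_triangle_ineq3)
      from mult_left_mono[OF this, of L] L have "\<bar>L * norm x - L * norm y\<bar> \<le> L * dist x y" by (simp add: right_diff_distrib[symmetric] abs_mult)
      then show ?thesis using lip[of x y] by (simp add: right_diff_distrib)
    qed
    moreover have "bounded {x. t n / 2 < ?F x}" unfolding bounded_iff
    proof (intro exI[of _ "R + 1 / L"] ballI)
      fix x assume "x \<in> {x. t n / 2 < ?F x}"
      then have "t n / 2 < L * (R + 1 / L - norm x)" by simp
      then have "0 < L * (R + 1 / L - norm x)" using t(1)[of n] by linarith
      then show "norm x \<le> R + 1 / L" using L by (simp add: zero_less_mult_iff)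
    qed
    ultimately obtain q where q: "cutoff (2 * L / (t n - t n / 2)) q" "\<And>x. t n \<le> ?F x \<Longrightarrow> q x = 1" "\<And>x. ?F x \<le> t n / 2 \<Longrightarrow> q x = 0"
      using lipschitz_cutoff[OF L, of ?F "t n / 2" "t n"] t(1)[of n] by auto
    have "q x = 1" if "x \<in> K" "G x \<ge> t n" for x
    proof -
      have "L * (1 / L) \<le> L * (R + 1 / L - norm x)" using R[OF that(1)] L by (intro mult_left_mono) auto
      then show ?thesis using q(2)[of x] that(2) t(2)[of n] L by simp
    qed
    moreover have "q x = 0" if "G x \<le> t n / 2" for x by (rule q(3), rule min.coboundedI1, rule that)
    moreover have "2 * L / (t n - t n / 2) = 4 * L / t n" by simp
    ultimately show ?thesis using q(1) by (intro exI[of _ q]) simp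
  qed
  then have "\<forall>n. \<exists>q. cutoff (4 * L / t n) q \<and> (\<forall>x\<in>K. G x \<ge> t n \<longrightarrow> q x = 1) \<and> (\<forall>x. G x \<le> t n / 2 \<longrightarrow> q x = 0)" by blast
  from choice[OF this] obtain q where cq: "\<And>n. cutoff (4 * L / t n) (q n)"
    and q1: "\<And>n x. x \<in> K \<Longrightarrow> G x \<ge> t n \<Longrightarrow> q n x = 1" and q0: "\<And>n x. G x \<le> t n / 2 \<Longrightarrow> q n x = 0" by blast
  note q = cutoffD(1-3)[OF cq] q1 cutoffD(5)[OF cq disjI2[OF q1]] q0 cutoffD(4)[OF cq]
  let ?h = "\<lambda>n x. q n x *\<^sub>R h x + v x *\<^sub>R grad (q n) x"
  \<comment> \<open>For fixed \<open>n\<close> the products with the smooth \<open>\<psi> k\<close>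
    are test functions: they live on the compact set of those points of \<open>K\<close> whose
    height is at least \<open>t n / 2\<close>.\<close>
  have Hn: "H10w D (\<lambda>x. q n x * v x) (?h n)" for n
  proof (rule H10w_seq_limit[OF Ds])
    note w = wgrad_smooth_mult[OF Ds D(2) q(1)[of n] vh]
    show "(\<lambda>x. q n x * v x) \<in> L2 D" "?h n \<in> L2 D" using wgradD(1,2)[OF w] by auto
    show "H10w D (\<lambda>x. q n x * \<psi> k x) (grad (\<lambda>x. q n x * \<psi> k x))" for k
    proof (rule H10w_test[OF Ds], rule test_functionI[OF smooth_mult[OF q(1) sp]])
      have cl: "closed {y. G y \<ge> t n / 2}" by (intro closed_Collect_le Gc continuous_on_const)
      show "compact (K \<inter> {y. G y \<ge> t n / 2})" using K(1) cl by (rule compact_Int_closed)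
      show "K \<inter> {y. G y \<ge> t n / 2} \<subseteq> D" using TK t(1)[of n] by fastforce
      show "q n x * \<psi> k x = 0" if "x \<notin> K \<inter> {y. G y \<ge> t n / 2}" for x using that p0[of x k] q(6)[of x n] by (cases "x \<in> K") auto
    qed
    show "(\<lambda>k. nrm D (\<lambda>x. q n x * \<psi> k x - q n x * v x)) \<longlonglongrightarrow> 0"
      "(\<lambda>k. nrm D (\<lambda>x. grad (\<lambda>x. q n x * \<psi> k x) x - ?h n x)) \<longlonglongrightarrow> 0"
      by (rule smooth_mult_converge[OF Ds D(2) q(1) vL sp pl])+
  qed
  \<comment> \<open>At points of \<open>K\<close> of height at least \<open>t n\<close> the cutoff
    is \<open>1\<close> with zero gradient, so all errors are confined to the strip.\<close>
  have off: "q n x = 1 \<and> grad (q n) x = 0" if "x \<in> D" "x \<notin> DT (t n)" "x \<in> K" for n x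
  proof -
    have "0 < G x" using chart[of x] that K(2) by blast
    then have "G x \<ge> t n" using that by (auto simp: DT_def T_def)
    then show ?thesis using q(4,5) that by blast
  qed
  have n1: "nrm D (\<lambda>x. q n x * v x - v x) \<le> nrm (DT (t n)) v" for n
  proof (rule nrm_le_subset[OF DT(1,3) Ds L2_subset(1)[OF DT(1,3) Ds vL(1)]])
    fix x
    have "\<bar>(q n x - 1) * v x\<bar> \<le> 1 * \<bar>v x\<bar>" unfolding abs_mult using q(2,3)[of n x] by (intro mult_right_mono) auto
    then show "norm (q n x * v x - v x) \<le> norm (v x)" by (simp add: left_diff_distrib)
    assume "x \<in> D" "x \<notin> DT (t n)"
    then show "q n x * v x - v x = 0" using off[of x n] v0[of x] by (cases "x \<in> K") auto
  qed
  have n2: "nrm D (\<lambda>x. ?h n x - h x) \<le> nrm (DT (t n)) h + (4  * L / t n) * nrm (DT (t n)) v" for n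
  proof -
    have vD: "v \<in> L2 (DT (t n))" "h \<in> L2 (DT (t n))" using L2_subset(1)[OF DT(1,3) Ds] vL by auto
    have hL: "(\<lambda>x. norm (h x)) \<in> L2 (DT (t n))" "(\<lambda>x. norm (v x)) \<in> L2 (DT (t n))" using vD by (auto simp: L2_def)
    have kL: "(\<lambda>x. (4  * L / t n) * norm (v x)) \<in> L2 (DT (t n))" by (rule L2_cmult[OF hL(2)])
    have k0: "4  * L / t n \<ge> 0" using L t(1)[of n] by simp
    have "nrm D (\<lambda>x. ?h n x - h x) \<le> nrm (DT (t n)) (\<lambda>x. norm (h x) + (4  * L / t n) * norm (v x))"
    proof (rule nrm_le_subset[OF DT(1,3) Ds L2_add[OF hL(1) kL]])
      fix x
      have "norm (?h n x - h x) = norm ((q n x - 1) *\<^sub>R h x + v x *\<^sub>R grad (q n) x)" by (simp add: algebra_simps)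
      also have "\<dots> \<le> norm ((q n x - 1) *\<^sub>R h x) + norm (v x *\<^sub>R grad (q n) x)" by (rule norm_triangle_ineq)
      also have "\<dots> = \<bar>q n x - 1\<bar> * norm (h x) + \<bar>v x\<bar> * norm (grad (q n) x)" by simp
      also have "\<dots> \<le> 1 * norm (h x) + \<bar>v x\<bar> * (4  * L / t n)" using q(2,3)[of n x] q(7)[of n x] by (intro add_mono mult_mono) auto
      finally show "norm (?h n x - h x) \<le> norm (norm (h x) + (4  * L / t n) * norm (v x))" using k0 by (simp add: mult.commute)
      assume "x \<in> D" "x \<notin> DT (t n)"
      then show "?h n x - h x = 0" using off[of x n] v0[of x] by (cases "x \<in> K") auto
    qed
    also have "\<dots> \<le> nrm (DT (t n)) (\<lambda>x. norm (h x)) + nrm (DT (t n)) (\<lambda>x. (4  * L / t n) * norm (v x))" by (rule nrm_triangle[OF hL(1) kL])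
    also have "\<dots> = nrm (DT (t n)) h + (4  * L / t n) * nrm (DT (t n)) v" unfolding nrm_cmult abs_of_nonneg[OF k0] by (simp add: nrm_def)
    finally show ?thesis .
  qed
  have m1: "(\<lambda>n. nrm D (\<lambda>x. q n x * v x - v x)) \<longlonglongrightarrow> 0"
  proof (rule tendsto_sandwich[OF _ _ tendsto_const])
    show "\<forall>\<^sub>F n in sequentially. nrm D (\<lambda>x. q n x * v x - v x) \<le> 2 * nrm (DT (t n)) h"
    proof (intro always_eventually allI)
      fix n
      have "2 * t n * nrm (DT (t n)) h \<le> 2 * 1 * nrm (DT (t n)) h" using t(2)[of n] by (intro mult_right_mono) auto
      then show "nrm D (\<lambda>x. q n x * v x - v x) \<le> 2 * nrm (DT (t n)) h" using n1[of n] strip1[OF t(1)[of n]] by linarith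
    qed
    show "(\<lambda>n. 2 * nrm (DT (t n)) h) \<longlonglongrightarrow> 0" using tendsto_mult_left[OF nh, of 2] by simp
  qed simp
  have m2: "(\<lambda>n. nrm D (\<lambda>x. ?h n x - h x)) \<longlonglongrightarrow> 0"
  proof (rule tendsto_sandwich[OF _ _ tendsto_const])
    show "\<forall>\<^sub>F n in sequentially. nrm D (\<lambda>x. ?h n x - h x) \<le> (1 + 8  * L) * nrm (DT (t n)) h"
    proof (intro always_eventually allI)
      fix n
      have "(4  * L / t n) * nrm (DT (t n)) v \<le> (4  * L / t n) * (2 * t n * nrm (DT (t n)) h)" using L t(1)[of n] by (intro mult_left_mono strip1) auto
      also have "\<dots> = 8  * L * nrm (DT (t n)) h" using t(1)[of n] by simp
      finally show "nrm D (\<lambda>x. ?h n x - h x) \<le> (1 + 8  * L) * nrm (DT (t n)) h" using n2[of n] by (simp add: distrib_right)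
    qed
    show "(\<lambda>n. (1 + 8  * L) * nrm (DT (t n)) h) \<longlonglongrightarrow> 0" using tendsto_mult_left[OF nh] by fastforce
  qed simp
  have "H10w D v h" by (rule H10w_seq_limit[OF Ds vL Hn m1 m2])
  then show ?thesis unfolding v_def[abs_def] h_def[abs_def] .
qed

text \<open>\<open>G\<close> measures the height above the graph in direction \<open>e\<close>. The
  projection along \<open>e\<close> at most doubles distances, which accounts for the Lipschitz
  constant \<open>1 + 2 * L0\<close>.\<close>

lemma lipschitz_boundary_chart:
  fixes D :: "(real^'d) set"
  assumes D: "open D" "lipschitz_boundary D" and x: "x \<in> frontier D"
  obtains r e L G where "r > 0" "graph_height e L G" "\<And>y. y \<in> ball x r \<Longrightarrow> y \<in> D \<longleftrightarrow> 0 < G y"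
proof -
  from bspec[OF D(2)[unfolded lipschitz_boundary_def] x] obtain r e L0 \<gamma> where r: "r > 0" and e: "norm e = 1" and g: "L0-lipschitz_on {z. z \<bullet> e = 0} \<gamma>"
    and c: "D \<inter> ball x r = {y \<in> ball x r. y \<bullet> e > \<gamma> (y - (y \<bullet> e) *\<^sub>R e)}"
    by (elim bexE exE conjE) (rule that)
  have L0: "L0 \<ge> 0" using g by (rule lipschitz_on_nonneg)
  have ee: "e \<bullet> e = 1" using e by (simp add: dot_square_norm)
  let ?p = "\<lambda>y. y - (y \<bullet> e) *\<^sub>R e"
  let ?G = "\<lambda>y. y \<bullet> e - \<gamma> (?p y)"
  have pe: "?p y \<bullet> e = 0" for y by (simp add: inner_diff_left ee)
  show ?thesis
  proof (rule that[OF r, of e "1 + 2 * L0" ?G])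
    show "graph_height e (1 + 2 * L0) ?G" unfolding graph_height_def
    proof (intro conjI allI e)
      show "1 + 2 * L0 > 0" using L0 by simp
      fix y :: "real^'d" and t :: real
      have "?p (y + t *\<^sub>R e) = ?p y" by (simp add: inner_add_left ee algebra_simps)
      from arg_cong[OF this, of \<gamma>] show "?G (y + t *\<^sub>R e) = ?G y + t" using inner_add_left[of y "t *\<^sub>R e" e] ee by (simp only: inner_scaleR_left)
    next
      fix y z :: "real^'d"
      have i: "\<bar>(y - z) \<bullet> e\<bar> \<le> dist y z" using Cauchy_Schwarz_ineq2[of "y - z" e] e by (simp add: dist_norm)
      have "?p y - ?p z = (y - z) - ((y - z) \<bullet> e) *\<^sub>R e" by (simp add: inner_diff_left algebra_simps)
      then have "dist (?p y) (?p z) = norm ((y - z) - ((y - z) \<bullet> e) *\<^sub>R e)" by (simp only: dist_norm)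
      also have "\<dots> \<le> norm (y - z) + norm (((y - z) \<bullet> e) *\<^sub>R e)" by (rule norm_triangle_ineq4)
      also have "\<dots> \<le> 2 * dist y z" using i e by (simp add: dist_norm)
      finally have p: "dist (?p y) (?p z) \<le> 2 * dist y z" .
      have "\<bar>\<gamma> (?p y) - \<gamma> (?p z)\<bar> \<le> L0 * dist (?p y) (?p z)" using lipschitz_onD[OF g, of "?p y" "?p z"] pe by (simp add: dist_real_def)
      also have "\<dots> \<le> L0 * (2 * dist y z)" by (rule mult_left_mono[OF p L0])
      finally have "\<bar>\<gamma> (?p y) - \<gamma> (?p z)\<bar> \<le> 2 * L0 * dist y z" by simp
      moreover have "\<bar>?G y - ?G z\<bar> \<le> \<bar>(y - z) \<bullet> e\<bar> + \<bar>\<gamma> (?p y) - \<gamma> (?p z)\<bar>" by (simp add: inner_diff_left)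
      ultimately have "\<bar>?G y - ?G z\<bar> \<le> dist y z + 2 * L0 * dist y z" using i by (meson add_mono order_trans)
      then show "\<bar>?G y - ?G z\<bar> \<le> (1 + 2 * L0) * dist y z" by (simp only: distrib_right mult_1)
    qed
    fix y assume y: "y \<in> ball x r"
    have "y \<in> D \<longleftrightarrow> y \<in> D \<inter> ball x r" using y by blast
    then have "y \<in> D \<longleftrightarrow> \<gamma> (?p y) < y \<bullet> e" unfolding c using y by blast
    then show "y \<in> D \<longleftrightarrow> 0 < ?G y" by linarith
  qed
qed

text \<open>One radius serves all smooth factors supported in the ball, so that a finite subcover
  can be chosen before the factors are constructed.\<close>

definition cutoff_ok :: "(real^'d) set \<Rightarrow> (real^'d \<Rightarrow> real) \<Rightarrow> (real^'d \<Rightarrow> real^'d) \<Rightarrow> real^'d \<Rightarrow> real \<Rightarrow> bool" where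
  "cutoff_ok D u g x r \<longleftrightarrow> r > 0 \<and> (\<forall>s K. smooth s \<and> compact K \<and> K \<subseteq> ball x r \<and> (\<forall>y. y \<notin> K \<longrightarrow> s y = 0) \<longrightarrow>
     H10w D (\<lambda>x. s x * u x) (\<lambda>x. s x *\<^sub>R g x + u x *\<^sub>R grad s x))"

lemma cutoff_okI:
  assumes "r > 0" "\<And>s K. smooth s \<Longrightarrow> compact K \<Longrightarrow> K \<subseteq> ball x r \<Longrightarrow> (\<And>y. y \<notin> K \<Longrightarrow> s y = 0) \<Longrightarrow>
     H10w D (\<lambda>x. s x * u x) (\<lambda>x. s x *\<^sub>R g x + u x *\<^sub>R grad s x)"
  shows "cutoff_ok D u g x r"
  unfolding cutoff_ok_def using assms by blast

lemma trace_zero_local: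
  fixes D :: "(real^'d) set"
  assumes d: "CARD('d) \<ge> 2" and D: "open D" "bounded D" "lipschitz_boundary D"
    and x: "x \<in> closure D" and loc: "x \<in> frontier D \<Longrightarrow> \<exists>r>0. frontier D \<inter> ball x r \<subseteq> \<Gamma>"
    and u: "wgrad D u g" and phi: "\<And>k::nat. smooth (\<phi> k)"
    and lim: "(\<lambda>k. nrm D (\<lambda>x. \<phi> k x - u x)) \<longlonglongrightarrow> 0" "(\<lambda>k. nrm D (\<lambda>x. grad (\<phi> k) x - g x)) \<longlonglongrightarrow> 0"
    and tr: "(\<lambda>k. \<integral>\<^sup>+y\<in>frontier D. ennreal ((\<phi> k y - w y)\<^sup>2) \<partial>surface_measure) \<longlonglongrightarrow> 0"
    and w: "AE y in surface_measure. y \<in> frontier D \<inter> \<Gamma> \<longrightarrow> w y = 0" "w \<in> borel_measurable borel"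
  shows "\<exists>r. cutoff_ok D u g x r"
proof -
  have Ds: "D \<in> sets lebesgue" using D by auto
  note uL = wgradD(1,2)[OF u]
  show ?thesis
  proof (cases "x \<in> D")
    case True
    then obtain r where r: "r > 0" "ball x r \<subseteq> D" using D(1) open_contains_ball by blast
    show ?thesis
    proof (rule exI[of _ r], rule cutoff_okI[OF r(1)])
      fix s K assume s: "smooth s" and K: "compact K" "K \<subseteq> ball x r" "\<And>y. y \<notin> K \<Longrightarrow> s y = 0"
      note sw = wgrad_smooth_mult[OF Ds D(2) s u]
      show "H10w D (\<lambda>x. s x * u x) (\<lambda>x. s x *\<^sub>R g x + u x *\<^sub>R grad s x)"
      proof (rule H10w_seq_limit[OF Ds wgradD(1)[OF sw] wgradD(2)[OF sw] _ smooth_mult_converge[OF Ds D(2) s uL phi lim]])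
        show "H10w D (\<lambda>x. s x * \<phi> k x) (grad (\<lambda>x. s x * \<phi> k x))" for k
          by (rule H10w_test[OF Ds], rule test_functionI[OF smooth_mult[OF s phi] K(1)]) (use K r in auto)
      qed
    qed
  next
    case False
    then have xf: "x \<in> frontier D" using x D(1) by (simp add: frontier_def interior_open)
    obtain r1 where r1: "r1 > 0" "frontier D \<inter> ball x r1 \<subseteq> \<Gamma>" using loc[OF xf] by blast
    obtain r2 e L G where r2: "r2 > 0" and G: "graph_height e L G" and c: "\<And>y. y \<in> ball x r2 \<Longrightarrow> y \<in> D \<longleftrightarrow> 0 < G y"
      using lipschitz_boundary_chart[OF D(1,3) xf] by blast
    define r where "r = min r1 r2"
    have r: "r > 0" "ball x r \<subseteq> ball x r1" "ball x r \<subseteq> ball x r2" using r1 r2 by (auto simp: r_def)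
    show ?thesis
    proof (rule exI[of _ r], rule cutoff_okI[OF r(1)])
      fix s K assume s: "smooth s" and K: "compact K" "K \<subseteq> ball x r" "\<And>y. y \<notin> K \<Longrightarrow> s y = 0"
      have cs: "csmooth s" unfolding csmooth_def using s K bounded_subset[OF compact_imp_bounded[OF K(1)], of "{x. s x \<noteq> 0}"] by blast
      obtain B where B: "B > 0" "\<And>x. \<bar>s x\<bar> \<le> B" using csmooth_bounded[OF cs] by blast
      \<comment> \<open>A zero of \<open>G\<close> within the chart is a boundary point: it is not
        in \<open>D\<close>, and an arbitrarily small shift along \<open>e\<close> leads into
        \<open>D\<close>.\<close>
      have front: "y \<in> frontier D \<inter> \<Gamma>" if y: "y \<in> K" "G y = 0" for y
      proof -
        have yb: "y \<in> ball x r" using K y by blast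
        have "y \<notin> D" using c[of y] yb r y(2) by auto
        moreover have "y \<in> closure D"
        proof (rule closure_approachable[THEN iffD2], intro allI impI)
          fix q :: real assume q: "q > 0"
          obtain p where p: "p > 0" "ball y p \<subseteq> ball x r" using yb open_ball open_contains_ball by blast
          define a where "a = min p q / 2"
          have a: "a > 0" "a < p" "a < q" using p q by (auto simp: a_def)
          have e: "norm e = 1" "G (y + a *\<^sub>R e) = a" using G y(2) by (auto simp: graph_height_def)
          have dy: "dist (y + a *\<^sub>R e) y = a" using e a by (simp add: dist_norm)
          have "y + a *\<^sub>R e \<in> ball y p" using dy a by (simp add: dist_commute)
          then have "y + a *\<^sub>R e \<in> ball x r2" using p r by blast
          from c[OF this] have "y + a *\<^sub>R e \<in> D" using e(2) a by simp
          then show "\<exists>z\<in>D. dist z y < q" using dy a by (intro bexI[of _ "y + a *\<^sub>R e"]) auto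
        qed
        ultimately have "y \<in> frontier D" using D(1) by (simp add: frontier_def interior_open)
        then show ?thesis using r1 r yb by blast
      qed
      show "H10w D (\<lambda>x. s x * u x) (\<lambda>x. s x *\<^sub>R g x + u x *\<^sub>R grad s x)"
      proof (rule chart_H10w[OF d D(1,2) G _ s K(1,2,3) u phi lim])
        show "y \<in> D \<longleftrightarrow> 0 < G y" if "y \<in> ball x r" for y using c that r by blast
        have fs: "frontier D \<in> sets borel" by (simp add: frontier_def)
        have ss [measurable_cong, simp]: "sets (surface_measure :: (real^'d) measure) = sets borel" by (rule sets_surface[OF d])
        note [measurable] = w(2) smooth_measurable[OF phi] fs
        show "(\<lambda>k. \<integral>\<^sup>+y. ennreal ((s y * \<phi> k y)\<^sup>2) * indicator {y. G y = 0} y \<partial>surface_measure) \<longlonglongrightarrow> 0"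
        proof (rule tendsto_sandwich[OF _ _ tendsto_const])
          show "\<forall>\<^sub>F k in sequentially. (\<integral>\<^sup>+y. ennreal ((s y * \<phi> k y)\<^sup>2) * indicator {y. G y = 0} y \<partial>surface_measure)
            \<le> ennreal (B\<^sup>2) * (\<integral>\<^sup>+y\<in>frontier D. ennreal ((\<phi> k y - w y)\<^sup>2) \<partial>surface_measure)"
          proof (intro always_eventually allI)
            fix k
            have "(\<integral>\<^sup>+y. ennreal ((s y * \<phi> k y)\<^sup>2) * indicator {y. G y = 0} y \<partial>surface_measure)
              \<le> (\<integral>\<^sup>+y. ennreal (B\<^sup>2) * (ennreal ((\<phi> k y - w y)\<^sup>2) * indicator (frontier D) y) \<partial>surface_measure)"
            proof (rule nn_integral_mono_AE)
              show "AE y in surface_measure. ennreal ((s y * \<phi> k y)\<^sup>2) * indicator {y. G y = 0} y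
                \<le> ennreal (B\<^sup>2) * (ennreal ((\<phi> k y - w y)\<^sup>2) * indicator (frontier D) y)" using w(1)
              proof eventually_elim
                case (elim y)
                show ?case
                proof (cases "y \<in> K \<and> G y = 0")
                  case True
                  then have f: "y \<in> frontier D" "w y = 0" using front elim by auto
                  have "(s y)\<^sup>2 \<le> B\<^sup>2" using power_mono[OF B(2)[of y], of 2] by simp
                  then have "(s y * \<phi> k y)\<^sup>2 \<le> B\<^sup>2 * (\<phi> k y)\<^sup>2" by (simp add: power_mult_distrib mult_right_mono)
                  then have "ennreal ((s y * \<phi> k y)\<^sup>2) \<le> ennreal (B\<^sup>2) * ennreal ((\<phi> k y)\<^sup>2)" by (simp add: ennreal_mult[symmetric])
                  then show ?thesis using f True by simp
                next
                  case False
                  then show ?thesis using K(3) by (auto simp: indicator_def)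
                qed
              qed
            qed
            also have "\<dots> = ennreal (B\<^sup>2) * (\<integral>\<^sup>+y\<in>frontier D. ennreal ((\<phi> k y - w y)\<^sup>2) \<partial>surface_measure)"
              by (rule nn_integral_cmult) measurable
            finally show "(\<integral>\<^sup>+y. ennreal ((s y * \<phi> k y)\<^sup>2) * indicator {y. G y = 0} y \<partial>surface_measure)
              \<le> ennreal (B\<^sup>2) * (\<integral>\<^sup>+y\<in>frontier D. ennreal ((\<phi> k y - w y)\<^sup>2) \<partial>surface_measure)" .
          qed
          show "(\<lambda>k. ennreal (B\<^sup>2) * (\<integral>\<^sup>+y\<in>frontier D. ennreal ((\<phi> k y - w y)\<^sup>2) \<partial>surface_measure)) \<longlonglongrightarrow> 0"
            using ennreal_tendsto_cmult[OF _ tr, of "ennreal (B\<^sup>2)"] by simp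
        qed simp
      qed (use K r in auto)
    qed
  qed
qed

text \<open>The balls are peeled off one at a time by \<open>z = s z + (1 - s) z\<close>, which
  replaces a partition of unity. The cover uses half radii because \<open>s\<close> needs room to
  drop from \<open>1\<close> to \<open>0\<close> inside its ball.\<close>

lemma H10w_finite_cover:
  fixes D :: "(real^'d) set" and X :: "(real^'d) set"
  assumes D: "open D" "bounded D" and u: "wgrad D u g" and X: "finite X"
    and ok: "\<And>x. x \<in> X \<Longrightarrow> cutoff_ok D u g x (r x)"
    and z: "smooth z" and cov: "closure {x. z x \<noteq> 0} \<inter> closure D \<subseteq> (\<Union>x\<in>X. ball x (r x / 2))"
  shows "H10w D (\<lambda>x. z x * u x) (\<lambda>x. z x *\<^sub>R g x + u x *\<^sub>R grad z x)"
  using X ok z cov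
proof (induction X arbitrary: z rule: finite_induct)
  case empty
  have Ds: "D \<in> sets lebesgue" using D by auto
  have z0: "z x = 0" if "x \<in> D" for x using empty.prems(3) that closure_subset[of "{x. z x \<noteq> 0}"] closure_subset[of D] by blast
  have g0: "grad z x = 0" if "x \<in> D" for x using that z0 by (intro grad_eq_0[OF D(1), of _ _ 0])
  have "H10w D (\<lambda>x. 0) (grad (\<lambda>x. 0))" by (rule H10w_test[OF Ds test_functions_zero])
  then show ?case by (rule H10w_AE_cong[OF Ds]) (auto intro!: AE_I2 simp: z0 g0 grad_const)
next
  case (insert x X)
  have Ds: "D \<in> sets lebesgue" using D by auto
  have okx: "cutoff_ok D u g x (r x)" using insert.prems(1) by blast
  then have rx: "r x > 0" by (simp add: cutoff_ok_def)
  obtain s where s: "smooth s" "\<And>y. y \<in> cball x (r x / 2) \<Longrightarrow> s y = 1"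
    "\<And>y. (\<And>w. w \<in> cball x (r x / 2) \<Longrightarrow> dist w y \<ge> r x / 4) \<Longrightarrow> s y = 0"
    using compact_cutoff[OF compact_cball, of "r x / 4" x "r x / 2"] rx by (metis divide_pos_pos zero_less_numeral)
  have s0: "s y = 0" if "y \<notin> cball x (3 * r x / 4)" for y
  proof (rule s(3))
    fix w assume "w \<in> cball x (r x / 2)"
    then show "dist w y \<ge> r x / 4" using that dist_triangle[of x y w] by simp
  qed
  let ?a = "\<lambda>y. s y * z y" and ?b = "\<lambda>y. (1 - s y) * z y"
  have sa: "smooth ?a" by (rule smooth_mult[OF s(1) insert.prems(2)])
  have sb: "smooth ?b" by (intro smooth_mult smooth_diff smooth_const s insert.prems)
  have Ha: "H10w D (\<lambda>y. ?a y * u y) (\<lambda>y. ?a y *\<^sub>R g y + u y *\<^sub>R grad ?a y)"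
  proof -
    have "smooth ?a \<and> compact (cball x (3 * r x / 4)) \<and> cball x (3 * r x / 4) \<subseteq> ball x (r x) \<and> (\<forall>y. y \<notin> cball x (3 * r x / 4) \<longrightarrow> ?a y = 0)"
      using sa s0 rx by auto
    then show ?thesis using okx unfolding cutoff_ok_def by blast
  qed
  have Hb: "H10w D (\<lambda>y. ?b y * u y) (\<lambda>y. ?b y *\<^sub>R g y + u y *\<^sub>R grad ?b y)"
  proof (rule insert.IH[OF _ sb])
    have "{y. ?b y \<noteq> 0} \<subseteq> closure {y. z y \<noteq> 0} \<inter> - ball x (r x / 2)" using s(2) closure_subset[of "{y. z y \<noteq> 0}"] by fastforce
    moreover have "closed (closure {y. z y \<noteq> 0} \<inter> - ball x (r x / 2))" by (intro closed_Int closed_closure closed_Compl open_ball)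
    ultimately have "closure {y. ?b y \<noteq> 0} \<subseteq> closure {y. z y \<noteq> 0} \<inter> - ball x (r x / 2)" by (rule closure_minimal)
    then show "closure {y. ?b y \<noteq> 0} \<inter> closure D \<subseteq> (\<Union>x\<in>X. ball x (r x / 2))" using insert.prems(3) by blast
  qed (use insert.prems in auto)
  have gz: "grad z y = grad ?a y + grad ?b y" for y
  proof -
    have "grad (\<lambda>y. ?a y + ?b y) y = grad ?a y + grad ?b y" by (intro grad_add smooth_differentiable sa sb)
    moreover have "(\<lambda>y. ?a y + ?b y) = z" by (simp add: algebra_simps)
    ultimately show ?thesis by simp
  qed
  show ?case by (rule H10w_AE_cong[OF Ds H10w_add[OF Ds Ha Hb]]) (auto intro!: AE_I2 simp: gz algebra_simps)
qed

text \<open>Boundary points away from the support of \<open>z\<close> impose no condition on the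
  trace. The part of the support in the closure of \<open>D\<close> is compact and is covered by
  finitely many balls on which every cutoff is admissible.\<close>

lemma trace_zero_cutoff:
  fixes D :: "(real^'d) set"
  assumes d: "CARD('d) \<ge> 2" and D: "open D" "bounded D" "lipschitz_boundary D"
    and u: "u \<in> H1_zero_on D \<Gamma>" and g: "wgrad D u g" and z: "smooth z"
    and loc: "\<And>x. x \<in> frontier D \<Longrightarrow> x \<in> closure {x. z x \<noteq> 0} \<Longrightarrow> \<exists>r>0. frontier D \<inter> ball x r \<subseteq> \<Gamma>"
  shows "H10w D (\<lambda>x. z x * u x) (\<lambda>x. z x *\<^sub>R g x + u x *\<^sub>R grad z x)"
proof -
  have Ds: "D \<in> sets lebesgue" using D by auto
  obtain w where w: "is_trace D u w" "AE x in surface_measure. x \<in> frontier D \<inter> \<Gamma> \<longrightarrow> w x = 0" using u by (auto simp: H1_zero_on_def)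
  obtain \<phi> where phi: "\<And>k::nat. smooth (\<phi> k)" "(\<lambda>k. H1_norm D (\<lambda>x. \<phi> k x - u x)) \<longlonglongrightarrow> 0"
    "(\<lambda>k. \<integral>\<^sup>+x\<in>frontier D. ennreal ((\<phi> k x - w x)\<^sup>2) \<partial>surface_measure) \<longlonglongrightarrow> 0" and wm: "w \<in> borel_measurable borel"
    using w(1) by (auto simp: is_trace_def)
  have l1: "(\<lambda>k. nrm D (\<lambda>x. \<phi> k x - u x)) \<longlonglongrightarrow> 0" by (rule tendsto_sandwich[OF _ _ tendsto_const phi(2)])
       (auto intro!: always_eventually H1_norm_small(1)[OF D(1) wgrad_smooth[OF Ds D(2) phi(1)] g])
  have l2: "(\<lambda>k. nrm D (\<lambda>x. grad (\<phi> k) x - g x)) \<longlonglongrightarrow> 0" by (rule tendsto_sandwich[OF _ _ tendsto_const phi(2)])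
       (auto intro!: always_eventually H1_norm_small(2)[OF D(1) wgrad_smooth[OF Ds D(2) phi(1)] g])
  let ?Z = "closure {x. z x \<noteq> 0} \<inter> closure D"
  have "\<forall>x. \<exists>r. x \<in> ?Z \<longrightarrow> cutoff_ok D u g x r"
  proof
    fix x
    show "\<exists>r. x \<in> ?Z \<longrightarrow> cutoff_ok D u g x r"
    proof (cases "x \<in> ?Z")
      case True
      then have x: "x \<in> closure D" "x \<in> frontier D \<Longrightarrow> \<exists>r>0. frontier D \<inter> ball x r \<subseteq> \<Gamma>" using loc by auto
      show ?thesis using trace_zero_local[OF d D x g phi(1) l1 l2 phi(3) w(2) wm] by blast
    qed blast
  qed
  from choice[OF this] obtain r where r: "\<And>x. x \<in> ?Z \<Longrightarrow> cutoff_ok D u g x (r x)" by blast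
  have "compact ?Z" by (intro closed_Int_compact closed_closure) (simp add: D(2))
  then obtain X where X: "X \<subseteq> ?Z" "finite X" "?Z \<subseteq> (\<Union>x\<in>X. ball x (r x / 2))"
  proof (rule compactE_image[of ?Z ?Z "\<lambda>x. ball x (r x / 2)"])
    show "?Z \<subseteq> (\<Union>x\<in>?Z. ball x (r x / 2))"
    proof
      fix x assume x: "x \<in> ?Z"
      then have "x \<in> ball x (r x / 2)" using r[OF x] by (simp add: cutoff_ok_def)
      then show "x \<in> (\<Union>x\<in>?Z. ball x (r x / 2))" using x by blast
    qed
  qed (use that in auto)
  show ?thesis by (rule H10w_finite_cover[OF D(1,2) g X(2) _ z X(3)]) (use X(1) r in blast)
qed

section \<open>A Poincare inequality on a grid\<close>

definition cell :: "real \<Rightarrow> ('d \<Rightarrow> int) \<Rightarrow> (real^'d) set" where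
  "cell h z = {x. \<forall>i. \<lfloor>x $ i / h\<rfloor> = z i}"

lemma cell_bounds: "h > 0 \<Longrightarrow> x \<in> cell h z \<longleftrightarrow> (\<forall>i. h * z i \<le> x $ i \<and> x $ i < h * (z i + 1))"
  by (auto simp: cell_def floor_eq_iff field_simps)

lemma cell_borel [measurable]: "cell h z \<in> sets borel"
proof -
  have "cell h z = (\<Inter>i\<in>UNIV. {x. of_int (z i) \<le> x $ i / h} \<inter> {x. x $ i / h < of_int (z i) + 1})" by (auto simp: cell_def floor_eq_iff)
  moreover have "{x::real^'a. of_int (z i) \<le> x $ i / h} \<in> sets borel" "{x::real^'a. x $ i / h < of_int (z i) + 1} \<in> sets borel" for i unfolding divide_inverse
    by (intro borel_closed closed_Collect_le borel_open open_Collect_less continuous_intros continuous_on_component)+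
  ultimately show ?thesis by (auto intro!: sets.finite_INT)
qed

lemma emeasure_cell:
  assumes h: "h > 0"
  shows "emeasure lborel (cell h (z :: 'd::finite \<Rightarrow> int)) = ennreal (h ^ CARD('d))"
proof -
  let ?l = "\<chi> i. h * of_int (z i) :: real^'d" and ?u = "\<chi> i. h * (of_int (z i) + 1) :: real^'d"
  have b: "(?u - ?l) \<bullet> b = h" if "b \<in> Basis" for b using that by (auto simp: Basis_vec_def inner_axis algebra_simps)
  have le: "?l \<bullet> b \<le> ?u \<bullet> b" if "b \<in> Basis" for b using b[OF that] h by (simp add: inner_diff_left)
  have p: "(\<Prod>b\<in>Basis. (?u - ?l) \<bullet> b) = h ^ CARD('d)" using b by simp
  have "cell h z \<subseteq> cbox ?l ?u" using h by (auto simp: cell_bounds mem_box_cart less_imp_le)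
  moreover have "box ?l ?u \<subseteq> cell h z" using h by (auto simp: cell_bounds mem_box_cart less_imp_le)
  ultimately have "emeasure lborel (cell h z) \<le> emeasure lborel (cbox ?l ?u)" "emeasure lborel (box ?l ?u) \<le> emeasure lborel (cell h z)"
    by (auto intro!: emeasure_mono)
  moreover have "emeasure lborel (cbox ?l ?u) = ennreal (h ^ CARD('d))" "emeasure lborel (box ?l ?u) = ennreal (h ^ CARD('d))"
    using emeasure_lborel_cbox[OF le] emeasure_lborel_box[OF le] p by auto
  ultimately show ?thesis by (simp add: antisym)
qed

definition cell_indices :: "nat \<Rightarrow> ('d::finite \<Rightarrow> int) set" where
  "cell_indices P = (\<Pi>\<^sub>E i\<in>UNIV. {- int P..<int P})"

lemma cell_indices_finite [simp]: "finite (cell_indices P)"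
  by (simp add: cell_indices_def finite_PiE)

lemma card_cell_indices: "card (cell_indices P :: ('d::finite \<Rightarrow> int) set) = (2 * P) ^ CARD('d)"
  by (simp add: cell_indices_def card_PiE nat_mult_distrib power_mult_distrib)

lemma cell_indices_cover:
  assumes h: "h > 0" and x: "\<And>i. \<bar>x $ i\<bar> < h * real P"
  obtains z where "z \<in> cell_indices P" "x \<in> cell h z"
proof (rule that[of "\<lambda>i. \<lfloor>x $ i / h\<rfloor>"])
  show "x \<in> cell h (\<lambda>i. \<lfloor>x $ i / h\<rfloor>)" by (simp add: cell_def)
  have "- real P < x $ i / h \<and> x $ i / h < real P" for i using x[of i] h by (auto simp: field_simps abs_less_iff)
  then have "- int P \<le> \<lfloor>x $ i / h\<rfloor> \<and> \<lfloor>x $ i / h\<rfloor> < int P" for i by (auto simp: le_floor_iff floor_less_iff less_imp_le)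
  then show "(\<lambda>i. \<lfloor>x $ i / h\<rfloor>) \<in> cell_indices P" by (auto simp: cell_indices_def)
qed

lemma cell_unique: "x \<in> cell h z \<Longrightarrow> x \<in> cell h z' \<Longrightarrow> z = z'"
  by (auto simp: cell_def)

lemma sum_cell_indicator: "finite Z \<Longrightarrow> (\<Sum>z\<in>Z. indicator (cell h z) x * indicator (cell h z) y * (c :: ennreal)) \<le> c"
proof -
  assume Z: "finite Z"
  show ?thesis
  proof (cases "\<exists>z\<in>Z. x \<in> cell h z")
    case True
    then obtain z where z: "z \<in> Z" "x \<in> cell h z" by blast
    have "(\<Sum>z'\<in>Z. indicator (cell h z') x * indicator (cell h z') y * c) = (\<Sum>z'\<in>{z}. indicator (cell h z') x * indicator (cell h z') y * c)"
    proof (rule sum.mono_neutral_right[OF Z], use z in simp, rule ballI)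
      fix z' assume "z' \<in> Z - {z}"
      then have "x \<notin> cell h z'" using cell_unique[OF z(2)] by blast
      then show "indicator (cell h z') x * indicator (cell h z') y * c = 0" by simp
    qed
    also have "\<dots> \<le> c" by (auto simp: indicator_def)
    finally show ?thesis .
  next
    case False
    then have "(\<Sum>z\<in>Z. indicator (cell h z) x * indicator (cell h z) y * c) = 0" by (intro sum.neutral) auto
    then show ?thesis by simp
  qed
qed

text \<open>Expanding the square expresses the variance on a cell through the differences
  \<open>\<psi> x - \<psi> y\<close>, which translations control. In this form the mean value never
  has to be subtracted from \<open>\<psi>\<close>.\<close>

lemma cell_variance:
  fixes \<psi> :: "real^'d \<Rightarrow> real"
  assumes h: "h > 0" and psi: "continuous_on UNIV \<psi>" "\<And>x. \<bar>\<psi> x\<bar> \<le> B"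
  shows "0 \<le> h ^ CARD('d) * (\<integral>x. indicator (cell h z) x * (\<psi> x)\<^sup>2 \<partial>lborel) - (\<integral>x. indicator (cell h z) x * \<psi> x \<partial>lborel)\<^sup>2"
    "ennreal (2 * (h ^ CARD('d) * (\<integral>x. indicator (cell h z) x * (\<psi> x)\<^sup>2 \<partial>lborel) - (\<integral>x. indicator (cell h z) x * \<psi> x \<partial>lborel)\<^sup>2))
    = (\<integral>\<^sup>+x. (\<integral>\<^sup>+y. indicator (cell h z) x * indicator (cell h z) y * ennreal ((\<psi> x - \<psi> y)\<^sup>2) \<partial>lborel) \<partial>lborel)"
proof -
  let ?q = "cell h z" and ?V = "h ^ CARD('d)"
  let ?i = "indicator ?q :: real^'d \<Rightarrow> real"
  have [measurable]: "\<psi> \<in> borel_measurable borel" by (rule borel_measurable_continuous_onI[OF psi(1)])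
  have i1: "integrable lborel ?i" using emeasure_cell[OF h, of z] by (intro integrable_real_indicator) auto
  have int: "integrable lborel (\<lambda>x. ?i x * f x)" if "f \<in> borel_measurable borel" "\<And>x. \<bar>f x\<bar> \<le> C" for f :: "real^'d \<Rightarrow> real" and C
    by (rule bounded_integrable_mult[OF i1 _ that(2)]) (use that in simp)
  have V: "(\<integral>x. ?i x \<partial>lborel) = ?V" using emeasure_cell[OF h, of z] h by (simp add: measure_def)
  have sqB: "\<bar>(\<psi> x)\<^sup>2\<bar> \<le> B\<^sup>2" for x using power_mono[OF psi(2)[of x], of 2] by simp
  have iI: "integrable lborel (\<lambda>x. ?i x * \<psi> x)" by (rule int[OF _ psi(2)]) measurable
  have iJ: "integrable lborel (\<lambda>x. ?i x * (\<psi> x)\<^sup>2)" by (rule int[OF _ sqB]) measurable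
  let ?I = "\<integral>x. ?i x * \<psi> x \<partial>lborel" and ?J = "\<integral>x. ?i x * (\<psi> x)\<^sup>2 \<partial>lborel"
  have i: "integrable lborel (\<lambda>y. ?i y * (\<psi> x - \<psi> y)\<^sup>2)" and ie: "(\<integral>y. ?i y * (\<psi> x - \<psi> y)\<^sup>2 \<partial>lborel) = ?V * (\<psi> x)\<^sup>2 - 2 * \<psi> x * ?I + ?J" for x
  proof -
    have e: "?i y * (\<psi> x - \<psi> y)\<^sup>2 = (\<psi> x)\<^sup>2 * ?i y - 2 * \<psi> x * (?i y * \<psi> y) + ?i y * (\<psi> y)\<^sup>2" for y
      by (simp add: power2_eq_square algebra_simps)
    show "integrable lborel (\<lambda>y. ?i y * (\<psi> x - \<psi> y)\<^sup>2)" unfolding e using i1 iI iJ by auto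
    show "(\<integral>y. ?i y * (\<psi> x - \<psi> y)\<^sup>2 \<partial>lborel) = ?V * (\<psi> x)\<^sup>2 - 2 * \<psi> x * ?I + ?J" unfolding e using i1 iI iJ V by simp
  qed
  have inner: "(\<integral>\<^sup>+y. indicator ?q y * ennreal ((\<psi> x - \<psi> y)\<^sup>2) \<partial>lborel) = ennreal (?V * (\<psi> x)\<^sup>2 - 2 * \<psi> x * ?I + ?J)" for x
  proof -
    have "(\<integral>\<^sup>+y. indicator ?q y * ennreal ((\<psi> x - \<psi> y)\<^sup>2) \<partial>lborel) = (\<integral>\<^sup>+y. ennreal (?i y * (\<psi> x - \<psi> y)\<^sup>2) \<partial>lborel)"
      by (intro nn_integral_cong) (auto simp: indicator_def)
    then show ?thesis using nn_integral_eq_integral[OF i[of x]] ie[of x] by simp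
  qed
  have nn: "0 \<le> ?i x * (?V * (\<psi> x)\<^sup>2 - 2 * \<psi> x * ?I + ?J)" for x
    unfolding ie[symmetric] by (intro mult_nonneg_nonneg Bochner_Integration.integral_nonneg) auto
  have o: "?i x * (?V * (\<psi> x)\<^sup>2 - 2 * \<psi> x * ?I + ?J) = ?V * (?i x * (\<psi> x)\<^sup>2) - 2 * ?I * (?i x * \<psi> x) + ?J * ?i x" for x
    by (simp add: algebra_simps)
  have io: "integrable lborel (\<lambda>x. ?i x * (?V * (\<psi> x)\<^sup>2 - 2 * \<psi> x * ?I + ?J))" unfolding o using i1 iI iJ by auto
  have "(\<integral>\<^sup>+x. (\<integral>\<^sup>+y. indicator ?q x * indicator ?q y * ennreal ((\<psi> x - \<psi> y)\<^sup>2) \<partial>lborel) \<partial>lborel)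
    = (\<integral>\<^sup>+x. ennreal (?i x * (?V * (\<psi> x)\<^sup>2 - 2 * \<psi> x * ?I + ?J)) \<partial>lborel)"
  proof (rule nn_integral_cong)
    fix x
    have "(\<integral>\<^sup>+y. indicator ?q x * indicator ?q y * ennreal ((\<psi> x - \<psi> y)\<^sup>2) \<partial>lborel) = indicator ?q x * (\<integral>\<^sup>+y. indicator ?q y * ennreal ((\<psi> x - \<psi> y)\<^sup>2) \<partial>lborel)"
      unfolding mult.assoc by (rule nn_integral_cmult) measurable
    also have "\<dots> = ennreal (?i x * (?V * (\<psi> x)\<^sup>2 - 2 * \<psi> x * ?I + ?J))" unfolding inner by (auto simp: indicator_def)
    finally show "(\<integral>\<^sup>+y. indicator ?q x * indicator ?q y * ennreal ((\<psi> x - \<psi> y)\<^sup>2) \<partial>lborel) = ennreal (?i x * (?V * (\<psi> x)\<^sup>2 - 2 * \<psi> x * ?I + ?J))" .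
  qed
  also have "\<dots> = ennreal (\<integral>x. ?i x * (?V * (\<psi> x)\<^sup>2 - 2 * \<psi> x * ?I + ?J) \<partial>lborel)"
    by (rule nn_integral_eq_integral[OF io AE_I2[OF nn]])
  also have tot: "(\<integral>x. ?i x * (?V * (\<psi> x)\<^sup>2 - 2 * \<psi> x * ?I + ?J) \<partial>lborel) = 2 * (?V * ?J - ?I\<^sup>2)"
    unfolding o using i1 iI iJ V by (simp add: power2_eq_square)
  finally show "ennreal (2 * (?V * ?J - ?I\<^sup>2)) = (\<integral>\<^sup>+x. (\<integral>\<^sup>+y. indicator ?q x * indicator ?q y * ennreal ((\<psi> x - \<psi> y)\<^sup>2) \<partial>lborel) \<partial>lborel)" by simp
  have "0 \<le> (\<integral>x. ?i x * (?V * (\<psi> x)\<^sup>2 - 2 * \<psi> x * ?I + ?J) \<partial>lborel)" by (intro Bochner_Integration.integral_nonneg nn)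
  then show "0 \<le> ?V * ?J - ?I\<^sup>2" unfolding tot by simp
qed

text \<open>The differences within a cell are translations by vectors of length at most \<open>d h\<close>.\<close>

lemma cell_poincare_smooth:
  fixes \<psi> :: "real^'d \<Rightarrow> real"
  assumes h: "h > 0" and psi: "csmooth \<psi>" and Z: "finite Z"
  shows "(\<Sum>z\<in>Z. h ^ CARD('d) * (\<integral>x. indicator (cell h z) x * (\<psi> x)\<^sup>2 \<partial>lborel) - (\<integral>x. indicator (cell h z) x * \<psi> x \<partial>lborel)\<^sup>2)
    \<le> h ^ CARD('d) * (2 ^ CARD('d) * (real CARD('d))\<^sup>2 * h\<^sup>2 * (\<integral>x. (norm (grad \<psi> x))\<^sup>2 \<partial>lborel))"
proof -
  obtain R where R: "smooth \<psi>" "\<And>x. norm x > R \<Longrightarrow> \<psi> x = 0" using csmoothE[OF psi] by blast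
  obtain B where B: "\<And>x. \<bar>\<psi> x\<bar> \<le> B" using csmooth_bounded[OF psi] by blast
  note pc = smooth_continuous[OF R(1), of UNIV]
  note [measurable] = smooth_measurable[OF R(1)] smooth_grad_measurable[OF R(1)]
  have g0: "grad \<psi> x = 0" if "norm x > R" for x by (rule grad_eq_0[of "- cball 0 R" _ _ 0]) (use that R(2) in auto)
  have iN: "integrable lborel (\<lambda>x. (norm (grad \<psi> x))\<^sup>2)"
  proof (rule continuous_integrable[of _ R])
    show "continuous_on UNIV (\<lambda>x. (norm (grad \<psi> x))\<^sup>2)" by (intro continuous_intros smooth_grad_continuous R)
  qed (use g0 in auto)
  let ?N = "\<integral>x. (norm (grad \<psi> x))\<^sup>2 \<partial>lborel"
  have N: "(\<integral>\<^sup>+x. ennreal ((norm (grad \<psi> x))\<^sup>2) \<partial>lborel) = ennreal ?N" by (rule nn_integral_eq_integral[OF iN]) simp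
  let ?c = "\<lambda>z. h ^ CARD('d) * (\<integral>x. indicator (cell h z) x * (\<psi> x)\<^sup>2 \<partial>lborel) - (\<integral>x. indicator (cell h z) x * \<psi> x \<partial>lborel)\<^sup>2"
  \<comment> \<open>All differences of two points of one cell lie in this cube. It replaces the sum
    over the cells, since a pair of points belongs to at most one cell.\<close>
  let ?W = "cbox (\<chi> i. - h) (\<chi> i. h) :: (real^'d) set"
  have Wm: "emeasure lborel ?W = ennreal ((2 * h) ^ CARD('d))"
  proof -
    have b: "((\<chi> i. h) - (\<chi> i. - h) :: real^'d) \<bullet> b = 2 * h" if "b \<in> Basis" for b using that by (auto simp: Basis_vec_def inner_axis)
    have "((\<chi> i. - h) :: real^'d) \<bullet> b \<le> (\<chi> i. h) \<bullet> b" if "b \<in> Basis" for b using b[OF that] h by (simp add: inner_diff_left)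
    from emeasure_lborel_cbox[OF this] b show ?thesis by simp
  qed
  note nn = cell_variance(1)[OF h pc B]
  have "ennreal (2 * (\<Sum>z\<in>Z. ?c z)) = (\<Sum>z\<in>Z. ennreal (2 * ?c z))" using nn by (simp add: sum_distrib_left sum_ennreal)
  also have "\<dots> = (\<Sum>z\<in>Z. \<integral>\<^sup>+x. (\<integral>\<^sup>+y. indicator (cell h z) x * indicator (cell h z) y * ennreal ((\<psi> x - \<psi> y)\<^sup>2) \<partial>lborel) \<partial>lborel)"
    by (intro sum.cong refl cell_variance(2)[OF h pc B])
  also have "\<dots> = (\<integral>\<^sup>+x. (\<Sum>z\<in>Z. \<integral>\<^sup>+y. indicator (cell h z) x * indicator (cell h z) y * ennreal ((\<psi> x - \<psi> y)\<^sup>2) \<partial>lborel) \<partial>lborel)"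
    by (rule nn_integral_sum[symmetric]) measurable
  also have "\<dots> = (\<integral>\<^sup>+x. (\<integral>\<^sup>+y. (\<Sum>z\<in>Z. indicator (cell h z) x * indicator (cell h z) y * ennreal ((\<psi> x - \<psi> y)\<^sup>2)) \<partial>lborel) \<partial>lborel)"
    by (intro nn_integral_cong nn_integral_sum[symmetric]) measurable
  also have "\<dots> \<le> (\<integral>\<^sup>+x. (\<integral>\<^sup>+y. indicator ?W (x - y) * ennreal ((\<psi> x - \<psi> y)\<^sup>2) \<partial>lborel) \<partial>lborel)"
  proof (intro nn_integral_mono)
    fix x y :: "real^'d"
    show "(\<Sum>z\<in>Z. indicator (cell h z) x * indicator (cell h z) y * ennreal ((\<psi> x - \<psi> y)\<^sup>2)) \<le> indicator ?W (x - y) * ennreal ((\<psi> x - \<psi> y)\<^sup>2)"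
    proof (cases "x - y \<in> ?W")
      case True
      then show ?thesis using sum_cell_indicator[OF Z] by simp
    next
      case False
      have "x \<notin> cell h z \<or> y \<notin> cell h z" for z
      proof (rule ccontr)
        assume "\<not> ?thesis"
        then have xy: "x \<in> cell h z" "y \<in> cell h z" by auto
        have "- h \<le> x $ i - y $ i \<and> x $ i - y $ i \<le> h" for i using xy[unfolded cell_bounds[OF h], rule_format, of i] by (simp add: distrib_left)
        then have "x - y \<in> ?W" by (simp add: mem_box_cart)
        then show False using False by simp
      qed
      then show ?thesis by (subst sum.neutral) (auto simp: indicator_def)
    qed
  qed
  \<comment> \<open>With \<open>w = x - y\<close> the inner integral runs over translations. After
    the exchange of the integrals each \<open>w\<close> is treated by
    \<open>translation_estimate\<close>.\<close>
  also have "\<dots> = (\<integral>\<^sup>+x. (\<integral>\<^sup>+w. indicator ?W w * ennreal ((\<psi> x - \<psi> (x - w))\<^sup>2) \<partial>lborel) \<partial>lborel)"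
  proof (rule nn_integral_cong)
    fix x
    show "(\<integral>\<^sup>+y. indicator ?W (x - y) * ennreal ((\<psi> x - \<psi> y)\<^sup>2) \<partial>lborel) = (\<integral>\<^sup>+w. indicator ?W w * ennreal ((\<psi> x - \<psi> (x - w))\<^sup>2) \<partial>lborel)"
      using lborel_nn_integral_affine[of "\<lambda>w. indicator ?W w * ennreal ((\<psi> x - \<psi> (x - w))\<^sup>2)" "-1" x] by simp
  qed
  also have "\<dots> = (\<integral>\<^sup>+w. (\<integral>\<^sup>+x. indicator ?W w * ennreal ((\<psi> x - \<psi> (x - w))\<^sup>2) \<partial>lborel) \<partial>lborel)"
    by (rule lborel_pair.Fubini'[symmetric]) measurable
  also have "\<dots> \<le> (\<integral>\<^sup>+w. ennreal ((real CARD('d) * h)\<^sup>2 * ?N) * indicator ?W w \<partial>lborel)"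
  proof (rule nn_integral_mono)
    fix w
    show "(\<integral>\<^sup>+x. indicator ?W w * ennreal ((\<psi> x - \<psi> (x - w))\<^sup>2) \<partial>lborel) \<le> ennreal ((real CARD('d) * h)\<^sup>2 * ?N) * indicator ?W w"
    proof (cases "w \<in> ?W")
      case True
      have "norm w \<le> (\<Sum>i\<in>UNIV. \<bar>w $ i\<bar>)" by (rule norm_le_l1_cart)
      also have "\<dots> \<le> (\<Sum>i\<in>(UNIV :: 'd set). h)" using True by (intro sum_mono) (auto simp: mem_box_cart abs_le_iff minus_le_iff)
      finally have "norm w \<le> real CARD('d) * h" by simp
      then have w2: "(norm w)\<^sup>2 \<le> (real CARD('d) * h)\<^sup>2" by (intro power_mono) auto
      have "(\<integral>\<^sup>+x. ennreal ((\<psi> x - \<psi> (x - w))\<^sup>2) \<partial>lborel) \<le> ennreal ((norm w)\<^sup>2) * ennreal ?N"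
        using translation_estimate[OF R(1), of w] unfolding N .
      also have "\<dots> \<le> ennreal ((real CARD('d) * h)\<^sup>2) * ennreal ?N" by (intro mult_right_mono ennreal_leI w2) simp
      also have "\<dots> = ennreal ((real CARD('d) * h)\<^sup>2 * ?N)" by (simp add: ennreal_mult')
      finally show ?thesis using True by simp
    qed simp
  qed
  also have "\<dots> = ennreal ((real CARD('d) * h)\<^sup>2 * ?N) * ennreal ((2 * h) ^ CARD('d))" using Wm by (subst nn_integral_cmult_indicator) auto
  also have "\<dots> = ennreal ((real CARD('d) * h)\<^sup>2 * ?N * (2 * h) ^ CARD('d))" using h by (subst ennreal_mult[symmetric]) auto
  finally have "2 * (\<Sum>z\<in>Z. ?c z) \<le> (real CARD('d) * h)\<^sup>2 * ?N * (2 * h) ^ CARD('d)" using h by (subst (asm) ennreal_le_iff) auto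
  moreover have "0 \<le> (\<Sum>z\<in>Z. ?c z)" by (intro sum_nonneg nn)
  ultimately have "(\<Sum>z\<in>Z. ?c z) \<le> (real CARD('d) * h)\<^sup>2 * ?N * (2 * h) ^ CARD('d)" by linarith
  then show ?thesis by (simp add: power_mult_distrib mult_ac)
qed

text \<open>The integral over the cell, not divided by its volume; the normalisation reappears as
  the division by \<open>h ^ CARD('d)\<close> in \<open>cell_poincare\<close>.\<close>

definition cell_avg :: "(real^'d) set \<Rightarrow> real \<Rightarrow> ('d \<Rightarrow> int) \<Rightarrow> (real^'d \<Rightarrow> real) \<Rightarrow> real" where
  "cell_avg D h z f = (\<integral>x. indicator (cell h z) x * f x \<partial>lebesgue_on D)"

text \<open>\<open>2 ^ CARD('d)\<close> is the volume of the cube of differences relative to that of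
  a cell, and a difference has length at most \<open>CARD('d) * h\<close>.\<close>

definition poincare_const :: "'d::finite itself \<Rightarrow> real" where
  "poincare_const _ = 2 ^ CARD('d) * (real CARD('d))\<^sup>2"

lemma cell_indicator_L2:
  assumes "D \<in> sets lebesgue" "bounded D" shows "(indicator (cell h z) :: _ \<Rightarrow> real) \<in> L2 D"
proof (rule L2_bounded[OF _ _ emeasure_bounded_lebesgue[OF assms(2,1)], of _ 1])
  have "cell h z \<in> sets lebesgue" using cell_borel[of h z] by auto
  then show "indicator (cell h z) \<in> borel_measurable (lebesgue_on D)" by (intro measurable_restrict_space1 borel_measurable_indicator)
qed (auto simp: indicator_def)

text \<open>Elements of \<open>H10w\<close> are limits of test functions, whose extensions by zero
  are smooth on every cell. So a cell that \<open>D\<close> meets only in part is treated like any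
  other.\<close>

lemma cell_poincare:
  fixes D :: "(real^'d) set"
  assumes D: "open D" "bounded D" "D \<subseteq> ball 0 (h * real P)" and h: "h > 0" and w: "H10w D w p"
  shows "(nrm D w)\<^sup>2 \<le> poincare_const TYPE('d) * h\<^sup>2 * (nrm D p)\<^sup>2 + (\<Sum>z\<in>cell_indices P. (cell_avg D h z w)\<^sup>2) / h ^ CARD('d)"
proof -
  have Ds: "D \<in> sets lebesgue" using D by auto
  have wL: "w \<in> L2 D" "p \<in> L2 D" using w by (auto simp: H10w_def)
  let ?C = "poincare_const TYPE('d)" and ?Z = "cell_indices P :: ('d \<Rightarrow> int) set"
  have test: "(nrm D \<phi>)\<^sup>2 \<le> ?C * h\<^sup>2 * (nrm D (grad \<phi>))\<^sup>2 + (\<Sum>z\<in>?Z. (cell_avg D h z \<phi>)\<^sup>2) / h ^ CARD('d)"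
    if phi: "\<phi> \<in> test_functions D" for \<phi>
  proof -
    have cs: "csmooth \<phi>" using phi by (simp add: test_function_csmooth)
    have sp: "smooth \<phi>" using phi by (simp add: test_functions_def)
    note [measurable] = smooth_measurable[OF sp] smooth_grad_measurable[OF sp]
    obtain K where K: "K \<subseteq> D" "\<And>x. x \<notin> K \<Longrightarrow> \<phi> x = 0" "\<And>x. x \<notin> K \<Longrightarrow> grad \<phi> x = 0"
      using test_functionD[OF phi] by metis
    have z: "\<phi> x = 0" "grad \<phi> x = 0" if "x \<notin> D" for x using that K by blast+
    note cv = lebesgue_on_integral_compact_support[OF Ds]
    have n1: "(nrm D \<phi>)\<^sup>2 = (\<Sum>y\<in>?Z. \<integral>x. indicator (cell h y) x * (\<phi> x)\<^sup>2 \<partial>lborel)"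
    proof -
      obtain B where B: "\<And>x. \<bar>\<phi> x\<bar> \<le> B" using csmooth_bounded[OF cs] by blast
      have sqB: "\<bar>(\<phi> x)\<^sup>2\<bar> \<le> B\<^sup>2" for x using power_mono[OF B[of x], of 2] by simp
      have "(nrm D \<phi>)\<^sup>2 = (\<integral>x. (\<phi> x)\<^sup>2 \<partial>lborel)" unfolding nrm_sq using z by (subst cv) auto
      also have "\<dots> = (\<integral>x. (\<Sum>y\<in>?Z. indicator (cell h y) x * (\<phi> x)\<^sup>2) \<partial>lborel)"
      proof (intro Bochner_Integration.integral_cong refl)
        fix x
        show "(\<phi> x)\<^sup>2 = (\<Sum>y\<in>?Z. indicator (cell h y) x * (\<phi> x)\<^sup>2)"
        proof (cases "x \<in> D")
          case True
          have "\<bar>x $ i\<bar> < h * real P" for i using True D(3) component_le_norm_cart[of x i] by (fastforce simp: subset_iff)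
          then obtain y where y: "y \<in> ?Z" "x \<in> cell h y" using cell_indices_cover[OF h] by blast
          have "(\<Sum>y'\<in>?Z. indicator (cell h y') x * (\<phi> x)\<^sup>2) = (\<Sum>y'\<in>{y}. indicator (cell h y') x * (\<phi> x)\<^sup>2)"
          proof (rule sum.mono_neutral_right[OF cell_indices_finite], use y in simp, rule ballI)
            fix y' assume "y' \<in> ?Z - {y}"
            then have "x \<notin> cell h y'" using cell_unique[OF y(2)] by blast
            then show "indicator (cell h y') x * (\<phi> x)\<^sup>2 = 0" by simp
          qed
          then show ?thesis using y by simp
        qed (simp add: z)
      qed
      also have "\<dots> = (\<Sum>y\<in>?Z. \<integral>x. indicator (cell h y) x * (\<phi> x)\<^sup>2 \<partial>lborel)"
      proof (rule Bochner_Integration.integral_sum)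
        fix y :: "'d \<Rightarrow> int"
        have "integrable lborel (indicator (cell h y) :: real^'d \<Rightarrow> real)" using emeasure_cell[OF h, of y] by (intro integrable_real_indicator) auto
        then show "integrable lborel (\<lambda>x. indicator (cell h y) x * (\<phi> x)\<^sup>2)" by (rule bounded_integrable_mult[OF _ _ sqB]) measurable
      qed
      finally show ?thesis .
    qed
    have n2: "(nrm D (grad \<phi>))\<^sup>2 = (\<integral>x. (norm (grad \<phi> x))\<^sup>2 \<partial>lborel)" unfolding nrm_sq using z by (intro cv) auto
    have n3: "cell_avg D h y \<phi> = (\<integral>x. indicator (cell h y) x * \<phi> x \<partial>lborel)" for y unfolding cell_avg_def using z by (intro cv) auto
    have V: "h ^ CARD('d) > 0" using h by simp
    have *: "h ^ CARD('d) * (nrm D \<phi>)\<^sup>2 - (\<Sum>z\<in>?Z. (cell_avg D h z \<phi>)\<^sup>2) \<le> h ^ CARD('d) * (?C * h\<^sup>2 * (nrm D (grad \<phi>))\<^sup>2)"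
      using cell_poincare_smooth[OF h cs cell_indices_finite[of P]] unfolding n1 n2 n3 poincare_const_def by (simp add: sum_subtractf sum_distrib_left)
    have "h ^ CARD('d) * (nrm D \<phi>)\<^sup>2 \<le> h ^ CARD('d) * (?C * h\<^sup>2 * (nrm D (grad \<phi>))\<^sup>2 + (\<Sum>z\<in>?Z. (cell_avg D h z \<phi>)\<^sup>2) / h ^ CARD('d))"
    proof -
      have "h ^ CARD('d) * ((\<Sum>z\<in>?Z. (cell_avg D h z \<phi>)\<^sup>2) / h ^ CARD('d)) = (\<Sum>z\<in>?Z. (cell_avg D h z \<phi>)\<^sup>2)" using h by simp
      then show ?thesis using * unfolding distrib_left by linarith
    qed
    then show ?thesis using V by (simp only: mult_le_cancel_left_pos)
  qed
  have "\<forall>k. \<exists>\<phi>. \<phi> \<in> test_functions D \<and> nrm D (\<lambda>x. \<phi> x - w x) < 1 / Suc k \<and> nrm D (\<lambda>x. grad \<phi> x - p x) < 1 / Suc k"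
    using w unfolding H10w_def Bex_def by simp
  from choice[OF this] obtain \<phi> where phi: "\<And>k. \<phi> k \<in> test_functions D" "\<And>k. nrm D (\<lambda>x. \<phi> k x - w x) < 1 / Suc k"
    "\<And>k. nrm D (\<lambda>x. grad (\<phi> k) x - p x) < 1 / Suc k" by blast
  have i0: "(\<lambda>k. 1 / real (Suc k)) \<longlonglongrightarrow> 0" using LIMSEQ_inverse_real_of_nat by (simp add: inverse_eq_divide)
  have l1: "(\<lambda>k. nrm D (\<lambda>x. \<phi> k x - w x)) \<longlonglongrightarrow> 0"
    by (rule tendsto_sandwich[OF always_eventually[OF allI[OF nrm_nonneg]] always_eventually[OF allI[OF less_imp_le[OF phi(2)]]] tendsto_const i0])
  have l2: "(\<lambda>k. nrm D (\<lambda>x. grad (\<phi> k) x - p x)) \<longlonglongrightarrow> 0"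
    by (rule tendsto_sandwich[OF always_eventually[OF allI[OF nrm_nonneg]] always_eventually[OF allI[OF less_imp_le[OF phi(3)]]] tendsto_const i0])
  note t = test_function_L2[OF phi(1) Ds]
  note iL = cell_indicator_L2[OF Ds D(2), of h]
  have avg: "(\<lambda>k. cell_avg D h z (\<phi> k)) \<longlonglongrightarrow> cell_avg D h z w" for z
  proof -
    have bd: "\<bar>cell_avg D h z (\<phi> k) - cell_avg D h z w\<bar> \<le> nrm D (indicator (cell h z) :: _ \<Rightarrow> real) * nrm D (\<lambda>x. \<phi> k x - w x)" for k
    proof -
      have "cell_avg D h z (\<phi> k) - cell_avg D h z w = (\<integral>x. indicator (cell h z) x * (\<phi> k x - w x) \<partial>lebesgue_on D)"
        unfolding cell_avg_def using L2_mult(1)[OF iL t(1)[of k], of z] L2_mult(1)[OF iL wL(1), of z] by (simp add: right_diff_distrib)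
      then show ?thesis using L2_mult(2)[OF iL L2_diff[OF t(1)[of k] wL(1)], of z] by simp
    qed
    have "(\<lambda>k. cell_avg D h z (\<phi> k) - cell_avg D h z w) \<longlonglongrightarrow> 0"
    proof (rule tendsto_rabs_zero_cancel, rule tendsto_sandwich[OF _ _ tendsto_const])
      show "(\<lambda>k. nrm D (indicator (cell h z) :: _ \<Rightarrow> real) * nrm D (\<lambda>x. \<phi> k x - w x)) \<longlonglongrightarrow> 0"
        using tendsto_mult_left[OF l1] by fastforce
    qed (use bd in auto)
    then show ?thesis by (simp add: LIM_zero_iff)
  qed
  have a: "(\<lambda>k. (nrm D (\<phi> k))\<^sup>2) \<longlonglongrightarrow> (nrm D w)\<^sup>2" by (intro tendsto_power nrm_tendsto[OF t(1) wL(1) l1])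
  have b: "(\<lambda>k. ?C * h\<^sup>2 * (nrm D (grad (\<phi> k)))\<^sup>2 + (\<Sum>z\<in>?Z. (cell_avg D h z (\<phi> k))\<^sup>2) / h ^ CARD('d))
     \<longlonglongrightarrow> ?C * h\<^sup>2 * (nrm D p)\<^sup>2 + (\<Sum>z\<in>?Z. (cell_avg D h z w)\<^sup>2) / h ^ CARD('d)"
    using h by (intro tendsto_intros nrm_tendsto[OF t(2) wL(2) l2] avg) auto
  show ?thesis by (rule LIMSEQ_le[OF a b]) (use test[OF phi(1)] in auto)
qed

section \<open>The energy form\<close>

lemma L2_vecI:
  fixes f :: "real^'d \<Rightarrow> real^'m"
  assumes "\<And>i. (\<lambda>x. f x $ i) \<in> L2 D" shows "f \<in> L2 D"
proof -
  have "(\<lambda>x. (f x $ i) *\<^sub>R (axis i 1 :: real^'m)) \<in> L2 D" for i using assms[of i] by (auto simp: L2_def)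
  then have "(\<lambda>x. \<Sum>i\<in>UNIV. (f x $ i) *\<^sub>R (axis i 1 :: real^'m)) \<in> L2 D" by (intro L2_sum) auto
  moreover have "(\<lambda>x. \<Sum>i\<in>UNIV. (f x $ i) *\<^sub>R (axis i 1 :: real^'m)) = f"
    using basis_expansion[of "f _"] by (simp add: fun_eq_iff scalar_mult_eq_scaleR)
  ultimately show ?thesis by simp
qed

definition coeff_field :: "(real^'d) set \<Rightarrow> real \<Rightarrow> real \<Rightarrow> (real^'d \<Rightarrow> real^'d^'d) \<Rightarrow> bool" where
  "coeff_field D amin amax A \<longleftrightarrow> (\<forall>k l. (\<lambda>x. A x $ k $ l) \<in> borel_measurable (lebesgue_on D)) \<and>
     (\<forall>k l. \<exists>B\<ge>0. AE x in lebesgue_on D. \<bar>A x $ k $ l\<bar> \<le> B) \<and>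
     (\<forall>x\<in>D. transpose (A x) = A x) \<and> (\<forall>x\<in>D. \<forall>\<xi>. amin * (norm \<xi>)\<^sup>2 \<le> (A x *v \<xi>) \<bullet> \<xi>) \<and>
     (\<forall>x\<in>D. \<forall>\<xi>. (A x *v \<xi>) \<bullet> \<xi> \<le> amax * (norm \<xi>)\<^sup>2) \<and> 0 < amin \<and> 0 < amax"

lemma coeff_field_subset:
  assumes "D' \<subseteq> D" "D' \<in> sets lebesgue" "D \<in> sets lebesgue" "coeff_field D amin amax A"
  shows "coeff_field D' amin amax A"
  using assms(4) measurable_restrict_mono[OF _ assms(1)] AE_lebesgue_on_subset[OF assms(1-3)] assms(1) unfolding coeff_field_def by (meson subsetD)

lemma coeff_field_L2:
  assumes A: "coeff_field D amin amax A" and f: "f \<in> L2 D" shows "(\<lambda>x. A x *v f x) \<in> L2 D"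
proof (rule L2_vecI)
  fix i
  have "(\<lambda>x. \<Sum>j\<in>UNIV. A x $ i $ j *\<^sub>R f x $ j) \<in> L2 D"
  proof (rule L2_sum)
    fix j
    obtain B where B: "B \<ge> 0" "AE x in lebesgue_on D. \<bar>A x $ i $ j\<bar> \<le> B" using A unfolding coeff_field_def by blast
    show "(\<lambda>x. A x $ i $ j *\<^sub>R f x $ j) \<in> L2 D"
      by (rule L2_bmult(1)[OF _ B(2) L2_component(1)[OF f] B(1)]) (use A in \<open>simp add: coeff_field_def\<close>)
  qed simp
  then show "(\<lambda>x. (A x *v f x) $ i) \<in> L2 D" by (simp add: matrix_vector_mult_def)
qed

lemma coeff_symmetric:
  assumes "coeff_field D amin amax A" "x \<in> D" shows "(A x *v a) \<bullet> b = (A x *v b) \<bullet> a"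
proof -
  have "(A x *v a) \<bullet> b = a \<bullet> (transpose (A x) *v b)" by (metis dot_lmul_matrix inner_commute transpose_matrix_vector)
  moreover have t: "transpose (A x) = A x" using assms unfolding coeff_field_def by blast
  ultimately show ?thesis unfolding t by (simp only: inner_commute)
qed

text \<open>The energy form with explicit gradients. By \<open>energy_form_eform\<close> every
  choice of weak gradients gives the value of \<open>energy_form\<close>.\<close>

definition eform :: "(real^'d \<Rightarrow> real^'d^'d) \<Rightarrow> real \<Rightarrow> (real^'d) set \<Rightarrow>
    (real^'d \<Rightarrow> real) \<Rightarrow> (real^'d \<Rightarrow> real^'d) \<Rightarrow> (real^'d \<Rightarrow> real) \<Rightarrow> (real^'d \<Rightarrow> real^'d) \<Rightarrow> real" where
  "eform A \<epsilon> D u g v h = \<epsilon>\<^sup>2 * (\<integral>x. (A x *v g x) \<bullet> h x \<partial>lebesgue_on D) + (\<integral>x. u x * v x \<partial>lebesgue_on D)"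

lemma energy_form_eform:
  assumes D: "open D" and A: "coeff_field D amin amax A" and u: "wgrad D u g" and v: "wgrad D v h"
  shows "energy_form A \<epsilon> D u v = eform A \<epsilon> D u g v h"
proof -
  note wu = wgradD(2)[OF wgrad_weak_grad[OF D u]] and wv = wgradD(2)[OF wgrad_weak_grad[OF D v]]
  have "(\<integral>x. (A x *v weak_grad D u x) \<bullet> weak_grad D v x \<partial>lebesgue_on D) = (\<integral>x. (A x *v g x) \<bullet> h x \<partial>lebesgue_on D)"
  proof (rule integral_cong_AE)
    show "AE x in lebesgue_on D. (A x *v weak_grad D u x) \<bullet> weak_grad D v x = (A x *v g x) \<bullet> h x"
      using wgrad_weak_grad_AE[OF D u] wgrad_weak_grad_AE[OF D v] by eventually_elim simp
  qed (use L2_inner(1)[OF coeff_field_L2[OF A wu] wv] L2_inner(1)[OF coeff_field_L2[OF A wgradD(2)[OF u]] wgradD(2)[OF v]] in auto)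
  then show ?thesis by (simp add: energy_form_def eform_def)
qed

lemma eform_add_cmult:
  assumes A: "coeff_field D amin amax A" and L: "u \<in> L2 D" "g \<in> L2 D" "u' \<in> L2 D" "g' \<in> L2 D" "v \<in> L2 D" "h \<in> L2 D"
  shows "eform A \<epsilon> D (\<lambda>x. u x + c * u' x) (\<lambda>x. g x + c *\<^sub>R g' x) v h = eform A \<epsilon> D u g v h + c * eform A \<epsilon> D u' g' v h"
proof -
  note i = L2_inner(1)[OF coeff_field_L2[OF A L(2)] L(6)] L2_inner(1)[OF coeff_field_L2[OF A L(4)] L(6)] L2_mult(1)[OF L(1,5)] L2_mult(1)[OF L(3,5)]
  have 1: "(\<integral>x. (A x *v (g x + c *\<^sub>R g' x)) \<bullet> h x \<partial>lebesgue_on D) = (\<integral>x. (A x *v g x) \<bullet> h x \<partial>lebesgue_on D) + c * (\<integral>x. (A x *v g' x) \<bullet> h x \<partial>lebesgue_on D)"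
    using i by (simp add: matrix_vector_right_distrib matrix_vector_mult_scaleR inner_add_left)
  have 2: "(\<integral>x. (u x + c * u' x) * v x \<partial>lebesgue_on D) = (\<integral>x. u x * v x \<partial>lebesgue_on D) + c * (\<integral>x. u' x * v x \<partial>lebesgue_on D)"
    using i by (simp add: distrib_right mult.assoc)
  show ?thesis unfolding eform_def 1 2 by (simp add: algebra_simps)
qed

lemma eform_commute:
  assumes A: "coeff_field D amin amax A"
  shows "eform A \<epsilon> D u g v h = eform A \<epsilon> D v h u g"
proof -
  have "(\<integral>x. (A x *v g x) \<bullet> h x \<partial>lebesgue_on D) = (\<integral>x. (A x *v h x) \<bullet> g x \<partial>lebesgue_on D)"
    using coeff_symmetric[OF A] by (intro Bochner_Integration.integral_cong refl) auto
  then show ?thesis by (simp add: eform_def mult.commute)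
qed

lemma eform_lower:
  assumes A: "coeff_field D amin amax A" and L: "u \<in> L2 D" "g \<in> L2 D"
  shows "\<epsilon>\<^sup>2 * (amin * (nrm D g)\<^sup>2) + (nrm D u)\<^sup>2 \<le> eform A \<epsilon> D u g u g"
proof -
  have "amin * (nrm D g)\<^sup>2 = (\<integral>x. amin * (norm (g x))\<^sup>2 \<partial>lebesgue_on D)" by (simp add: nrm_sq)
  also have "\<dots> \<le> (\<integral>x. (A x *v g x) \<bullet> g x \<partial>lebesgue_on D)"
    using L2_integrable[OF L(2)] L2_inner(1)[OF coeff_field_L2[OF A L(2)] L(2)] A by (intro integral_mono) (auto simp: coeff_field_def)
  finally have "\<epsilon>\<^sup>2 * (amin * (nrm D g)\<^sup>2) \<le> \<epsilon>\<^sup>2 * (\<integral>x. (A x *v g x) \<bullet> g x \<partial>lebesgue_on D)" by (rule mult_left_mono) simp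
  moreover have "(nrm D u)\<^sup>2 = (\<integral>x. u x * u x \<partial>lebesgue_on D)" unfolding nrm_sq by (simp add: power2_eq_square)
  ultimately show ?thesis by (simp add: eform_def)
qed

lemma eform_nonneg:
  assumes A: "coeff_field D amin amax A" and L: "u \<in> L2 D" "g \<in> L2 D"
  shows "0 \<le> eform A \<epsilon> D u g u g" "nrm D u \<le> sqrt (eform A \<epsilon> D u g u g)"
proof -
  have "0 \<le> \<epsilon>\<^sup>2 * (amin * (nrm D g)\<^sup>2)" using A by (simp add: coeff_field_def)
  then have "(nrm D u)\<^sup>2 \<le> eform A \<epsilon> D u g u g" using eform_lower[OF A L, of \<epsilon>] by linarith
  then show "0 \<le> eform A \<epsilon> D u g u g" "nrm D u \<le> sqrt (eform A \<epsilon> D u g u g)" by (auto intro: real_le_rsqrt order_trans[OF zero_le_power2])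
qed

definition weakly_harmonic :: "(real^'d \<Rightarrow> real^'d^'d) \<Rightarrow> real \<Rightarrow> (real^'d) set \<Rightarrow> (real^'d \<Rightarrow> real) \<Rightarrow> (real^'d \<Rightarrow> real^'d) \<Rightarrow> bool" where
  "weakly_harmonic A \<epsilon> D u g \<longleftrightarrow> wgrad D u g \<and> (\<forall>v h. H10w D v h \<longrightarrow> eform A \<epsilon> D u g v h = 0)"

text \<open>Test functions of the smaller domain are test functions of the larger one, and the form
  is continuous in its second argument. This permits testing on \<open>\<omega>\<close> alone, where
  the product with the partition function lives.\<close>

lemma weakly_harmonic_restrict:
  assumes D: "open D" "open D'" "bounded D" "D' \<subseteq> D" and A: "coeff_field D amin amax A" and u: "weakly_harmonic A \<epsilon> D u g"
  shows "weakly_harmonic A \<epsilon> D' u g"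
  unfolding weakly_harmonic_def
proof (intro conjI allI impI)
  have Ds: "D \<in> sets lebesgue" "D' \<in> sets lebesgue" using D by auto
  have A': "coeff_field D' amin amax A" by (rule coeff_field_subset[OF D(4) Ds(2,1) A])
  have w: "wgrad D u g" using u by (simp add: weakly_harmonic_def)
  show w': "wgrad D' u g" by (rule wgrad_restrict[OF Ds D(4) w])
  note L = wgradD(1,2)[OF w']
  fix v h assume H: "H10w D' v h"
  have vL: "v \<in> L2 D'" "h \<in> L2 D'" using H by (auto simp: H10w_def)
  have test: "eform A \<epsilon> D' u g \<phi> (grad \<phi>) = 0" if phi: "\<phi> \<in> test_functions D'" for \<phi>
  proof -
    have phi': "\<phi> \<in> test_functions D" using phi test_functions_mono[OF D(4)] by blast
    obtain K where K: "K \<subseteq> D'" "\<And>x. x \<notin> K \<Longrightarrow> \<phi> x = 0" "\<And>x. x \<notin> K \<Longrightarrow> grad \<phi> x = 0"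
      using test_functionD[OF phi] by metis
    have z: "\<phi> x = 0" "grad \<phi> x = 0" if "x \<notin> D'" for x using that K by blast+
    have r: "(\<integral>x. f x \<partial>lebesgue_on D') = (\<integral>x. f x \<partial>lebesgue_on D)" if "\<And>x. x \<notin> D' \<Longrightarrow> f x = 0" for f :: "real^'a \<Rightarrow> real"
    proof -
      have "(\<lambda>x. if x \<in> D' then f x else 0) = f" using that by auto
      then show ?thesis using Lebesgue_Measure.integral_restrict[OF D(4) Ds(2,1), of f] by simp
    qed
    have "eform A \<epsilon> D' u g \<phi> (grad \<phi>) = eform A \<epsilon> D u g \<phi> (grad \<phi>)"
      unfolding eform_def using r[of "\<lambda>x. (A x *v g x) \<bullet> grad \<phi> x"] r[of "\<lambda>x. u x * \<phi> x"] z by simp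
    then show ?thesis using u H10w_test[OF Ds(1) phi'] by (simp add: weakly_harmonic_def)
  qed
  let ?M = "\<epsilon>\<^sup>2 * nrm D' (\<lambda>x. A x *v g x) + nrm D' u"
  have M: "?M \<ge> 0" by simp
  have "\<bar>eform A \<epsilon> D' u g v h\<bar> \<le> 0"
  proof (rule field_le_epsilon)
    fix e :: real assume e: "e > 0"
    define q where "q = e / (?M + 1)"
    have q: "q > 0" using e M unfolding q_def by (intro divide_pos_pos) linarith+
    obtain \<phi> where phi: "\<phi> \<in> test_functions D'" "nrm D' (\<lambda>x. \<phi> x - v x) < q" "nrm D' (\<lambda>x. grad \<phi> x - h x) < q"
      using H q unfolding H10w_def by blast
    note t = test_function_L2(1,2)[OF phi(1) Ds(2)]
    note AL = coeff_field_L2[OF A' L(2)]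
    have "eform A \<epsilon> D' u g v h = - (\<epsilon>\<^sup>2 * (\<integral>x. (A x *v g x) \<bullet> (grad \<phi> x - h x) \<partial>lebesgue_on D') + (\<integral>x. u x * (\<phi> x - v x) \<partial>lebesgue_on D'))"
      using test[OF phi(1)] L2_inner(1)[OF AL t(2)] L2_inner(1)[OF AL vL(2)] L2_mult(1)[OF L(1) t(1)] L2_mult(1)[OF L(1) vL(1)]
      by (simp add: eform_def inner_diff_right right_diff_distrib)
    then have "\<bar>eform A \<epsilon> D' u g v h\<bar> \<le> \<epsilon>\<^sup>2 * \<bar>\<integral>x. (A x *v g x) \<bullet> (grad \<phi> x - h x) \<partial>lebesgue_on D'\<bar> + \<bar>\<integral>x. u x * (\<phi> x - v x) \<partial>lebesgue_on D'\<bar>"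
      using abs_triangle_ineq[of "\<epsilon>\<^sup>2 * (\<integral>x. (A x *v g x) \<bullet> (grad \<phi> x - h x) \<partial>lebesgue_on D')" "\<integral>x. u x * (\<phi> x - v x) \<partial>lebesgue_on D'"]
      by (simp add: abs_mult)
    also have "\<dots> \<le> \<epsilon>\<^sup>2 * (nrm D' (\<lambda>x. A x *v g x) * nrm D' (\<lambda>x. grad \<phi> x - h x)) + nrm D' u * nrm D' (\<lambda>x. \<phi> x - v x)"
      by (intro add_mono mult_left_mono L2_inner(2) L2_mult(2) L2_diff AL t vL L) simp
    also have "\<dots> \<le> \<epsilon>\<^sup>2 * (nrm D' (\<lambda>x. A x *v g x) * q) + nrm D' u * q" using phi(2,3) by (intro add_mono mult_left_mono) auto
    also have "\<dots> = ?M * q" by (simp add: distrib_right)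
    also have "\<dots> = e * (?M / (?M + 1))" by (simp add: q_def)
    also have "\<dots> \<le> e * 1"
    proof (rule mult_left_mono)
      show "?M / (?M + 1) \<le> 1" using M by (subst divide_le_eq_1_pos) linarith+
    qed (use e in simp)
    finally show "\<bar>eform A \<epsilon> D' u g v h\<bar> \<le> 0 + e" by simp
  qed
  then show "eform A \<epsilon> D' u g v h = 0" by simp
qed

text \<open>Testing with \<open>s\<^sup>2 u\<close>: the terms with the gradient of \<open>u\<close> cancel and only the one with the gradient
  of \<open>s\<close> remains, so that both sides carry the factor \<open>\<epsilon>\<^sup>2\<close>.\<close>

lemma caccioppoli:
  assumes A: "coeff_field D amin amax A" and u: "weakly_harmonic A \<epsilon> D u g"
    and p: "p \<in> L2 D" "(\<lambda>x. s x * u x) \<in> L2 D" "\<And>x. x \<in> D \<Longrightarrow> p x = s x *\<^sub>R g x + u x *\<^sub>R gs x"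
    and gs: "(\<lambda>x. u x *\<^sub>R gs x) \<in> L2 D"
    and H: "H10w D (\<lambda>x. s x * (s x * u x)) q" "\<And>x. x \<in> D \<Longrightarrow> q x = s x *\<^sub>R p x + (s x * u x) *\<^sub>R gs x"
  shows "eform A \<epsilon> D (\<lambda>x. s x * u x) p (\<lambda>x. s x * u x) p \<le> \<epsilon>\<^sup>2 * (amax * (nrm D (\<lambda>x. u x *\<^sub>R gs x))\<^sup>2)"
proof -
  have w: "wgrad D u g" using u by (simp add: weakly_harmonic_def)
  note L = wgradD(1,2)[OF w]
  have qL: "(\<lambda>x. s x * (s x * u x)) \<in> L2 D" "q \<in> L2 D" using H(1) by (auto simp: H10w_def)
  let ?r = "\<lambda>x. u x *\<^sub>R gs x"
  \<comment> \<open>\<open>gs\<close> stands for the gradient of \<open>s\<close>, smooth or weak.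
    With \<open>r = u gs\<close> the field \<open>q\<close> equals
    \<open>s\<^sup>2 g + 2 s r\<close>, so both sides are the sum of
    \<open>s\<^sup>2 (A g) \<bullet> g\<close>, \<open>2 s (A g) \<bullet> r\<close> and
    \<open>(A r) \<bullet> r\<close>; the symmetry of \<open>A\<close> merges the mixed
    terms.\<close>
  have pt: "(A x *v p x) \<bullet> p x = (A x *v g x) \<bullet> q x + (A x *v ?r x) \<bullet> ?r x" if "x \<in> D" for x
    unfolding p(3)[OF that] H(2)[OF that] matrix_vector_right_distrib matrix_vector_mult_scaleR
      inner_add_left inner_add_right inner_scaleR_left inner_scaleR_right scaleR_add_right
      coeff_symmetric[OF A that, of "gs x" "g x"] by (simp add: algebra_simps)
  have "(\<integral>x. (A x *v p x) \<bullet> p x \<partial>lebesgue_on D) = (\<integral>x. (A x *v g x) \<bullet> q x + (A x *v ?r x) \<bullet> ?r x \<partial>lebesgue_on D)"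
    using pt by (intro Bochner_Integration.integral_cong refl) auto
  also have "\<dots> = (\<integral>x. (A x *v g x) \<bullet> q x \<partial>lebesgue_on D) + (\<integral>x. (A x *v ?r x) \<bullet> ?r x \<partial>lebesgue_on D)"
    by (intro Bochner_Integration.integral_add L2_inner(1) coeff_field_L2[OF A] L qL gs)
  finally have "eform A \<epsilon> D (\<lambda>x. s x * u x) p (\<lambda>x. s x * u x) p
    = eform A \<epsilon> D u g (\<lambda>x. s x * (s x * u x)) q + \<epsilon>\<^sup>2 * (\<integral>x. (A x *v ?r x) \<bullet> ?r x \<partial>lebesgue_on D)"
    by (simp add: eform_def algebra_simps)
  also have "eform A \<epsilon> D u g (\<lambda>x. s x * (s x * u x)) q = 0" using u H(1) by (simp add: weakly_harmonic_def)
  also have "(\<integral>x. (A x *v ?r x) \<bullet> ?r x \<partial>lebesgue_on D) \<le> amax * (nrm D ?r)\<^sup>2"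
  proof -
    have "(\<integral>x. (A x *v ?r x) \<bullet> ?r x \<partial>lebesgue_on D) \<le> (\<integral>x. amax * (norm (?r x))\<^sup>2 \<partial>lebesgue_on D)"
    proof (rule Bochner_Integration.integral_mono)
      show "integrable (lebesgue_on D) (\<lambda>x. (A x *v ?r x) \<bullet> ?r x)" by (intro L2_inner(1) coeff_field_L2[OF A] gs)
      show "integrable (lebesgue_on D) (\<lambda>x. amax * (norm (?r x))\<^sup>2)" using L2_integrable[OF gs] by simp
      show "(A x *v ?r x) \<bullet> ?r x \<le> amax * (norm (?r x))\<^sup>2" if "x \<in> space (lebesgue_on D)" for x
        using A that unfolding coeff_field_def by (metis space_lebesgue_on)
    qed
    then show ?thesis by (simp add: nrm_sq)
  qed
  finally show ?thesis by (simp add: mult_left_mono)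
qed

section \<open>Finite-dimensional approximation\<close>

text \<open>Only semidefinite: functions that vanish almost everywhere on the domain have energy
  zero without being the zero function. The combination \<open>u + c v\<close> covers sums and
  multiples by a single axiom.\<close>

locale semi_inner_space =
  fixes V :: "('x \<Rightarrow> real) set" and a :: "('x \<Rightarrow> real) \<Rightarrow> ('x \<Rightarrow> real) \<Rightarrow> real"
  assumes zero: "(\<lambda>_. 0) \<in> V" and closed: "u \<in> V \<Longrightarrow> v \<in> V \<Longrightarrow> (\<lambda>x. u x + c * v x) \<in> V"
    and add: "u \<in> V \<Longrightarrow> v \<in> V \<Longrightarrow> w \<in> V \<Longrightarrow> a (\<lambda>x. u x + c * v x) w = a u w + c * a v w"
    and commute: "u \<in> V \<Longrightarrow> v \<in> V \<Longrightarrow> a u v = a v u" and nonneg: "u \<in> V \<Longrightarrow> 0 \<le> a u u"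
begin

lemma expand: "u \<in> V \<Longrightarrow> v \<in> V \<Longrightarrow> a (\<lambda>x. u x + c * v x) (\<lambda>x. u x + c * v x) = a u u + 2 * c * a u v + c\<^sup>2 * a v v"
  using add[of u v "\<lambda>x. u x + c * v x" c] add[of u v u c] add[of u v v c] closed[of u v c]
    commute[of u "\<lambda>x. u x + c * v x"] commute[of v "\<lambda>x. u x + c * v x"] commute[of u v] by (simp add: power2_eq_square algebra_simps)

lemma zero_form: "a (\<lambda>_. 0) (\<lambda>_. 0) = 0"
  using add[OF zero zero zero, of 1] by simp

lemma scale: "u \<in> V \<Longrightarrow> (\<lambda>x. c * u x) \<in> V" "u \<in> V \<Longrightarrow> a (\<lambda>x. c * u x) (\<lambda>x. c * u x) = c\<^sup>2 * a u u"
  "u \<in> V \<Longrightarrow> w \<in> V \<Longrightarrow> a (\<lambda>x. c * u x) w = c * a u w"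
proof -
  show 1: "(\<lambda>x. c * u x) \<in> V" if "u \<in> V" using closed[OF zero that, of c] by simp
  show 2: "a (\<lambda>x. c * u x) w = c * a u w" if "u \<in> V" "w \<in> V" for w using add[OF zero that, of c] add[OF zero zero that(2), of 1] by simp
  show "a (\<lambda>x. c * u x) (\<lambda>x. c * u x) = c\<^sup>2 * a u u" if u: "u \<in> V"
    using 2[OF u 1[OF u]] commute[OF u 1[OF u]] 2[OF u u] by (simp add: power2_eq_square)
qed

text \<open>Representing \<open>l\<close> approximately by a near-maximiser avoids completeness of \<open>V\<close>.\<close>

lemma near_maximiser:
  assumes l: "\<And>u v c. u \<in> V \<Longrightarrow> v \<in> V \<Longrightarrow> l (\<lambda>x. u x + c * v x) = l u + c * l v"
    and B: "\<And>u. u \<in> V \<Longrightarrow> \<bar>l u\<bar> \<le> B * sqrt (a u u)" and \<tau>: "\<tau> > 0"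
  obtains e where "e \<in> V" "\<And>u. u \<in> V \<Longrightarrow> \<exists>c. a (\<lambda>x. u x + c * e x) e = 0"
    "\<And>k. k \<in> V \<Longrightarrow> a k e = 0 \<Longrightarrow> \<bar>l k\<bar> \<le> \<tau> * sqrt (a k k)"
proof -
  define S where "S = (\<lambda>u. \<bar>l u\<bar>) ` {u \<in> V. a u u \<le> 1}"
  define s where "s = Sup S"
  have l0: "l (\<lambda>_. 0) = 0" using l[OF zero zero, of 1] by simp
  have ls: "l (\<lambda>x. c * u x) = c * l u" if "u \<in> V" for u c using l[OF zero that, of c] l0 by simp
  have S0: "0 \<in> S" using zero zero_form l0 unfolding S_def by (intro image_eqI[of _ _ "\<lambda>_. 0"]) auto
  have bd: "bdd_above S"
  proof (rule bdd_aboveI)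
    fix y assume "y \<in> S"
    then obtain u where u: "u \<in> V" "a u u \<le> 1" "y = \<bar>l u\<bar>" unfolding S_def by auto
    have "\<bar>l u\<bar> \<le> \<bar>B\<bar> * 1" using B[OF u(1)] u(2) nonneg[OF u(1)] by (rule_tac order_trans[OF B[OF u(1)]]) (intro mult_mono; simp)
    then show "y \<le> \<bar>B\<bar>" using u(3) by simp
  qed
  have s0: "s \<ge> 0" unfolding s_def by (rule cSup_upper[OF S0 bd])
  have H: "\<bar>l u\<bar> \<le> s * sqrt (a u u)" if u: "u \<in> V" for u
  proof (cases "a u u = 0")
    case True
    then show ?thesis using B[OF u] by simp
  next
    case False
    then have p: "a u u > 0" using nonneg[OF u] by simp
    let ?c = "1 / sqrt (a u u)"
    have "a (\<lambda>x. ?c * u x) (\<lambda>x. ?c * u x) = 1" using p scale(2)[OF u, of ?c] by (simp add: power_divide)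
    then have "\<bar>l (\<lambda>x. ?c * u x)\<bar> \<in> S" unfolding S_def using scale(1)[OF u, of ?c] by (intro imageI CollectI) simp
    then have "\<bar>?c * l u\<bar> \<le> s" unfolding s_def ls[OF u, symmetric] by (rule cSup_upper[OF _ bd])
    then show ?thesis using p by (simp add: abs_mult field_simps)
  qed
  show ?thesis
  proof (cases "s \<le> \<tau>")
    \<comment> \<open>The functional is small on the whole space, so \<open>e = 0\<close> can be
      taken, to which everything is orthogonal.\<close>
    case True
    show ?thesis
    proof (rule that[OF zero])
      show "\<exists>c. a (\<lambda>x. u x + c * 0) (\<lambda>_. 0) = 0" if "u \<in> V" for u using commute[OF that zero] scale(3)[OF zero that, of 0] by simp
      show "\<bar>l k\<bar> \<le> \<tau> * sqrt (a k k)" if "k \<in> V" for k using H[OF that] mult_right_mono[OF True, of "sqrt (a k k)"] nonneg[OF that] by simp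
    qed
  next
    case False
    \<comment> \<open>By the Pythagorean theorem the squared norm of \<open>l\<close> splits over a
      direction and its orthogonal complement. A direction that captures more than
      \<open>s\<^sup>2 - \<tau>\<^sup>2\<close> leaves at most \<open>\<tau>\<^sup>2\<close> for the
      complement.\<close>
    have "sqrt (s\<^sup>2 - \<tau>\<^sup>2) < s" using False \<tau> by (intro real_less_lsqrt) auto
    then obtain y where y: "y \<in> S" "sqrt (s\<^sup>2 - \<tau>\<^sup>2) < y" using less_cSup_iff[OF _ bd] S0 unfolding s_def by blast
    then obtain e where e: "e \<in> V" "a e e \<le> 1" "y = \<bar>l e\<bar>" unfolding S_def by auto
    have "\<tau>\<^sup>2 < s\<^sup>2" using False \<tau> by (intro power_strict_mono) auto
    then have p2: "s\<^sup>2 - \<tau>\<^sup>2 < (l e)\<^sup>2" using y(2) e(3) by (metis diff_ge_0_iff_ge less_imp_le power2_abs real_sqrt_abs real_sqrt_less_iff)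
    \<comment> \<open>Energy zero would force \<open>l e = 0\<close> by the bound \<open>B\<close>,
      contrary to \<open>p2\<close>.\<close>
    have ne: "a e e \<noteq> 0" using B[OF e(1)] p2 \<open>\<tau>\<^sup>2 < s\<^sup>2\<close> by auto
    show ?thesis
    proof (rule that[OF e(1)])
      fix u assume u: "u \<in> V"
      show "\<exists>c. a (\<lambda>x. u x + c * e x) e = 0" using add[OF u e(1) e(1), of "- a u e / a e e"] ne by (intro exI[of _ "- a u e / a e e"]) simp
    next
      fix k assume k: "k \<in> V" and o: "a k e = 0"
      define A where "A = a k k"
      have A: "A \<ge> 0" unfolding A_def by (rule nonneg[OF k])
      let ?p = "l e" and ?q = "l k"
      \<comment> \<open>For orthogonal \<open>e\<close> and \<open>k\<close> with
        \<open>a e e = 1\<close> this is, up to a factor, the combination on which \<open>l\<close>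
        is largest relative to the energy. The bound \<open>H\<close> for it limits what is left for
        \<open>k\<close>.\<close>
      let ?w = "\<lambda>x. (?p * A) * e x + ?q * k x"
      have wV: "?w \<in> V" using closed[OF scale(1)[OF e(1)] k] .
      have lw: "l ?w = ?p\<^sup>2 * A + ?q\<^sup>2" using l[OF scale(1)[OF e(1)] k] ls[OF e(1)] by (simp add: power2_eq_square)
      have "a (\<lambda>x. (?p * A) * e x) k = 0" using scale(3)[OF e(1) k] commute[OF e(1) k] o by simp
      then have aw: "a ?w ?w = (?p * A)\<^sup>2 * a e e + ?q\<^sup>2 * A" using expand[OF scale(1)[OF e(1)] k] scale(2)[OF e(1)] by (simp add: A_def)
      have "(l ?w)\<^sup>2 \<le> s\<^sup>2 * a ?w ?w" using power_mono[OF H[OF wV], of 2] nonneg[OF wV] by (simp add: power_mult_distrib)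
      also have "a ?w ?w \<le> (?p * A)\<^sup>2 * 1 + ?q\<^sup>2 * A" unfolding aw by (intro add_mono mult_left_mono e(2)) auto
      finally have "(?p\<^sup>2 * A + ?q\<^sup>2)\<^sup>2 \<le> s\<^sup>2 * ((?p * A)\<^sup>2 + ?q\<^sup>2 * A)" unfolding lw by (simp add: mult_left_mono)
      also have "\<dots> = (s\<^sup>2 * A) * (?p\<^sup>2 * A + ?q\<^sup>2)" by (simp add: power2_eq_square algebra_simps)
      finally have le: "(?p\<^sup>2 * A + ?q\<^sup>2) * (?p\<^sup>2 * A + ?q\<^sup>2) \<le> (s\<^sup>2 * A) * (?p\<^sup>2 * A + ?q\<^sup>2)" by (simp add: power2_eq_square)
      have nn: "0 \<le> ?p\<^sup>2 * A" using A by simp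
      have "?q\<^sup>2 \<le> \<tau>\<^sup>2 * A"
      proof (cases "?p\<^sup>2 * A + ?q\<^sup>2 > 0")
        case True
        then have "?p\<^sup>2 * A + ?q\<^sup>2 \<le> s\<^sup>2 * A" using le by (simp only: mult_le_cancel_right_pos)
        moreover have "(s\<^sup>2 - \<tau>\<^sup>2) * A \<le> ?p\<^sup>2 * A" using p2 A by (intro mult_right_mono) auto
        ultimately show ?thesis by (simp add: left_diff_distrib)
      next
        case False
        then have "?q\<^sup>2 \<le> 0" using nn by linarith
        then show ?thesis using A by (meson mult_nonneg_nonneg order_trans zero_le_power2)
      qed
      then have "sqrt (?q\<^sup>2) \<le> sqrt (\<tau>\<^sup>2 * A)" by (rule real_sqrt_le_mono)
      then show "\<bar>l k\<bar> \<le> \<tau> * sqrt (a k k)" using \<tau> by (simp add: real_sqrt_mult A_def)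
    qed
  qed
qed

text \<open>Induction on the functionals. The next one is treated in the orthogonal complement of
  the elements found so far, so the earlier bounds persist; removing the component along the new
  element does not raise the energy.\<close>

lemma orthogonal_small_functionals:
  assumes L: "\<And>j u v c. j < (n::nat) \<Longrightarrow> u \<in> V \<Longrightarrow> v \<in> V \<Longrightarrow> L j (\<lambda>x. u x + c * v x) = L j u + c * L j v"
    and B: "\<And>j u. j < n \<Longrightarrow> u \<in> V \<Longrightarrow> \<bar>L j u\<bar> \<le> B j * sqrt (a u u)" and \<tau>: "\<tau> > 0"
  shows "\<exists>r. (\<forall>j<n. r j \<in> V) \<and> (\<forall>u\<in>V. \<exists>c k. k \<in> V \<and> (\<forall>x. u x = k x + (\<Sum>j<n. c j * r j x)) \<and> (\<forall>j<n. a k (r j) = 0) \<and> a k k \<le> a u u) \<and>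
     (\<forall>k\<in>V. (\<forall>j<n. a k (r j) = 0) \<longrightarrow> (\<forall>j<n. \<bar>L j k\<bar> \<le> \<tau> * sqrt (a k k)))" using L B
proof (induction n)
  case 0
  show ?case by auto
next
  case (Suc n)
  have "\<exists>r. (\<forall>j<n. r j \<in> V) \<and> (\<forall>u\<in>V. \<exists>c k. k \<in> V \<and> (\<forall>x. u x = k x + (\<Sum>j<n. c j * r j x)) \<and> (\<forall>j<n. a k (r j) = 0) \<and> a k k \<le> a u u) \<and>
     (\<forall>k\<in>V. (\<forall>j<n. a k (r j) = 0) \<longrightarrow> (\<forall>j<n. \<bar>L j k\<bar> \<le> \<tau> * sqrt (a k k)))"
    using Suc.prems by (intro Suc.IH) auto
  then obtain r where r': "\<forall>j<n. r j \<in> V"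
    "\<forall>u\<in>V. \<exists>c k. k \<in> V \<and> (\<forall>x. u x = k x + (\<Sum>j<n. c j * r j x)) \<and> (\<forall>j<n. a k (r j) = 0) \<and> a k k \<le> a u u"
    "\<forall>k\<in>V. (\<forall>j<n. a k (r j) = 0) \<longrightarrow> (\<forall>j<n. \<bar>L j k\<bar> \<le> \<tau> * sqrt (a k k))" by (elim exE conjE) (rule that)
  note r = r'(1)[rule_format] bspec[OF r'(2)] r'(3)[rule_format]
  define W where "W = {k \<in> V. \<forall>j<n. a k (r j) = 0}"
  interpret W: semi_inner_space W a
  proof
    show "(\<lambda>_. 0) \<in> W" unfolding W_def using zero r(1) scale(3)[OF zero r(1), of _ 0] by auto
    show "(\<lambda>x. u x + c * v x) \<in> W" if "u \<in> W" "v \<in> W" for u v c using that closed add r(1) unfolding W_def by simp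
  qed (use add commute nonneg W_def in auto)
  obtain e where e: "e \<in> W" "\<And>u. u \<in> W \<Longrightarrow> \<exists>c. a (\<lambda>x. u x + c * e x) e = 0"
    "\<And>k. k \<in> W \<Longrightarrow> a k e = 0 \<Longrightarrow> \<bar>L n k\<bar> \<le> \<tau> * sqrt (a k k)"
    using W.near_maximiser[of "L n" "B n" \<tau>] Suc.prems[of n] \<tau> unfolding W_def by auto
  define r' where "r' = (\<lambda>j. if j < n then r j else e)"
  have eV: "e \<in> V" using e(1) by (simp add: W_def)
  have ort: "(\<forall>j<Suc n. a k (r' j) = 0) \<longleftrightarrow> (\<forall>j<n. a k (r j) = 0) \<and> a k e = 0" for k by (auto simp: r'_def less_Suc_eq)
  have D: "\<exists>c k. k \<in> V \<and> (\<forall>x. u x = k x + (\<Sum>j<Suc n. c j * r' j x)) \<and> (\<forall>j<Suc n. a k (r' j) = 0) \<and> a k k \<le> a u u"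
    if u: "u \<in> V" for u
  proof -
    obtain c k where k: "k \<in> V" "\<And>x. u x = k x + (\<Sum>j<n. c j * r j x)" "\<forall>j<n. a k (r j) = 0" "a k k \<le> a u u" using r(2)[OF u] by blast
    have kW: "k \<in> W" using k by (simp add: W_def)
    obtain d where d: "a (\<lambda>x. k x + d * e x) e = 0" using e(2)[OF kW] by blast
    let ?k = "\<lambda>x. k x + d * e x" and ?c = "\<lambda>j. if j < n then c j else - d"
    have kV: "?k \<in> W" by (rule W.closed[OF kW e(1)])
    have "a (\<lambda>x. ?k x + (- d) * e x) (\<lambda>x. ?k x + (- d) * e x) = a ?k ?k + 2 * (- d) * a ?k e + (- d)\<^sup>2 * a e e" by (rule W.expand[OF kV e(1)])
    then have "a k k = a ?k ?k + d\<^sup>2 * a e e" using d by simp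
    moreover have "0 \<le> d\<^sup>2 * a e e" using nonneg[OF eV] by simp
    ultimately have "a ?k ?k \<le> a u u" using k(4) by linarith
    moreover have "u x = ?k x + (\<Sum>j<Suc n. ?c j * r' j x)" for x using k(2)[of x] by (simp add: r'_def)
    ultimately show ?thesis using kV d unfolding ort W_def by (intro exI[of _ ?c] exI[of _ ?k]) auto
  qed
  show ?case
  proof (intro exI[of _ r'] conjI allI impI ballI)
    show "r' j \<in> V" if "j < Suc n" for j using r(1) eV by (simp add: r'_def)
    show "\<bar>L j k\<bar> \<le> \<tau> * sqrt (a k k)" if "k \<in> V" "\<forall>j<Suc n. a k (r' j) = 0" "j < Suc n" for k j
      using r(3)[of k j] e(3)[of k] that unfolding ort W_def by (cases "j = n") auto
  qed (rule D)
qed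

end

section \<open>Linear independence and spans modulo equality almost everywhere\<close>

lemma homogeneous_system:
  fixes M :: "'i \<Rightarrow> nat \<Rightarrow> real"
  assumes "finite I" "p < card I"
  shows "\<exists>d. (\<exists>i\<in>I. d i \<noteq> 0) \<and> (\<forall>j<p. (\<Sum>i\<in>I. d i * M i j) = 0)"
  using assms
proof (induction p arbitrary: I M)
  case 0
  then obtain i where "i \<in> I" by (metis card.empty ex_in_conv less_numeral_extra(3))
  then show ?case by (intro exI[of _ "\<lambda>_. 1"]) auto
next
  case (Suc p)
  show ?case
  proof (cases "\<forall>i\<in>I. M i p = 0")
    case True
    obtain d where "\<exists>i\<in>I. d i \<noteq> 0" "\<forall>j<p. (\<Sum>i\<in>I. d i * M i j) = 0" using Suc.IH[of I M] Suc.prems by auto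
    then show ?thesis using True by (intro exI[of _ d]) (auto simp: less_Suc_eq)
  next
    case False
    then obtain i0 where i0: "i0 \<in> I" "M i0 p \<noteq> 0" by blast
    let ?I = "I - {i0}"
    have "p < card ?I" using Suc.prems i0 by simp
    then obtain d where d: "\<exists>i\<in>?I. d i \<noteq> 0" "\<forall>j<p. (\<Sum>i\<in>?I. d i * (M i j - M i p / M i0 p * M i0 j)) = 0"
      using Suc.IH[of ?I "\<lambda>i j. M i j - M i p / M i0 p * M i0 j"] Suc.prems(1) by auto
    \<comment> \<open>The value at \<open>i0\<close> solves equation \<open>p\<close>. The
      coefficients passed to the induction hypothesis are those left after \<open>i0\<close> has
      been eliminated from the other equations.\<close>
    define d' where "d' = d(i0 := - (\<Sum>i\<in>?I. d i * M i p) / M i0 p)"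
    have s: "(\<Sum>i\<in>I. d' i * M i j) = (\<Sum>i\<in>?I. d i * M i j) - (\<Sum>i\<in>?I. d i * M i p) / M i0 p * M i0 j" for j
    proof -
      have "(\<Sum>i\<in>I. d' i * M i j) = d' i0 * M i0 j + (\<Sum>i\<in>?I. d' i * M i j)" by (rule sum.remove[OF Suc.prems(1) i0(1)])
      also have "(\<Sum>i\<in>?I. d' i * M i j) = (\<Sum>i\<in>?I. d i * M i j)" by (intro sum.cong) (auto simp: d'_def)
      finally show ?thesis by (simp add: d'_def)
    qed
    have "(\<Sum>i\<in>I. d' i * M i j) = 0" if "j < Suc p" for j
    proof (cases "j = p")
      case True
      then show ?thesis using s[of p] i0(2) by simp
    next
      case False
      then have "(\<Sum>i\<in>?I. d i * (M i j - M i p / M i0 p * M i0 j)) = 0" using d(2) that by simp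
      then have "(\<Sum>i\<in>?I. d i * M i j) = (\<Sum>i\<in>?I. d i * M i p * (M i0 j / M i0 p))" by (simp add: right_diff_distrib sum_subtractf mult_ac)
      then show ?thesis unfolding s sum_distrib_right[symmetric] by simp
    qed
    moreover have "\<exists>i\<in>I. d' i \<noteq> 0" using d(1) by (auto simp: d'_def)
    ultimately show ?thesis by blast
  qed
qed

lemma disjoint_bumps:
  fixes D :: "(real^'d) set"
  assumes D: "open D" "D \<noteq> {}"
  obtains g where "\<And>i. i \<le> (n::nat) \<Longrightarrow> g i \<in> test_functions D"
    "\<And>d i. (AE x in lebesgue_on D. (\<Sum>i\<le>n. d i * g i x) = 0) \<Longrightarrow> i \<le> n \<Longrightarrow> d i = 0"
proof -
  obtain x0 r where r: "r > 0" "ball x0 r \<subseteq> D" using D by (meson ex_in_conv open_contains_ball)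
  \<comment> \<open>\<open>n + 1\<close> balls of radius \<open>\<rho>\<close> in a row: the last
    one reaches to distance \<open>2 * \<rho> * n + \<rho>\<close> from \<open>x0\<close>, which is
    less than \<open>r\<close>.\<close>
  define \<rho> where "\<rho> = r / (2 * (real n + 1))"
  have rho: "\<rho> > 0" and rr: "r = 2 * (real n + 1) * \<rho>" using r(1) by (auto simp: \<rho>_def)
  let ?e = "axis undefined 1 :: real^'d"
  define q where "q i = x0 + (2 * \<rho> * real i) *\<^sub>R ?e" for i :: nat
  define g where "g i x = moll \<rho> (x - q i)" for i x
  have out: "g i x = 0" if "x \<notin> ball (q i) \<rho>" for i x unfolding g_def using that rho by (intro moll_eq_0) (auto simp: dist_norm norm_minus_commute)
  have sm0: "smooth (moll \<rho> :: real^'d \<Rightarrow> real)" using csmooth_moll[OF rho] unfolding csmooth_def by blast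
  have sm: "smooth (g i)" for i
  proof -
    from smooth_affine(1)[OF sm0, of 1 "- q i"] show ?thesis by (simp add: g_def[abs_def])
  qed
  have sub: "cball (q i) \<rho> \<subseteq> D" if "i \<le> n" for i
  proof -
    have "cball (q i) \<rho> \<subseteq> ball x0 r"
    proof
      fix x assume "x \<in> cball (q i) \<rho>"
      then have "dist x0 x \<le> dist x0 (q i) + \<rho>" using dist_triangle[of x0 x "q i"] by simp
      also have "dist x0 (q i) = 2 * \<rho> * real i" using rho by (simp add: q_def dist_norm norm_axis_1)
      also have "2 * \<rho> * real i + \<rho> < r" proof -
        have "\<rho> * real i \<le> \<rho> * real n" using that rho by simp
        moreover have "r = 2 * (\<rho> * real n) + 2 * \<rho>" by (simp add: rr algebra_simps)
        ultimately show ?thesis using rho by linarith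
      qed
      finally show "x \<in> ball x0 r" by simp
    qed
    then show ?thesis using r(2) by blast
  qed
  have tf: "g i \<in> test_functions D" if "i \<le> n" for i by (rule test_functionI[OF sm compact_cball sub[OF that]]) (use out[of _ i] in auto)
  have disj: "x \<notin> ball (q j) \<rho>" if "x \<in> ball (q i) \<rho>" "i \<noteq> j" for x i j
  proof
    assume "x \<in> ball (q j) \<rho>"
    then have "dist (q i) (q j) < 2 * \<rho>" using that(1) dist_triangle_less_add[of "q i" x \<rho> "q j" \<rho>] by (simp add: dist_commute)
    moreover have "dist (q i) (q j) = 2 * \<rho> * \<bar>real i - real j\<bar>"
    proof -
      have "q i - q j = (2 * \<rho> * (real i - real j)) *\<^sub>R ?e" by (simp add: q_def algebra_simps)
      then show ?thesis using rho by (simp add: dist_norm norm_axis_1 abs_mult)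
    qed
    moreover have "\<bar>real i - real j\<bar> \<ge> 1" using that(2) by linarith
    ultimately show False using rho mult_left_mono[of 1 "\<bar>real i - real j\<bar>" "2 * \<rho>"] by linarith
  qed
  have ind: "d i = 0" if ae: "AE x in lebesgue_on D. (\<Sum>i\<le>n. d i * g i x) = 0" and i: "i \<le> n" for d i
  proof (rule ccontr)
    assume ne: "d i \<noteq> 0"
    have "AE x in lebesgue_on D. g i x = 0" using ae
    proof eventually_elim
      case (elim x)
      show ?case
      proof (cases "x \<in> ball (q i) \<rho>")
        case True
        have "(\<Sum>j\<le>n. d j * g j x) = (\<Sum>j\<in>{i}. d j * g j x)" using i out disj[OF True] by (intro sum.mono_neutral_right) auto
        then show ?thesis using elim ne by simp
      qed (rule out)
    qed
    then have "(\<integral>x. g i x \<partial>lebesgue_on D) = 0" by (rule integral_eq_zero_AE)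
    moreover have "(\<integral>x. g i x \<partial>lebesgue_on D) = (\<integral>x. g i x \<partial>lborel)"
    proof (rule lebesgue_on_integral_compact_support[OF _ smooth_measurable[OF sm]])
      show "g i x = 0" if "x \<notin> D" for x using that sub[OF i] ball_subset_cball[of "q i" \<rho>] by (intro out) blast
    qed (use D(1) in simp)
    moreover have "\<dots> = 1" using lborel_integral_affine[OF smooth_measurable[OF sm0], of 1 "- q i"] moll_integral[OF rho, where 'd='d] by (simp add: g_def)
    ultimately show False by simp
  qed
  show ?thesis by (rule that[of g]) (use tf ind in blast)+
qed

definition ae_independent :: "(real^'d) set \<Rightarrow> nat \<Rightarrow> (nat \<Rightarrow> real^'d \<Rightarrow> real) \<Rightarrow> bool" where
  "ae_independent D n b \<longleftrightarrow> (\<forall>c::nat \<Rightarrow> real. (AE x in lebesgue_on D. (\<Sum>k<n. c k * b k x) = 0) \<longrightarrow> (\<forall>k<n. c k = 0))"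

definition ae_span :: "(real^'d) set \<Rightarrow> nat \<Rightarrow> (nat \<Rightarrow> real^'d \<Rightarrow> real) \<Rightarrow> (real^'d \<Rightarrow> real) set" where
  "ae_span D n b = {v. \<exists>c::nat \<Rightarrow> real. AE x in lebesgue_on D. v x = (\<Sum>k<n. c k * b k x)}"

lemma ae_independent_extend:
  assumes b: "ae_independent D n b" and v: "v \<notin> ae_span D n b"
  shows "ae_independent D (Suc n) (b(n := v))"
  unfolding ae_independent_def
proof (rule allI, rule impI)
  fix c assume ae: "AE x in lebesgue_on D. (\<Sum>k<Suc n. c k * (b(n := v)) k x) = 0"
  have cn: "c n = 0"
  proof (rule ccontr)
    assume ne: "c n \<noteq> 0"
    have "AE x in lebesgue_on D. v x = (\<Sum>k<n. (- c k / c n) * b k x)" using ae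
    proof eventually_elim
      case (elim x)
      then have "c n * v x = - (\<Sum>k<n. c k * b k x)" by simp
      also have "\<dots> = c n * (\<Sum>k<n. (- c k / c n) * b k x)" using ne by (simp add: sum_distrib_left sum_negf)
      finally show ?case using ne by simp
    qed
    then show False using v unfolding ae_span_def mem_Collect_eq not_ex by (elim allE[of _ "\<lambda>k. - c k / c n"]) blast
  qed
  then have "AE x in lebesgue_on D. (\<Sum>k<n. c k * b k x) = 0" using ae by simp
  then show "\<forall>k<Suc n. c k = 0" using b cn unfolding ae_independent_def less_Suc_eq by blast
qed

lemma ae_span_extend: "ae_span D n b \<subseteq> ae_span D (Suc n) (b(n := v))" "v \<in> ae_span D (Suc n) (b(n := v))"
proof -
  show "ae_span D n b \<subseteq> ae_span D (Suc n) (b(n := v))"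
  proof
    fix w assume "w \<in> ae_span D n b"
    then obtain c where c: "AE x in lebesgue_on D. w x = (\<Sum>k<n. c k * b k x)" unfolding ae_span_def by blast
    have "AE x in lebesgue_on D. w x = (\<Sum>k<Suc n. (c(n := 0)) k * (b(n := v)) k x)" using c by simp
    then show "w \<in> ae_span D (Suc n) (b(n := v))" unfolding ae_span_def mem_Collect_eq by (rule exI[of _ "c(n := 0)"])
  qed
  have "AE x in lebesgue_on D. v x = (\<Sum>k<Suc n. (if k = n then 1 else 0) * (b(n := v)) k x)" by simp
  then show "v \<in> ae_span D (Suc n) (b(n := v))" unfolding ae_span_def mem_Collect_eq by (rule exI[of _ "\<lambda>k. if k = n then 1 else 0"])
qed

lemma ae_span_sum:
  assumes "\<And>i. i \<in> I \<Longrightarrow> f i \<in> ae_span D n b" "finite I"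
  shows "(\<lambda>x. \<Sum>i\<in>I. d i * f i x) \<in> ae_span D n b"
proof -
  have "\<forall>i\<in>I. \<exists>c. AE x in lebesgue_on D. f i x = (\<Sum>k<n. c k * b k x)" using assms(1) unfolding ae_span_def by blast
  from bchoice[OF this] obtain c where c: "\<forall>i\<in>I. AE x in lebesgue_on D. f i x = (\<Sum>k<n. c i k * b k x)" by blast
  have "AE x in lebesgue_on D. \<forall>i\<in>I. f i x = (\<Sum>k<n. c i k * b k x)" using c assms(2) by (simp add: AE_finite_all)
  then have "AE x in lebesgue_on D. (\<Sum>i\<in>I. d i * f i x) = (\<Sum>k<n. (\<Sum>i\<in>I. d i * c i k) * b k x)"
  proof eventually_elim
    case (elim x)
    have "(\<Sum>i\<in>I. d i * f i x) = (\<Sum>i\<in>I. \<Sum>k<n. d i * c i k * b k x)" using elim by (simp add: sum_distrib_left mult.assoc)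
    also have "\<dots> = (\<Sum>k<n. (\<Sum>i\<in>I. d i * c i k) * b k x)" by (subst sum.swap) (simp add: sum_distrib_right)
    finally show ?case .
  qed
  then show ?thesis unfolding ae_span_def by (intro CollectI exI[of _ "\<lambda>k. \<Sum>i\<in>I. d i * c i k"])
qed

text \<open>\<open>n + 1\<close> bumps with disjoint supports are independent. If all of them lay in
  a span of \<open>n\<close> functions, a homogeneous system of \<open>n\<close> equations would
  give a nontrivial relation.\<close>

lemma outside_span:
  fixes D :: "(real^'d) set"
  assumes D: "open D" "D \<noteq> {}"
  shows "\<exists>v\<in>test_functions D. v \<notin> ae_span D n b"
proof (rule ccontr)
  assume "\<not> ?thesis"
  then have no': "\<forall>v\<in>test_functions D. v \<in> ae_span D n b" by simp
  obtain g where g: "\<And>i. i \<le> n \<Longrightarrow> g i \<in> test_functions D"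
    "\<And>d i. (AE x in lebesgue_on D. (\<Sum>i\<le>n. d i * g i x) = 0) \<Longrightarrow> i \<le> n \<Longrightarrow> d i = 0"
    by (rule disjoint_bumps[OF D, of n]) (rule that, blast+)
  have "\<forall>i\<in>{..n}. \<exists>c. AE x in lebesgue_on D. g i x = (\<Sum>k<n. c k * b k x)"
  proof
    fix i assume "i \<in> {..n}"
    then have "g i \<in> ae_span D n b" using g(1)[of i] bspec[OF no'] by simp
    then show "\<exists>c. AE x in lebesgue_on D. g i x = (\<Sum>k<n. c k * b k x)" by (simp only: ae_span_def mem_Collect_eq)
  qed
  from bchoice[OF this] obtain M where M: "\<forall>i\<in>{..n}. AE x in lebesgue_on D. g i x = (\<Sum>k<n. M i k * b k x)" by blast
  obtain d where d: "\<exists>i\<in>{..n}. d i \<noteq> 0" "\<forall>j<n. (\<Sum>i\<in>{..n}. d i * M i j) = 0" using homogeneous_system[of "{..n}" n M] by auto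
  have "AE x in lebesgue_on D. \<forall>i\<in>{..n}. g i x = (\<Sum>k<n. M i k * b k x)" using M by (simp add: AE_finite_all)
  then have "AE x in lebesgue_on D. (\<Sum>i\<le>n. d i * g i x) = 0"
  proof eventually_elim
    case (elim x)
    have "(\<Sum>i\<le>n. d i * g i x) = (\<Sum>i\<le>n. \<Sum>k<n. d i * M i k * b k x)" using elim by (simp add: sum_distrib_left mult.assoc)
    also have "\<dots> = (\<Sum>k<n. (\<Sum>i\<le>n. d i * M i k) * b k x)" by (subst sum.swap) (simp add: sum_distrib_right)
    also have "\<dots> = 0" using d(2) by simp
    finally show ?case .
  qed
  from g(2)[OF this] d(1) show False by auto
qed

text \<open>\<open>n_width\<close> asks for dimension exactly \<open>n\<close>. Functions already in
  the span are passed over, and the missing dimensions are filled up with test functions from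
  \<open>outside_span\<close>.\<close>

lemma basis_containing:
  fixes D :: "(real^'d) set"
  assumes D: "open D" "D \<noteq> {}" and V: "test_functions D \<subseteq> V" and f: "\<And>j. j < m \<Longrightarrow> f j \<in> V" and mn: "m \<le> n"
  obtains b where "\<And>k. k < n \<Longrightarrow> b k \<in> V" "ae_independent D n b" "\<And>j. j < m \<Longrightarrow> f j \<in> ae_span D n b"
proof -
  have "\<exists>p b. p \<le> m \<and> (\<forall>k<p. b k \<in> V) \<and> ae_independent D p b \<and> (\<forall>j<m. f j \<in> ae_span D p b)" using f
  proof (induction m)
    case 0
    show ?case by (intro exI[of _ 0]) (simp add: ae_independent_def)
  next
    case (Suc m)
    then obtain p b where b: "p \<le> m" "\<forall>k<p. b k \<in> V" "ae_independent D p b" "\<forall>j<m. f j \<in> ae_span D p b" by auto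
    show ?case
    proof (cases "f m \<in> ae_span D p b")
      case True
      then show ?thesis using b by (intro exI[of _ p] exI[of _ b]) (auto simp: less_Suc_eq)
    next
      case False
      have "\<forall>k<Suc p. (b(p := f m)) k \<in> V" using b(2) Suc.prems[of m] by (simp add: less_Suc_eq)
      moreover have "\<forall>j<Suc m. f j \<in> ae_span D (Suc p) (b(p := f m))"
        using b(4) ae_span_extend[where D=D and n=p and b=b and v="f m"] by (auto simp: less_Suc_eq)
      ultimately show ?thesis using b(1) ae_independent_extend[OF b(3) False] by blast
    qed
  qed
  then obtain p b where b: "p \<le> m" "\<forall>k<p. b k \<in> V" "ae_independent D p b" "\<forall>j<m. f j \<in> ae_span D p b" by blast
  have "p \<le> n" using b(1) mn by simp
  then have "\<exists>b. (\<forall>k<n. b k \<in> V) \<and> ae_independent D n b \<and> (\<forall>j<m. f j \<in> ae_span D n b)"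
  proof (induction n rule: dec_induct)
    case base
    show ?case using b by blast
  next
    case (step n)
    then obtain b where b: "\<forall>k<n. b k \<in> V" "ae_independent D n b" "\<forall>j<m. f j \<in> ae_span D n b" by blast
    obtain v where v: "v \<in> test_functions D" "v \<notin> ae_span D n b" using outside_span[OF D] by blast
    have "\<forall>k<Suc n. (b(n := v)) k \<in> V" using b(1) V v(1) by (auto simp: less_Suc_eq)
    moreover have "\<forall>j<m. f j \<in> ae_span D (Suc n) (b(n := v))" using b(3) ae_span_extend(1)[where D=D and n=n and b=b and v=v] by blast
    ultimately show ?case using ae_independent_extend[OF b(2) v(2)] by blast
  qed
  then show ?thesis using that by blast
qed

section \<open>Decay through the layers\<close>

lemma set_edist_posD:
  assumes "set_edist S T > 0"
  obtains \<delta> where "\<delta> > 0" "\<And>x y. x \<in> S \<Longrightarrow> y \<in> T \<Longrightarrow> \<delta> \<le> dist x y"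
proof -
  \<comment> \<open>\<open>set_edist\<close> is infinite when the second set is empty; a value
    strictly below it is finite in any case.\<close>
  obtain e where e: "0 < e" "e < set_edist S T" using dense[OF assms] by blast
  then obtain d where d: "e = ennreal d" "d \<ge> 0" by (cases e) auto
  show ?thesis
  proof (rule that)
    show "d > 0" using e(1) d by (simp add: ennreal_less_zero_iff)
    fix x y assume "x \<in> S" "y \<in> T"
    then have "set_edist S T \<le> ennreal (dist x y)" unfolding set_edist_def by (intro INF_lower2[of x] INF_lower2[of y]) auto
    then show "d \<le> dist x y" using e(2) d by (metis ennreal_le_iff less_imp_le order_trans zero_le_dist)
  qed
qed

lemma coeff_field_Linf:
  assumes "\<And>k l. (\<lambda>x. A x $ k $ l) \<in> Linf D" "\<And>x. x \<in> D \<Longrightarrow> transpose (A x) = A x" "0 < amin" "amin < amax"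
    "\<And>x \<xi>. x \<in> D \<Longrightarrow> amin * (norm \<xi>)\<^sup>2 \<le> (A x *v \<xi>) \<bullet> \<xi>" "\<And>x \<xi>. x \<in> D \<Longrightarrow> (A x *v \<xi>) \<bullet> \<xi> \<le> amax * (norm \<xi>)\<^sup>2"
  shows "coeff_field D amin amax A"
proof -
  have "\<exists>B\<ge>0. AE x in lebesgue_on D. \<bar>A x $ k $ l\<bar> \<le> B" for k l by (rule Linf_AE_bound[OF assms(1)[of k l]]) auto
  moreover have "(\<lambda>x. A x $ k $ l) \<in> borel_measurable (lebesgue_on D)" for k l using assms(1)[of k l] by (simp add: Linf_def)
  moreover have "0 < amax" using assms(3,4) by simp
  ultimately show ?thesis using assms(2,3,5,6) unfolding coeff_field_def by blast
qed

text \<open>Vanishing on the part of the boundary of \<open>D\<close> within distance \<open>\<delta>\<close> of \<open>W\<close> is expressed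
  by membership in \<open>H\<^sup>1\<^sub>0\<close> after multiplication by smooth functions supported there.\<close>

definition local_harmonic :: "(real^'d \<Rightarrow> real^'d^'d) \<Rightarrow> real \<Rightarrow> (real^'d) set \<Rightarrow> (real^'d) set \<Rightarrow> real \<Rightarrow>
    (real^'d \<Rightarrow> real) \<Rightarrow> (real^'d \<Rightarrow> real^'d) \<Rightarrow> bool" where
  "local_harmonic A \<epsilon> D W \<delta> u g \<longleftrightarrow> weakly_harmonic A \<epsilon> D u g \<and>
     (\<forall>s. smooth s \<and> (\<forall>x. \<delta> \<le> infdist x W \<longrightarrow> s x = 0) \<longrightarrow> H10w D (\<lambda>x. s x * u x) (\<lambda>x. s x *\<^sub>R g x + u x *\<^sub>R grad s x))"

locale oversampled =
  fixes D W :: "(real^'d) set" and A :: "real^'d \<Rightarrow> real^'d^'d" and amin amax \<delta> :: real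
  assumes D: "open D" "bounded D" and W: "open W" "W \<noteq> {}" "W \<subseteq> D" and A: "coeff_field D amin amax A" and \<delta>: "\<delta> > 0"
begin

lemma Ds: "D \<in> sets lebesgue" and Ws: "W \<in> sets lebesgue" and bW: "bounded W"
  using D W bounded_subset by auto

lemma amin_pos: "amin > 0" and amax_pos: "amax > 0" using A by (auto simp: coeff_field_def)

text \<open>Of the separation \<open>2 * \<delta>\<close> one half is for the support of the cutoff.
  The other half leaves around each boundary point of that support a ball in which the whole
  boundary of \<open>D\<close> belongs to \<open>\<Gamma>\<close>, so that the trace vanishes
  there.\<close>

lemma harmonic_space_local:
  assumes d: "CARD('d) \<ge> 2" and lip: "lipschitz_boundary D" and sep: "\<And>x y. x \<in> W \<Longrightarrow> y \<in> frontier D - \<Gamma> \<Longrightarrow> 2 * \<delta> \<le> dist x y"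
    and u: "u \<in> harmonic_space A \<epsilon> \<Gamma> D"
  shows "local_harmonic A \<epsilon> D W \<delta> u (weak_grad D u)"
proof -
  have uz: "u \<in> H1_zero_on D \<Gamma>" using u by (simp add: harmonic_space_def)
  then have w: "wgrad D u (weak_grad D u)" using H1_wgrad[OF D(1)] by (simp add: H1_zero_on_def)
  have "eform A \<epsilon> D u (weak_grad D u) v h = 0" if "H10w D v h" for v h
    using u H10w_imp_H10[OF D that] energy_form_eform[OF D(1) A w H10w_wgrad[OF Ds D(2) that], of \<epsilon>] by (simp add: harmonic_space_def)
  moreover have "H10w D (\<lambda>x. s x * u x) (\<lambda>x. s x *\<^sub>R weak_grad D u x + u x *\<^sub>R grad s x)"
    if s: "smooth s" "\<And>x. \<delta> \<le> infdist x W \<Longrightarrow> s x = 0" for s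
  proof (rule trace_zero_cutoff[OF d D lip uz w s(1)])
    fix x assume x: "x \<in> frontier D" "x \<in> closure {x. s x \<noteq> 0}"
    have "{x. s x \<noteq> 0} \<subseteq> {x. infdist x W \<le> \<delta>}" using s(2) by (auto simp: not_le intro: less_imp_le leI)
    then have "closure {x. s x \<noteq> 0} \<subseteq> {x. infdist x W \<le> \<delta>}" by (rule closure_minimal) (intro closed_Collect_le continuous_intros)
    then have i: "infdist x W \<le> \<delta>" using x(2) by blast
    have "y \<in> \<Gamma>" if y: "y \<in> frontier D" "y \<in> ball x \<delta>" for y
    proof (rule ccontr)
      assume "y \<notin> \<Gamma>"
      then have "\<And>w. w \<in> W \<Longrightarrow> 2 * \<delta> \<le> dist y w" using sep y(1) by (simp add: dist_commute)
      then have "2 * \<delta> \<le> infdist y W" unfolding infdist_notempty[OF W(2)] by (intro cINF_greatest W(2))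
      then show False using infdist_triangle[of y W x] i y(2) by (simp add: dist_commute)
    qed
    then show "\<exists>r>0. frontier D \<inter> ball x r \<subseteq> \<Gamma>" using \<delta> by blast
  qed
  ultimately show ?thesis using w unfolding local_harmonic_def weakly_harmonic_def by blast
qed

lemma local_harmonicD:
  assumes "local_harmonic A \<epsilon> D W \<delta> u g"
  shows "weakly_harmonic A \<epsilon> D u g" "wgrad D u g" "u \<in> L2 D" "g \<in> L2 D"
  using assms wgradD(1,2)[of D u g] by (auto simp: local_harmonic_def weakly_harmonic_def)

lemma local_harmonic_cutoff:
  assumes "local_harmonic A \<epsilon> D W \<delta> u g" "smooth s" "\<And>x. \<delta> \<le> infdist x W \<Longrightarrow> s x = 0"
  shows "H10w D (\<lambda>x. s x * u x) (\<lambda>x. s x *\<^sub>R g x + u x *\<^sub>R grad s x)"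
  using assms unfolding local_harmonic_def by blast

lemma local_harmonic_zero: "local_harmonic A \<epsilon> D W \<delta> (\<lambda>_. 0) (\<lambda>_. 0)"
proof -
  have "H10w D (\<lambda>_. 0) (\<lambda>_. 0)" using H10w_test[OF Ds test_functions_zero] by (simp add: grad_const[abs_def])
  then show ?thesis using wgrad_zero[OF Ds] by (auto simp: local_harmonic_def weakly_harmonic_def eform_def)
qed

lemma local_harmonic_add_cmult:
  assumes u: "local_harmonic A \<epsilon> D W \<delta> u g" and v: "local_harmonic A \<epsilon> D W \<delta> v h"
  shows "local_harmonic A \<epsilon> D W \<delta> (\<lambda>x. u x + c * v x) (\<lambda>x. g x + c *\<^sub>R h x)"
proof -
  note U = local_harmonicD[OF u] and V = local_harmonicD[OF v]
  have "wgrad D (\<lambda>x. u x + c * v x) (\<lambda>x. g x + c *\<^sub>R h x)" by (intro wgrad_add wgrad_cmult Ds U V)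
  moreover have "eform A \<epsilon> D (\<lambda>x. u x + c * v x) (\<lambda>x. g x + c *\<^sub>R h x) w p = 0" if "H10w D w p" for w p
  proof -
    have "w \<in> L2 D" "p \<in> L2 D" using that by (auto simp: H10w_def)
    from eform_add_cmult[OF A U(3,4) V(3,4) this] show ?thesis using U(1) V(1) that by (simp add: weakly_harmonic_def)
  qed
  moreover have "H10w D (\<lambda>x. s x * (u x + c * v x)) (\<lambda>x. s x *\<^sub>R (g x + c *\<^sub>R h x) + (u x + c * v x) *\<^sub>R grad s x)"
    if s: "smooth s" "\<And>x. \<delta> \<le> infdist x W \<Longrightarrow> s x = 0" for s
  proof -
    have e: "(\<lambda>x. s x * (u x + c * v x)) = (\<lambda>x. s x * u x + c * (s x * v x))"
      "(\<lambda>x. s x *\<^sub>R (g x + c *\<^sub>R h x) + (u x + c * v x) *\<^sub>R grad s x) = (\<lambda>x. (s x *\<^sub>R g x + u x *\<^sub>R grad s x) + c *\<^sub>R (s x *\<^sub>R h x + v x *\<^sub>R grad s x))"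
      by (auto simp: fun_eq_iff algebra_simps)
    show ?thesis unfolding e by (intro H10w_add H10w_cmult Ds local_harmonic_cutoff[OF u s] local_harmonic_cutoff[OF v s])
  qed
  ultimately show ?thesis unfolding local_harmonic_def weakly_harmonic_def by blast
qed

text \<open>This takes the place of \<open>harmonic_space\<close>, which it contains under the
  assumptions of \<open>harmonic_space_local\<close>. Linear combinations can be formed through
  \<open>H10w\<close> without adding up traces.\<close>

definition harmonic_functions :: "real \<Rightarrow> (real^'d \<Rightarrow> real) set" where
  "harmonic_functions \<epsilon> = {u. \<exists>g. local_harmonic A \<epsilon> D W \<delta> u g}"

lemma energy_form_local:
  "local_harmonic A \<epsilon> D W \<delta> u g \<Longrightarrow> local_harmonic A \<epsilon> D W \<delta> v h \<Longrightarrow> energy_form A \<epsilon> D u v = eform A \<epsilon> D u g v h"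
  by (rule energy_form_eform[OF D(1) A local_harmonicD(2) local_harmonicD(2)])

lemma semi_inner_space_harmonic: "semi_inner_space (harmonic_functions \<epsilon>) (energy_form A \<epsilon> D)"
proof
  show "(\<lambda>_. 0) \<in> harmonic_functions \<epsilon>" using local_harmonic_zero unfolding harmonic_functions_def by blast
  show "(\<lambda>x. u x + c * v x) \<in> harmonic_functions \<epsilon>" if "u \<in> harmonic_functions \<epsilon>" "v \<in> harmonic_functions \<epsilon>" for u v c
    using that local_harmonic_add_cmult unfolding harmonic_functions_def by blast
  fix u v w c assume "u \<in> harmonic_functions \<epsilon>" "v \<in> harmonic_functions \<epsilon>" "w \<in> harmonic_functions \<epsilon>"
  then obtain g h p where l: "local_harmonic A \<epsilon> D W \<delta> u g" "local_harmonic A \<epsilon> D W \<delta> v h" "local_harmonic A \<epsilon> D W \<delta> w p"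
    unfolding harmonic_functions_def by blast
  show "energy_form A \<epsilon> D (\<lambda>x. u x + c * v x) w = energy_form A \<epsilon> D u w + c * energy_form A \<epsilon> D v w"
    unfolding energy_form_local[OF local_harmonic_add_cmult[OF l(1,2)] l(3)] energy_form_local[OF l(1,3)] energy_form_local[OF l(2,3)]
    by (rule eform_add_cmult[OF A]) (rule local_harmonicD[OF l(1)] local_harmonicD[OF l(2)] local_harmonicD[OF l(3)])+
next
  fix u v assume "u \<in> harmonic_functions \<epsilon>" "v \<in> harmonic_functions \<epsilon>"
  then obtain g h where l: "local_harmonic A \<epsilon> D W \<delta> u g" "local_harmonic A \<epsilon> D W \<delta> v h" unfolding harmonic_functions_def by blast
  show "energy_form A \<epsilon> D u v = energy_form A \<epsilon> D v u" unfolding energy_form_local[OF l] energy_form_local[OF l(2,1)] by (rule eform_commute[OF A])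
next
  fix u assume "u \<in> harmonic_functions \<epsilon>"
  then obtain g where l: "local_harmonic A \<epsilon> D W \<delta> u g" unfolding harmonic_functions_def by blast
  show "0 \<le> energy_form A \<epsilon> D u u" unfolding energy_form_local[OF l l] by (rule eform_nonneg(1)[OF A local_harmonicD(3,4)[OF l]])
qed

lemma nrm_le_energy:
  assumes "local_harmonic A \<epsilon> D W \<delta> u g" shows "nrm D u \<le> sqrt (energy_form A \<epsilon> D u u)"
  unfolding energy_form_local[OF assms assms] by (rule eform_nonneg(2)[OF A local_harmonicD(3,4)[OF assms]])

definition layer :: "real \<Rightarrow> (real^'d) set" where
  "layer t = {x \<in> D. infdist x W \<le> t}"

lemma layer_sets: "layer t \<in> sets lebesgue"
proof -
  have "closed {x. infdist x W \<le> t}" by (intro closed_Collect_le continuous_intros)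
  then have "D \<inter> {x. infdist x W \<le> t} \<in> sets lebesgue" using D(1) by (intro sets.Int) auto
  moreover have "D \<inter> {x. infdist x W \<le> t} = layer t" by (auto simp: layer_def)
  ultimately show ?thesis by simp
qed

lemma layer_subset: "layer t \<subseteq> D" by (auto simp: layer_def)

text \<open>Caccioppoli's estimate for \<open>s k\<close>, followed by the Poincare inequality on
  the grid. The gradient of \<open>s\<close> vanishes off \<open>layer b\<close>, so only the norm
  of \<open>k\<close> on that layer enters on the right.\<close>

lemma layer_decay:
  assumes \<epsilon>: "\<epsilon> > 0" and k: "local_harmonic A \<epsilon> D W \<delta> k g" and ab: "a < b" "b \<le> \<delta>" and h: "h > 0" and P: "D \<subseteq> ball 0 (h * real P)"
    and s: "smooth s" "\<And>x. infdist x W \<le> a \<Longrightarrow> s x = 1" "\<And>x. infdist x W \<ge> b \<Longrightarrow> s x = 0" "\<And>x. norm (grad s x) \<le> G"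
  shows "(nrm (layer a) k)\<^sup>2 \<le> poincare_const TYPE('d) * h\<^sup>2 * (amax / amin * (G * nrm (layer b) k)\<^sup>2)
    + (\<Sum>z\<in>cell_indices P. (cell_avg D h z (\<lambda>x. s x * k x))\<^sup>2) / h ^ CARD('d)"
proof -
  note K = local_harmonicD[OF k]
  have G: "G \<ge> 0" using s(4)[of 0] norm_ge_zero order_trans by blast
  have z: "s x = 0" if "infdist x W \<ge> \<delta>" for x using s(3) that ab(2) by auto
  define p where "p = (\<lambda>x. s x *\<^sub>R g x + k x *\<^sub>R grad s x)"
  have H: "H10w D (\<lambda>x. s x * k x) p" unfolding p_def by (rule local_harmonic_cutoff[OF k s(1) z])
  have pL: "(\<lambda>x. s x * k x) \<in> L2 D" "p \<in> L2 D" using H by (auto simp: H10w_def)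
  have gs: "(\<lambda>x. k x *\<^sub>R grad s x) \<in> L2 D"
  proof (rule L2_bmult_vec(1)[OF _ _ G K(3)])
    show "grad s \<in> borel_measurable (lebesgue_on D)" using smooth_L2(2)[OF s(1) D(2) Ds] by (rule L2_measurable)
  qed (use s(4) in simp)
  \<comment> \<open>\<open>s * s\<close> is again an admissible cutoff, so the test function of
    Caccioppoli's estimate belongs to the space.\<close>
  have q: "H10w D (\<lambda>x. s x * (s x * k x)) (\<lambda>x. s x *\<^sub>R p x + (s x * k x) *\<^sub>R grad s x)"
  proof -
    have "H10w D (\<lambda>x. (s x * s x) * k x) (\<lambda>x. (s x * s x) *\<^sub>R g x + k x *\<^sub>R grad (\<lambda>x. s x * s x) x)"
      by (rule local_harmonic_cutoff[OF k smooth_mult[OF s(1) s(1)]]) (simp add: z)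
    moreover have "(\<lambda>x. (s x * s x) *\<^sub>R g x + k x *\<^sub>R grad (\<lambda>x. s x * s x) x) = (\<lambda>x. s x *\<^sub>R p x + (s x * k x) *\<^sub>R grad s x)"
      unfolding p_def grad_mult[OF smooth_differentiable[OF s(1)] smooth_differentiable[OF s(1)]] by (simp add: fun_eq_iff scaleR_add_right mult.commute add.commute)
    ultimately show ?thesis by (simp add: mult.assoc)
  qed
  have "nrm D (\<lambda>x. k x *\<^sub>R grad s x) \<le> nrm (layer b) (\<lambda>x. G * k x)"
  proof (rule nrm_le_subset[OF layer_subset layer_sets Ds L2_cmult[OF L2_subset(1)[OF layer_subset layer_sets Ds K(3)]]])
    fix x assume "x \<in> D" "x \<notin> layer b"
    then have x: "x \<in> {x. b < infdist x W}" by (auto simp: layer_def)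
    have "open {x. b < infdist x W}" by (intro open_Collect_less continuous_intros)
    from grad_eq_0[OF this x, of s 0] show "k x *\<^sub>R grad s x = 0" using s(3) by auto
  next
    fix x show "norm (k x *\<^sub>R grad s x) \<le> norm (G * k x)"
      using mult_left_mono[OF s(4)[of x], of "\<bar>k x\<bar>"] G by (simp add: abs_mult mult.commute)
  qed
  then have sup: "nrm D (\<lambda>x. k x *\<^sub>R grad s x) \<le> G * nrm (layer b) k" using G by (simp add: nrm_cmult)
  have "\<epsilon>\<^sup>2 * (amin * (nrm D p)\<^sup>2) \<le> eform A \<epsilon> D (\<lambda>x. s x * k x) p (\<lambda>x. s x * k x) p"
    using eform_lower[OF A pL, of \<epsilon>] by (smt (verit) zero_le_power2)
  also have "\<dots> \<le> \<epsilon>\<^sup>2 * (amax * (nrm D (\<lambda>x. k x *\<^sub>R grad s x))\<^sup>2)"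
    by (rule caccioppoli[OF A K(1) pL(2,1) _ gs q]) (simp_all add: p_def)
  also have "\<dots> \<le> \<epsilon>\<^sup>2 * (amax * (G * nrm (layer b) k)\<^sup>2)" using amax_pos by (intro mult_left_mono power_mono sup) auto
  finally have "amin * (nrm D p)\<^sup>2 \<le> amax * (G * nrm (layer b) k)\<^sup>2" using \<epsilon> by simp
  then have pb: "(nrm D p)\<^sup>2 \<le> amax / amin * (G * nrm (layer b) k)\<^sup>2" using amin_pos by (simp add: field_simps)
  have "nrm (layer a) k = nrm (layer a) (\<lambda>x. s x * k x)"
    unfolding nrm_def using s(2) by (intro arg_cong[of _ _ sqrt] Bochner_Integration.integral_cong refl) (auto simp: layer_def)
  also have "\<dots> \<le> nrm D (\<lambda>x. s x * k x)" by (rule L2_subset(2)[OF layer_subset layer_sets Ds pL(1)])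
  finally have "(nrm (layer a) k)\<^sup>2 \<le> (nrm D (\<lambda>x. s x * k x))\<^sup>2" by (intro power_mono) auto
  also have "\<dots> \<le> poincare_const TYPE('d) * h\<^sup>2 * (nrm D p)\<^sup>2 + (\<Sum>z\<in>cell_indices P. (cell_avg D h z (\<lambda>x. s x * k x))\<^sup>2) / h ^ CARD('d)"
    by (rule cell_poincare[OF D P h H])
  also have "\<dots> \<le> poincare_const TYPE('d) * h\<^sup>2 * (amax / amin * (G * nrm (layer b) k)\<^sup>2) + (\<Sum>z\<in>cell_indices P. (cell_avg D h z (\<lambda>x. s x * k x))\<^sup>2) / h ^ CARD('d)"
    using pb by (intro add_right_mono mult_left_mono) (auto simp: poincare_const_def)
  finally show ?thesis .
qed

text \<open>There is one functional for each pair of a layer and a cell, and \<open>f\<close>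
  enumerates the pairs. They are bounded because the energy dominates the \<open>L\<^sup>2\<close>
  norm, so \<open>orthogonal_small_functionals\<close> applies.\<close>

lemma small_functionals:
  assumes s: "\<And>m. m < N \<Longrightarrow> smooth (s m)" "\<And>m x. m < N \<Longrightarrow> 0 \<le> s m x" "\<And>m x. m < N \<Longrightarrow> s m x \<le> 1" and \<tau>: "\<tau> > 0"
    and n: "n = N * card (cell_indices P :: ('d \<Rightarrow> int) set)"
  shows "\<exists>r. (\<forall>j<n. r j \<in> harmonic_functions \<epsilon>) \<and> (\<forall>u\<in>harmonic_functions \<epsilon>. \<exists>c k. k \<in> harmonic_functions \<epsilon> \<and>
      (\<forall>x. u x = k x + (\<Sum>j<n. c j * r j x)) \<and> energy_form A \<epsilon> D k k \<le> energy_form A \<epsilon> D u u \<and>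
      (\<forall>m<N. \<forall>z\<in>cell_indices P. \<bar>cell_avg D h z (\<lambda>x. s m x * k x)\<bar> \<le> \<tau> * sqrt (energy_form A \<epsilon> D k k)))"
proof -
  interpret semi_inner_space "harmonic_functions \<epsilon>" "energy_form A \<epsilon> D" by (rule semi_inner_space_harmonic)
  let ?I = "{..<N} \<times> (cell_indices P :: ('d \<Rightarrow> int) set)"
  obtain f where f: "bij_betw f {0..<card ?I} ?I" using ex_bij_betw_nat_finite[of ?I] by auto
  have nI: "card ?I = n" by (simp add: n card_cartesian_product)
  define L where "L = (\<lambda>j u. cell_avg D h (snd (f j)) (\<lambda>x. s (fst (f j)) x * u x))"
  have fj: "fst (f j) < N" if "j < n" for j
  proof -
    have "f j \<in> ?I" using bspec[OF bij_betwE[OF f], of j] that nI by simp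
    then show ?thesis by (simp add: mem_Times_iff)
  qed
  have L2s: "(\<lambda>x. s m x * u x) \<in> L2 D" "nrm D (\<lambda>x. s m x * u x) \<le> 1 * nrm D u" if "m < N" "u \<in> L2 D" for m u
  proof -
    have "s m \<in> borel_measurable (lebesgue_on D)" using smooth_L2(1)[OF s(1)[OF that(1)] D(2) Ds] by (rule L2_measurable)
    moreover have "AE x in lebesgue_on D. \<bar>s m x\<bar> \<le> 1" using s(2,3)[OF that(1)] by simp
    ultimately show "(\<lambda>x. s m x * u x) \<in> L2 D" "nrm D (\<lambda>x. s m x * u x) \<le> 1 * nrm D u" using L2_bmult[of "s m" D 1 u] that(2) by simp_all
  qed
  note iL = cell_indicator_L2[OF Ds D(2), of h]
  have L: "L j (\<lambda>x. u x + c * v x) = L j u + c * L j v"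
    if j: "j < n" and uv: "u \<in> harmonic_functions \<epsilon>" "v \<in> harmonic_functions \<epsilon>" for j u v c
  proof -
    have "u \<in> L2 D" "v \<in> L2 D" using uv local_harmonicD(3) unfolding harmonic_functions_def by blast+
    note i = L2_mult(1)[OF iL L2s(1)[OF fj[OF j] this(1)], of "snd (f j)"] L2_mult(1)[OF iL L2s(1)[OF fj[OF j] this(2)], of "snd (f j)"]
    have "(\<lambda>x. indicator (cell h (snd (f j))) x * (s (fst (f j)) x * (u x + c * v x)))
      = (\<lambda>x. indicator (cell h (snd (f j))) x * (s (fst (f j)) x * u x) + c * (indicator (cell h (snd (f j))) x * (s (fst (f j)) x * v x)))"
      by (simp add: fun_eq_iff algebra_simps)
    then show ?thesis unfolding L_def cell_avg_def using i by simp
  qed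
  have B: "\<bar>L j u\<bar> \<le> nrm D (indicator (cell h (snd (f j))) :: _ \<Rightarrow> real) * sqrt (energy_form A \<epsilon> D u u)"
    if j: "j < n" and u: "u \<in> harmonic_functions \<epsilon>" for j u
  proof -
    obtain g where g: "local_harmonic A \<epsilon> D W \<delta> u g" using u unfolding harmonic_functions_def by blast
    note uL = local_harmonicD(3)[OF g]
    have "\<bar>L j u\<bar> \<le> nrm D (indicator (cell h (snd (f j))) :: _ \<Rightarrow> real) * nrm D (\<lambda>x. s (fst (f j)) x * u x)"
      unfolding L_def cell_avg_def by (rule L2_mult(2)[OF iL L2s(1)[OF fj[OF j] uL]])
    also have "\<dots> \<le> nrm D (indicator (cell h (snd (f j))) :: _ \<Rightarrow> real) * sqrt (energy_form A \<epsilon> D u u)"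
      using L2s(2)[OF fj[OF j] uL] nrm_le_energy[OF g] by (intro mult_left_mono) auto
    finally show ?thesis .
  qed
  obtain r where r: "\<forall>j<n. r j \<in> harmonic_functions \<epsilon>"
    "\<forall>u\<in>harmonic_functions \<epsilon>. \<exists>c k. k \<in> harmonic_functions \<epsilon> \<and> (\<forall>x. u x = k x + (\<Sum>j<n. c j * r j x)) \<and>
       (\<forall>j<n. energy_form A \<epsilon> D k (r j) = 0) \<and> energy_form A \<epsilon> D k k \<le> energy_form A \<epsilon> D u u"
    "\<forall>k\<in>harmonic_functions \<epsilon>. (\<forall>j<n. energy_form A \<epsilon> D k (r j) = 0) \<longrightarrow> (\<forall>j<n. \<bar>L j k\<bar> \<le> \<tau> * sqrt (energy_form A \<epsilon> D k k))"
    by (rule exE[OF orthogonal_small_functionals[where L = L and n = n and B = "\<lambda>j. nrm D (indicator (cell h (snd (f j))) :: _ \<Rightarrow> real)", OF _ _ \<tau>]];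
        (rule L B; assumption | elim conjE; rule that; assumption))
  show ?thesis
  proof (intro exI[of _ r] conjI r(1) ballI)
    fix u assume "u \<in> harmonic_functions \<epsilon>"
    then obtain c k where k: "k \<in> harmonic_functions \<epsilon>" "\<forall>x. u x = k x + (\<Sum>j<n. c j * r j x)"
       "\<forall>j<n. energy_form A \<epsilon> D k (r j) = 0" "energy_form A \<epsilon> D k k \<le> energy_form A \<epsilon> D u u" using bspec[OF r(2)] by blast
    have "\<bar>cell_avg D h z (\<lambda>x. s m x * k x)\<bar> \<le> \<tau> * sqrt (energy_form A \<epsilon> D k k)" if "m < N" "z \<in> cell_indices P" for m z
    proof -
      have "(m, z) \<in> f ` {0..<card ?I}" using f that by (simp add: bij_betw_def)
      then obtain j where "j < n" "f j = (m, z)" unfolding nI by auto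
      moreover have "\<bar>L j k\<bar> \<le> \<tau> * sqrt (energy_form A \<epsilon> D k k)" using r(3) k(1,3) \<open>j < n\<close> by blast
      ultimately show ?thesis by (simp add: L_def)
    qed
    then show "\<exists>c k. k \<in> harmonic_functions \<epsilon> \<and> (\<forall>x. u x = k x + (\<Sum>j<n. c j * r j x)) \<and> energy_form A \<epsilon> D k k \<le> energy_form A \<epsilon> D u u \<and>
      (\<forall>m<N. \<forall>z\<in>cell_indices P. \<bar>cell_avg D h z (\<lambda>x. s m x * k x)\<bar> \<le> \<tau> * sqrt (energy_form A \<epsilon> D k k))"
      using k by blast
  qed
qed

text \<open>The constant of \<open>layer_decay\<close> for cutoffs with gradient bound
  \<open>2 * N / \<delta>\<close> and cells of side \<open>h0 / N\<close>, up to the factor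
  \<open>h0\<^sup>2\<close>. The powers of \<open>N\<close> cancel.\<close>

definition rate :: real where
  "rate = poincare_const TYPE('d) * (amax / amin * (2 / \<delta>)\<^sup>2)"

text \<open>The domain is divided into \<open>N\<close> layers and the cells have side \<open>h0 / N\<close>, where \<open>h0\<close> makes
  the energy lose a factor \<open>e\<^sup>2\<close> from one layer to the next.\<close>

lemma exponential_decay:
  assumes h0: "h0 > 0" "rate * h0\<^sup>2 = exp (- 2) / 2" and P: "P > 0" "D \<subseteq> ball 0 (h0 * real P)" and N: "N > 0" and \<epsilon>: "\<epsilon> > 0"
    and n: "n = N * (2 * (P * N)) ^ CARD('d)"
  shows "\<exists>r. (\<forall>j<n. r j \<in> harmonic_functions \<epsilon>) \<and> (\<forall>u\<in>harmonic_functions \<epsilon>. \<exists>c k. k \<in> harmonic_functions \<epsilon> \<and>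
      (\<forall>x. u x = k x + (\<Sum>j<n. c j * r j x)) \<and> nrm W k \<le> exp (- real N) * sqrt (energy_form A \<epsilon> D u u))"
proof -
  define h where "h = h0 / real N"
  \<comment> \<open>Distances from \<open>W\<close> that decrease from \<open>\<delta>\<close> at
    \<open>m = 0\<close> to \<open>0\<close> at \<open>m = N\<close>.\<close>
  define t where "t m = (1 - real m / real N) * \<delta>" for m
  define G where "G = 2 / (\<delta> / real N)"
  let ?Z = "cell_indices (P * N) :: ('d \<Rightarrow> int) set"
  have h: "h > 0" using h0 N by (simp add: h_def)
  have cZ: "card ?Z > 0" using P N by (simp add: card_cell_indices)
  have hP: "D \<subseteq> ball 0 (h * real (P * N))" using P(2) N by (simp add: h_def)
  have td: "t m - t (Suc m) = \<delta> / real N" for m using N by (simp add: t_def field_simps)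
  have dN: "\<delta> / real N > 0" using \<delta> N by simp
  have t: "t (Suc m) < t m" for m using td[of m] dN by linarith
  have "\<exists>s. cutoff G s \<and> (\<forall>x. infdist x W \<le> t (Suc m) \<longrightarrow> s x = 1) \<and> (\<forall>x. t m \<le> infdist x W \<longrightarrow> s x = 0)" for m
    using infdist_cutoff[OF bW W(2) t[of m]] unfolding td G_def by metis
  then obtain s where cs: "\<And>m. cutoff G (s m)" and s': "\<And>m x. infdist x W \<le> t (Suc m) \<Longrightarrow> s m x = 1"
    "\<And>m x. t m \<le> infdist x W \<Longrightarrow> s m x = 0" by metis
  note s = cutoffD(1-3)[OF cs] s' cutoffD(4)[OF cs]
  define q where "q = real (card ?Z)"
  have q: "q > 0" using cZ by (simp only: q_def of_nat_0_less_iff)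
  \<comment> \<open>Chosen so that the averages over all \<open>q\<close> cells together contribute
    at most \<open>exp (- 2 * real N) / 2\<close> times the energy to the squared norm.\<close>
  define \<tau> where "\<tau> = sqrt (exp (- 2 * real N) * h ^ CARD('d) / (2 * q))"
  have \<tau>: "\<tau> > 0" "q * \<tau>\<^sup>2 / h ^ CARD('d) = exp (- 2 * real N) / 2" using h q by (simp_all add: \<tau>_def field_simps)
  have "n = N * card ?Z" by (simp add: n card_cell_indices)
  from small_functionals[where s = s and N = N, OF s(1-3) \<tau>(1) this, of \<epsilon> h]
  obtain r where r: "\<forall>j<n. r j \<in> harmonic_functions \<epsilon>"
    "\<forall>u\<in>harmonic_functions \<epsilon>. \<exists>c k. k \<in> harmonic_functions \<epsilon> \<and>
      (\<forall>x. u x = k x + (\<Sum>j<n. c j * r j x)) \<and> energy_form A \<epsilon> D k k \<le> energy_form A \<epsilon> D u u \<and>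
      (\<forall>m<N. \<forall>z\<in>?Z. \<bar>cell_avg D h z (\<lambda>x. s m x * k x)\<bar> \<le> \<tau> * sqrt (energy_form A \<epsilon> D k k))" by (elim exE conjE) (rule that)
  have "nrm W k \<le> exp (- real N) * sqrt (energy_form A \<epsilon> D k k)"
    if k: "k \<in> harmonic_functions \<epsilon>" and avg: "\<forall>m<N. \<forall>z\<in>?Z. \<bar>cell_avg D h z (\<lambda>x. s m x * k x)\<bar> \<le> \<tau> * sqrt (energy_form A \<epsilon> D k k)" for k
  proof -
    obtain g where g: "local_harmonic A \<epsilon> D W \<delta> k g" using k unfolding harmonic_functions_def by blast
    define e where "e = energy_form A \<epsilon> D k k"
    have e0: "e \<ge> 0" and ke: "(nrm D k)\<^sup>2 \<le> e"
      using semi_inner_space.nonneg[OF semi_inner_space_harmonic k] power_mono[OF nrm_le_energy[OF g] nrm_nonneg, of 2] by (simp_all add: e_def)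
    note kL = local_harmonicD(3)[OF g]
    have "(nrm (layer (t m)) k)\<^sup>2 \<le> exp (- 2 * real m) * e" if "m \<le> N" for m using that
    proof (induction m)
      case 0
      have "(nrm (layer (t 0)) k)\<^sup>2 \<le> (nrm D k)\<^sup>2" by (intro power_mono L2_subset(2)[OF layer_subset layer_sets Ds kL]) auto
      from order_trans[OF this ke] show ?case by simp
    next
      case (Suc m)
      let ?x = "(nrm (layer (t m)) k)\<^sup>2"
      have tm: "t m \<le> \<delta>" using \<delta> by (simp add: t_def mult_le_cancel_right1)
      have "(nrm (layer (t (Suc m))) k)\<^sup>2 \<le> poincare_const TYPE('d) * h\<^sup>2 * (amax / amin * (G * nrm (layer (t m)) k)\<^sup>2)
        + (\<Sum>z\<in>?Z. (cell_avg D h z (\<lambda>x. s m x * k x))\<^sup>2) / h ^ CARD('d)" by (rule layer_decay[OF \<epsilon> g t tm h hP s(1,4,5,6)])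
      also have "poincare_const TYPE('d) * h\<^sup>2 * (amax / amin * (G * nrm (layer (t m)) k)\<^sup>2) = (rate * h0\<^sup>2) * ?x"
        using N \<delta> unfolding rate_def h_def G_def by (simp add: power_mult_distrib power_divide)
      also have "(\<Sum>z\<in>?Z. (cell_avg D h z (\<lambda>x. s m x * k x))\<^sup>2) \<le> (\<Sum>z\<in>?Z. \<tau>\<^sup>2 * e)"
      proof (rule sum_mono)
        fix z assume "z \<in> ?Z"
        then have "\<bar>cell_avg D h z (\<lambda>x. s m x * k x)\<bar> \<le> \<tau> * sqrt e" using avg Suc.prems by (simp add: e_def)
        from power_mono[OF this abs_ge_zero, of 2] show "(cell_avg D h z (\<lambda>x. s m x * k x))\<^sup>2 \<le> \<tau>\<^sup>2 * e"
          using e0 by (simp add: power_mult_distrib)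
      qed
      also have "(rate * h0\<^sup>2) * ?x + (\<Sum>z\<in>?Z. \<tau>\<^sup>2 * e) / h ^ CARD('d) = (exp (- 2) / 2) * ?x + (q * \<tau>\<^sup>2 / h ^ CARD('d)) * e"
        unfolding h0(2) q_def by simp
      \<comment> \<open>One half of the target comes from the previous layer, the other half from
        the averages, since \<open>Suc m \<le> N\<close>.\<close>
      also have "\<dots> \<le> (exp (- 2) / 2) * (exp (- 2 * real m) * e) + (exp (- 2 * real (Suc m)) / 2) * e"
        unfolding \<tau>(2) using Suc e0 by (intro add_mono mult_left_mono mult_right_mono divide_right_mono) auto
      also have "\<dots> = exp (- 2 * real (Suc m)) * e" by (simp add: exp_add[symmetric] algebra_simps)
      finally show ?case using h by (simp add: divide_right_mono)
    qed
    from this[of N] have "(nrm (layer (t N)) k)\<^sup>2 \<le> exp (- 2 * real N) * e" by simp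
    also have "\<dots> = (exp (- real N) * sqrt e)\<^sup>2" using e0 by (simp add: power_mult_distrib exp_double[symmetric])
    finally have "nrm (layer (t N)) k \<le> exp (- real N) * sqrt e" by (rule power2_le_imp_le) (use e0 in simp)
    moreover have "nrm W k \<le> nrm (layer (t N)) k"
    proof (rule L2_subset(2)[OF _ Ws layer_sets L2_subset(1)[OF layer_subset layer_sets Ds kL]])
      show "W \<subseteq> layer (t N)" using W(3) N by (auto simp: layer_def t_def)
    qed
    ultimately show ?thesis by (simp add: e_def)
  qed
  then have "nrm W k \<le> exp (- real N) * sqrt (energy_form A \<epsilon> D u u)"
    if "k \<in> harmonic_functions \<epsilon>" "energy_form A \<epsilon> D k k \<le> energy_form A \<epsilon> D u u"
      "\<forall>m<N. \<forall>z\<in>?Z. \<bar>cell_avg D h z (\<lambda>x. s m x * k x)\<bar> \<le> \<tau> * sqrt (energy_form A \<epsilon> D k k)" for k u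
    using that by (meson exp_ge_zero mult_left_mono order_trans real_sqrt_le_mono)
  then show ?thesis using r by (intro exI[of _ r] conjI r(1)) blast
qed

end

section \<open>The width\<close>

lemma H10_test: "open D \<Longrightarrow> bounded D \<Longrightarrow> test_functions D \<subseteq> H10 D"
  by (rule subsetI, rule H10w_imp_H10, assumption+, rule H10w_test) auto

lemma H10_add_cmult:
  assumes D: "open D" "bounded D" and u: "u \<in> H10 D" and v: "v \<in> H10 D"
  shows "(\<lambda>x. u x + c * v x) \<in> H10 D"
proof -
  have Ds: "D \<in> sets lebesgue" using D by auto
  have "wgrad D u (weak_grad D u)" "wgrad D v (weak_grad D v)" using u v H1_wgrad[OF D(1)] by (auto simp: H10_def)
  then show ?thesis by (intro H10w_imp_H10[OF D H10w_add[OF Ds H10_imp_H10w[OF D u] H10w_cmult[OF Ds H10_imp_H10w[OF D v]]]])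
qed

lemma H10_sum:
  assumes "open D" "bounded D" "\<And>j. j < (n::nat) \<Longrightarrow> f j \<in> H10 D"
  shows "(\<lambda>x. \<Sum>j<n. c j * f j x) \<in> H10 D"
  using assms(3)
proof (induction n)
  case 0
  show ?case using H10_test[OF assms(1,2)] test_functions_zero by auto
next
  case (Suc n)
  then show ?case using H10_add_cmult[OF assms(1,2), of "\<lambda>x. \<Sum>j<n. c j * f j x" "f n" "c n"] by simp
qed

text \<open>The norm is taken on \<open>W\<close>, but of a gradient on \<open>E\<close>, which is
  bounded there. Finiteness permits real instead of extended arithmetic.\<close>

lemma Linf_norm_winf:
  assumes E: "open E" "open W" "W \<subseteq> E" and u: "winf E B u g"
  shows "AE x in lebesgue_on W. norm (g x) \<le> enn2real (Linf_norm W g)" "Linf_norm W g = ennreal (enn2real (Linf_norm W g))"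
    "g \<in> borel_measurable (lebesgue_on W)"
proof -
  have s: "E \<in> sets lebesgue" "W \<in> sets lebesgue" using E by auto
  have "g \<in> L2 E" using u wgradD(2) unfolding winf_def by blast
  then show m: "g \<in> borel_measurable (lebesgue_on W)" using L2_subset(1)[OF E(3) s(2,1)] L2_measurable by blast
  have "AE x in lebesgue_on W. norm (g x) \<le> B" using u AE_lebesgue_on_subset[OF E(3) s(2,1)] unfolding winf_def by blast
  then have "AE x in lebesgue_on W. ennreal (norm (g x)) \<le> ennreal B" by eventually_elim (rule ennreal_leI)
  then have "Linf_norm W g \<le> ennreal B" unfolding Linf_norm_def by (intro esssup_I) (use m in measurable)
  then have fin: "Linf_norm W g < top" by (rule le_less_trans) simp
  then show eq: "Linf_norm W g = ennreal (enn2real (Linf_norm W g))" by simp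
  have "AE x in lebesgue_on W. ennreal (norm (g x)) \<le> Linf_norm W g" unfolding Linf_norm_def by (rule esssup_AE)
  then show "AE x in lebesgue_on W. norm (g x) \<le> enn2real (Linf_norm W g)" by eventually_elim (use eq in \<open>metis ennreal_le_iff enn2real_nonneg\<close>)
qed

context oversampled
begin

text \<open>\<open>k\<close> itself need not lie in \<open>H10\<close> of \<open>D\<close>. It is
  replaced by \<open>s k\<close> with a cutoff \<open>s\<close> that is \<open>1\<close> on
  \<open>W\<close>; this does not change the product on \<open>W\<close>, and it makes the results
  on products with bounded weak gradient applicable.\<close>

lemma partition_energy:
  assumes E: "open E" "bounded E" "D \<subseteq> E" and \<psi>: "\<psi> \<in> W1inf E" "continuous_on E \<psi>" "\<And>x. x \<in> E - W \<Longrightarrow> \<psi> x = 0"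
    and k: "local_harmonic A \<epsilon> D W \<delta> k g" and \<epsilon>: "\<epsilon> > 0"
  shows "(\<lambda>x. \<psi> x * k x) \<in> H10 W"
    "energy_norm A \<epsilon> W (\<lambda>x. \<psi> x * k x) \<le> \<epsilon> * sqrt amax * enn2real (Linf_norm W (weak_grad E \<psi>)) * nrm W k"
proof -
  let ?\<gamma> = "weak_grad E \<psi>" and ?G = "enn2real (Linf_norm W (weak_grad E \<psi>))"
  obtain B where B: "winf E B \<psi> ?\<gamma>" by (rule W1inf_winf[OF E(1,2) \<psi>(1)])
  have WE: "W \<subseteq> E" using W E by blast
  note \<gamma> = Linf_norm_winf[OF E(1) W(1) WE B]
  have \<psi>W: "\<psi> x = 0" if "x \<in> D - W" for x using \<psi>(3) that E(3) by blast
  have AW: "coeff_field W amin amax A" by (rule coeff_field_subset[OF W(3) Ws Ds A])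
  obtain s where cs: "cutoff (2 / (\<delta> - 0)) s" and s': "\<And>x. infdist x W \<le> 0 \<Longrightarrow> s x = 1" "\<And>x. \<delta> \<le> infdist x W \<Longrightarrow> s x = 0"
    using infdist_cutoff[OF bW W(2) \<delta>] by blast
  note s = cutoffD(1)[OF cs] s'
  have s1: "s x = 1" "grad s x = 0" if "x \<in> W" for x using s'(1)[of x] cutoffD(5)[OF cs] that by auto
  note H0 = local_harmonic_cutoff[OF k s(1,3)]
  note van = H10w_winf_mult_vanishing[OF E(1,2) D(1) E(3) B _ \<psi>(2) W(1,3) \<psi>W]
  let ?p = "\<lambda>x. \<psi> x *\<^sub>R g x + k x *\<^sub>R ?\<gamma> x"
  have H1: "H10w W (\<lambda>x. \<psi> x * k x) ?p" by (rule H10w_AE_cong[OF Ws van[OF H0]]) (auto simp: s1 AE_restrict_space_iff intro!: AE_I2)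
  \<comment> \<open>The first factor \<open>\<psi>\<close> keeps \<open>s k\<close> in the space on
    \<open>D\<close>; the second, by its vanishing, brings the product into the space on
    \<open>W\<close>.\<close>
  have H2: "H10w W (\<lambda>x. \<psi> x * (\<psi> x * k x)) (\<lambda>x. \<psi> x *\<^sub>R ?p x + (\<psi> x * k x) *\<^sub>R ?\<gamma> x)"
    by (rule H10w_AE_cong[OF Ws van[OF H10w_winf_mult[OF E(1,2) D(1) E(3) B H0]]]) (auto simp: s1 intro!: AE_I2)
  show "(\<lambda>x. \<psi> x * k x) \<in> H10 W" by (rule H10w_imp_H10[OF W(1) bW H1])
  have pL: "?p \<in> L2 W" "(\<lambda>x. \<psi> x * k x) \<in> L2 W" using H1 by (auto simp: H10w_def)
  have kW: "k \<in> L2 W" by (rule L2_subset(1)[OF W(3) Ws Ds local_harmonicD(3)[OF k]])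
  note bm = L2_bmult_vec[OF \<gamma>(3,1) enn2real_nonneg kW]
  note w = H10w_wgrad[OF Ws bW H1]
  have "energy_form A \<epsilon> W (\<lambda>x. \<psi> x * k x) (\<lambda>x. \<psi> x * k x) = eform A \<epsilon> W (\<lambda>x. \<psi> x * k x) ?p (\<lambda>x. \<psi> x * k x) ?p"
    by (rule energy_form_eform[OF W(1) AW w w])
  also have "\<dots> \<le> \<epsilon>\<^sup>2 * (amax * (nrm W (\<lambda>x. k x *\<^sub>R ?\<gamma> x))\<^sup>2)"
    by (rule caccioppoli[OF AW weakly_harmonic_restrict[OF D(1) W(1) D(2) W(3) A local_harmonicD(1)[OF k]] pL _ bm(1) H2]) simp_all
  also have "\<dots> \<le> \<epsilon>\<^sup>2 * (amax * (?G * nrm W k)\<^sup>2)" using amax_pos bm(2) by (intro mult_left_mono power_mono) auto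
  also have "\<dots> = (\<epsilon> * sqrt amax * ?G * nrm W k)\<^sup>2" using amax_pos by (simp add: power_mult_distrib)
  finally have "energy_norm A \<epsilon> W (\<lambda>x. \<psi> x * k x) \<le> sqrt ((\<epsilon> * sqrt amax * ?G * nrm W k)\<^sup>2)"
    unfolding energy_norm_def by (rule real_sqrt_le_mono)
  then show "energy_norm A \<epsilon> W (\<lambda>x. \<psi> x * k x) \<le> \<epsilon> * sqrt amax * ?G * nrm W k" using \<epsilon> amax_pos by simp
qed

text \<open>The competitor in the infimum is \<open>\<psi>\<close> times the part of
  \<open>u\<close> that \<open>exponential_decay\<close> splits off, so the error is exactly
  \<open>\<psi> k\<close>.\<close>

lemma n_width_le:
  assumes d: "CARD('d) \<ge> 2" and lip: "lipschitz_boundary D" and sep: "\<And>x y. x \<in> W \<Longrightarrow> y \<in> frontier D - \<Gamma> \<Longrightarrow> 2 * \<delta> \<le> dist x y"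
    and E: "open E" "bounded E" "D \<subseteq> E" and \<psi>: "\<psi> \<in> W1inf E" "continuous_on E \<psi>" "\<And>x. x \<in> E - W \<Longrightarrow> \<psi> x = 0"
    and \<epsilon>: "\<epsilon> > 0" and h0: "h0 > 0" "rate * h0\<^sup>2 = exp (- 2) / 2" and P: "P > 0" "D \<subseteq> ball 0 (h0 * real P)" and N: "N > 0"
    and n: "N * (2 * (P * N)) ^ CARD('d) \<le> n"
  shows "n_width A \<epsilon> \<Gamma> \<psi> W D n \<le> ennreal (\<epsilon> * sqrt amax) * Linf_norm W (weak_grad E \<psi>) * ennreal (exp (- real N))"
proof -
  let ?m = "N * (2 * (P * N)) ^ CARD('d)" and ?G = "enn2real (Linf_norm W (weak_grad E \<psi>))"
  obtain r where r: "\<forall>j<?m. r j \<in> harmonic_functions \<epsilon>"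
    "\<forall>u\<in>harmonic_functions \<epsilon>. \<exists>c k. k \<in> harmonic_functions \<epsilon> \<and> (\<forall>x. u x = k x + (\<Sum>j<?m. c j * r j x)) \<and>
       nrm W k \<le> exp (- real N) * sqrt (energy_form A \<epsilon> D u u)" using exponential_decay[OF h0 P N \<epsilon> refl] by (elim exE conjE) (rule that)
  have f: "(\<lambda>x. \<psi> x * r j x) \<in> H10 W" if "j < ?m" for j
    using r(1) that partition_energy(1)[OF E \<psi> _ \<epsilon>] unfolding harmonic_functions_def by blast
  obtain b where b: "\<And>k. k < n \<Longrightarrow> b k \<in> H10 W" "ae_independent W n b" "\<And>j. j < ?m \<Longrightarrow> (\<lambda>x. \<psi> x * r j x) \<in> ae_span W n b"
    by (rule basis_containing[where f = "\<lambda>j x. \<psi> x * r j x", OF W(1,2) H10_test[OF W(1) bW] f n]) (assumption, rule that, blast+)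
  define Q where "Q = {v \<in> H10 W. \<exists>c::nat \<Rightarrow> real. AE x in lebesgue_on W. v x = (\<Sum>k<n. c k * b k x)}"
  have Q: "Q \<in> subspaces_of_dim W (H10 W) n" unfolding subspaces_of_dim_def Q_def using b(1,2)[unfolded ae_independent_def] by blast
  obtain B where B: "winf E B \<psi> (weak_grad E \<psi>)" by (rule W1inf_winf[OF E(1,2) \<psi>(1)])
  have G: "Linf_norm W (weak_grad E \<psi>) = ennreal ?G" using Linf_norm_winf(2)[OF E(1) W(1) _ B] W(3) E(3) by blast
  let ?K = "\<epsilon> * sqrt amax * ?G * exp (- real N)"
  have K: "?K \<ge> 0" using \<epsilon> amax_pos by simp
  have "n_width A \<epsilon> \<Gamma> \<psi> W D n \<le> ennreal ?K" unfolding n_width_def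
  proof (rule INF_lower2[OF Q], rule SUP_least)
    fix u assume "u \<in> {u \<in> harmonic_space A \<epsilon> \<Gamma> D. \<not> (AE x in lebesgue_on D. u x = 0)}"
    then have "u \<in> harmonic_functions \<epsilon>" using harmonic_space_local[OF d lip sep, of \<Gamma> u \<epsilon>] unfolding harmonic_functions_def by blast
    then obtain c k where k: "k \<in> harmonic_functions \<epsilon>" "\<And>x. u x = k x + (\<Sum>j<?m. c j * r j x)"
      "nrm W k \<le> exp (- real N) * sqrt (energy_form A \<epsilon> D u u)" using r(2) by blast
    obtain g where g: "local_harmonic A \<epsilon> D W \<delta> k g" using k(1) unfolding harmonic_functions_def by blast
    define v where "v = (\<lambda>x. \<Sum>j<?m. c j * (\<psi> x * r j x))"
    have "v \<in> H10 W" unfolding v_def by (rule H10_sum[OF W(1) bW f])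
    moreover have "v \<in> ae_span W n b" unfolding v_def by (rule ae_span_sum) (use b(3) in auto)
    ultimately have vQ: "v \<in> Q" unfolding Q_def ae_span_def by blast
    have e: "(\<lambda>x. \<psi> x * u x - v x) = (\<lambda>x. \<psi> x * k x)" by (simp add: fun_eq_iff v_def k(2) distrib_left sum_distrib_left mult_ac)
    have "energy_norm A \<epsilon> W (\<lambda>x. \<psi> x * k x) \<le> \<epsilon> * sqrt amax * ?G * nrm W k" by (rule partition_energy(2)[OF E \<psi> g \<epsilon>])
    also have "\<dots> \<le> \<epsilon> * sqrt amax * ?G * (exp (- real N) * energy_norm A \<epsilon> D u)"
      using k(3) \<epsilon> amax_pos by (intro mult_left_mono) (auto simp: energy_norm_def)
    finally have le: "energy_norm A \<epsilon> W (\<lambda>x. \<psi> x * u x - v x) \<le> ?K * energy_norm A \<epsilon> D u" unfolding e by (simp add: mult.assoc)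
    have en: "energy_norm A \<epsilon> D u \<ge> 0"
      using semi_inner_space.nonneg[OF semi_inner_space_harmonic \<open>u \<in> harmonic_functions \<epsilon>\<close>] by (simp add: energy_norm_def)
    have "energy_norm A \<epsilon> W (\<lambda>x. \<psi> x * u x - v x) / energy_norm A \<epsilon> D u \<le> ?K"
    proof (cases "energy_norm A \<epsilon> D u = 0")
      \<comment> \<open>Division by zero yields \<open>0\<close>, so a vanishing energy does no
        harm.\<close>
      case True
      then show ?thesis using K by simp
    next
      case False
      then show ?thesis using le en by (simp add: pos_divide_le_eq)
    qed
    then show "(INF v\<in>Q. ennreal (energy_norm A \<epsilon> W (\<lambda>x. \<psi> x * u x - v x) / energy_norm A \<epsilon> D u)) \<le> ennreal ?K"
      by (intro INF_lower2[OF vQ] ennreal_leI)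
  qed
  also have "ennreal ?K = ennreal (\<epsilon> * sqrt amax) * ennreal ?G * ennreal (exp (- real N))" using \<epsilon> amax_pos by (simp add: ennreal_mult[symmetric])
  finally show ?thesis using G by simp
qed

lemma rate_pos: "rate > 0"
  unfolding rate_def poincare_const_def using amin_pos amax_pos \<delta> by (intro mult_pos_pos divide_pos_pos zero_less_power) auto

end

text \<open>A budget of \<open>n\<close> dimensions pays for about \<open>n powr (1 / (d + 1))\<close> layers.\<close>

lemma layer_number:
  fixes c :: real and n d :: nat
  assumes c: "c > 0" and n: "real n > c"
  obtains N :: nat where "N > 0" "c * real N ^ Suc d \<le> real n"
    "1 / (2 * c powr (1 / (real d + 1))) * real n powr (1 / (real d + 1)) \<le> real N"
proof -
  define y where "y = (real n / c) powr (1 / (real d + 1))"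
  have q: "real n / c \<ge> 1" using n c by simp
  have y1: "y \<ge> 1" unfolding y_def using q by (intro ge_one_powr_ge_zero) auto
  \<comment> \<open>As \<open>y \<ge> 1\<close>, rounding down at most halves \<open>y\<close>; this
    is the origin of the factor \<open>2\<close> in the denominator of the third conclusion.\<close>
  define N where "N = nat \<lfloor>y\<rfloor>"
  have N: "real N \<le> y" "y < real N + 1" "real N \<ge> 1"
  proof -
    have "\<lfloor>y\<rfloor> \<ge> 1" using y1 by simp
    then show "real N \<le> y" "y < real N + 1" "real N \<ge> 1" unfolding N_def by linarith+
  qed
  have "c * real N ^ Suc d \<le> c * y ^ Suc d" using N c by (intro mult_left_mono power_mono) auto
  also have "y ^ Suc d = y powr (real d + 1)" using y1 by (subst powr_realpow[symmetric]) (auto simp: add.commute)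
  also have "\<dots> = real n / c" unfolding y_def powr_powr using q c by simp
  finally have 1: "c * real N ^ Suc d \<le> real n" using c by simp
  have "1 / (2 * c powr (1 / (real d + 1))) * real n powr (1 / (real d + 1)) = y / 2" unfolding y_def using c by (simp add: powr_divide)
  also have "\<dots> \<le> real N" using N by simp
  finally show ?thesis using that[of N] 1 N(3) by simp
qed

theorem theorem3p8:
  fixes \<Omega> :: "(real^'d) set"
    and A :: "real^'d \<Rightarrow> real^'d^'d"
    and amin amax C :: real
    and M \<kappa> i :: nat
    and \<omega> \<omega>s :: "nat \<Rightarrow> (real^'d) set"
    and \<eta> :: "nat \<Rightarrow> real^'d \<Rightarrow> real"
  assumes dim: "CARD('d) = 2 \<or> CARD('d) = 3"
    and Omega: "domain \<Omega>" "bounded \<Omega>" "lipschitz_boundary \<Omega>" "polyhedral \<Omega>"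
    and A_Linf: "\<And>k l. (\<lambda>x. A x $ k $ l) \<in> Linf \<Omega>"
    and A_sym: "\<And>x. x \<in> \<Omega> \<Longrightarrow> transpose (A x) = A x"
    and a_bounds: "0 < amin" "amin < amax"
    and A_elliptic: "\<And>x \<xi>. x \<in> \<Omega> \<Longrightarrow> amin * (norm \<xi>)\<^sup>2 \<le> (A x *v \<xi>) \<bullet> \<xi>"
                    "\<And>x \<xi>. x \<in> \<Omega> \<Longrightarrow> (A x *v \<xi>) \<bullet> \<xi> \<le> amax * (norm \<xi>)\<^sup>2"
    and cover: "\<And>j. j \<in> {1..M} \<Longrightarrow> domain (\<omega> j)"
               "(\<Union>j\<in>{1..M}. \<omega> j) = \<Omega>"
               "\<And>x. x \<in> \<Omega> \<Longrightarrow> card {j \<in> {1..M}. x \<in> \<omega> j} \<le> \<kappa>"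
    and pu_W1inf: "\<And>j. j \<in> {1..M} \<Longrightarrow> \<eta> j \<in> W1inf \<Omega>"
    and pu_continuous: "\<And>j. j \<in> {1..M} \<Longrightarrow> continuous_on \<Omega> (\<eta> j)"
    and pu_range: "\<And>j x. j \<in> {1..M} \<Longrightarrow> x \<in> \<Omega> \<Longrightarrow> 0 \<le> \<eta> j x \<and> \<eta> j x \<le> 1"
    and pu_sum: "\<And>x. x \<in> \<Omega> \<Longrightarrow> (\<Sum>j=1..M. \<eta> j x) = 1"
    and pu_zero: "\<And>j x. j \<in> {1..M} \<Longrightarrow> x \<in> \<Omega> - \<omega> j \<Longrightarrow> \<eta> j x = 0"
    and pu_grad: "\<And>j. j \<in> {1..M} \<Longrightarrow>
                    Linf_norm (\<omega> j) (weak_grad \<Omega> (\<eta> j)) \<le> ennreal (C / diameter (\<omega> j))"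
    and oversampling: "\<And>j. j \<in> {1..M} \<Longrightarrow> domain (\<omega>s j)"
                      "\<And>j. j \<in> {1..M} \<Longrightarrow> lipschitz_boundary (\<omega>s j)"
                      "\<And>j. j \<in> {1..M} \<Longrightarrow> \<omega> j \<subseteq> \<omega>s j \<and> \<omega>s j \<subseteq> \<Omega>"
    and i: "i \<in> {1..M}"
    and dist_pos: "set_edist (\<omega> i) (frontier (\<omega>s i) - frontier \<Omega>) > 0"
  shows "\<exists>\<Lambda>>0. \<exists>b>0. \<forall>\<epsilon>. 0 < \<epsilon> \<and> \<epsilon> \<le> 1 \<longrightarrow>
           (\<forall>n::nat. real n > \<Lambda> \<longrightarrow>
              n_width A \<epsilon> (frontier \<Omega>) (\<eta> i) (\<omega> i) (\<omega>s i) n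
                \<le> ennreal (\<epsilon> * sqrt amax) * Linf_norm (\<omega> i) (weak_grad \<Omega> (\<eta> i))
                    * ennreal (exp (- b * real n powr (1 / (real CARD('d) + 1)))))"
proof -
  let ?D = "\<omega>s i" and ?W = "\<omega> i" and ?s = "1 / (real CARD('d) + 1)"
  have O: "open \<Omega>" using Omega(1) by (simp add: domain_def)
  have dom: "open ?D" "?W \<subseteq> ?D" "?D \<subseteq> \<Omega>" "bounded ?D" "lipschitz_boundary ?D"
    using oversampling[OF i] bounded_subset[OF Omega(2)] by (auto simp: domain_def)
  have W: "open ?W" "?W \<noteq> {}" using cover(1)[OF i] by (auto simp: domain_def)
  have d: "CARD('d) \<ge> 2" using dim by auto
  obtain \<delta>0 where \<delta>0: "\<delta>0 > 0" "\<And>x y. x \<in> ?W \<Longrightarrow> y \<in> frontier ?D - frontier \<Omega> \<Longrightarrow> \<delta>0 \<le> dist x y"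
    by (rule set_edist_posD[OF dist_pos]) (rule that, assumption, blast)
  \<comment> \<open>Half of the distance, to match the separation \<open>2 * \<delta>\<close> in
    \<open>harmonic_space_local\<close>.\<close>
  define \<delta> where "\<delta> = \<delta>0 / 2"
  have sep: "2 * \<delta> \<le> dist x y" if "x \<in> ?W" "y \<in> frontier ?D - frontier \<Omega>" for x y using \<delta>0(2)[OF that] by (simp add: \<delta>_def)
  have "coeff_field \<Omega> amin amax A" by (rule coeff_field_Linf[OF A_Linf A_sym a_bounds A_elliptic])
  then have "coeff_field ?D amin amax A" using coeff_field_subset[OF dom(3)] O dom(1) by auto
  then interpret oversampled ?D ?W A amin amax \<delta> using dom W \<delta>0(1) by unfold_locales (auto simp: \<delta>_def)
  define h0 where "h0 = sqrt (exp (- 2) / (2 * rate))"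
  have h0: "h0 > 0" "rate * h0\<^sup>2 = exp (- 2) / 2" using rate_pos by (simp_all add: h0_def)
  obtain R where R: "\<And>x. x \<in> ?D \<Longrightarrow> norm x \<le> R" using dom(4) unfolding bounded_iff by blast
  obtain P0 :: nat where "R / h0 < real P0" using reals_Archimedean2 by blast
  then have "R < h0 * real (Suc P0)" using h0(1) by (simp add: field_simps)
  then obtain P where P: "P > 0" "?D \<subseteq> ball 0 (h0 * real P)" using R that[of "Suc P0"] by (force intro: le_less_trans)
  \<comment> \<open>\<open>N\<close> layers take \<open>c * N ^ (d + 1)\<close> dimensions, so
    \<open>c\<close> serves as \<open>\<Lambda>\<close>: beyond it at least one layer can be
    afforded. Neither \<open>c\<close> nor \<open>b\<close> involves \<open>\<epsilon>\<close>,
    because \<open>rate\<close> does not.\<close>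
  define c where "c = (2 * real P) ^ CARD('d)"
  have c: "c > 0" using P by (simp add: c_def)
  define b where "b = 1 / (2 * c powr ?s)"
  have b: "b > 0" using c by (simp add: b_def)
  have "n_width A \<epsilon> (frontier \<Omega>) (\<eta> i) ?W ?D n \<le> ennreal (\<epsilon> * sqrt amax) * Linf_norm ?W (weak_grad \<Omega> (\<eta> i)) *
      ennreal (exp (- b * real n powr ?s))" if \<epsilon>: "0 < \<epsilon>" and n: "real n > c" for \<epsilon> and n :: nat
  proof -
    obtain N where N: "N > 0" "c * real N ^ Suc CARD('d) \<le> real n" "b * real n powr ?s \<le> real N"
      using layer_number[OF c n, of "CARD('d)"] unfolding b_def by blast
    have "real (N * (2 * (P * N)) ^ CARD('d)) = c * real N ^ Suc CARD('d)" by (simp add: c_def power_mult_distrib)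
    then have le: "N * (2 * (P * N)) ^ CARD('d) \<le> n" using N(2) by linarith
    have "n_width A \<epsilon> (frontier \<Omega>) (\<eta> i) ?W ?D n \<le> ennreal (\<epsilon> * sqrt amax) * Linf_norm ?W (weak_grad \<Omega> (\<eta> i)) * ennreal (exp (- real N))"
      by (rule n_width_le[OF d dom(5) _ O Omega(2) dom(3) pu_W1inf[OF i] pu_continuous[OF i] _ \<epsilon> h0 P N(1) le])
        (use sep pu_zero[OF i] in blast)+
    also have "\<dots> \<le> ennreal (\<epsilon> * sqrt amax) * Linf_norm ?W (weak_grad \<Omega> (\<eta> i)) * ennreal (exp (- b * real n powr ?s))"
      using N(3) by (intro mult_left_mono ennreal_leI) auto
    finally show ?thesis .
  qed
  then show ?thesis using c b by blast
qed

end
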